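(* Let $G$ be a locally compact group and suppose that $G$ has an abelian, non-compact, closed, normal subgroup $N$ of finite index. Then $L^1(G)$ does not have spectral synthesis, and the topology $\tau_r$ is not Hausdorff on $Id(L^1(G))$.
   Context: For a Banach algebra $A$, $Id(A)$ is the set of closed two-sided ideals of $A$. $\tau_u$ is the weakest topology on $Id(A)$ for which all functions $I\mapsto\|a+I\|$ ($a\in A$) are upper semicontinuous. A net $(I_\alpha)$ in $Id(A)$ has the normality property with respect to $I\in Id(A)$ if $a\notin I$ implies $\liminf_\alpha\|a+I_\alpha\|>0$. $\tau_n$ is the topology on $Id(A)$ whose closed sets are those $M\subseteq Id(A)$ such that whenever a net in $M$ has the normality property with respect to $I\in Id(A)$, then $I\in M$. $\tau_r$ is the topology generated by $\tau_u$ and $\tau_n$. $Prim(A)$ is the set of primitive ideals with hull-kernel topology; $Prim^s(A)$ the set of proper prime ideals which are intersections of primitive ideals, with hull-kernel topology. $A$ has spectral synthesis if: (i) $Prim^s(A)$ is locally compact; (ii) whenever a net $(P_\alpha)$ in $Prim(A)$ converges in the hull-kernel topology to $P\in Prim(A)$ and $a\in A\setminus P$, then $\liminf_\alpha\|a+P_\alpha\|>0$; (iii) every proper closed two-sided ideal of $A$ is an intersection of primitive ideals. *)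

theory Defs
  imports "HOL-Analysis.Analysis"
begin

text \<open>A Banach algebra is presented through a carrier of representatives, with a
seminorm; elements at seminorm-distance 0 are identified.  Ideals are always taken
saturated (closed under this identification), so they correspond exactly to
ideals of the genuine quotient Banach algebra.\<close>

record 'a snalg =
  acar  :: "'a set"
  aadd  :: "'a \<Rightarrow> 'a \<Rightarrow> 'a"
  asmul :: "complex \<Rightarrow> 'a \<Rightarrow> 'a"
  amul  :: "'a \<Rightarrow> 'a \<Rightarrow> 'a"
  anorm :: "'a \<Rightarrow> real"
  azero :: 'a

definition asub :: "'a snalg \<Rightarrow> 'a \<Rightarrow> 'a \<Rightarrow> 'a" where
  "asub A a b = aadd A a (asmul A (-1) b)"

definition saturated :: "'a snalg \<Rightarrow> 'a set \<Rightarrow> bool" where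
  "saturated A I \<longleftrightarrow> (\<forall>a\<in>I. \<forall>b\<in>acar A. anorm A (asub A a b) = 0 \<longrightarrow> b \<in> I)"

definition subspace_of :: "'a snalg \<Rightarrow> 'a set \<Rightarrow> bool" where
  "subspace_of A I \<longleftrightarrow> I \<subseteq> acar A \<and> azero A \<in> I \<and>
     (\<forall>a\<in>I. \<forall>b\<in>I. aadd A a b \<in> I) \<and> (\<forall>c. \<forall>a\<in>I. asmul A c a \<in> I) \<and> saturated A I"

definition left_ideal :: "'a snalg \<Rightarrow> 'a set \<Rightarrow> bool" where
  "left_ideal A L \<longleftrightarrow> subspace_of A L \<and> (\<forall>a\<in>acar A. \<forall>b\<in>L. amul A a b \<in> L)"

definition two_sided_ideal :: "'a snalg \<Rightarrow> 'a set \<Rightarrow> bool" where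
  "two_sided_ideal A I \<longleftrightarrow> left_ideal A I \<and> (\<forall>a\<in>acar A. \<forall>b\<in>I. amul A b a \<in> I)"

definition norm_closed :: "'a snalg \<Rightarrow> 'a set \<Rightarrow> bool" where
  "norm_closed A I \<longleftrightarrow> (\<forall>a\<in>acar A. (\<forall>e>0. \<exists>b\<in>I. anorm A (asub A a b) < e) \<longrightarrow> a \<in> I)"

definition Id_set :: "'a snalg \<Rightarrow> 'a set set" where
  "Id_set A = {I. two_sided_ideal A I \<and> norm_closed A I}"

definition qnorm :: "'a snalg \<Rightarrow> 'a set \<Rightarrow> 'a \<Rightarrow> real" where
  "qnorm A I a = Inf ((\<lambda>b. anorm A (asub A a b)) ` I)"

text \<open>Primitive ideals: \<open>P = (L : A) = {a. a A \<subseteq> L}\<close> for a maximal modular left ideal \<open>L\<close>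
 (equivalently, kernels of algebraically irreducible representations).\<close>
definition modular_left_ideal :: "'a snalg \<Rightarrow> 'a set \<Rightarrow> bool" where
  "modular_left_ideal A L \<longleftrightarrow> left_ideal A L \<and>
     (\<exists>u\<in>acar A. \<forall>a\<in>acar A. asub A a (amul A a u) \<in> L)"

definition maximal_modular_left_ideal :: "'a snalg \<Rightarrow> 'a set \<Rightarrow> bool" where
  "maximal_modular_left_ideal A L \<longleftrightarrow> modular_left_ideal A L \<and> L \<noteq> acar A \<and>
     (\<forall>L'. left_ideal A L' \<and> L \<subseteq> L' \<and> L' \<noteq> acar A \<longrightarrow> L' = L)"

definition Prim :: "'a snalg \<Rightarrow> 'a set set" where
  "Prim A = {P. \<exists>L. maximal_modular_left_ideal A L \<and>
                   P = {a\<in>acar A. \<forall>b\<in>acar A. amul A a b \<in> L}}"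

definition prime_ideal :: "'a snalg \<Rightarrow> 'a set \<Rightarrow> bool" where
  "prime_ideal A P \<longleftrightarrow> P \<in> Id_set A \<and> P \<noteq> acar A \<and>
     (\<forall>I\<in>Id_set A. \<forall>J\<in>Id_set A. (\<forall>a\<in>I. \<forall>b\<in>J. amul A a b \<in> P) \<longrightarrow> I \<subseteq> P \<or> J \<subseteq> P)"

definition Prim_s :: "'a snalg \<Rightarrow> 'a set set" where
  "Prim_s A = {P. prime_ideal A P \<and> (\<exists>S. S \<subseteq> Prim A \<and> S \<noteq> {} \<and> P = \<Inter>S)}"

definition hk_closed :: "'a set set \<Rightarrow> 'a set set \<Rightarrow> bool" where
  "hk_closed X M \<longleftrightarrow> M \<subseteq> X \<and> (\<forall>P\<in>X. \<Inter>M \<subseteq> P \<longrightarrow> P \<in> M)"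

definition hk_topology :: "'a set set \<Rightarrow> 'a set topology" where
  "hk_topology X = topology (\<lambda>U. U \<subseteq> X \<and> hk_closed X (X - U))"

text \<open>Nets are represented by (proper) filters on the ideal space itself:
 a net \<open>(I\<^sub>\<alpha>)\<close> corresponds to its image filter, with the same convergence and liminf.\<close>
definition normality_property :: "'a snalg \<Rightarrow> 'a set filter \<Rightarrow> 'a set \<Rightarrow> bool" where
  "normality_property A F I \<longleftrightarrow>
     (\<forall>a\<in>acar A. a \<notin> I \<longrightarrow> Liminf F (\<lambda>J. ereal (qnorm A J a)) > 0)"

definition spectral_synthesis :: "'a snalg \<Rightarrow> bool" where
  "spectral_synthesis A \<longleftrightarrow>
     locally_compact_space (hk_topology (Prim_s A)) \<and>
     (\<forall>F P. F \<noteq> bot \<and> eventually (\<lambda>Q. Q \<in> Prim A) F \<and> P \<in> Prim A \<and>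
            limitin (hk_topology (Prim A)) (\<lambda>Q. Q) P F \<longrightarrow> normality_property A F P) \<and>
     (\<forall>I\<in>Id_set A. I \<noteq> acar A \<longrightarrow> (\<exists>S. S \<subseteq> Prim A \<and> S \<noteq> {} \<and> I = \<Inter>S))"

definition tau_u :: "'a snalg \<Rightarrow> 'a set topology" where
  "tau_u A = topology_generated_by
     (insert (Id_set A) {{I\<in>Id_set A. qnorm A I a < t} | a t. a \<in> acar A})"

definition tau_n_closed :: "'a snalg \<Rightarrow> 'a set set \<Rightarrow> bool" where
  "tau_n_closed A M \<longleftrightarrow> M \<subseteq> Id_set A \<and>
     (\<forall>F. \<forall>I\<in>Id_set A. F \<noteq> bot \<and> eventually (\<lambda>J. J \<in> M) F \<and> normality_property A F I
        \<longrightarrow> I \<in> M)"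

definition tau_n :: "'a snalg \<Rightarrow> 'a set topology" where
  "tau_n A = topology (\<lambda>U. U \<subseteq> Id_set A \<and> tau_n_closed A (Id_set A - U))"

definition tau_r :: "'a snalg \<Rightarrow> 'a set topology" where
  "tau_r A = topology_generated_by ({U. openin (tau_u A) U} \<union> {U. openin (tau_n A) U})"

definition lc_group :: "('g::t2_space \<Rightarrow> 'g \<Rightarrow> 'g) \<Rightarrow> ('g \<Rightarrow> 'g) \<Rightarrow> 'g \<Rightarrow> bool" where
  "lc_group gmul ginv e \<longleftrightarrow>
     (\<forall>x y z. gmul (gmul x y) z = gmul x (gmul y z)) \<and>
     (\<forall>x. gmul e x = x \<and> gmul x e = x) \<and>
     (\<forall>x. gmul (ginv x) x = e \<and> gmul x (ginv x) = e) \<and>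
     continuous_on UNIV (\<lambda>p. gmul (fst p) (snd p)) \<and> continuous_on UNIV ginv \<and>
     locally_compact_space (euclidean :: 'g topology)"

definition left_haar :: "('g::t2_space \<Rightarrow> 'g \<Rightarrow> 'g) \<Rightarrow> 'g measure \<Rightarrow> bool" where
  "left_haar gmul \<mu> \<longleftrightarrow>
     sets \<mu> = sets borel \<and>
     (\<forall>g. \<forall>B\<in>sets borel. emeasure \<mu> (gmul g ` B) = emeasure \<mu> B) \<and>
     (\<forall>K. compact K \<longrightarrow> emeasure \<mu> K < \<infinity>) \<and>
     (\<forall>U. open U \<and> U \<noteq> {} \<longrightarrow> emeasure \<mu> U > 0) \<and>
     (\<forall>B\<in>sets borel. emeasure \<mu> B = (INF U\<in>{U. open U \<and> B \<subseteq> U}. emeasure \<mu> U)) \<and>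
     (\<forall>U. open U \<longrightarrow> emeasure \<mu> U = (SUP K\<in>{K. compact K \<and> K \<subseteq> U}. emeasure \<mu> K))"

definition convolution ::
  "('g \<Rightarrow> 'g \<Rightarrow> 'g) \<Rightarrow> ('g \<Rightarrow> 'g) \<Rightarrow> 'g measure \<Rightarrow> ('g \<Rightarrow> complex) \<Rightarrow> ('g \<Rightarrow> complex) \<Rightarrow> 'g \<Rightarrow> complex"
  where "convolution gmul ginv \<mu> f g x = (\<integral>y. f y * g (gmul (ginv y) x) \<partial>\<mu>)"

definition L1_alg :: "('g \<Rightarrow> 'g \<Rightarrow> 'g) \<Rightarrow> ('g \<Rightarrow> 'g) \<Rightarrow> 'g measure \<Rightarrow> ('g \<Rightarrow> complex) snalg" where
  "L1_alg gmul ginv \<mu> =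
     \<lparr> acar = {f. integrable \<mu> f},
       aadd = (\<lambda>f g x. f x + g x),
       asmul = (\<lambda>c f x. c * f x),
       amul = convolution gmul ginv \<mu>,
       anorm = (\<lambda>f. \<integral>x. norm (f x) \<partial>\<mu>),
       azero = (\<lambda>_. 0) \<rparr>"

end

theory Submission
  imports Defs
begin

text \<open>
  The group acts by translations on the Banach space of bounded continuous functions, and closed ideals of
  \<open>L\<^sup>1\<close> arise as annihilators of translation invariant sets of such functions. For \<open>x \<in> N\<close> let \<open>\<nu>\<^sub>x\<close> be the
  average of the translations by the conjugates of \<open>x\<close> and their inverses; it commutes with all translations.
  Because \<open>N\<close> is not compact, \<open>x\<close> can be chosen so far out that \<open>exp (i t \<nu>\<^sub>x)\<close> strictly contracts a given finite
  family of functions vanishing at infinity, and inductively one obtains a series \<open>V\<close> of such averages for which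
  \<open>exp (i n V) \<phi>\<close> decays rapidly in \<open>n\<close>. With \<open>E = exp (i (V - \<lambda>))\<close>, the sums \<open>T = \<Sum>\<^sub>n E\<^sup>n \<phi>\<close> and
  \<open>S = \<Sum>\<^sub>n n E\<^sup>n \<phi>\<close> satisfy \<open>(E - 1) T = 0\<close> and \<open>(E - 1) S = - T \<noteq> 0\<close>. As in Malliavin's theorem, the
  annihilator \<open>I\<close> of the kernel of \<open>(E - 1)\<^sup>2\<close> is then strictly smaller than the annihilator \<open>K\<close> of the kernel of
  \<open>E - 1\<close> although \<open>K K \<subseteq> I\<close>, so \<open>I\<close> is not an intersection of primitive ideals. Replacing \<open>V\<close> by \<open>V - \<eta> \<nu>\<^sub>x\<close>
  gives ideals whose iterated limit (\<open>x \<rightarrow> \<infinity>\<close>, then \<open>\<eta> \<rightarrow> 0\<close>) omits an element \<open>f = (E - 1) k\<close> whose quotient norm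
  tends to \<open>0\<close> with \<open>\<eta>\<close>; the same net has a second limit containing \<open>f\<close>.
\<close>

section \<open>Bounded operators on bounded continuous functions\<close>

text \<open>Haar measure need not be \<sigma>-finite, and the Borel sets of a product may exceed the
  product \<sigma>-algebra. Integrals are therefore interchanged by hand, first for continuous
  functions of compact support, then by regularity and density. The averages contain inverses, hence
  are symmetric; their exponentials are unitary on L2, which bounds orbits uniformly where operator
  norms give only exponential bounds. A far average pushes a function off its support, so the
  first-order term of exp (i t \<open>\<nu>\<^sub>x\<close>) is lost there; but y y' = e for some
  pairs, so a proportion \<theta> of the second-order term comes back. The factor 1 - t^2 \<theta> /
  2 is the contraction. Decay beyond every power is wanted because perturbing by
  \<open>\<nu>\<^sub>x\<close> costs a polynomial in n, of a degree independent of x. Integer times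
  n leave finitely many conditions at each stage of the induction. In the last part the effect of
  the perturbation and the distance to the perturbed wave are both of order \<eta>; \<eta> cancels,
  and this keeps f away from the iterated limit.\<close>

instance bcontfun :: (topological_space, complete_space) complete_space
proof
  fix f :: "nat \<Rightarrow> ('a, 'b) bcontfun"
  assume "Cauchy f"
  then obtain g where "uniform_limit UNIV f g sequentially"
    using uniformly_convergent_eq_cauchy[of "\<lambda>_. True" f]
    unfolding Cauchy_def uniform_limit_sequentially_iff
    by (metis dist_fun_lt_imp_dist_val_lt)
  from uniform_limit_bcontfunE[OF this sequentially_bot]
  obtain l' where "g = apply_bcontfun l'" "(f \<longlonglongrightarrow> l')" by metis
  then show "convergent f"
    by (intro convergentI)
qed

instance bcontfun :: (topological_space, banach) banach ..

text \<open>A copy of the type of bounded operators on which composition can be the multiplication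
  of a Banach algebra, so that \<open>exp\<close> applies. The operators are linear over the reals
  only, which admits complex conjugation among them.\<close>

typedef (overloaded) 'a cbop = "UNIV :: (('a::topological_space \<Rightarrow>\<^sub>C complex) \<Rightarrow>\<^sub>L ('a \<Rightarrow>\<^sub>C complex)) set"
  morphisms blin Cbop ..

lemma blin_Cbop [simp]: "blin (Cbop f) = f"
  by (simp add: Cbop_inverse)

lemma blin_inject_iff: "S = T \<longleftrightarrow> blin S = blin T"
  by (simp add: blin_inject)

instantiation cbop :: (topological_space) real_normed_algebra_1
begin
definition "zero_cbop = Cbop 0"
definition "one_cbop = Cbop id_blinfun"
definition "plus_cbop S T = Cbop (blin S + blin T)"
definition "minus_cbop S T = Cbop (blin S - blin T)"
definition "uminus_cbop S = Cbop (- blin S)"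
definition "times_cbop S T = Cbop (blin S o\<^sub>L blin T)"
definition "scaleR_cbop r S = Cbop (r *\<^sub>R blin S)"
definition "norm_cbop S = norm (blin S)"
definition "sgn_cbop S = inverse (norm S) *\<^sub>R (S :: 'a cbop)"
definition "dist_cbop S T = norm (S - T :: 'a cbop)"
definition uniformity_cbop :: "('a cbop \<times> 'a cbop) filter"
  where "uniformity_cbop = (INF e\<in>{0<..}. principal {(x, y). dist x y < e})"
definition open_cbop :: "'a cbop set \<Rightarrow> bool"
  where "open_cbop S = (\<forall>x\<in>S. \<forall>\<^sub>F (x', y) in uniformity. x' = x \<longrightarrow> y \<in> S)"

instance
proof
  fix S T U :: "'a cbop" and a b :: real
  note defs = zero_cbop_def one_cbop_def plus_cbop_def minus_cbop_def uminus_cbop_def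
    times_cbop_def scaleR_cbop_def norm_cbop_def
  show "S + T + U = S + (T + U)" "S + T = T + S" "0 + S = S" "- S + S = 0" "S - T = S + - T"
    "a *\<^sub>R (S + T) = a *\<^sub>R S + a *\<^sub>R T" "(a + b) *\<^sub>R S = a *\<^sub>R S + b *\<^sub>R S"
    "a *\<^sub>R b *\<^sub>R S = (a * b) *\<^sub>R S" "1 *\<^sub>R S = S"
    by (simp_all add: blin_inject_iff defs algebra_simps)
  show "S * T * U = S * (T * U)" "(S + T) * U = S * U + T * U" "S * (T + U) = S * T + S * U"
    "a *\<^sub>R S * T = a *\<^sub>R (S * T)" "S * a *\<^sub>R T = a *\<^sub>R (S * T)" "1 * S = S" "S * 1 = S"
    by (auto simp: blin_inject_iff defs blinfun.bilinear_simps intro!: blinfun_eqI)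
  \<comment> \<open>A unit of norm 1 requires a nonzero function; the constant 1 serves on any
    space.\<close>
  have n1: "norm (const_bcontfun 1 :: 'a \<Rightarrow>\<^sub>C complex) = 1"
  proof (rule antisym)
    show "norm (const_bcontfun 1 :: 'a \<Rightarrow>\<^sub>C complex) \<le> 1"
      by (rule norm_bound) (simp add: const_bcontfun.rep_eq)
    show "1 \<le> norm (const_bcontfun 1 :: 'a \<Rightarrow>\<^sub>C complex)"
      using norm_bounded[of "const_bcontfun 1 :: 'a \<Rightarrow>\<^sub>C complex" undefined]
      by (simp add: const_bcontfun.rep_eq)
  qed
  then have ne: "const_bcontfun 1 \<noteq> (0 :: 'a \<Rightarrow>\<^sub>C complex)" by auto
  show "(0 :: 'a cbop) \<noteq> 1"
  proof
    assume "(0 :: 'a cbop) = 1"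
    then have "(0 :: ('a \<Rightarrow>\<^sub>C complex) \<Rightarrow>\<^sub>L ('a \<Rightarrow>\<^sub>C complex)) = id_blinfun"
      by (simp add: defs blin_inject_iff)
    then have "blinfun_apply (0 :: ('a \<Rightarrow>\<^sub>C complex) \<Rightarrow>\<^sub>L ('a \<Rightarrow>\<^sub>C complex)) (const_bcontfun 1)
        = blinfun_apply id_blinfun (const_bcontfun 1)" by simp
    with ne show False by simp
  qed
  show "dist S T = norm (S - T)" by (simp add: dist_cbop_def)
  show "sgn S = inverse (norm S) *\<^sub>R S" by (simp add: sgn_cbop_def)
  show "norm (S + T) \<le> norm S + norm T" by (simp add: defs norm_triangle_ineq)
  show "norm (a *\<^sub>R S) = \<bar>a\<bar> * norm S" by (simp add: defs)
  show "norm S = 0 \<longleftrightarrow> S = 0" by (simp add: defs blin_inject_iff)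
  show "norm (S * T) \<le> norm S * norm T" by (simp add: defs norm_blinfun_compose)
  show "norm (1 :: 'a cbop) = 1"
  proof (rule antisym)
    show "norm (1 :: 'a cbop) \<le> 1" by (simp add: defs norm_blinfun_id_le)
    show "1 \<le> norm (1 :: 'a cbop)"
      using norm_blinfun[of id_blinfun "const_bcontfun 1 :: 'a \<Rightarrow>\<^sub>C complex"] n1
      by (simp add: defs)
  qed
qed (rule uniformity_cbop_def open_cbop_def)+
end

instance cbop :: (topological_space) banach
proof
  fix X :: "nat \<Rightarrow> 'a cbop" assume "Cauchy X"
  then have "Cauchy (\<lambda>n. blin (X n))"
    by (simp add: Cauchy_def dist_norm norm_cbop_def minus_cbop_def)
  then obtain l where "(\<lambda>n. blin (X n)) \<longlonglongrightarrow> l"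
    using Cauchy_convergent_iff convergent_def by blast
  then have "X \<longlonglongrightarrow> Cbop l"
    by (simp add: tendsto_iff dist_norm norm_cbop_def minus_cbop_def)
  then show "convergent X" by (rule convergentI)
qed

definition app :: "'a::topological_space cbop \<Rightarrow> ('a \<Rightarrow>\<^sub>C complex) \<Rightarrow> ('a \<Rightarrow>\<^sub>C complex)" where
  "app T \<phi> = blinfun_apply (blin T) \<phi>"

lemma norm_app: "norm (app T \<phi>) \<le> norm T * norm \<phi>"
  by (simp add: app_def norm_cbop_def norm_blinfun)

lemma app_bounded_bilinear: "bounded_bilinear (app :: 'a::topological_space cbop \<Rightarrow> _)"
proof
  show "\<exists>K. \<forall>a b. norm (app (a :: 'a cbop) b) \<le> norm a * norm b * K"
    by (rule exI[of _ 1]) (simp add: norm_app)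
qed (simp_all add: app_def plus_cbop_def scaleR_cbop_def blinfun.bilinear_simps)

interpretation app: bounded_bilinear "app :: 'a::topological_space cbop \<Rightarrow> _"
  by (rule app_bounded_bilinear)

lemma app_mult [simp]: "app (S * T) \<phi> = app S (app T \<phi>)"
  by (simp add: app_def times_cbop_def)

lemma app_one [simp]: "app 1 \<phi> = \<phi>"
  by (simp add: app_def one_cbop_def)

lemma cbop_eqI: "(\<And>\<phi> p. app S \<phi> p = app T \<phi> p) \<Longrightarrow> S = T"
  by (auto simp: blin_inject_iff app_def intro!: blinfun_eqI bcontfun_eqI)

lemma norm_cbop_le: "0 \<le> c \<Longrightarrow> (\<And>\<phi>. norm (app T \<phi>) \<le> c * norm \<phi>) \<Longrightarrow> norm T \<le> c"
  by (simp add: norm_cbop_def app_def norm_blinfun_bound)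

definition cbop_of :: "(('a::topological_space \<Rightarrow>\<^sub>C complex) \<Rightarrow> ('a \<Rightarrow>\<^sub>C complex)) \<Rightarrow> 'a cbop" where
  "cbop_of f = Cbop (Blinfun f)"

lemma app_cbop_of: "bounded_linear f \<Longrightarrow> app (cbop_of f) = f"
  by (rule ext) (simp add: app_def cbop_of_def bounded_linear_Blinfun_apply)

lemma apply_bcontfun_simps [simp]:
  "apply_bcontfun (f + g) p = apply_bcontfun f p + apply_bcontfun g p"
  "apply_bcontfun (f - g) p = apply_bcontfun f p - apply_bcontfun g p"
  "apply_bcontfun (- f) p = - apply_bcontfun f p"
  "apply_bcontfun 0 p = 0"
  "apply_bcontfun (r *\<^sub>R f) p = r *\<^sub>R apply_bcontfun f p"
  for f g :: "'a::topological_space \<Rightarrow>\<^sub>C 'b::real_normed_vector"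
  by (simp_all add: plus_bcontfun.rep_eq minus_bcontfun.rep_eq uminus_bcontfun.rep_eq
      zero_bcontfun.rep_eq scaleR_bcontfun.rep_eq const_bcontfun.rep_eq)

lemma apply_bcontfun_sum: "apply_bcontfun (sum f A) p = (\<Sum>i\<in>A. apply_bcontfun (f i) p)"
  for f :: "'i \<Rightarrow> 'a::topological_space \<Rightarrow>\<^sub>C 'b::real_normed_vector"
  by (induction A rule: infinite_finite_induct) auto

lemma bounded_linear_apply_bcontfun:
  "bounded_linear (\<lambda>f :: 'a::topological_space \<Rightarrow>\<^sub>C 'b::real_normed_vector. apply_bcontfun f p)"
  by (rule bounded_linear_intro[of _ 1]) (simp_all add: norm_bounded)

text \<open>Scalars, conjugation, pullbacks and \<open>theta\<close> are all given by pointwise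
  formulas. Checking continuity and boundedness once guarantees that \<open>Bcontfun\<close> is
  applied only to functions in its domain.\<close>

lemma cbop_from_pointwise:
  fixes F :: "('a::topological_space \<Rightarrow>\<^sub>C complex) \<Rightarrow> 'a \<Rightarrow> complex"
  assumes cont: "\<And>\<phi>. continuous_on UNIV (F \<phi>)"
    and bd: "\<And>\<phi> p. norm (F \<phi> p) \<le> c * norm \<phi>"
    and add: "\<And>\<phi> \<psi> p. F (\<phi> + \<psi>) p = F \<phi> p + F \<psi> p"
    and scale: "\<And>r \<phi> p. F (r *\<^sub>R \<phi>) p = r *\<^sub>R F \<phi> p"
  shows "apply_bcontfun (app (cbop_of (\<lambda>\<phi>. Bcontfun (F \<phi>))) \<phi>) p = F \<phi> p"
    and "0 \<le> c \<Longrightarrow> norm (cbop_of (\<lambda>\<phi>. Bcontfun (F \<phi>))) \<le> c"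
proof -
  have b: "F \<phi> \<in> bcontfun" for \<phi>
    using cont bd by (rule bcontfun_normI)
  have ap: "apply_bcontfun (Bcontfun (F \<phi>)) p = F \<phi> p" for \<phi> p
    by (simp add: Bcontfun_inverse b)
  have nb: "norm (Bcontfun (F \<phi>)) \<le> c * norm \<phi>" for \<phi>
    by (rule norm_bound) (simp add: ap bd)
  have bl: "bounded_linear (\<lambda>\<phi>. Bcontfun (F \<phi>))"
    by (rule bounded_linear_intro[of _ c])
      (use nb in \<open>auto intro!: bcontfun_eqI simp: ap add scale mult.commute\<close>)
  show "apply_bcontfun (app (cbop_of (\<lambda>\<phi>. Bcontfun (F \<phi>))) \<phi>) p = F \<phi> p"
    by (simp add: app_cbop_of[OF bl] ap)
  show "norm (cbop_of (\<lambda>\<phi>. Bcontfun (F \<phi>))) \<le> c" if "0 \<le> c"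
    by (rule norm_cbop_le[OF that]) (simp add: app_cbop_of[OF bl] nb)
qed

text \<open>Complex scalars enter as operators, the algebra being one over the reals. Commuting with
  every \<open>mulc c\<close> is complex linearity.\<close>

definition mulc :: "complex \<Rightarrow> 'a::topological_space cbop" where
  "mulc c = cbop_of (\<lambda>\<phi>. Bcontfun (\<lambda>p. c * \<phi> p))"

lemma app_mulc [simp]: "apply_bcontfun (app (mulc c) \<phi>) p = c * \<phi> p"
  and norm_mulc_le: "norm (mulc c :: 'a cbop) \<le> norm c"
  for \<phi> :: "'a::topological_space \<Rightarrow>\<^sub>C complex"
  unfolding mulc_def
  by (rule cbop_from_pointwise[where c="norm c"];
      auto simp: algebra_simps norm_mult mult_left_mono norm_bounded intro!: continuous_intros)+

text \<open>Commuting with this real-linear operator says that an operator maps real functions to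
  real functions.\<close>

definition cnjop :: "'a::topological_space cbop" where
  "cnjop = cbop_of (\<lambda>\<phi>. Bcontfun (\<lambda>p. cnj (\<phi> p)))"

lemma app_cnjop [simp]: "apply_bcontfun (app cnjop \<phi>) p = cnj (\<phi> p)"
  for \<phi> :: "'a::topological_space \<Rightarrow>\<^sub>C complex"
  unfolding cnjop_def
  by (rule cbop_from_pointwise[where c=1];
      auto simp: norm_bounded intro!: continuous_intros)+

definition pullback :: "('a \<Rightarrow> 'a) \<Rightarrow> 'a::topological_space cbop" where
  "pullback h = cbop_of (\<lambda>\<phi>. Bcontfun (\<lambda>p. \<phi> (h p)))"

lemma app_pullback: "continuous_on UNIV h \<Longrightarrow> apply_bcontfun (app (pullback h) \<phi>) p = \<phi> (h p)"
  and norm_pullback_le: "continuous_on UNIV h \<Longrightarrow> norm (pullback h :: 'a cbop) \<le> 1"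
  for \<phi> :: "'a::topological_space \<Rightarrow>\<^sub>C complex"
  unfolding pullback_def
  by (rule cbop_from_pointwise[where c=1];
      auto simp: norm_bounded intro!: continuous_on_compose2[OF continuous_on_apply_bcontfun])+

abbreviation Jop :: "'a::topological_space cbop" where "Jop \<equiv> mulc \<i>"

lemma mulc_mult: "mulc (a * b) = mulc a * mulc b"
  by (rule cbop_eqI) simp

lemma mulc_add: "mulc (a + b) = mulc a + mulc b"
  by (rule cbop_eqI) (simp add: app.add_left algebra_simps)

lemma mulc_of_real: "mulc (of_real r) = r *\<^sub>R 1"
  by (rule cbop_eqI) (simp only: app.scaleR_left app_one app_mulc apply_bcontfun_simps, simp only: scaleR_conv_of_real)

lemma Jop_sq: "Jop * Jop = - (1 :: 'a::topological_space cbop)"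
  by (rule cbop_eqI) (simp add: app.minus_left flip: mult.assoc)

lemma norm_Jop: "norm (Jop :: 'a::topological_space cbop) \<le> 1"
  using norm_mulc_le[of \<i>] by simp

lemma cnjop_Jop: "cnjop * Jop = - (Jop * cnjop :: 'a::topological_space cbop)"
  by (rule cbop_eqI) (simp add: app.minus_left)

section \<open>Exponentials in real Banach algebras and closed subalgebras\<close>

lemma exp_intertwine:
  fixes A B C :: "'a::{real_normed_algebra_1,banach}"
  assumes "C * A = B * C"
  shows "C * exp A = exp B * C"
proof -
  have p: "C * A ^ n = B ^ n * C" for n
  proof (induction n)
    case (Suc n)
    have "C * A ^ Suc n = (C * A) * A ^ n" by (simp add: mult.assoc)
    also have "\<dots> = B * (C * A ^ n)" by (simp add: assms mult.assoc)
    finally show ?case by (simp add: Suc mult.assoc)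
  qed simp
  have "C * exp A = (\<Sum>n. C * (A ^ n /\<^sub>R fact n))"
    unfolding exp_def by (rule suminf_mult[symmetric]) (rule summable_exp_generic)
  also have "\<dots> = (\<Sum>n. (B ^ n /\<^sub>R fact n) * C)" by (simp add: p)
  also have "\<dots> = exp B * C"
    unfolding exp_def by (rule suminf_mult2[symmetric]) (rule summable_exp_generic)
  finally show ?thesis .
qed

text \<open>Commutants, and the operators preserving functions that vanish at infinity, are of this
  kind; membership then passes to norm-convergent series and to exponentials.\<close>

definition closed_subalg :: "'a::real_normed_algebra_1 set \<Rightarrow> bool" where
  "closed_subalg P \<longleftrightarrow> closed P \<and> 1 \<in> P \<and> (\<forall>x\<in>P. \<forall>y\<in>P. x + y \<in> P \<and> x * y \<in> P) \<and>
     (\<forall>r. \<forall>x\<in>P. r *\<^sub>R x \<in> P)"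

lemma closed_subalgD:
  assumes "closed_subalg P"
  shows "closed P" "1 \<in> P" "x \<in> P \<Longrightarrow> y \<in> P \<Longrightarrow> x + y \<in> P" "x \<in> P \<Longrightarrow> y \<in> P \<Longrightarrow> x * y \<in> P"
    "x \<in> P \<Longrightarrow> r *\<^sub>R x \<in> P" "0 \<in> P" "x \<in> P \<Longrightarrow> x ^ n \<in> P"
    "x \<in> P \<Longrightarrow> y \<in> P \<Longrightarrow> x - y \<in> P"
proof -
  note A = assms[unfolded closed_subalg_def]
  show "closed P" "1 \<in> P" and a: "x \<in> P \<Longrightarrow> y \<in> P \<Longrightarrow> x + y \<in> P"
    and m: "x \<in> P \<Longrightarrow> y \<in> P \<Longrightarrow> x * y \<in> P" and s: "x \<in> P \<Longrightarrow> r *\<^sub>R x \<in> P" for x y r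
    using A by auto
  show "0 \<in> P" using s[of 1 0] A by simp
  show "x \<in> P \<Longrightarrow> x ^ n \<in> P" by (induction n) (use A in auto)
  show "x \<in> P \<Longrightarrow> y \<in> P \<Longrightarrow> x - y \<in> P" using a[of x "(-1) *\<^sub>R y"] s[of y "-1"] by simp
qed

lemma closed_subalg_sum:
  assumes "closed_subalg P" "\<And>i. i \<in> I \<Longrightarrow> f i \<in> P"
  shows "sum f I \<in> P"
  using assms(2) by (induction I rule: infinite_finite_induct) (auto intro: closed_subalgD[OF assms(1)])

lemma closed_subalg_suminf:
  fixes f :: "nat \<Rightarrow> 'a::{real_normed_algebra_1,banach}"
  assumes "closed_subalg P" "\<And>i. f i \<in> P" "summable f"
  shows "suminf f \<in> P"
  by (rule closed_sequentially[OF closed_subalgD(1)[OF assms(1)] _ summable_LIMSEQ[OF assms(3)]])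
    (rule closed_subalg_sum[OF assms(1,2)])

lemma closed_subalg_exp:
  fixes A :: "'a::{real_normed_algebra_1,banach}"
  assumes "closed_subalg P" "A \<in> P"
  shows "exp A \<in> P"
  unfolding exp_def
  by (intro closed_subalg_suminf[OF assms(1)] closed_subalgD(5,7)[OF assms(1)] assms(2)
      summable_exp_generic)

lemma closed_subalg_commute: "closed_subalg {T :: 'a::real_normed_algebra_1. T * D = D * T}"
  unfolding closed_subalg_def
proof safe
  show "closed {T :: 'a. T * D = D * T}"
    by (intro closed_Collect_eq continuous_intros)
next
  fix x y :: 'a assume c: "x * D = D * x" "y * D = D * y"
  have "x * y * D = x * D * y" by (simp only: c(2) mult.assoc)
  also have "\<dots> = D * (x * y)" by (simp only: c(1) mult.assoc)
  finally show "x * y * D = D * (x * y)" .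
qed (simp_all add: algebra_simps)

lemma closed_subalg_Inter: "(\<And>P. P \<in> \<P> \<Longrightarrow> closed_subalg P) \<Longrightarrow> closed_subalg (\<Inter>\<P>)"
  by (auto simp: closed_subalg_def)

text \<open>Since \<open>fact (n + k)\<close> is at least \<open>fact n\<close>, the tail is
  dominated by \<open>norm A ^ k\<close> times the full series of \<open>exp (norm A)\<close>.
  Orders 1, 2 and 3 are used later.\<close>

lemma exp_remainder:
  fixes A :: "'a::{real_normed_algebra_1,banach}"
  shows "norm (exp A - (\<Sum>n<k. A ^ n /\<^sub>R fact n)) \<le> norm A ^ k * exp (norm A)"
proof -
  have eq: "exp A - (\<Sum>n<k. A ^ n /\<^sub>R fact n) = (\<Sum>n. A ^ (n + k) /\<^sub>R fact (n + k))"
    using exp_first_terms[of A k] by simp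
  have "norm (A ^ (n + k) /\<^sub>R fact (n + k)) \<le> norm A ^ k * (norm A ^ n /\<^sub>R fact n)" for n
  proof -
    have "norm (A ^ (n + k) /\<^sub>R fact (n + k)) \<le> norm A ^ (n + k) / fact (n + k)"
      by (simp add: norm_power_ineq divide_simps)
    also have "\<dots> \<le> norm A ^ (n + k) / fact n"
      by (intro divide_left_mono) (simp_all add: fact_mono)
    finally show ?thesis by (simp add: power_add field_simps)
  qed
  moreover have s: "summable (\<lambda>n. norm A ^ k * (norm A ^ n /\<^sub>R fact n))"
    by (intro summable_mult summable_exp_generic)
  ultimately have "norm (\<Sum>n. A ^ (n + k) /\<^sub>R fact (n + k)) \<le> (\<Sum>n. norm A ^ k * (norm A ^ n /\<^sub>R fact n))"
    by (intro norm_suminf_le)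
  also have "\<dots> = norm A ^ k * exp (norm A)"
    unfolding exp_def by (intro suminf_mult summable_exp_generic)
  finally show ?thesis by (simp only: eq)
qed

section \<open>Linear growth of exponentials of averages along two-sided orbits\<close>

definition avg :: "(int \<Rightarrow> complex) \<Rightarrow> int \<Rightarrow> complex" where
  "avg b l = (b (l + 1) + b (l - 1)) / 2"

lemma avg_pow_Suc: "(avg ^^ Suc k) b l = ((avg ^^ k) b (l + 1) + (avg ^^ k) b (l - 1)) / 2"
  by (simp add: avg_def[of "(avg ^^ k) b"])

lemma avg_pow_bound: "(\<And>l. norm (b l) \<le> c) \<Longrightarrow> norm ((avg ^^ k) b l) \<le> c"
proof (induction k arbitrary: l)
  case (Suc k)
  have "norm ((avg ^^ k) b (l + 1) + (avg ^^ k) b (l - 1)) \<le> c + c"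
    by (intro norm_triangle_le add_mono Suc)
  then show ?case by (simp add: avg_pow_Suc norm_divide del: funpow.simps)
qed simp

text \<open>Finite propagation: each application of \<open>avg\<close> looks one step further to
  either side.\<close>

lemma avg_pow_local:
  "(\<And>l. \<bar>l\<bar> \<le> int h \<Longrightarrow> b l = b' l) \<Longrightarrow> \<bar>l\<bar> + int k \<le> int h \<Longrightarrow> (avg ^^ k) b l = (avg ^^ k) b' l"
proof (induction k arbitrary: l)
  case (Suc k)
  have "(avg ^^ k) b (l + 1) = (avg ^^ k) b' (l + 1)" "(avg ^^ k) b (l - 1) = (avg ^^ k) b' (l - 1)"
    using Suc.prems(2) by (auto intro!: Suc.IH Suc.prems(1))
  then show ?case by (simp only: avg_pow_Suc)
qed simp

lemma avg_pow_exp_sum: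
  "(avg ^^ k) (\<lambda>l. \<Sum>j\<in>A. \<beta> j * cis (\<theta> j * of_int l)) l
    = (\<Sum>j\<in>A. \<beta> j * cos (\<theta> j) ^ k * cis (\<theta> j * of_int l))"
proof (induction k arbitrary: l)
  case (Suc k)
  have c: "cis (x + y) + cis (x - y) = 2 * cos y * cis x" for x y :: real
    by (simp add: complex_eq_iff cos_add cos_diff sin_add sin_diff)
  have "(avg ^^ Suc k) (\<lambda>l. \<Sum>j\<in>A. \<beta> j * cis (\<theta> j * of_int l)) l =
     (\<Sum>j\<in>A. \<beta> j * cos (\<theta> j) ^ k * (cis (\<theta> j * of_int l + \<theta> j) + cis (\<theta> j * of_int l - \<theta> j))) / 2"
    by (simp add: avg_pow_Suc Suc del: funpow.simps flip: sum.distrib) (simp add: algebra_simps)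
  also have "\<dots> = (\<Sum>j\<in>A. \<beta> j * cos (\<theta> j) ^ Suc k * cis (\<theta> j * of_int l))"
    unfolding c sum_divide_distrib by (rule sum.cong) (simp_all add: field_simps)
  finally show ?case .
qed simp

lemma root_of_unity_sum:
  fixes d :: int assumes M: "M > 0"
  shows "(\<Sum>j<M. cis (2 * pi * real j / real M * of_int d)) = (if int M dvd d then of_nat M else 0)"
proof -
  define \<zeta> where "\<zeta> = cis (2 * pi * of_int d / real M)"
  have z: "cis (2 * pi * real j / real M * of_int d) = \<zeta> ^ j" for j
    unfolding \<zeta>_def Complex.DeMoivre by (rule arg_cong[of _ _ cis]) simp
  have zM: "\<zeta> ^ M = 1"
    using M cis_multiple_2pi[of "of_int d"] by (simp add: \<zeta>_def Complex.DeMoivre)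
  show ?thesis
  proof (cases "int M dvd d")
    case True
    then obtain q where "d = int M * q" by auto
    then have "\<zeta> = cis (2 * pi * of_int q)"
      unfolding \<zeta>_def using M by (intro arg_cong[of _ _ cis]) simp
    then have "\<zeta> = 1" by (simp only: complex_eq_iff cis.sel cos_int_2pin sin_int_2pin one_complex.sel)
    then show ?thesis unfolding z using True by simp
  next
    case False
    have "\<zeta> \<noteq> 1"
    proof
      assume "\<zeta> = 1"
      from arg_cong[OF this, of Re] have "cos (2 * pi * of_int d / real M) = 1"
        unfolding \<zeta>_def by (simp only: cis.sel one_complex.sel)
      then obtain q :: int where "2 * pi * of_int d / real M = of_int q * 2 * pi"
        unfolding cos_one_2pi_int by blast
      then have "pi * real_of_int d = pi * of_int (q * int M)" using M by (simp add: divide_simps mult_ac)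
      then have "d = q * int M" using pi_neq_zero unfolding mult_cancel_left of_int_eq_iff by blast
      with False show False by simp
    qed
    then show ?thesis unfolding z using False zM by (simp add: sum_gp_strict)
  qed
qed

text \<open>The sequence is replaced by a periodic one, which is a combination of characters;
  each character is an eigenvector of the averaging operator with real eigenvalue.\<close>
lemma exp_avg_bound:
  fixes b :: "int \<Rightarrow> complex"
  assumes b: "\<And>l. norm (b l) \<le> 1"
  shows "norm (\<Sum>k. (\<i> * of_real t) ^ k / fact k * (avg ^^ k) b 0) \<le> 8 * \<bar>t\<bar> + 7"
proof -
  \<comment> \<open>\<open>h\<close> is the radius on which b and its periodic replacement agree. By
    ln 2 \<ge> 1/2 it satisfies exp (2 |t|) \<le> 2 ^ h, which makes the terms k > h harmless, while
    the period 2 h + 1 remains linear in |t|.\<close>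
  define h where "h = nat \<lceil>4 * \<bar>t\<bar>\<rceil>"
  define M where "M = 2 * h + 1"
  have M: "M > 0" by (simp add: M_def)
  have h: "4 * \<bar>t\<bar> \<le> real h" "real h \<le> 4 * \<bar>t\<bar> + 1" unfolding h_def by linarith+
  define b' where "b' l = b ((l + int h) mod int M - int h)" for l
  have bb: "b l = b' l" if "\<bar>l\<bar> \<le> int h" for l
  proof -
    have "(l + int h) mod int M = l + int h"
      using that by (intro mod_pos_pos_trivial) (auto simp: M_def)
    then show ?thesis by (simp add: b'_def)
  qed
  have b': "norm (b' l) \<le> 1" for l by (simp add: b'_def b)
  have per: "b' (l mod int M) = b' l" for l
    by (simp add: b'_def mod_add_left_eq)
  define \<theta> where "\<theta> j = 2 * pi * real j / real M" for j
  define \<beta> where "\<beta> j = (\<Sum>r<M. b' (int r) * cis (- \<theta> j * real r)) / of_nat M" for j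
  \<comment> \<open>Every Fourier coefficient is at most 1 and every exponential below has modulus
    1, so the periodic part costs no more than the period M.\<close>
  have \<beta>: "norm (\<beta> j) \<le> 1" for j
  proof -
    have "norm (\<Sum>r<M. b' (int r) * cis (- \<theta> j * real r)) \<le> (\<Sum>r<M. 1)"
      by (intro sum_norm_le) (simp add: norm_mult b')
    then show ?thesis using M by (simp add: \<beta>_def norm_divide)
  qed
  have inv: "b' l = (\<Sum>j<M. \<beta> j * cis (\<theta> j * of_int l))" for l
  proof -
    have "(\<Sum>j<M. \<beta> j * cis (\<theta> j * of_int l)) =
        (\<Sum>j<M. \<Sum>r<M. b' (int r) / of_nat M * cis (2 * pi * real j / real M * of_int (l - int r)))"
      unfolding \<beta>_def sum_divide_distrib sum_distrib_right
      by (intro sum.cong refl) (simp add: \<theta>_def cis_mult algebra_simps diff_divide_distrib)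
    also have "\<dots> = (\<Sum>r<M. b' (int r) / of_nat M *
        (\<Sum>j<M. cis (2 * pi * real j / real M * of_int (l - int r))))"
      by (subst sum.swap) (simp add: sum_distrib_left)
    also have "\<dots> = (\<Sum>r<M. if r = nat (l mod int M) then b' (int r) else 0)"
    proof (intro sum.cong refl)
      fix r assume r: "r \<in> {..<M}"
      have "int M dvd l - int r \<longleftrightarrow> l mod int M = int r mod int M"
        by (simp add: mod_eq_dvd_iff)
      also have "\<dots> \<longleftrightarrow> r = nat (l mod int M)"
        using r M by (auto simp: nat_eq_iff)
      finally have "int M dvd l - int r \<longleftrightarrow> r = nat (l mod int M)" .
      then show "b' (int r) / of_nat M * (\<Sum>j<M. cis (2 * pi * real j / real M * of_int (l - int r)))
          = (if r = nat (l mod int M) then b' (int r) else 0)"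
        unfolding root_of_unity_sum[OF M] using M by simp
    qed
    also have "\<dots> = b' (l mod int M)"
      using M by (simp add: nat_less_iff)
    finally show ?thesis by (simp add: per)
  qed
  define F where "F b = (\<lambda>k. (\<i> * of_real t) ^ k / fact k * (avg ^^ k) b 0)" for b
  have Fn: "norm (F b k) \<le> \<bar>t\<bar> ^ k / fact k" if "\<And>l. norm (b l) \<le> 1" for b k
  proof -
    have "norm (F b k) = \<bar>t\<bar> ^ k / fact k * norm ((avg ^^ k) b 0)"
      by (simp add: F_def norm_mult norm_divide norm_power)
    also have "\<dots> \<le> \<bar>t\<bar> ^ k / fact k * 1"
      by (intro mult_left_mono avg_pow_bound that) auto
    finally show ?thesis by simp
  qed
  have sR: "summable (\<lambda>k. r ^ k / fact k)" for r :: real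
    using summable_exp_generic[of r] by (simp add: field_simps)
  have sF: "summable (F b)" if "\<And>l. norm (b l) \<le> 1" for b
    by (rule summable_comparison_test'[OF sR[of "\<bar>t\<bar>"], of 0]) (use Fn[OF that] in auto)
  have e1: "norm (suminf (F b')) \<le> real M"
  proof -
    have "F b' k = (\<Sum>j<M. \<beta> j * ((\<i> * of_real (t * cos (\<theta> j))) ^ k /\<^sub>R fact k))" for k
    proof -
      have "(avg ^^ k) b' 0 = (\<Sum>j<M. \<beta> j * cos (\<theta> j) ^ k)"
        using avg_pow_exp_sum[where k=k and \<beta>=\<beta> and \<theta>=\<theta> and A="{..<M}" and l=0]
        by (simp add: inv[abs_def])
      then show ?thesis
        by (simp add: F_def sum_distrib_left scaleR_conv_of_real power_mult_distrib field_simps)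
    qed
    then have F_eq: "F b' = (\<lambda>k. \<Sum>j<M. \<beta> j * ((\<i> * of_real (t * cos (\<theta> j))) ^ k /\<^sub>R fact k))"
      by (rule ext)
    have "F b' sums (\<Sum>j<M. \<beta> j * exp (\<i> * of_real (t * cos (\<theta> j))))"
      unfolding F_eq by (intro sums_sum sums_mult exp_converges)
    then have "suminf (F b') = (\<Sum>j<M. \<beta> j * exp (\<i> * of_real (t * cos (\<theta> j))))"
      by (rule sums_unique[symmetric])
    also have "norm \<dots> \<le> (\<Sum>j<M. 1)"
      by (intro sum_norm_le) (simp only: norm_mult norm_exp_i_times mult_1_right \<beta>)
    finally show ?thesis by simp
  qed
  have e2: "norm (suminf (F b) - suminf (F b')) \<le> 2"
  proof -
    have "norm (F b k - F b' k) \<le> 2 / 2 ^ h * ((2 * \<bar>t\<bar>) ^ k / fact k)" for k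
    proof (cases "k \<le> h")
      case True
      then have "(avg ^^ k) b 0 = (avg ^^ k) b' 0"
        by (intro avg_pow_local[of h]) (auto simp: bb)
      then show ?thesis by (simp add: F_def)
    next
      case False
      \<comment> \<open>For k > h a factor 2 ^ k / 2 ^ h \<ge> 1 is inserted. The power 2 ^ k turns
        |t| into 2 |t|, and the tail sums to at most 2 exp (2 |t|) / 2 ^ h.\<close>
      then have "(2::real) ^ h \<le> 2 ^ k" by simp
      then have *: "1 \<le> 2 ^ k / (2::real) ^ h" by simp
      have "norm (F b k - F b' k) \<le> \<bar>t\<bar> ^ k / fact k + \<bar>t\<bar> ^ k / fact k"
        by (intro norm_triangle_le_diff add_mono Fn b b')
      also have "\<dots> \<le> (2 ^ k / 2 ^ h) * (\<bar>t\<bar> ^ k / fact k + \<bar>t\<bar> ^ k / fact k)"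
        using mult_right_mono[OF *, of "\<bar>t\<bar> ^ k / fact k + \<bar>t\<bar> ^ k / fact k"] by simp
      finally show ?thesis by (simp add: power_mult_distrib field_simps)
    qed
    moreover have "summable (\<lambda>k. 2 / 2 ^ h * ((2 * \<bar>t\<bar>) ^ k / fact k))"
      by (intro summable_mult sR)
    ultimately have "norm (\<Sum>k. F b k - F b' k) \<le> (\<Sum>k. 2 / 2 ^ h * ((2 * \<bar>t\<bar>) ^ k / fact k))"
      by (intro norm_suminf_le)
    also have "\<dots> = 2 / 2 ^ h * exp (2 * \<bar>t\<bar>)"
      unfolding exp_def by (subst suminf_mult[OF sR]) (simp add: divide_inverse mult.commute)
    also have "\<dots> \<le> 2"
    proof -
      have "2 * \<bar>t\<bar> \<le> real h * ln 2"
      proof -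
        have "2 * \<bar>t\<bar> \<le> real h * (1/2)" using h by simp
        also have "\<dots> \<le> real h * ln 2"
          using ln_le_minus_one[of "1/2 :: real"] by (intro mult_left_mono) (auto simp: ln_div)
        finally show ?thesis .
      qed
      then have "exp (2 * \<bar>t\<bar>) \<le> exp (real h * ln 2)" by simp
      also have "\<dots> = 2 ^ h" by (simp add: exp_of_nat_mult)
      finally show ?thesis by (simp add: field_simps)
    qed
    finally show ?thesis by (simp add: suminf_diff sF b b')
  qed
  have "norm (suminf (F b)) \<le> norm (suminf (F b')) + norm (suminf (F b) - suminf (F b'))"
    by (metis add.commute diff_add_cancel norm_triangle_ineq)
  also have "\<dots> \<le> 8 * \<bar>t\<bar> + 7" using e1 e2 h by (simp add: M_def)
  finally show ?thesis by (simp add: F_def)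
qed

text \<open>At a point p the operator sees \<phi> only along the two-sided orbit of p under h, where
  it acts as \<open>avg\<close> on a sequence indexed by the integers. The linear bound replaces the
  exponential one that the operator norm gives.\<close>

lemma norm_exp_pullback_le:
  assumes hc: "continuous_on UNIV h" "continuous_on UNIV h'"
    and inv: "\<And>p. h (h' p) = p" "\<And>p. h' (h p) = p"
  shows "norm (exp (t *\<^sub>R (Jop * ((1/2) *\<^sub>R (pullback h + pullback h'))))) \<le> 8 * \<bar>t\<bar> + 7"
proof (rule norm_cbop_le)
  show "0 \<le> 8 * \<bar>t\<bar> + 7" by simp
next
  fix \<phi> :: "'a \<Rightarrow>\<^sub>C complex"
  define Q where "Q = (1/2) *\<^sub>R (pullback h + pullback h' :: 'a cbop)"
  have appQ: "app Q \<psi> p = (\<psi> (h p) + \<psi> (h' p)) / 2" for \<psi> p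
    by (simp add: Q_def app.add_left app.scaleR_left app_pullback hc del: scaleR_conv_of_real)
      (simp add: scaleR_conv_of_real)
  have pw: "(t *\<^sub>R (Jop * Q)) ^ k = mulc ((\<i> * of_real t) ^ k) * Q ^ k" for k
  proof (induction k)
    case 0
    show ?case by (rule cbop_eqI) simp
  next
    case (Suc k)
    have c: "mulc a * Q = Q * mulc a" for a
      by (rule cbop_eqI) (simp add: appQ algebra_simps)
    have t: "t *\<^sub>R (Jop * Q) = mulc (\<i> * of_real t) * Q"
      by (simp add: mulc_mult mulc_of_real)
    have "(t *\<^sub>R (Jop * Q)) ^ Suc k = mulc (\<i> * of_real t) * (Q * mulc ((\<i> * of_real t) ^ k)) * Q ^ k"
      using Suc t by (simp add: mult.assoc)
    also have "\<dots> = mulc ((\<i> * of_real t) ^ Suc k) * Q ^ Suc k"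
      by (simp only: c[symmetric] mult.assoc) (simp add: mulc_mult mult.assoc)
    finally show ?case .
  qed
  have "norm (app (exp (t *\<^sub>R (Jop * Q))) \<phi> p) \<le> (8 * \<bar>t\<bar> + 7) * norm \<phi>" for p
  proof (cases "\<phi> = 0")
    case False
    \<comment> \<open>With h' at negative indices, h and h' become the two shifts of the
      index.\<close>
    define orb where "orb l = (if l \<ge> 0 then (h ^^ nat l) p else (h' ^^ nat (- l)) p)" for l :: int
    have orb1: "h (orb l) = orb (l + 1)" for l
    proof -
      consider "l \<ge> 0" | "l = -1" | "l < -1" by linarith
      then show ?thesis
      proof cases
        case 1
        then have "nat (l + 1) = Suc (nat l)" by simp
        then show ?thesis using 1 by (simp add: orb_def)
      next
        case 3
        then have "nat (- l) = Suc (nat (- (l + 1)))" by simp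
        then show ?thesis using 3 inv by (simp add: orb_def)
      qed (simp add: orb_def inv)
    qed
    have orb2: "h' (orb l) = orb (l - 1)" for l
      using orb1[of "l - 1"] inv by (metis diff_add_cancel)
    define b where "b l = \<phi> (orb l) / of_real (norm \<phi>)" for l
    have b1: "norm (b l) \<le> 1" for l
      using norm_bounded[of \<phi> "orb l"] False by (simp add: b_def norm_divide)
    have Qk: "app (Q ^ k) \<phi> (orb l) = of_real (norm \<phi>) * (avg ^^ k) b l" for k l
    proof (induction k arbitrary: l)
      case 0
      show ?case using False by (simp add: b_def)
    next
      case (Suc k)
      have "app (Q ^ Suc k) \<phi> (orb l) = (app (Q ^ k) \<phi> (orb (l + 1)) + app (Q ^ k) \<phi> (orb (l - 1))) / 2"
        by (simp add: appQ orb1 orb2)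
      then show ?case by (simp add: Suc avg_pow_Suc algebra_simps del: funpow.simps power_Suc)
    qed
    have lin: "bounded_linear (\<lambda>T. apply_bcontfun (app T \<phi>) p)"
      by (rule bounded_linear_compose[OF bounded_linear_apply_bcontfun app.bounded_linear_left])
    have "app (exp (t *\<^sub>R (Jop * Q))) \<phi> p = (\<Sum>k. app ((t *\<^sub>R (Jop * Q)) ^ k /\<^sub>R fact k) \<phi> p)"
      unfolding exp_def
      by (rule bounded_linear.suminf[OF lin]) (rule summable_exp_generic)
    also have "\<dots> = (\<Sum>k. of_real (norm \<phi>) * ((\<i> * of_real t) ^ k / fact k * (avg ^^ k) b 0))"
    proof (rule suminf_cong)
      fix k
      have "app (Q ^ k) \<phi> p = of_real (norm \<phi>) * (avg ^^ k) b 0"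
        using Qk[of k 0] by (simp add: orb_def)
      then have "app ((t *\<^sub>R (Jop * Q)) ^ k /\<^sub>R fact k) \<phi> p
          = ((\<i> * of_real t) ^ k * (of_real (norm \<phi>) * (avg ^^ k) b 0)) /\<^sub>R fact k"
        by (simp only: pw app.scaleR_left apply_bcontfun_simps app_mult app_mulc)
      then show "app ((t *\<^sub>R (Jop * Q)) ^ k /\<^sub>R fact k) \<phi> p
          = of_real (norm \<phi>) * ((\<i> * of_real t) ^ k / fact k * (avg ^^ k) b 0)"
        by (simp add: scaleR_conv_of_real divide_inverse)
    qed
    also have "\<dots> = of_real (norm \<phi>) * (\<Sum>k. (\<i> * of_real t) ^ k / fact k * (avg ^^ k) b 0)"
    proof (rule suminf_mult)
      have "summable (\<lambda>k. \<bar>t\<bar> ^ k /\<^sub>R fact k)" by (rule summable_exp_generic)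
      then show "summable (\<lambda>k. (\<i> * of_real t) ^ k / fact k * (avg ^^ k) b 0)"
      proof (rule summable_comparison_test'[of _ 0])
        fix k
        have "norm ((\<i> * of_real t) ^ k / fact k * (avg ^^ k) b 0) = \<bar>t\<bar> ^ k / fact k * norm ((avg ^^ k) b 0)"
          by (simp add: norm_mult norm_divide norm_power)
        also have "\<dots> \<le> \<bar>t\<bar> ^ k / fact k * 1"
          by (intro mult_left_mono avg_pow_bound b1) auto
        finally show "norm ((\<i> * of_real t) ^ k / fact k * (avg ^^ k) b 0) \<le> \<bar>t\<bar> ^ k /\<^sub>R fact k"
          by (simp add: field_simps)
      qed
    qed
    finally have "norm (app (exp (t *\<^sub>R (Jop * Q))) \<phi> p) \<le> norm \<phi> * (8 * \<bar>t\<bar> + 7)"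
      using exp_avg_bound[OF b1, of t] by (simp add: norm_mult mult_left_mono)
    then show ?thesis by (simp add: mult.commute)
  qed (simp add: app.zero_right)
  then show "norm (app (exp (t *\<^sub>R (Jop * ((1/2) *\<^sub>R (pullback h + pullback h'))))) \<phi>) \<le> (8 * \<bar>t\<bar> + 7) * norm \<phi>"
    unfolding Q_def by (rule norm_bound)
qed

section \<open>Locally compact groups with Haar measure\<close>

locale haar_group =
  fixes gmul :: "'g::t2_space \<Rightarrow> 'g \<Rightarrow> 'g" (infixl "\<cdot>" 70) and ginv :: "'g \<Rightarrow> 'g" and e :: 'g
    and \<mu> :: "'g measure"
  assumes lc: "lc_group gmul ginv e" and haar: "left_haar gmul \<mu>"
begin

lemma assoc: "(x \<cdot> y) \<cdot> z = x \<cdot> (y \<cdot> z)"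
  and e_left [simp]: "e \<cdot> x = x" and e_right [simp]: "x \<cdot> e = x"
  and inv_left [simp]: "ginv x \<cdot> x = e" and inv_right [simp]: "x \<cdot> ginv x = e"
  using lc by (auto simp: lc_group_def)

lemma inv_left' [simp]: "ginv x \<cdot> (x \<cdot> y) = y" and inv_right' [simp]: "x \<cdot> (ginv x \<cdot> y) = y"
  by (simp_all flip: assoc)

lemma inv_inv [simp]: "ginv (ginv x) = x"
  by (metis assoc e_left e_right inv_left)

lemma inv_mul: "ginv (x \<cdot> y) = ginv y \<cdot> ginv x"
  by (metis assoc e_right inv_left' inv_right)

lemma inv_e [simp]: "ginv e = e"
  by (metis e_left inv_right)

lemma lc_cont: "continuous_on UNIV (\<lambda>p. fst p \<cdot> snd p)" "continuous_on UNIV ginv"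
  and lc_space: "locally_compact_space (euclidean :: 'g topology)"
  using lc unfolding lc_group_def by auto

lemma continuous_on_gmul [continuous_intros]:
  "continuous_on S f \<Longrightarrow> continuous_on S g \<Longrightarrow> continuous_on S (\<lambda>x. f x \<cdot> g x)"
  using continuous_on_compose2[OF lc_cont(1), of S "\<lambda>x. (f x, g x)"]
  by (simp add: continuous_on_Pair)

lemma continuous_on_ginv [continuous_intros]: "continuous_on S f \<Longrightarrow> continuous_on S (\<lambda>x. ginv (f x))"
  using continuous_on_compose2[OF lc_cont(2), of S f] by simp

lemma continuous_on_gmul_left [continuous_intros]: "continuous_on S (gmul g)"
  using continuous_on_gmul[OF continuous_on_const continuous_on_id] by simp

lemma sets_mu [simp, measurable_cong]: "sets \<mu> = sets borel"
  by (rule haar[unfolded left_haar_def, THEN conjunct1])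

lemma space_mu [simp]: "space \<mu> = UNIV"
  using sets_eq_imp_space_eq[OF sets_mu] by simp

lemma cont_meas: "continuous_on UNIV f \<Longrightarrow> f \<in> borel_measurable \<mu>"
  using borel_measurable_continuous_onI[of f] by (simp cong: measurable_cong_sets)

lemma cont_meas': "continuous_on UNIV f \<Longrightarrow> f \<in> \<mu> \<rightarrow>\<^sub>M borel"
  by (rule cont_meas)

lemma emeasure_compact: "compact K \<Longrightarrow> emeasure \<mu> K < \<infinity>"
  using haar[unfolded left_haar_def, THEN conjunct2, THEN conjunct2, THEN conjunct1] by blast

lemma emeasure_open_pos: "open U \<Longrightarrow> U \<noteq> {} \<Longrightarrow> emeasure \<mu> U > 0"
  using haar[unfolded left_haar_def, THEN conjunct2, THEN conjunct2, THEN conjunct2, THEN conjunct1]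
  by blast

lemma outer_regular: "B \<in> sets borel \<Longrightarrow> emeasure \<mu> B = (INF U\<in>{U. open U \<and> B \<subseteq> U}. emeasure \<mu> U)"
  using haar[unfolded left_haar_def, THEN conjunct2, THEN conjunct2, THEN conjunct2,
      THEN conjunct2, THEN conjunct1] by (rule bspec)

lemma inner_regular: "open U \<Longrightarrow> emeasure \<mu> U = (SUP K\<in>{K. compact K \<and> K \<subseteq> U}. emeasure \<mu> K)"
  by (rule haar[unfolded left_haar_def, THEN conjunct2, THEN conjunct2, THEN conjunct2,
      THEN conjunct2, THEN conjunct2, THEN spec, THEN mp])

lemma compact_borel: "compact K \<Longrightarrow> K \<in> sets borel" for K :: "'g set"
  by (intro borel_closed compact_imp_closed)

lemma locally_compact: "\<exists>U K. open U \<and> compact K \<and> x \<in> U \<and> U \<subseteq> K" for x :: 'g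
  using lc_space by (auto simp: locally_compact_space_def)

section \<open>Compact neighbourhoods and Urysohn functions\<close>

lemma compact_nbhd:
  fixes C :: "'g set"
  assumes "compact C"
  shows "\<exists>U K. open U \<and> compact K \<and> C \<subseteq> U \<and> U \<subseteq> K"
proof -
  have "\<forall>x. \<exists>UK. open (fst UK) \<and> compact (snd UK) \<and> x \<in> fst UK \<and> fst UK \<subseteq> (snd UK :: 'g set)"
    using locally_compact by simp
  from choice[OF this] obtain UK where
    UK': "\<forall>x. open (fst (UK x)) \<and> compact (snd (UK x)) \<and> x \<in> fst (UK x) \<and> fst (UK x) \<subseteq> (snd (UK x) :: 'g set)"
    by blast
  define U K where "U x = fst (UK x)" and "K x = snd (UK x)" for x
  have UK: "open (U x)" "compact (K x)" "x \<in> U x" "U x \<subseteq> K x" for x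
    using UK' by (auto simp: U_def K_def)
  obtain D where D: "finite D" "C \<subseteq> (\<Union>x\<in>D. U x)"
  proof (rule compactE_image[OF assms, of C U])
    show "C \<subseteq> (\<Union>c\<in>C. U c)" using UK(3) by auto
  qed (use UK(1) in auto)
  show ?thesis
  proof (intro exI conjI)
    show "open (\<Union>x\<in>D. U x)" "compact (\<Union>x\<in>D. K x)" "(\<Union>x\<in>D. U x) \<subseteq> (\<Union>x\<in>D. K x)"
      using UK(1,2) D(1) by (auto intro!: compact_UN open_UN) (use UK(4) in blast)
  qed (rule D(2))
qed

text \<open>Locally compact Hausdorff spaces are completely regular. Letting f vanish off a
  relatively compact neighbourhood and cutting it off at height 1/2 gives a compact support inside
  W.\<close>

lemma urysohn:
  fixes C :: "'g set"
  assumes "compact C" "open W" "C \<subseteq> W"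
  obtains k :: "'g \<Rightarrow> real" and K where "continuous_on UNIV k" "\<And>x. 0 \<le> k x" "\<And>x. k x \<le> 1"
    "\<And>x. x \<in> C \<Longrightarrow> k x = 1" "compact K" "K \<subseteq> W" "\<And>x. x \<notin> K \<Longrightarrow> k x = 0"
proof -
  obtain U K0 where U: "open U" "compact K0" "C \<subseteq> U" "U \<subseteq> K0"
    using compact_nbhd[OF assms(1)] by blast
  have cr: "completely_regular_space (euclidean :: 'g topology)"
  proof (rule locally_compact_regular_imp_completely_regular_space[OF lc_space], rule disjI1)
    show "Hausdorff_space (euclidean :: 'g topology)"
      unfolding Hausdorff_space_def disjnt_def using hausdorff by (simp add: conj_commute) blast
  qed
  obtain f :: "'g \<Rightarrow> real" where f: "continuous_map euclidean (top_of_set {0..1}) f"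
      "f ` (- (W \<inter> U)) \<subseteq> {0}" "f ` C \<subseteq> {1}"
    using Urysohn_completely_regular_compact_closed[OF _ cr, of 0 1 C "- (W \<inter> U)"] assms U
    by (auto simp: disjnt_def open_Int)
  have cf: "continuous_on UNIV f" and f01: "\<And>x. 0 \<le> f x \<and> f x \<le> 1"
    using f(1) by (auto simp: continuous_map_in_subtopology Pi_iff image_subset_iff)
  define K where "K = {x. 1/2 \<le> f x}"
  have clK: "closed K" unfolding K_def by (intro closed_Collect_le cf continuous_intros)
  have KW: "K \<subseteq> W \<inter> U"
  proof
    fix x assume "x \<in> K"
    then have "f x \<noteq> 0" by (auto simp: K_def)
    then show "x \<in> W \<inter> U" using f(2) by blast
  qed
  then have "K = K0 \<inter> K" using U by auto
  then have cK: "compact K" using compact_Int_closed[OF U(2) clK] by simp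
  show thesis
  proof (rule that[of "\<lambda>x. max 0 (2 * f x - 1)" K])
    show "continuous_on UNIV (\<lambda>x. max 0 (2 * f x - 1))" by (intro continuous_intros cf)
    show "max 0 (2 * f x - 1) \<le> 1" for x using f01[of x] by auto
    show "max 0 (2 * f x - 1) = 1" if "x \<in> C" for x using f(3) that by auto
    show "max 0 (2 * f x - 1) = 0" if "x \<notin> K" for x using that by (auto simp: K_def)
  qed (use cK KW in auto)
qed

lemma translate_distr: "distr \<mu> \<mu> (\<lambda>x. g \<cdot> x) = \<mu>"
proof (rule measure_eqI)
  fix A assume "A \<in> sets (distr \<mu> \<mu> (\<lambda>x. g \<cdot> x))"
  then have A: "A \<in> sets borel" by simp
  have m: "(\<lambda>x. g \<cdot> x) \<in> measurable \<mu> \<mu>"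
    using borel_measurable_continuous_onI[of "\<lambda>x. g \<cdot> x"]
    by (auto simp: measurable_cong_sets[OF sets_mu sets_mu] intro!: continuous_intros)
  have "(\<lambda>x. g \<cdot> x) -` A = gmul (ginv g) ` A"
    by (auto simp: image_iff) (metis inv_left')
  then show "emeasure (distr \<mu> \<mu> (\<lambda>x. g \<cdot> x)) A = emeasure \<mu> A"
    using haar[unfolded left_haar_def, THEN conjunct2, THEN conjunct1] A m
    by (simp add: emeasure_distr)
qed simp

lemma translate_measurable: "(\<lambda>x. g \<cdot> x) \<in> measurable \<mu> \<mu>"
  using borel_measurable_continuous_onI[of "\<lambda>x. g \<cdot> x"]
  by (auto simp: measurable_cong_sets[OF sets_mu sets_mu] intro!: continuous_intros)

lemma integral_translate:
  fixes f :: "'g \<Rightarrow> 'b::{banach, second_countable_topology}"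
  assumes "f \<in> borel_measurable \<mu>"
  shows "(\<integral>x. f (g \<cdot> x) \<partial>\<mu>) = (\<integral>x. f x \<partial>\<mu>)"
  using integral_distr[OF translate_measurable assms, of g] by (simp add: translate_distr)

lemma integrable_translate:
  fixes f :: "'g \<Rightarrow> 'b::{banach, second_countable_topology}"
  assumes "integrable \<mu> f"
  shows "integrable \<mu> (\<lambda>x. f (g \<cdot> x))"
  using integrable_distr[OF translate_measurable, of g f] assms by (simp add: translate_distr)

lemma nn_integral_translate:
  assumes "f \<in> borel_measurable \<mu>"
  shows "(\<integral>\<^sup>+x. f (g \<cdot> x) \<partial>\<mu>) = (\<integral>\<^sup>+x. f x \<partial>\<mu>)"
  using nn_integral_distr[OF translate_measurable, of f g] assms by (simp add: translate_distr)

section \<open>Integrals of compactly supported functions and their interchange\<close>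

lemma ccont_integrable:
  fixes f :: "'g \<Rightarrow> 'b::{banach, second_countable_topology}"
  assumes "continuous_on UNIV f" "compact K" "\<And>x. x \<notin> K \<Longrightarrow> f x = 0"
  shows "integrable \<mu> f"
proof -
  have "compact (f ` K)"
    using assms by (intro compact_continuous_image) (auto intro: continuous_on_subset)
  then obtain B where "\<And>x. x \<in> K \<Longrightarrow> norm (f x) \<le> B"
    using compact_imp_bounded bounded_pos by (metis image_eqI)
  then show ?thesis
    using assms emeasure_compact[OF assms(2)] compact_borel[OF assms(2)]
    by (intro integrableI_bounded_set[of K _ _ B]) (auto intro: cont_meas)
qed

lemma integral_supp_bound:
  fixes f :: "'g \<Rightarrow> 'b::{banach, second_countable_topology}"
  assumes "f \<in> borel_measurable \<mu>" "compact K" "\<And>x. x \<notin> K \<Longrightarrow> f x = 0" "\<And>x. norm (f x) \<le> B"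
  shows "norm (\<integral>x. f x \<partial>\<mu>) \<le> B * measure \<mu> K" and "integrable \<mu> f"
proof -
  have fin: "emeasure \<mu> K < \<infinity>" and K: "K \<in> sets \<mu>"
    using emeasure_compact compact_borel assms(2) by auto
  show i: "integrable \<mu> f"
    using assms fin K by (intro integrableI_bounded_set[of K _ _ B]) auto
  have "norm (\<integral>x. f x \<partial>\<mu>) \<le> (\<integral>x. norm (f x) \<partial>\<mu>)" by (rule integral_norm_bound)
  also have "\<dots> \<le> (\<integral>x. B * indicator K x \<partial>\<mu>)"
  proof (rule integral_mono)
    show "integrable \<mu> (\<lambda>x. B * indicator K x)"
      using K fin by (intro integrable_mult_right) (simp add: integrable_indicator_iff less_top)
    show "norm (f x) \<le> B * indicator K x" for x
      using assms(3,4)[of x] by (cases "x \<in> K") auto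
  qed (use i in simp)
  also have "\<dots> = B * measure \<mu> K" using K by simp
  finally show "norm (\<integral>x. f x \<partial>\<mu>) \<le> B * measure \<mu> K" .
qed

text \<open>By the tube lemma the integrand varies uniformly over the compact L as y varies, and off
  L it vanishes.\<close>

lemma continuous_on_parametric_integral:
  fixes H :: "'x::topological_space \<Rightarrow> 'g \<Rightarrow> complex"
  assumes cont: "continuous_on UNIV (\<lambda>p. H (fst p) (snd p))"
    and L: "compact L" and supp: "\<And>y z. z \<notin> L \<Longrightarrow> H y z = 0"
  shows "continuous_on UNIV (\<lambda>y. \<integral>z. H y z \<partial>\<mu>)"
proof -
  have cH: "continuous_on UNIV (H y)" for y
    using continuous_on_compose2[OF cont, of UNIV "\<lambda>z. (y, z)"]
    by (simp add: continuous_on_Pair continuous_on_const continuous_on_id)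
  have iH: "integrable \<mu> (H y)" for y
    by (rule ccont_integrable[OF cH L supp])
  have "\<exists>A. open A \<and> y0 \<in> A \<and> (\<forall>y\<in>A. dist (\<integral>z. H y z \<partial>\<mu>) (\<integral>z. H y0 z \<partial>\<mu>) < \<epsilon>)"
    if "\<epsilon> > 0" for y0 \<epsilon>
  proof -
    define d where "d = \<epsilon> / (measure \<mu> L + 1)"
    have d: "d > 0" using that by (simp add: d_def add_nonneg_pos)
    obtain A where A: "y0 \<in> A" "open A" "\<forall>y\<in>A \<inter> UNIV. \<forall>t\<in>L. dist (H y t) (H y0 t) \<le> d"
      using continuous_on_prod_compactE[OF continuous_on_subset[OF cont subset_UNIV] L UNIV_I d, of y0]
      by auto
    have "dist (\<integral>z. H y z \<partial>\<mu>) (\<integral>z. H y0 z \<partial>\<mu>) < \<epsilon>" if y: "y \<in> A" for y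
    proof -
      have "norm (\<integral>z. H y z - H y0 z \<partial>\<mu>) \<le> d * measure \<mu> L"
      proof (rule integral_supp_bound(1)[OF _ L])
        show "norm (H y x - H y0 x) \<le> d" for x
          using A(3) y supp[of x] d by (cases "x \<in> L") (auto simp: dist_norm)
      qed (use iH supp in auto)
      also have "\<dots> < d * (measure \<mu> L + 1)" using d by simp
      also have "\<dots> = \<epsilon>"
      proof -
        have "measure \<mu> L + 1 \<noteq> 0" using measure_nonneg[of \<mu> L] by linarith
        then show ?thesis by (simp add: d_def)
      qed
      finally show ?thesis by (simp add: dist_norm Bochner_Integration.integral_diff[OF iH iH])
    qed
    then show ?thesis using A by blast
  qed
  then show ?thesis
    unfolding continuous_on_def tendsto_iff eventually_at_topological by fastforce
qed

text \<open>H is uniformly close to a function that is a step function in the first variable; for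
  the latter the interchange is linearity of the integral. All supports lie in sets of finite
  measure, so uniform closeness controls both iterated integrals.\<close>

lemma fubini_ccont:
  fixes H :: "'g \<Rightarrow> 'g \<Rightarrow> complex"
  assumes cont: "continuous_on UNIV (\<lambda>p. H (fst p) (snd p))"
    and K: "compact K" and L: "compact L"
    and suppK: "\<And>y z. y \<notin> K \<Longrightarrow> H y z = 0" and suppL: "\<And>y z. z \<notin> L \<Longrightarrow> H y z = 0"
  shows "(\<integral>y. \<integral>z. H y z \<partial>\<mu> \<partial>\<mu>) = (\<integral>z. \<integral>y. H y z \<partial>\<mu> \<partial>\<mu>)"
proof -
  have cH: "continuous_on UNIV (H y)" for y
    using continuous_on_compose2[OF cont, of UNIV "\<lambda>z. (y, z)"]
    by (simp add: continuous_on_Pair continuous_on_const continuous_on_id)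
  have cH': "continuous_on UNIV (\<lambda>y. H y z)" for z
    using continuous_on_compose2[OF cont, of UNIV "\<lambda>y. (y, z)"]
    by (simp add: continuous_on_Pair continuous_on_const continuous_on_id)
  have iH: "integrable \<mu> (H y)" for y by (rule ccont_integrable[OF cH L suppL])
  have iH': "integrable \<mu> (\<lambda>y. H y z)" for z by (rule ccont_integrable[OF cH' K suppK])
  have cI: "continuous_on UNIV (\<lambda>y. \<integral>z. H y z \<partial>\<mu>)"
    by (rule continuous_on_parametric_integral[OF cont L suppL])
  have cI': "continuous_on UNIV (\<lambda>z. \<integral>y. H y z \<partial>\<mu>)"
    by (rule continuous_on_parametric_integral[OF _ K suppK])
      (use continuous_on_compose2[OF cont, of UNIV prod.swap] in \<open>auto intro: continuous_on_swap\<close>)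
  have iI: "integrable \<mu> (\<lambda>y. \<integral>z. H y z \<partial>\<mu>)"
    by (rule ccont_integrable[OF cI K]) (simp add: suppK)
  have iI': "integrable \<mu> (\<lambda>z. \<integral>y. H y z \<partial>\<mu>)"
    by (rule ccont_integrable[OF cI' L]) (simp add: suppL)
  define m where "m = measure \<mu> K * measure \<mu> L"
  have bound: "norm ((\<integral>y. \<integral>z. H y z \<partial>\<mu> \<partial>\<mu>) - (\<integral>z. \<integral>y. H y z \<partial>\<mu> \<partial>\<mu>)) \<le> 2 * \<epsilon> * m"
    if \<epsilon>: "\<epsilon> > 0" for \<epsilon>
  proof -
    have "\<forall>y0. \<exists>A. open A \<and> y0 \<in> A \<and> (\<forall>y\<in>A. \<forall>z\<in>L. dist (H y z) (H y0 z) \<le> \<epsilon>)"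
      by (rule allI, rule continuous_on_prod_compactE[OF continuous_on_subset[OF cont subset_UNIV] L UNIV_I \<epsilon>]) auto
    from choice[OF this] obtain A where A: "\<And>y0. open (A y0)" "\<And>y0. y0 \<in> A y0"
      "\<And>y0. \<forall>y\<in>A y0. \<forall>z\<in>L. dist (H y z) (H y0 z) \<le> \<epsilon>"
      by auto
    obtain D where D: "finite D" "K \<subseteq> (\<Union>y\<in>D. A y)"
    proof (rule compactE_image[OF K, of K A])
      show "K \<subseteq> (\<Union>c\<in>K. A c)" using A(2) by auto
    qed (use A(1) in auto)
    obtain n :: nat and w where w: "D = w ` {..<n}"
      using finite_imp_nat_seg_image_inj_on[OF D(1)] unfolding lessThan_def by blast
    \<comment> \<open>Removing the earlier sets makes the finite cover disjoint, so that
      \<open>s y\<close> is the slice of H at a single sample point.\<close>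
    define B where "B i = K \<inter> A (w i) - (\<Union>j<i. A (w j))" for i
    have Bb: "B i \<in> sets \<mu>" for i
      unfolding B_def using A(1) compact_borel[OF K] by (auto intro!: sets.Diff sets.Int)
    have disj: "disjoint_family_on B {..<n}"
    proof -
      have "B i \<inter> B j = {}" if "i < j" for i j using that by (auto simp: B_def)
      then show ?thesis unfolding disjoint_family_on_def by (metis Int_commute linorder_neqE_nat)
    qed
    have cov: "\<exists>i<n. y \<in> B i" if "y \<in> K" for y
    proof -
      define i where "i = (LEAST i. i < n \<and> y \<in> A (w i))"
      have ex: "\<exists>i. i < n \<and> y \<in> A (w i)" using that D(2) w by auto
      have "i < n \<and> y \<in> A (w i)" unfolding i_def by (rule LeastI_ex[OF ex])
      moreover have "\<not> (y \<in> A (w j))" if "j < i" for j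
        using not_less_Least[of j "\<lambda>i. i < n \<and> y \<in> A (w i)"] that calculation
        unfolding i_def[symmetric] by auto
      ultimately show ?thesis using that by (auto simp: B_def)
    qed
    define s where "s y z = (\<Sum>i<n. indicator (B i) y * H (w i) z)" for y z
    have emB: "emeasure \<mu> (B i) < \<infinity>" for i
      by (rule le_less_trans[OF emeasure_mono emeasure_compact[OF K]])
        (use compact_borel[OF K] in \<open>auto simp: B_def\<close>)
    have iB: "integrable \<mu> (\<lambda>y. indicator (B i) y :: complex)" for i
      by (rule integral_supp_bound(2)[OF borel_measurable_indicator[OF Bb] K, of _ 1])
        (simp_all add: B_def indicator_def)
    have sz: "(\<integral>z. s y z \<partial>\<mu>) = (\<Sum>i<n. indicator (B i) y * (\<integral>z. H (w i) z \<partial>\<mu>))" for y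
      unfolding s_def
      by (subst Bochner_Integration.integral_sum) (intro integrable_mult_right iH, simp)
    have sy: "(\<integral>y. s y z \<partial>\<mu>) = (\<Sum>i<n. (\<integral>y. indicator (B i) y \<partial>\<mu>) * H (w i) z)" for z
      unfolding s_def
      by (subst Bochner_Integration.integral_sum) (intro integrable_mult_left iB, simp)
    have is1: "integrable \<mu> (\<lambda>z. s y z)" for y unfolding s_def
      by (intro Bochner_Integration.integrable_sum integrable_mult_right iH)
    have is2: "integrable \<mu> (\<lambda>y. s y z)" for z unfolding s_def
      by (intro Bochner_Integration.integrable_sum integrable_mult_left iB)
    have isz: "integrable \<mu> (\<lambda>y. \<integral>z. s y z \<partial>\<mu>)" unfolding sz
      by (intro Bochner_Integration.integrable_sum integrable_mult_left iB)
    have isy: "integrable \<mu> (\<lambda>z. \<integral>y. s y z \<partial>\<mu>)" unfolding sy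
      by (intro Bochner_Integration.integrable_sum integrable_mult_right iH)
    have eq: "(\<integral>y. \<integral>z. s y z \<partial>\<mu> \<partial>\<mu>) = (\<integral>z. \<integral>y. s y z \<partial>\<mu> \<partial>\<mu>)"
      unfolding sz sy
      by (subst (1 2) Bochner_Integration.integral_sum)
        (intro integrable_mult_right iH, intro integrable_mult_left iB,
          simp add: iB iH)
    have sB: "s y z = H (w i) z" if "y \<in> B i" "i < n" for i y z
    proof -
      have "s y z = (\<Sum>j<n. if j = i then H (w i) z else 0)"
        unfolding s_def
      proof (rule sum.cong)
        fix j assume j: "j \<in> {..<n}"
        have "y \<notin> B j" if "j \<noteq> i"
          using disj j that \<open>i < n\<close> \<open>y \<in> B i\<close> unfolding disjoint_family_on_def by blast
        then show "indicator (B j) y * H (w j) z = (if j = i then H (w i) z else 0)"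
          using \<open>y \<in> B i\<close> by auto
      qed simp
      then show ?thesis using that by simp
    qed
    have s0: "s y z = 0" if "y \<notin> K" for y z
      using that by (auto simp: s_def B_def intro!: sum.neutral)
    have s0': "s y z = 0" if "z \<notin> L" for y z
      using that by (auto simp: s_def suppL intro!: sum.neutral)
    have close: "norm (H y z - s y z) \<le> \<epsilon>" for y z
    proof (cases "y \<in> K \<and> z \<in> L")
      case True
      then obtain i where i: "i < n" "y \<in> B i" using cov by blast
      then have "y \<in> A (w i)" by (simp add: B_def)
      with A(3) True have "dist (H y z) (H (w i) z) \<le> \<epsilon>" by blast
      then show ?thesis using i by (simp add: sB dist_norm)
    next
      case False
      then show ?thesis using \<epsilon> suppK suppL s0 s0' by auto
    qed
    have d1: "norm ((\<integral>y. \<integral>z. H y z \<partial>\<mu> \<partial>\<mu>) - (\<integral>y. \<integral>z. s y z \<partial>\<mu> \<partial>\<mu>)) \<le> \<epsilon> * measure \<mu> L * measure \<mu> K"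
    proof -
      have "norm (\<integral>y. (\<integral>z. H y z \<partial>\<mu>) - (\<integral>z. s y z \<partial>\<mu>) \<partial>\<mu>) \<le> \<epsilon> * measure \<mu> L * measure \<mu> K"
      proof (rule integral_supp_bound(1)[OF _ K])
        show "norm ((\<integral>z. H y z \<partial>\<mu>) - (\<integral>z. s y z \<partial>\<mu>)) \<le> \<epsilon> * measure \<mu> L" for y
          unfolding Bochner_Integration.integral_diff[OF iH is1, symmetric]
          by (rule integral_supp_bound(1)[OF borel_measurable_integrable L])
            (use Bochner_Integration.integrable_diff[OF iH is1] suppL s0' close in simp_all)
        show "(\<lambda>y. (\<integral>z. H y z \<partial>\<mu>) - (\<integral>z. s y z \<partial>\<mu>)) \<in> borel_measurable \<mu>"
          using Bochner_Integration.integrable_diff[OF iI isz] by (rule borel_measurable_integrable)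
      qed (simp add: suppK s0)
      then show ?thesis by (simp add: Bochner_Integration.integral_diff[OF iI isz])
    qed
    have d2: "norm ((\<integral>z. \<integral>y. H y z \<partial>\<mu> \<partial>\<mu>) - (\<integral>z. \<integral>y. s y z \<partial>\<mu> \<partial>\<mu>)) \<le> \<epsilon> * measure \<mu> K * measure \<mu> L"
    proof -
      have "norm (\<integral>z. (\<integral>y. H y z \<partial>\<mu>) - (\<integral>y. s y z \<partial>\<mu>) \<partial>\<mu>) \<le> \<epsilon> * measure \<mu> K * measure \<mu> L"
      proof (rule integral_supp_bound(1)[OF _ L])
        show "norm ((\<integral>y. H y z \<partial>\<mu>) - (\<integral>y. s y z \<partial>\<mu>)) \<le> \<epsilon> * measure \<mu> K" for z
          unfolding Bochner_Integration.integral_diff[OF iH' is2, symmetric]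
          by (rule integral_supp_bound(1)[OF borel_measurable_integrable K])
            (use Bochner_Integration.integrable_diff[OF iH' is2] suppK s0 close in simp_all)
        show "(\<lambda>z. (\<integral>y. H y z \<partial>\<mu>) - (\<integral>y. s y z \<partial>\<mu>)) \<in> borel_measurable \<mu>"
          using Bochner_Integration.integrable_diff[OF iI' isy] by (rule borel_measurable_integrable)
      qed (simp add: suppL s0')
      then show ?thesis by (simp add: Bochner_Integration.integral_diff[OF iI' isy])
    qed
    have "norm ((\<integral>y. \<integral>z. H y z \<partial>\<mu> \<partial>\<mu>) - (\<integral>z. \<integral>y. H y z \<partial>\<mu> \<partial>\<mu>)) \<le>
        norm ((\<integral>y. \<integral>z. H y z \<partial>\<mu> \<partial>\<mu>) - (\<integral>y. \<integral>z. s y z \<partial>\<mu> \<partial>\<mu>)) +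
        norm ((\<integral>z. \<integral>y. H y z \<partial>\<mu> \<partial>\<mu>) - (\<integral>z. \<integral>y. s y z \<partial>\<mu> \<partial>\<mu>))"
      unfolding eq by (rule norm_diff_triangle_le[OF order_refl]) (simp add: norm_minus_commute)
    also have "\<dots> \<le> 2 * \<epsilon> * m" using add_mono[OF d1 d2] by (simp add: m_def mult_ac)
    finally show ?thesis .
  qed
  have m0: "m \<ge> 0" by (simp add: m_def)
  have "norm ((\<integral>y. \<integral>z. H y z \<partial>\<mu> \<partial>\<mu>) - (\<integral>z. \<integral>y. H y z \<partial>\<mu> \<partial>\<mu>)) \<le> 0"
  proof (rule field_le_epsilon)
    fix \<delta> :: real assume \<delta>: "\<delta> > 0"
    have "2 * (\<delta> / (2 * (m + 1))) * m \<le> \<delta>"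
      using \<delta> m0 by (simp add: field_simps)
    then show "norm ((\<integral>y. \<integral>z. H y z \<partial>\<mu> \<partial>\<mu>) - (\<integral>z. \<integral>y. H y z \<partial>\<mu> \<partial>\<mu>)) \<le> 0 + \<delta>"
      using bound[of "\<delta> / (2 * (m + 1))"] \<delta> m0 by simp
  qed
  then show ?thesis by simp
qed


section \<open>The measure of A \<inter> x B^-1 for open A and B\<close>

lemma compact_nbhd_in:
  fixes C :: "'g set"
  assumes "compact C" "open W" "C \<subseteq> W"
  obtains U K where "open U" "compact K" "C \<subseteq> U" "U \<subseteq> K" "K \<subseteq> W"
proof -
  obtain k :: "'g \<Rightarrow> real" and K where k: "continuous_on UNIV k" "\<And>x. x \<in> C \<Longrightarrow> k x = 1"
    "compact K" "K \<subseteq> W" "\<And>x. x \<notin> K \<Longrightarrow> k x = 0"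
    using urysohn[OF assms] by metis
  show thesis
  proof (rule that[of "{x. 0 < k x}" K])
    show "open {x. 0 < k x}" by (intro open_Collect_less continuous_intros k(1))
    show "{x. 0 < k x} \<subseteq> K" using k(5) by force
  qed (use k in auto)
qed

lemma inner_regular_seq:
  assumes "open W"
  obtains f :: "nat \<Rightarrow> 'g set" where "\<And>i. compact (f i)" "\<And>i. f i \<subseteq> W"
    "(\<lambda>i. emeasure \<mu> (f i)) \<longlonglongrightarrow> emeasure \<mu> W"
proof -
  define A where "A = emeasure \<mu> ` {K. compact K \<and> K \<subseteq> W}"
  have "A \<noteq> {}" unfolding A_def by auto
  then obtain g where g: "incseq g" "range g \<subseteq> A" "Sup A = (SUP i. g i)"
    using ennreal_Sup_countable_SUP by blast
  have "\<forall>i. \<exists>K. compact K \<and> K \<subseteq> W \<and> g i = emeasure \<mu> K"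
    using g(2) unfolding A_def by blast
  from choice[OF this] obtain f where f: "\<forall>i. compact (f i) \<and> f i \<subseteq> W \<and> g i = emeasure \<mu> (f i)"
    by blast
  have "g \<longlonglongrightarrow> emeasure \<mu> W"
    using LIMSEQ_SUP[OF g(1)] inner_regular[OF assms] g(3) by (simp add: A_def)
  moreover have "g = (\<lambda>i. emeasure \<mu> (f i))" using f by (simp add: fun_eq_iff)
  ultimately show thesis using f that[of f] by blast
qed

text \<open>A lower semicontinuous function is the limit of its staircase approximations, whose
  integrals are determined by compact subsets of the level sets.\<close>
lemma lsc_nn_integral_le:
  fixes h :: "'g \<Rightarrow> ennreal"
  assumes op: "\<And>c. open {x. c < h x}" and fin: "\<And>x. h x < top"
    and bound: "\<And>n D. 0 < n \<Longrightarrow>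
      (\<And>j. compact (D j) \<and> D j \<subseteq> {x. ennreal (real j / real n) < h x}) \<Longrightarrow>
      (\<Sum>j\<in>{1..n * n}. ennreal (1 / real n) * emeasure \<mu> (D j)) \<le> C"
  shows "(\<integral>\<^sup>+x. h x \<partial>\<mu>) \<le> C"
proof -
  define A where "A n j = {x. ennreal (real j / real n) < h x}" for n j :: nat
  have Ao: "open (A n j)" for n j unfolding A_def by (rule op)
  then have As: "A n j \<in> sets \<mu>" for n j by simp
  \<comment> \<open>The staircase below h with steps 1 / n up to height n, hence n * n
    levels.\<close>
  define f where "f n x = (\<Sum>j\<in>{1..n * n}. ennreal (1 / real n) * indicator (A n j) x)" for n x
  have fm: "f n \<in> borel_measurable \<mu>" for n
    unfolding f_def using As by (intro borel_measurable_sum) auto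
  have int_le: "(\<integral>\<^sup>+x. f n x \<partial>\<mu>) \<le> C" if "0 < n" for n
  proof -
    have "\<forall>j. \<exists>K :: nat \<Rightarrow> 'g set. (\<forall>i. compact (K i)) \<and> (\<forall>i. K i \<subseteq> A n j) \<and>
        (\<lambda>i. emeasure \<mu> (K i)) \<longlonglongrightarrow> emeasure \<mu> (A n j)"
      using inner_regular_seq[OF Ao] by metis
    from choice[OF this] obtain K :: "nat \<Rightarrow> nat \<Rightarrow> 'g set" where
      K': "\<forall>j. (\<forall>i. compact (K j i)) \<and> (\<forall>i. K j i \<subseteq> A n j) \<and>
        (\<lambda>i. emeasure \<mu> (K j i)) \<longlonglongrightarrow> emeasure \<mu> (A n j)" ..
    then have K: "\<And>j i. compact (K j i)" "\<And>j i. K j i \<subseteq> A n j"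
        "\<And>j. (\<lambda>i. emeasure \<mu> (K j i)) \<longlonglongrightarrow> emeasure \<mu> (A n j)" by simp_all
    have "(\<lambda>i. \<Sum>j\<in>{1..n * n}. ennreal (1 / real n) * emeasure \<mu> (K j i)) \<longlonglongrightarrow>
        (\<Sum>j\<in>{1..n * n}. ennreal (1 / real n) * emeasure \<mu> (A n j))"
      by (intro tendsto_sum ennreal_tendsto_cmult K(3)) auto
    then have "(\<Sum>j\<in>{1..n * n}. ennreal (1 / real n) * emeasure \<mu> (A n j)) \<le> C"
      by (rule LIMSEQ_le_const2) (use K(1,2) bound[OF that] in \<open>auto simp: A_def\<close>)
    also have "(\<Sum>j\<in>{1..n * n}. ennreal (1 / real n) * emeasure \<mu> (A n j)) = (\<integral>\<^sup>+x. f n x \<partial>\<mu>)"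
      unfolding f_def using As
      by (subst nn_integral_sum) (auto simp: nn_integral_cmult)
    finally show ?thesis .
  qed
  have lim: "h x \<le> liminf (\<lambda>n. f n x)" for x
  proof -
    obtain r where r: "h x = ennreal r" "0 \<le> r" using fin[of x] by (cases "h x") auto
    have *: "ennreal (r - 1 / real n) \<le> f n x" if n: "real n \<ge> r + 1" for n
    proof -
      have n0: "0 < n" using n r by (cases n) auto
      \<comment> \<open>\<open>m\<close> counts the levels j / n strictly below r, so the staircase
        at x is at least m / n, within 1 / n of r.\<close>
      define m where "m = nat (\<lceil>real n * r\<rceil> - 1)"
      have m: "real m \<ge> real n * r - 1" "m = 0 \<or> real m < real n * r"
        unfolding m_def by (cases "\<lceil>real n * r\<rceil> \<ge> 1"; linarith)+
      have "real n * r \<le> real n * real n" using n r by (intro mult_left_mono) auto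
      then have mn: "m \<le> n * n" using m(2) by (metis le0 less_le_trans less_imp_le of_nat_less_iff of_nat_mult)
      have "ennreal (r - 1 / real n) \<le> ennreal (real m / real n)"
      proof (rule ennreal_leI)
        have "(real n * r - 1) / real n \<le> real m / real n"
          using m(1) by (intro divide_right_mono) auto
        then show "r - 1 / real n \<le> real m / real n" using n0 by (simp add: diff_divide_distrib)
      qed
      also have "\<dots> = (\<Sum>j\<in>{1..m}. ennreal (1 / real n))"
        by (simp add: ennreal_of_nat_eq_real_of_nat flip: ennreal_mult)
      also have "\<dots> \<le> (\<Sum>j\<in>{1..m}. ennreal (1 / real n) * indicator (A n j) x)"
      proof (rule sum_mono)
        fix j assume "j \<in> {1..m}"
        then have "real j < real n * r" using m(2) by auto
        then have "real j / real n < r" using n0 by (simp add: field_simps)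
        then have "x \<in> A n j" by (simp add: A_def r ennreal_less_iff)
        then show "ennreal (1 / real n) \<le> ennreal (1 / real n) * indicator (A n j) x" by simp
      qed
      also have "\<dots> \<le> f n x"
        unfolding f_def using mn by (intro sum_mono2) auto
      finally show ?thesis .
    qed
    have ev: "\<forall>\<^sub>F n in sequentially. ennreal (r - 1 / real n) \<le> f n x"
    proof (rule eventually_sequentiallyI[of "nat \<lceil>r + 1\<rceil>"])
      fix n assume "nat \<lceil>r + 1\<rceil> \<le> n"
      then have "r + 1 \<le> real n" by linarith
      then show "ennreal (r - 1 / real n) \<le> f n x" using * by blast
    qed
    have "(\<lambda>n. ennreal (r - 1 / real n)) \<longlonglongrightarrow> ennreal (r - 0)"
      by (intro tendsto_ennrealI tendsto_diff tendsto_const lim_const_over_n)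
    then have "liminf (\<lambda>n. ennreal (r - 1 / real n)) = h x"
      using lim_imp_Liminf[OF sequentially_bot] r by simp
    then show ?thesis using Liminf_mono[OF ev] by simp
  qed
  have "(\<integral>\<^sup>+x. h x \<partial>\<mu>) \<le> (\<integral>\<^sup>+x. liminf (\<lambda>n. f n x) \<partial>\<mu>)"
    by (intro nn_integral_mono lim)
  also have "\<dots> \<le> liminf (\<lambda>n. \<integral>\<^sup>+x. f n x \<partial>\<mu>)"
    by (intro nn_integral_liminf fm)
  also have "\<dots> \<le> liminf (\<lambda>n. C)"
    by (rule Liminf_mono) (auto simp: eventually_sequentially intro!: exI[of _ 1] int_le)
  also have "\<dots> = C" by (simp add: Liminf_const)
  finally show ?thesis .
qed

lemma compact_mult_image:
  assumes "compact K" "compact L" "continuous_on UNIV f"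
  shows "compact ((\<lambda>p. f (fst p) \<cdot> snd p) ` (K \<times> L))"
proof -
  have "continuous_on UNIV (\<lambda>p. f (fst p) \<cdot> snd p)"
    by (intro continuous_intros continuous_on_compose2[OF assms(3)]) auto
  then show ?thesis
    by (intro compact_continuous_image compact_Times assms) (auto intro: continuous_on_subset)
qed

text \<open>Interchange of integrals followed by left invariance. S = 1 gives multiplicativity of
  the integral; general S gives the transpose of convolution by l.\<close>

lemma integral_conv_ccont:
  fixes k l S :: "'g \<Rightarrow> complex"
  assumes k: "continuous_on UNIV k" "compact K" "\<And>x. x \<notin> K \<Longrightarrow> k x = 0"
    and l: "continuous_on UNIV l" "compact L" "\<And>x. x \<notin> L \<Longrightarrow> l x = 0"
    and S: "continuous_on UNIV S"
  shows "(\<integral>x. (\<integral>y. k y * l (ginv y \<cdot> x) \<partial>\<mu>) * S x \<partial>\<mu>) = (\<integral>y. k y * (\<integral>x. l x * S (y \<cdot> x) \<partial>\<mu>) \<partial>\<mu>)"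
    and "continuous_on UNIV (\<lambda>x. \<integral>y. k y * l (ginv y \<cdot> x) \<partial>\<mu>)"
    and "x \<notin> (\<lambda>p. fst p \<cdot> snd p) ` (K \<times> L) \<Longrightarrow> (\<integral>y. k y * l (ginv y \<cdot> x) \<partial>\<mu>) = 0"
proof -
  note [continuous_intros] = continuous_on_compose2[OF k(1)] continuous_on_compose2[OF l(1)]
    continuous_on_compose2[OF S]
  define M where "M = (\<lambda>p. fst p \<cdot> snd p) ` (K \<times> L)"
  have M: "compact M" unfolding M_def using compact_mult_image[OF k(2) l(2) continuous_on_id] by simp
  have supp: "k y * l (ginv y \<cdot> x) = 0" if "x \<notin> M" for x y
  proof (rule ccontr)
    assume "k y * l (ginv y \<cdot> x) \<noteq> 0"
    then have "y \<in> K" "ginv y \<cdot> x \<in> L" using k(3) l(3) by auto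
    then have "y \<cdot> (ginv y \<cdot> x) \<in> M" unfolding M_def by force
    with that show False by simp
  qed
  show "(\<integral>y. k y * l (ginv y \<cdot> x) \<partial>\<mu>) = 0" if "x \<notin> (\<lambda>p. fst p \<cdot> snd p) ` (K \<times> L)"
    by (simp only: supp[OF that[folded M_def]] Bochner_Integration.integral_zero)
  show "continuous_on UNIV (\<lambda>x. \<integral>y. k y * l (ginv y \<cdot> x) \<partial>\<mu>)"
    by (rule continuous_on_parametric_integral[OF _ k(2)])
      (use k(3) in \<open>auto intro!: continuous_intros\<close>)
  have "(\<integral>x. (\<integral>y. k y * l (ginv y \<cdot> x) \<partial>\<mu>) * S x \<partial>\<mu>) = (\<integral>x. \<integral>y. k y * l (ginv y \<cdot> x) * S x \<partial>\<mu> \<partial>\<mu>)"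
    by simp
  also have "\<dots> = (\<integral>y. \<integral>x. k y * l (ginv y \<cdot> x) * S x \<partial>\<mu> \<partial>\<mu>)"
    by (rule fubini_ccont[OF _ M k(2)])
      (use k(3) supp in \<open>auto intro!: continuous_intros\<close>)
  also have "\<dots> = (\<integral>y. k y * (\<integral>x. l x * S (y \<cdot> x) \<partial>\<mu>) \<partial>\<mu>)"
  proof (rule Bochner_Integration.integral_cong[OF refl])
    fix y
    have "(\<integral>x. l (ginv y \<cdot> x) * S x \<partial>\<mu>) = (\<integral>x. l (ginv y \<cdot> (y \<cdot> x)) * S (y \<cdot> x) \<partial>\<mu>)"
      by (rule integral_translate[symmetric], rule cont_meas) (auto intro!: continuous_intros)
    then show "(\<integral>x. k y * l (ginv y \<cdot> x) * S x \<partial>\<mu>) = k y * (\<integral>x. l x * S (y \<cdot> x) \<partial>\<mu>)"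
      by (simp add: mult.assoc)
  qed
  finally show "(\<integral>x. (\<integral>y. k y * l (ginv y \<cdot> x) \<partial>\<mu>) * S x \<partial>\<mu>) = (\<integral>y. k y * (\<integral>x. l x * S (y \<cdot> x) \<partial>\<mu>) \<partial>\<mu>)" .
qed

lemma nn_integral_conv_ccont:
  fixes k l :: "'g \<Rightarrow> real"
  assumes k: "continuous_on UNIV k" "compact K" "\<And>x. x \<notin> K \<Longrightarrow> k x = 0" "\<And>x. 0 \<le> k x"
    and l: "continuous_on UNIV l" "compact L" "\<And>x. x \<notin> L \<Longrightarrow> l x = 0" "\<And>x. 0 \<le> l x"
  shows "(\<integral>\<^sup>+x. \<integral>\<^sup>+y. ennreal (k y) * ennreal (l (ginv y \<cdot> x)) \<partial>\<mu> \<partial>\<mu>) =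
    (\<integral>\<^sup>+x. ennreal (k x) \<partial>\<mu>) * (\<integral>\<^sup>+x. ennreal (l x) \<partial>\<mu>)"
proof -
  note [continuous_intros] = continuous_on_compose2[OF k(1)] continuous_on_compose2[OF l(1)]
  have ik: "integrable \<mu> k" by (rule ccont_integrable[OF k(1-3)])
  have il: "integrable \<mu> l" by (rule ccont_integrable[OF l(1-3)])
  have ikl: "integrable \<mu> (\<lambda>y. k y * l (ginv y \<cdot> x))" for x
    by (rule ccont_integrable[OF _ k(2)]) (use k(3) in \<open>auto intro!: continuous_intros\<close>)
  define g where "g x = (\<integral>y. k y * l (ginv y \<cdot> x) \<partial>\<mu>)" for x
  have gc: "(\<integral>y. complex_of_real (k y) * complex_of_real (l (ginv y \<cdot> x)) \<partial>\<mu>) = complex_of_real (g x)" for x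
    unfolding g_def integral_complex_of_real[symmetric] by simp
  have ck: "continuous_on UNIV (\<lambda>x. complex_of_real (k x))" and cl: "continuous_on UNIV (\<lambda>x. complex_of_real (l x))"
    by (auto intro!: continuous_intros)
  note C = integral_conv_ccont[OF ck k(2) _ cl l(2), unfolded gc]
  have cg: "continuous_on UNIV g"
    using continuous_on_Re[OF C(2)[of "\<lambda>_. 1"]] k(3) l(3) by simp
  have gsupp: "g x = 0" if "x \<notin> (\<lambda>p. fst p \<cdot> snd p) ` (K \<times> L)" for x
    using C(3)[of "\<lambda>_. 1" x] that k(3) l(3) by simp
  have ig: "integrable \<mu> g"
    by (rule ccont_integrable[OF cg compact_mult_image[OF k(2) l(2) continuous_on_id] gsupp])
  have "complex_of_real (\<integral>x. g x \<partial>\<mu>) = complex_of_real ((\<integral>x. k x \<partial>\<mu>) * (\<integral>x. l x \<partial>\<mu>))"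
    using C(1)[of "\<lambda>_. 1"] k(3) l(3) by (simp add: integral_complex_of_real)
  then have eq: "(\<integral>x. g x \<partial>\<mu>) = (\<integral>x. k x \<partial>\<mu>) * (\<integral>x. l x \<partial>\<mu>)" by (simp only: of_real_eq_iff)
  have g0: "0 \<le> g x" for x unfolding g_def by (intro integral_nonneg_AE) (simp add: k l)
  have "(\<integral>\<^sup>+y. ennreal (k y) * ennreal (l (ginv y \<cdot> x)) \<partial>\<mu>) = ennreal (g x)" for x
    unfolding g_def
    by (subst nn_integral_eq_integral[OF ikl, symmetric]) (auto simp: k l ennreal_mult)
  then have "(\<integral>\<^sup>+x. \<integral>\<^sup>+y. ennreal (k y) * ennreal (l (ginv y \<cdot> x)) \<partial>\<mu> \<partial>\<mu>) = ennreal (\<integral>x. g x \<partial>\<mu>)"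
    by (simp add: nn_integral_eq_integral[OF ig] g0)
  also have "\<dots> = ennreal (\<integral>x. k x \<partial>\<mu>) * ennreal (\<integral>x. l x \<partial>\<mu>)"
    unfolding eq by (intro ennreal_mult integral_nonneg_AE) (auto simp: k l)
  finally show ?thesis
    by (simp add: nn_integral_eq_integral[OF ik] nn_integral_eq_integral[OF il] k l)
qed

text \<open>This is A \<inter> x B^-1; its measure is the convolution of the indicators of A and B
  at x.\<close>

definition cset :: "'g set \<Rightarrow> 'g set \<Rightarrow> 'g \<Rightarrow> 'g set" where
  "cset A B x = {y \<in> A. ginv y \<cdot> x \<in> B}"

lemma cset_mono: "A \<subseteq> A' \<Longrightarrow> B \<subseteq> B' \<Longrightarrow> cset A B x \<subseteq> cset A' B' x"
  by (auto simp: cset_def)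

lemma open_cset: "open A \<Longrightarrow> open B \<Longrightarrow> open (cset A B x)"
  using open_vimage[of B "\<lambda>y. ginv y \<cdot> x"]
    continuous_on_gmul[OF continuous_on_ginv[OF continuous_on_id] continuous_on_const]
  by (simp add: cset_def Collect_conj_eq vimage_def open_Int)

lemma cset_borel: "A \<in> sets borel \<Longrightarrow> B \<in> sets borel \<Longrightarrow> cset A B x \<in> sets borel"
proof -
  assume A: "A \<in> sets borel" and B: "B \<in> sets borel"
  have "(\<lambda>y. ginv y \<cdot> x) \<in> borel_measurable borel"
    by (intro borel_measurable_continuous_onI continuous_intros)
  from measurable_sets[OF this B] have "(\<lambda>y. ginv y \<cdot> x) -` B \<in> sets borel" by simp
  moreover have "cset A B x = A \<inter> (\<lambda>y. ginv y \<cdot> x) -` B" by (auto simp: cset_def)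
  ultimately show ?thesis using A by auto
qed

text \<open>The points \<open>ginv y \<cdot> x'\<close> with y in K and x' near x fill a compact
  subset L of B. Hence the measure of \<open>cset A B x\<close> is lower semicontinuous in x, and
  lower bounds for it survive near x when A and B shrink to compact subsets.\<close>

lemma cset_tube:
  assumes K: "compact K" "K \<subseteq> cset A B x" and B: "open B"
  obtains W L where "open W" "x \<in> W" "compact L" "L \<subseteq> B" "\<And>x'. x' \<in> W \<Longrightarrow> K \<subseteq> cset K L x'"
proof -
  have "open ((\<lambda>p. ginv (snd p) \<cdot> fst p) -` B)"
    by (intro open_vimage B continuous_intros)
  moreover have "{x} \<times> K \<subseteq> (\<lambda>p. ginv (snd p) \<cdot> fst p) -` B"
    using K(2) by (auto simp: cset_def)
  ultimately obtain X where X: "x \<in> X" "open X" "X \<times> K \<subseteq> (\<lambda>p. ginv (snd p) \<cdot> fst p) -` B"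
    using Elementary_Topology.tube_lemma[OF K(1)] by blast
  obtain U C where U: "open U" "compact C" "{x} \<subseteq> U" "U \<subseteq> C" "C \<subseteq> X"
    using compact_nbhd_in[of "{x}" X] X by auto
  show thesis
  proof (rule that[of U "(\<lambda>p. ginv (fst p) \<cdot> snd p) ` (K \<times> C)"])
    show "compact ((\<lambda>p. ginv (fst p) \<cdot> snd p) ` (K \<times> C))"
      by (intro compact_mult_image K U continuous_intros)
    show "(\<lambda>p. ginv (fst p) \<cdot> snd p) ` (K \<times> C) \<subseteq> B" using subsetD[OF X(3)] U(5) by force
    show "K \<subseteq> cset K ((\<lambda>p. ginv (fst p) \<cdot> snd p) ` (K \<times> C)) x'" if "x' \<in> U" for x'
      using that U(4) by (force simp: cset_def)
  qed (use U in auto)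
qed

text \<open>Lower semicontinuity gives measurability. For the upper bound, finitely many tubes over
  the compact sets \<open>D j\<close> yield compact K in A and L in B that account for all levels,
  and Urysohn functions of K and L have a convolution that dominates the staircase. The lower bound
  is inner regularity.\<close>

lemma cset_open:
  assumes A: "open A" "emeasure \<mu> A < top" and B: "open B" "emeasure \<mu> B < top"
  shows "(\<lambda>x. emeasure \<mu> (cset A B x)) \<in> borel_measurable \<mu>"
    and "(\<integral>\<^sup>+x. emeasure \<mu> (cset A B x) \<partial>\<mu>) = emeasure \<mu> A * emeasure \<mu> B"
proof -
  define h where "h x = emeasure \<mu> (cset A B x)" for x
  have cb: "cset A B x \<in> sets \<mu>" for x using open_cset[OF A(1) B(1)] by simp
  have ex: "\<exists>K. compact K \<and> K \<subseteq> cset A B x \<and> c < emeasure \<mu> K" if "c < h x" for c x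
    using that unfolding h_def inner_regular[OF open_cset[OF A(1) B(1)]] less_SUP_iff by auto
  have op: "open {x. c < h x}" for c
  proof (subst open_subopen, safe)
    fix x assume "c < h x"
    then obtain K where K: "compact K" "K \<subseteq> cset A B x" "c < emeasure \<mu> K" using ex by blast
    obtain W L where W: "open W" "x \<in> W" "L \<subseteq> B" "\<And>x'. x' \<in> W \<Longrightarrow> K \<subseteq> cset K L x'"
      using cset_tube[OF K(1,2) B(1)] by metis
    have KA: "K \<subseteq> A" using K(2) by (auto simp: cset_def)
    have "c < h x'" if "x' \<in> W" for x'
      unfolding h_def
      by (rule less_le_trans[OF K(3)], rule emeasure_mono)
        (use W(4)[OF that] cset_mono[OF KA W(3)] cb in auto)
    then show "\<exists>T. open T \<and> x \<in> T \<and> T \<subseteq> {x. c < h x}" using W by blast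
  qed
  show m: "(\<lambda>x. emeasure \<mu> (cset A B x)) \<in> borel_measurable \<mu>"
    unfolding h_def[symmetric]
    by (rule borel_measurableI_greater) (use op in simp)
  have fin: "h x < top" for x
    unfolding h_def by (rule le_less_trans[OF emeasure_mono A(2)]) (use A in \<open>auto simp: cset_def\<close>)
  have kl_le: "(\<integral>\<^sup>+x. ennreal (k x) \<partial>\<mu>) \<le> emeasure \<mu> X"
    if "open X" "K \<subseteq> X" "\<And>x. x \<notin> K \<Longrightarrow> k x = 0" "\<And>x. k x \<le> 1" for X K and k :: "'g \<Rightarrow> real"
  proof -
    have "(\<integral>\<^sup>+x. ennreal (k x) \<partial>\<mu>) \<le> (\<integral>\<^sup>+x. indicator X x \<partial>\<mu>)"
    proof (rule nn_integral_mono)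
      fix x show "ennreal (k x) \<le> indicator X x"
        using that(2)[THEN subsetD, of x] that(3,4)[of x] by (cases "x \<in> X"; cases "x \<in> K") auto
    qed
    then show ?thesis using that(1) by simp
  qed
  have le: "(\<integral>\<^sup>+x. h x \<partial>\<mu>) \<le> emeasure \<mu> A * emeasure \<mu> B"
  proof (rule lsc_nn_integral_le[OF op fin])
    fix n :: nat and D :: "nat \<Rightarrow> 'g set"
    assume n: "0 < n" and D: "\<And>j. compact (D j) \<and> D j \<subseteq> {x. ennreal (real j / real n) < h x}"
    \<comment> \<open>Compactness of \<open>D j\<close> makes one choice of K and L valid for all
      its points.\<close>
    have "\<exists>K L. compact K \<and> compact L \<and> K \<subseteq> A \<and> L \<subseteq> B \<and>
      (\<forall>x\<in>D j. ennreal (real j / real n) < emeasure \<mu> (cset K L x))" for j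
    proof -
      have "\<forall>x\<in>D j. \<exists>KWL. compact (fst KWL) \<and> fst KWL \<subseteq> A \<and> open (fst (snd KWL)) \<and> x \<in> fst (snd KWL) \<and>
          compact (snd (snd KWL)) \<and> snd (snd KWL) \<subseteq> B \<and>
          (\<forall>x'\<in>fst (snd KWL). ennreal (real j / real n) < emeasure \<mu> (cset (fst KWL) (snd (snd KWL)) x'))"
      proof
        fix x assume "x \<in> D j"
        then have "ennreal (real j / real n) < h x" using D by auto
        then obtain K where K: "compact K" "K \<subseteq> cset A B x" "ennreal (real j / real n) < emeasure \<mu> K"
          using ex by blast
        obtain W L where W: "open W" "x \<in> W" "compact L" "L \<subseteq> B" "\<And>x'. x' \<in> W \<Longrightarrow> K \<subseteq> cset K L x'"
          using cset_tube[OF K(1,2) B(1)] by metis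
        have KA: "K \<subseteq> A" using K(2) by (auto simp: cset_def)
        have "ennreal (real j / real n) < emeasure \<mu> (cset K L x')" if "x' \<in> W" for x'
          by (rule less_le_trans[OF K(3)], rule emeasure_mono)
            (use W(5)[OF that] cset_borel[OF compact_borel[OF K(1)] compact_borel[OF W(3)]] in auto)
        then show "\<exists>KWL. compact (fst KWL) \<and> fst KWL \<subseteq> A \<and> open (fst (snd KWL)) \<and> x \<in> fst (snd KWL) \<and>
          compact (snd (snd KWL)) \<and> snd (snd KWL) \<subseteq> B \<and>
          (\<forall>x'\<in>fst (snd KWL). ennreal (real j / real n) < emeasure \<mu> (cset (fst KWL) (snd (snd KWL)) x'))"
          using W K KA by (intro exI[of _ "(K, W, L)"]) simp
      qed
      from bchoice[OF this] obtain KWL where KWL: "\<forall>x\<in>D j. compact (fst (KWL x)) \<and> fst (KWL x) \<subseteq> A \<and>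
          open (fst (snd (KWL x))) \<and> x \<in> fst (snd (KWL x)) \<and>
          compact (snd (snd (KWL x))) \<and> snd (snd (KWL x)) \<subseteq> B \<and>
          (\<forall>x'\<in>fst (snd (KWL x)). ennreal (real j / real n) < emeasure \<mu> (cset (fst (KWL x)) (snd (snd (KWL x))) x'))"
        by blast
      define K W L where "K x = fst (KWL x)" and "W x = fst (snd (KWL x))" and "L x = snd (snd (KWL x))" for x
      have KW: "compact (K x)" "K x \<subseteq> A" "open (W x)" "x \<in> W x" "compact (L x)" "L x \<subseteq> B"
        "\<And>x'. x' \<in> W x \<Longrightarrow> ennreal (real j / real n) < emeasure \<mu> (cset (K x) (L x) x')" if "x \<in> D j" for x
        using KWL that by (auto simp: K_def W_def L_def)
      have Dc: "compact (D j)" using D by simp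
      obtain F where F: "F \<subseteq> D j" "finite F" "D j \<subseteq> (\<Union>x\<in>F. W x)"
      proof (rule compactE_image[OF Dc, of "D j" W])
        show "D j \<subseteq> (\<Union>x\<in>D j. W x)" using KW(4) by auto
      qed (use KW(3) in auto)
      have Fc: "compact (\<Union>x\<in>F. K x)" "compact (\<Union>x\<in>F. L x)"
        using F KW(1,5) by (auto intro!: compact_UN)
      show ?thesis
      proof (intro exI conjI ballI)
        show "(\<Union>x\<in>F. K x) \<subseteq> A" using F(1) KW(2) by (intro UN_least) auto
        show "(\<Union>x\<in>F. L x) \<subseteq> B" using F(1) KW(6) by (intro UN_least) auto
        fix x assume "x \<in> D j"
        then obtain z where z: "z \<in> F" "x \<in> W z" using F(3) by blast
        have "ennreal (real j / real n) < emeasure \<mu> (cset (K z) (L z) x)"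
          using KW(7)[of z x] z F(1) by auto
        also have "\<dots> \<le> emeasure \<mu> (cset (\<Union>x\<in>F. K x) (\<Union>x\<in>F. L x) x)"
          by (intro emeasure_mono cset_mono)
            (use z cset_borel[OF compact_borel[OF Fc(1)] compact_borel[OF Fc(2)]] in auto)
        finally show "ennreal (real j / real n) < emeasure \<mu> (cset (\<Union>x\<in>F. K x) (\<Union>x\<in>F. L x) x)" .
      qed (rule Fc)+
    qed
    then have "\<forall>j. \<exists>KL. compact (fst KL) \<and> compact (snd KL) \<and> fst KL \<subseteq> A \<and> snd KL \<subseteq> B \<and>
      (\<forall>x\<in>D j. ennreal (real j / real n) < emeasure \<mu> (cset (fst KL) (snd KL) x))" by simp
    from choice[OF this] obtain KL where KL: "\<And>j. compact (fst (KL j)) \<and> compact (snd (KL j)) \<and>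
      fst (KL j) \<subseteq> A \<and> snd (KL j) \<subseteq> B \<and>
      (\<forall>x\<in>D j. ennreal (real j / real n) < emeasure \<mu> (cset (fst (KL j)) (snd (KL j)) x))" by blast
    define K L where "K = (\<Union>j\<in>{1..n * n}. fst (KL j))" and "L = (\<Union>j\<in>{1..n * n}. snd (KL j))"
    have K: "compact K" "K \<subseteq> A" and L: "compact L" "L \<subseteq> B"
      unfolding K_def L_def using KL by (auto intro!: compact_UN UN_least)
    obtain k :: "'g \<Rightarrow> real" and K' where k: "continuous_on UNIV k" "\<And>x. 0 \<le> k x" "\<And>x. k x \<le> 1"
      "\<And>x. x \<in> K \<Longrightarrow> k x = 1" "compact K'" "K' \<subseteq> A" "\<And>x. x \<notin> K' \<Longrightarrow> k x = 0"
      by (rule urysohn[OF K(1) A(1) K(2)], rule that)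
    obtain l :: "'g \<Rightarrow> real" and L' where l: "continuous_on UNIV l" "\<And>x. 0 \<le> l x" "\<And>x. l x \<le> 1"
      "\<And>x. x \<in> L \<Longrightarrow> l x = 1" "compact L'" "L' \<subseteq> B" "\<And>x. x \<notin> L' \<Longrightarrow> l x = 0"
      by (rule urysohn[OF L(1) B(1) L(2)], rule that)
    define g where "g x = (\<integral>\<^sup>+y. ennreal (k y) * ennreal (l (ginv y \<cdot> x)) \<partial>\<mu>)" for x
    have g_ge: "ennreal (real j / real n) \<le> g x" if j: "j \<in> {1..n * n}" and x: "x \<in> D j" for j x
    proof -
      have "ennreal (real j / real n) \<le> emeasure \<mu> (cset (fst (KL j)) (snd (KL j)) x)"
        using KL x by (auto intro: less_imp_le)
      also have "\<dots> \<le> emeasure \<mu> (cset K L x)"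
      proof (intro emeasure_mono cset_mono)
        show "fst (KL j) \<subseteq> K" "snd (KL j) \<subseteq> L" using j by (auto simp: K_def L_def)
        show "cset K L x \<in> sets \<mu>"
          using cset_borel[OF compact_borel[OF K(1)] compact_borel[OF L(1)]] by simp
      qed
      also have "\<dots> = (\<integral>\<^sup>+y. indicator (cset K L x) y \<partial>\<mu>)"
        using cset_borel[OF compact_borel[OF K(1)] compact_borel[OF L(1)]] by simp
      also have "\<dots> \<le> g x" unfolding g_def
        by (intro nn_integral_mono) (use k(4) l(4) in \<open>auto simp: cset_def indicator_def\<close>)
      finally show ?thesis .
    qed
    \<comment> \<open>The height of the staircase at x is the number of j with x in
      \<open>D j\<close>, divided by n. It is at most j / n for the largest such j, and g is at
      least that value.\<close>
    have stair: "(\<Sum>j\<in>{1..n * n}. ennreal (1 / real n) * indicator (D j) x) \<le> g x" for x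
    proof -
      define J where "J = {j \<in> {1..n * n}. x \<in> D j}"
      have fJ: "finite J" unfolding J_def by simp
      have "(\<Sum>j\<in>{1..n * n}. ennreal (1 / real n) * indicator (D j) x) = (\<Sum>j\<in>J. ennreal (1 / real n))"
        unfolding J_def sum.inter_filter[OF finite_atLeastAtMost]
        by (rule sum.cong) (auto simp: indicator_def)
      also have "\<dots> = ennreal (real (card J) / real n)"
        by (simp add: ennreal_of_nat_eq_real_of_nat flip: ennreal_mult)
      also have "\<dots> \<le> g x"
      proof (cases "J = {}")
        case False
        then have mx: "Max J \<in> J" using fJ by simp
        have "J \<subseteq> {1..Max J}" using fJ by (auto simp: J_def)
        then have "card J \<le> Max J" using card_mono[of "{1..Max J}" J] by simp
        then have "ennreal (real (card J) / real n) \<le> ennreal (real (Max J) / real n)"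
          by (intro ennreal_leI divide_right_mono) auto
        also have "\<dots> \<le> g x" using g_ge mx by (auto simp: J_def)
        finally show ?thesis .
      qed simp
      finally show ?thesis .
    qed
    have "(\<Sum>j\<in>{1..n * n}. ennreal (1 / real n) * emeasure \<mu> (D j)) =
        (\<integral>\<^sup>+x. (\<Sum>j\<in>{1..n * n}. ennreal (1 / real n) * indicator (D j) x) \<partial>\<mu>)"
      using D compact_borel by (subst nn_integral_sum) (auto simp: nn_integral_cmult)
    also have "\<dots> \<le> (\<integral>\<^sup>+x. g x \<partial>\<mu>)" by (intro nn_integral_mono stair)
    also have "\<dots> = (\<integral>\<^sup>+x. ennreal (k x) \<partial>\<mu>) * (\<integral>\<^sup>+x. ennreal (l x) \<partial>\<mu>)"
      unfolding g_def by (rule nn_integral_conv_ccont[OF k(1,5,7,2) l(1,5,7,2)])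
    also have "\<dots> \<le> emeasure \<mu> A * emeasure \<mu> B"
      by (intro mult_mono kl_le[of _ K'] kl_le[of _ L']) (use A B k l in auto)
    finally show "(\<Sum>j\<in>{1..n * n}. ennreal (1 / real n) * emeasure \<mu> (D j)) \<le> emeasure \<mu> A * emeasure \<mu> B" .
  qed
  have ge: "emeasure \<mu> K * emeasure \<mu> L \<le> (\<integral>\<^sup>+x. h x \<partial>\<mu>)"
    if K: "compact K" "K \<subseteq> A" and L: "compact L" "L \<subseteq> B" for K L
  proof -
    obtain k :: "'g \<Rightarrow> real" and K' where k: "continuous_on UNIV k" "\<And>x. 0 \<le> k x" "\<And>x. k x \<le> 1"
      "\<And>x. x \<in> K \<Longrightarrow> k x = 1" "compact K'" "K' \<subseteq> A" "\<And>x. x \<notin> K' \<Longrightarrow> k x = 0"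
      by (rule urysohn[OF K(1) A(1) K(2)], rule that)
    obtain l :: "'g \<Rightarrow> real" and L' where l: "continuous_on UNIV l" "\<And>x. 0 \<le> l x" "\<And>x. l x \<le> 1"
      "\<And>x. x \<in> L \<Longrightarrow> l x = 1" "compact L'" "L' \<subseteq> B" "\<And>x. x \<notin> L' \<Longrightarrow> l x = 0"
      by (rule urysohn[OF L(1) B(1) L(2)], rule that)
    have low: "emeasure \<mu> X \<le> (\<integral>\<^sup>+x. ennreal (f x) \<partial>\<mu>)"
      if "compact X" "\<And>x. x \<in> X \<Longrightarrow> f x = 1" for X and f :: "'g \<Rightarrow> real"
    proof -
      have "(\<integral>\<^sup>+x. indicator X x \<partial>\<mu>) \<le> (\<integral>\<^sup>+x. ennreal (f x) \<partial>\<mu>)"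
        by (intro nn_integral_mono) (use that in \<open>auto simp: indicator_def\<close>)
      then show ?thesis using compact_borel[OF that(1)] by simp
    qed
    have "emeasure \<mu> K * emeasure \<mu> L \<le> (\<integral>\<^sup>+x. ennreal (k x) \<partial>\<mu>) * (\<integral>\<^sup>+x. ennreal (l x) \<partial>\<mu>)"
      by (intro mult_mono low) (use K L k l in auto)
    also have "\<dots> = (\<integral>\<^sup>+x. \<integral>\<^sup>+y. ennreal (k y) * ennreal (l (ginv y \<cdot> x)) \<partial>\<mu> \<partial>\<mu>)"
      by (rule nn_integral_conv_ccont[OF k(1,5,7,2) l(1,5,7,2), symmetric])
    also have "\<dots> \<le> (\<integral>\<^sup>+x. h x \<partial>\<mu>)"
    proof (rule nn_integral_mono)
      fix x
      have "(\<integral>\<^sup>+y. ennreal (k y) * ennreal (l (ginv y \<cdot> x)) \<partial>\<mu>) \<le> (\<integral>\<^sup>+y. indicator (cset A B x) y \<partial>\<mu>)"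
      proof (rule nn_integral_mono)
        fix y
        show "ennreal (k y) * ennreal (l (ginv y \<cdot> x)) \<le> indicator (cset A B x) y"
        proof (cases "y \<in> K' \<and> ginv y \<cdot> x \<in> L'")
          case True
          then have "y \<in> cset A B x" using k(6) l(6) by (auto simp: cset_def)
          moreover have "k y * l (ginv y \<cdot> x) \<le> 1" using k l by (intro mult_le_one) auto
          ultimately show ?thesis using k(2) l(2) by (simp flip: ennreal_mult)
        next
          case False
          then show ?thesis using k(7) l(7) by auto
        qed
      qed
      then show "(\<integral>\<^sup>+y. ennreal (k y) * ennreal (l (ginv y \<cdot> x)) \<partial>\<mu>) \<le> h x" using cb by (simp add: h_def)
    qed
    finally show ?thesis .
  qed
  obtain f1 where f1: "\<And>i. compact (f1 i)" "\<And>i. f1 i \<subseteq> A" "(\<lambda>i. emeasure \<mu> (f1 i)) \<longlonglongrightarrow> emeasure \<mu> A"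
    by (rule inner_regular_seq[OF A(1)], rule that)
  obtain f2 where f2: "\<And>i. compact (f2 i)" "\<And>i. f2 i \<subseteq> B" "(\<lambda>i. emeasure \<mu> (f2 i)) \<longlonglongrightarrow> emeasure \<mu> B"
    by (rule inner_regular_seq[OF B(1)], rule that)
  have "(\<lambda>i. emeasure \<mu> (f1 i) * emeasure \<mu> (f2 i)) \<longlonglongrightarrow> emeasure \<mu> A * emeasure \<mu> B"
    using A B by (intro tendsto_mult_ennreal f1 f2) auto
  then have "emeasure \<mu> A * emeasure \<mu> B \<le> (\<integral>\<^sup>+x. h x \<partial>\<mu>)"
    by (rule LIMSEQ_le_const2) (use ge f1 f2 in auto)
  with le show "(\<integral>\<^sup>+x. emeasure \<mu> (cset A B x) \<partial>\<mu>) = emeasure \<mu> A * emeasure \<mu> B"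
    unfolding h_def by (rule antisym)
qed

end

section \<open>Convolution\<close>

context haar_group begin

text \<open>Dynkin's argument from open sets to Borel sets, to be applied to each factor of a
  convolution in turn. Intersecting with an open W of finite measure keeps the subtraction for
  complements meaningful.\<close>

lemma kernel_extend:
  fixes \<kappa> :: "'g \<Rightarrow> 'g measure"
  assumes sets: "\<And>x. sets (\<kappa> x) = sets borel" and W: "open W" "emeasure \<mu> W < top" and c: "c < top"
    and fin: "\<And>x. emeasure (\<kappa> x) W < top"
    and op: "\<And>C. open C \<Longrightarrow> C \<subseteq> W \<Longrightarrow> (\<lambda>x. emeasure (\<kappa> x) C) \<in> borel_measurable \<mu> \<and>
      (\<integral>\<^sup>+x. emeasure (\<kappa> x) C \<partial>\<mu>) = c * emeasure \<mu> C"
    and B: "B \<in> sets borel"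
  shows "(\<lambda>x. emeasure (\<kappa> x) (B \<inter> W)) \<in> borel_measurable \<mu> \<and>
      (\<integral>\<^sup>+x. emeasure (\<kappa> x) (B \<inter> W) \<partial>\<mu>) = c * emeasure \<mu> (B \<inter> W)"
proof -
  have Wb: "W \<in> sets borel" using W by simp
  have "Int_stable {S :: 'g set. open S}" by (auto simp: Int_stable_def)
  moreover have "{S :: 'g set. open S} \<subseteq> Pow UNIV" by simp
  moreover have "B \<in> sigma_sets UNIV {S. open S}" using B by (simp add: borel_def)
  ultimately show ?thesis
  proof (induction B rule: sigma_sets_induct_disjoint)
    case (basic A)
    then show ?case using op[of "A \<inter> W"] W by auto
  next
    case empty
    show ?case by simp
  next
    case (compl A)
    have "A \<in> sets borel" using compl(1) by (simp add: borel_def)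
    then have Ab: "A \<inter> W \<in> sets borel" using Wb by (rule sets.Int)
    have eq: "(UNIV - A) \<inter> W = W - A \<inter> W" by auto
    have k: "emeasure (\<kappa> x) (W - A \<inter> W) = emeasure (\<kappa> x) W - emeasure (\<kappa> x) (A \<inter> W)" for x
      using Ab Wb le_less_trans[OF emeasure_mono[of "A \<inter> W" W "\<kappa> x"] fin[of x]]
      by (intro emeasure_Diff) (auto simp: sets less_top)
    have m: "emeasure \<mu> (W - A \<inter> W) = emeasure \<mu> W - emeasure \<mu> (A \<inter> W)"
      using Ab Wb le_less_trans[OF emeasure_mono[of "A \<inter> W" W \<mu>] W(2)]
      by (intro emeasure_Diff) (auto simp: less_top)
    have mW: "(\<lambda>x. emeasure (\<kappa> x) W) \<in> borel_measurable \<mu>"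
      and iW: "(\<integral>\<^sup>+x. emeasure (\<kappa> x) W \<partial>\<mu>) = c * emeasure \<mu> W" using op[OF W(1)] by auto
    have mA: "(\<lambda>x. emeasure (\<kappa> x) (A \<inter> W)) \<in> borel_measurable \<mu>"
      and iA: "(\<integral>\<^sup>+x. emeasure (\<kappa> x) (A \<inter> W) \<partial>\<mu>) = c * emeasure \<mu> (A \<inter> W)" using compl(2) by auto
    have mm: "(\<lambda>x. emeasure (\<kappa> x) W - emeasure (\<kappa> x) (A \<inter> W)) \<in> borel_measurable \<mu>"
      using mW mA by simp
    have "(\<integral>\<^sup>+x. emeasure (\<kappa> x) W - emeasure (\<kappa> x) (A \<inter> W) \<partial>\<mu>) = c * emeasure \<mu> W - c * emeasure \<mu> (A \<inter> W)"
    proof (subst nn_integral_diff[OF mW mA])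
      have "emeasure \<mu> (A \<inter> W) < top"
        using Ab Wb le_less_trans[OF emeasure_mono[of "A \<inter> W" W \<mu>] W(2)] by auto
      then show "(\<integral>\<^sup>+x. emeasure (\<kappa> x) (A \<inter> W) \<partial>\<mu>) \<noteq> \<infinity>"
        using c unfolding iA by (simp add: ennreal_mult_eq_top_iff less_top)
      show "AE x in \<mu>. emeasure (\<kappa> x) (A \<inter> W) \<le> emeasure (\<kappa> x) W"
        using Wb by (intro AE_I2 emeasure_mono) (auto simp: sets)
    qed (simp add: iA iW)
    also have "\<dots> = c * (emeasure \<mu> W - emeasure \<mu> (A \<inter> W))"
      using c by (simp add: ennreal_right_diff_distrib)
    finally show ?case using mm unfolding eq k m by simp
  next
    case (union A)
    have "A i \<in> sets borel" for i using union(2) by (auto simp: borel_def)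
    then have Ab: "A i \<inter> W \<in> sets borel" for i using Wb by (rule sets.Int)
    have d: "disjoint_family (\<lambda>i. A i \<inter> W)" using union(1) by (auto simp: disjoint_family_on_def)
    have k: "emeasure (\<kappa> x) (\<Union>(range A) \<inter> W) = (\<Sum>i. emeasure (\<kappa> x) (A i \<inter> W))" for x
      using suminf_emeasure[of "\<lambda>i. A i \<inter> W" "\<kappa> x"] Ab d by (simp add: sets image_subset_iff)
    have m: "emeasure \<mu> (\<Union>(range A) \<inter> W) = (\<Sum>i. emeasure \<mu> (A i \<inter> W))"
      using suminf_emeasure[of "\<lambda>i. A i \<inter> W" \<mu>] Ab d by (simp add: image_subset_iff)
    show ?case
    proof -
      have m1: "(\<lambda>x. emeasure (\<kappa> x) (A i \<inter> W)) \<in> borel_measurable \<mu>"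
        and i1: "(\<integral>\<^sup>+x. emeasure (\<kappa> x) (A i \<inter> W) \<partial>\<mu>) = c * emeasure \<mu> (A i \<inter> W)" for i
        using union(3)[of i] by auto
      show ?thesis
        unfolding k m using m1 by (simp add: nn_integral_suminf i1)
    qed
  qed
qed

section \<open>Tonelli's formula for convolutions of nonnegative functions\<close>

definition nconv :: "('g \<Rightarrow> ennreal) \<Rightarrow> ('g \<Rightarrow> ennreal) \<Rightarrow> 'g \<Rightarrow> ennreal" where
  "nconv a b x = (\<integral>\<^sup>+y. a y * b (ginv y \<cdot> x) \<partial>\<mu>)"

definition nconv_ok :: "('g \<Rightarrow> ennreal) \<Rightarrow> ('g \<Rightarrow> ennreal) \<Rightarrow> bool" where
  "nconv_ok a b \<longleftrightarrow> nconv a b \<in> borel_measurable \<mu> \<and>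
     (\<integral>\<^sup>+x. nconv a b x \<partial>\<mu>) = (\<integral>\<^sup>+x. a x \<partial>\<mu>) * (\<integral>\<^sup>+x. b x \<partial>\<mu>)"

lemma mult_inv_measurable: "(\<lambda>y. ginv y \<cdot> x) \<in> measurable \<mu> \<mu>"
  using borel_measurable_continuous_onI[OF continuous_on_gmul[OF continuous_on_ginv[OF continuous_on_id] continuous_on_const]]
  by (simp add: measurable_cong_sets[OF sets_mu sets_mu])

lemma nconv_indicator:
  assumes "A \<in> sets borel" "B \<in> sets borel"
  shows "nconv (indicator A) (indicator B) x = emeasure \<mu> (cset A B x)"
proof -
  have "nconv (indicator A) (indicator B) x = (\<integral>\<^sup>+y. indicator (cset A B x) y \<partial>\<mu>)"
    unfolding nconv_def by (intro nn_integral_cong) (auto simp: cset_def indicator_def)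
  then show ?thesis using cset_borel[OF assms] by simp
qed

lemma nconv_ok_indicator:
  assumes A: "A \<in> sets borel" "emeasure \<mu> A < top" and B: "B \<in> sets borel" "emeasure \<mu> B < top"
  shows "nconv_ok (indicator A) (indicator B)"
proof -
  have outer: "\<exists>W. open W \<and> X \<subseteq> W \<and> emeasure \<mu> W < top" if "X \<in> sets borel" "emeasure \<mu> X < top" for X
    using that(2) unfolding outer_regular[OF that(1)] INF_less_iff by auto
  obtain W where W: "open W" "A \<subseteq> W" "emeasure \<mu> W < top" using outer[OF A] by blast
  obtain V where V: "open V" "B \<subseteq> V" "emeasure \<mu> V < top" using outer[OF B] by blast
  have step1: "(\<lambda>x. emeasure \<mu> (cset C B x)) \<in> borel_measurable \<mu> \<and>
      (\<integral>\<^sup>+x. emeasure \<mu> (cset C B x) \<partial>\<mu>) = emeasure \<mu> C * emeasure \<mu> B"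
    if C: "open C" "emeasure \<mu> C < top" for C
  proof -
    \<comment> \<open>First pass, from open to Borel in the second factor: under y \<mapsto>
      \<open>ginv y \<cdot> x\<close> the measure of \<open>cset C B x\<close> becomes the value at
      B of a measure depending on x.\<close>
    define \<kappa> where "\<kappa> x = distr (density \<mu> (indicator C)) borel (\<lambda>y. ginv y \<cdot> x)" for x
    have ks: "sets (\<kappa> x) = sets borel" for x by (simp add: \<kappa>_def)
    have em: "emeasure (\<kappa> x) X = emeasure \<mu> (cset C X x)" if X: "X \<in> sets borel" for x X
    proof -
      have m: "(\<lambda>y. ginv y \<cdot> x) \<in> measurable (density \<mu> (indicator C)) borel"
        using mult_inv_measurable[of x] by (simp add: measurable_cong_sets[OF _ sets_mu])
      have X': "(\<lambda>y. ginv y \<cdot> x) -` X \<in> sets \<mu>"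
        using measurable_sets[OF mult_inv_measurable, of X x] X by simp
      have mC: "(indicator C :: 'g \<Rightarrow> ennreal) \<in> borel_measurable \<mu>"
        using C(1) by (intro borel_measurable_indicator) simp
      have "emeasure (\<kappa> x) X = (\<integral>\<^sup>+y. indicator C y * indicator ((\<lambda>y. ginv y \<cdot> x) -` X) y \<partial>\<mu>)"
        unfolding \<kappa>_def using m X X' C mC
        by (simp add: emeasure_distr emeasure_density)
      also have "\<dots> = (\<integral>\<^sup>+y. indicator (cset C X x) y \<partial>\<mu>)"
        by (intro nn_integral_cong) (auto simp: cset_def indicator_def)
      finally show ?thesis using cset_borel[of C X x] C X by simp
    qed
    have "(\<lambda>x. emeasure (\<kappa> x) (B \<inter> V)) \<in> borel_measurable \<mu> \<and>
      (\<integral>\<^sup>+x. emeasure (\<kappa> x) (B \<inter> V) \<partial>\<mu>) = emeasure \<mu> C * emeasure \<mu> (B \<inter> V)"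
    proof (rule kernel_extend[OF ks V(1,3) C(2) _ _ B(1)])
      show "emeasure (\<kappa> x) V < top" for x
        using V(1) C cset_borel[of C V x]
        by (subst em) (auto intro!: le_less_trans[OF emeasure_mono C(2)] simp: cset_def)
      fix D assume D: "open D" "D \<subseteq> V"
      have "emeasure \<mu> D < top" by (rule le_less_trans[OF emeasure_mono V(3)]) (use D V in auto)
      then show "(\<lambda>x. emeasure (\<kappa> x) D) \<in> borel_measurable \<mu> \<and>
        (\<integral>\<^sup>+x. emeasure (\<kappa> x) D \<partial>\<mu>) = emeasure \<mu> C * emeasure \<mu> D"
        using cset_open[OF C D(1)] D(1) by (simp add: em)
    qed
    moreover have "B \<inter> V = B" using V by auto
    ultimately show ?thesis by (simp add: em B(1))
  qed
  \<comment> \<open>Second pass, from open to Borel in the first factor, with the Borel set B held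
    fixed inside a density.\<close>
  define \<kappa> where "\<kappa> x = density \<mu> (\<lambda>y. indicator B (ginv y \<cdot> x))" for x
  have mi: "(\<lambda>y. indicator B (ginv y \<cdot> x) :: ennreal) \<in> borel_measurable \<mu>" for x
    using measurable_compose[OF mult_inv_measurable, of "indicator B" borel x] B(1) by simp
  have ks: "sets (\<kappa> x) = sets borel" for x by (simp add: \<kappa>_def)
  have em: "emeasure (\<kappa> x) X = emeasure \<mu> (cset X B x)" if X: "X \<in> sets borel" for x X
  proof -
    have "emeasure (\<kappa> x) X = (\<integral>\<^sup>+y. indicator B (ginv y \<cdot> x) * indicator X y \<partial>\<mu>)"
      unfolding \<kappa>_def using mi X by (simp add: emeasure_density)
    also have "\<dots> = (\<integral>\<^sup>+y. indicator (cset X B x) y \<partial>\<mu>)"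
      by (intro nn_integral_cong) (auto simp: cset_def indicator_def)
    finally show ?thesis using cset_borel[of X B x] B X by simp
  qed
  have "(\<lambda>x. emeasure (\<kappa> x) (A \<inter> W)) \<in> borel_measurable \<mu> \<and>
      (\<integral>\<^sup>+x. emeasure (\<kappa> x) (A \<inter> W) \<partial>\<mu>) = emeasure \<mu> B * emeasure \<mu> (A \<inter> W)"
  proof (rule kernel_extend[OF ks W(1,3) B(2) _ _ A(1)])
    show "emeasure (\<kappa> x) W < top" for x
      using W(1) B cset_borel[of W B x]
      by (subst em) (auto intro!: le_less_trans[OF emeasure_mono W(3)] simp: cset_def)
    fix D assume D: "open D" "D \<subseteq> W"
    have "emeasure \<mu> D < top" by (rule le_less_trans[OF emeasure_mono W(3)]) (use D W in auto)
    then show "(\<lambda>x. emeasure (\<kappa> x) D) \<in> borel_measurable \<mu> \<and>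
      (\<integral>\<^sup>+x. emeasure (\<kappa> x) D \<partial>\<mu>) = emeasure \<mu> B * emeasure \<mu> D"
      using step1[OF D(1)] D(1) by (simp add: em mult.commute)
  qed
  moreover have "A \<inter> W = A" using W by auto
  ultimately show ?thesis
    using A B nconv_indicator[OF A(1) B(1)]
    by (simp add: nconv_ok_def em mult.commute cong: measurable_cong)
qed

lemma borel_translate_inv: "b \<in> borel_measurable \<mu> \<Longrightarrow> (\<lambda>y. b (ginv y \<cdot> x)) \<in> borel_measurable \<mu>"
  for b :: "'g \<Rightarrow> 'b::topological_space"
  by (rule measurable_compose[OF mult_inv_measurable])

lemma nconv_ok_right:
  assumes A: "A \<in> sets borel" "emeasure \<mu> A < top"
    and b: "b \<in> borel_measurable \<mu>" "(\<integral>\<^sup>+x. b x \<partial>\<mu>) < top"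
  shows "nconv_ok (indicator A) b"
  using b
proof (induction rule: borel_measurable_induct)
  case (cong f g)
  have "f = g" using cong(3) by (auto simp: fun_eq_iff)
  then show ?case using cong by simp
next
  case (set B)
  then show ?case using nconv_ok_indicator[OF A, of B] by simp
next
  case (mult u c)
  have m: "(\<lambda>y. indicator A y * u (ginv y \<cdot> x)) \<in> borel_measurable \<mu>" for x
    using borel_translate_inv[OF mult(2)] A by simp
  have n: "nconv (indicator A) (\<lambda>x. c * u x) = (\<lambda>x. c * nconv (indicator A) u x)"
    unfolding nconv_def using m by (simp add: mult.left_commute nn_integral_cmult)
  show ?case
  \<comment> \<open>For c = 0 the integral of u may be infinite, and the induction hypothesis does
    not apply to u.\<close>
  proof (cases "c = 0")
    case True
    then show ?thesis by (simp add: nconv_ok_def nconv_def[abs_def])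
  next
    case False
    have "(\<integral>\<^sup>+x. u x \<partial>\<mu>) < top"
      using mult(5) mult(2) False by (auto simp: nn_integral_cmult ennreal_mult_less_top)
    then have "nconv_ok (indicator A) u" using mult(4) by blast
    then show ?thesis
    proof -
      assume "nconv_ok (indicator A) u"
      then have m1: "nconv (indicator A) u \<in> borel_measurable \<mu>"
        and i1: "(\<integral>\<^sup>+x. nconv (indicator A) u x \<partial>\<mu>) = integral\<^sup>N \<mu> (indicator A) * integral\<^sup>N \<mu> u"
        by (auto simp: nconv_ok_def)
      show ?thesis
        using mult(2) m1 i1 unfolding nconv_ok_def n by (simp add: nn_integral_cmult mult.left_commute)
    qed
  qed
next
  case (add u v)
  have m: "(\<lambda>y. indicator A y * w (ginv y \<cdot> x)) \<in> borel_measurable \<mu>" if "w \<in> borel_measurable \<mu>" for x and w :: "'g \<Rightarrow> ennreal"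
    using borel_translate_inv[OF that] A by simp
  have n: "nconv (indicator A) (\<lambda>x. v x + u x) = (\<lambda>x. nconv (indicator A) v x + nconv (indicator A) u x)"
    unfolding nconv_def using m add(1,3) by (simp add: distrib_left nn_integral_add)
  have s: "(\<integral>\<^sup>+x. v x + u x \<partial>\<mu>) = (\<integral>\<^sup>+x. v x \<partial>\<mu>) + (\<integral>\<^sup>+x. u x \<partial>\<mu>)"
    using add(1,3) by (simp add: nn_integral_add)
  have "nconv_ok (indicator A) u" "nconv_ok (indicator A) v"
    using add(6,7,8) unfolding s by auto
  then show ?case
    unfolding nconv_ok_def n s
  proof (elim conjE)
    assume "nconv (indicator A) u \<in> borel_measurable \<mu>" "nconv (indicator A) v \<in> borel_measurable \<mu>"
      "integral\<^sup>N \<mu> (nconv (indicator A) u) = integral\<^sup>N \<mu> (indicator A) * integral\<^sup>N \<mu> u" "integral\<^sup>N \<mu> (nconv (indicator A) v) = integral\<^sup>N \<mu> (indicator A) * integral\<^sup>N \<mu> v"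
    then show "(\<lambda>x. nconv (indicator A) v x + nconv (indicator A) u x) \<in> borel_measurable \<mu> \<and>
        (\<integral>\<^sup>+x. nconv (indicator A) v x + nconv (indicator A) u x \<partial>\<mu>) = integral\<^sup>N \<mu> (indicator A) * (integral\<^sup>N \<mu> v + integral\<^sup>N \<mu> u)"
      by (simp add: nn_integral_add distrib_left)
  qed
next
  case (seq U)
  have inc: "incseq U" by fact
  have sup: "(SUP i. U i) x = (SUP i. U i x)" for x by (simp add: image_comp)
  have m: "(\<lambda>y. indicator A y * U i (ginv y \<cdot> x)) \<in> borel_measurable \<mu>" for x i
    using borel_translate_inv[OF seq(1)] A by simp
  have n: "nconv (indicator A) (SUP i. U i) = (\<lambda>x. SUP i. nconv (indicator A) (U i) x)"
  proof
    fix x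
    have "nconv (indicator A) (SUP i. U i) x = (\<integral>\<^sup>+y. (SUP i. indicator A y * U i (ginv y \<cdot> x)) \<partial>\<mu>)"
      unfolding nconv_def sup by (simp add: SUP_mult_left_ennreal)
    also have "\<dots> = (SUP i. nconv (indicator A) (U i) x)"
      unfolding nconv_def using inc m
      by (intro nn_integral_monotone_convergence_SUP)
        (auto simp: incseq_def le_fun_def intro!: mult_left_mono)
    finally show "nconv (indicator A) (SUP i. U i) x = (SUP i. nconv (indicator A) (U i) x)" .
  qed
  have s: "(\<integral>\<^sup>+x. (SUP i. U i) x \<partial>\<mu>) = (SUP i. \<integral>\<^sup>+x. U i x \<partial>\<mu>)"
    unfolding sup by (rule nn_integral_monotone_convergence_SUP[OF inc seq(1)])
  have ok: "nconv_ok (indicator A) (U i)" for i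
  proof (rule seq(5))
    have "(\<integral>\<^sup>+x. U i x \<partial>\<mu>) \<le> (\<integral>\<^sup>+x. (SUP i. U i) x \<partial>\<mu>)"
      unfolding s by (rule SUP_upper) simp
    then show "(\<integral>\<^sup>+x. U i x \<partial>\<mu>) < top" using seq(6) by (rule le_less_trans)
  qed
  have incn: "incseq (\<lambda>i. nconv (indicator A) (U i))"
    unfolding nconv_def using inc
    by (auto simp: incseq_def le_fun_def intro!: nn_integral_mono mult_left_mono)
  show ?case
  proof -
    have m1: "nconv (indicator A) (U i) \<in> borel_measurable \<mu>"
      and i1: "(\<integral>\<^sup>+x. nconv (indicator A) (U i) x \<partial>\<mu>) = integral\<^sup>N \<mu> (indicator A) * integral\<^sup>N \<mu> (U i)" for i
      using ok[of i] by (auto simp: nconv_ok_def)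
    show ?thesis
      unfolding nconv_ok_def n s using m1
      by (simp add: nn_integral_monotone_convergence_SUP[OF incn] i1 SUP_mult_left_ennreal)
  qed
qed

lemma nconv_ok_all:
  assumes b: "b \<in> borel_measurable \<mu>" "(\<integral>\<^sup>+x. b x \<partial>\<mu>) < top"
    and a: "a \<in> borel_measurable \<mu>" "(\<integral>\<^sup>+x. a x \<partial>\<mu>) < top"
  shows "nconv_ok a b"
  using a
proof (induction rule: borel_measurable_induct)
  case (cong f g)
  have "f = g" using cong(3) by (auto simp: fun_eq_iff)
  then show ?case using cong by simp
next
  case (set A)
  then show ?case using nconv_ok_right[OF _ _ b, of A] by simp
next
  case (mult u c)
  have m: "(\<lambda>y. u y * b (ginv y \<cdot> x)) \<in> borel_measurable \<mu>" for x
    using borel_translate_inv[OF b(1)] mult(2) by simp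
  have n: "nconv (\<lambda>x. c * u x) b = (\<lambda>x. c * nconv u b x)"
    unfolding nconv_def using m by (simp add: mult.assoc nn_integral_cmult)
  show ?case
  proof (cases "c = 0")
    case True
    then show ?thesis by (simp add: nconv_ok_def nconv_def[abs_def])
  next
    case False
    have "(\<integral>\<^sup>+x. u x \<partial>\<mu>) < top"
      using mult(5) mult(2) False by (auto simp: nn_integral_cmult ennreal_mult_less_top)
    then have "nconv_ok u b" using mult(4) by blast
    then show ?thesis
    proof -
      assume "nconv_ok u b"
      then have m1: "nconv u b \<in> borel_measurable \<mu>"
        and i1: "(\<integral>\<^sup>+x. nconv u b x \<partial>\<mu>) = integral\<^sup>N \<mu> u * integral\<^sup>N \<mu> b"
        by (auto simp: nconv_ok_def)
      show ?thesis
        using mult(2) m1 i1 unfolding nconv_ok_def n by (simp add: nn_integral_cmult mult.assoc)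
    qed
  qed
next
  case (add u v)
  have m: "(\<lambda>y. w y * b (ginv y \<cdot> x)) \<in> borel_measurable \<mu>" if "w \<in> borel_measurable \<mu>" for x w
    using borel_translate_inv[OF b(1)] that by simp
  have n: "nconv (\<lambda>x. v x + u x) b = (\<lambda>x. nconv v b x + nconv u b x)"
    unfolding nconv_def using m add(1,3) by (simp add: distrib_right nn_integral_add)
  have s: "(\<integral>\<^sup>+x. v x + u x \<partial>\<mu>) = (\<integral>\<^sup>+x. v x \<partial>\<mu>) + (\<integral>\<^sup>+x. u x \<partial>\<mu>)"
    using add(1,3) by (simp add: nn_integral_add)
  have "nconv_ok u b" "nconv_ok v b"
    using add(6,7,8) unfolding s by auto
  then show ?case
    unfolding nconv_ok_def n s
  proof (elim conjE)
    assume "nconv u b \<in> borel_measurable \<mu>" "nconv v b \<in> borel_measurable \<mu>"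
      "integral\<^sup>N \<mu> (nconv u b) = integral\<^sup>N \<mu> u * integral\<^sup>N \<mu> b" "integral\<^sup>N \<mu> (nconv v b) = integral\<^sup>N \<mu> v * integral\<^sup>N \<mu> b"
    then show "(\<lambda>x. nconv v b x + nconv u b x) \<in> borel_measurable \<mu> \<and>
        (\<integral>\<^sup>+x. nconv v b x + nconv u b x \<partial>\<mu>) = (integral\<^sup>N \<mu> v + integral\<^sup>N \<mu> u) * integral\<^sup>N \<mu> b"
      by (simp add: nn_integral_add distrib_right)
  qed
next
  case (seq U)
  have inc: "incseq U" by fact
  have sup: "(SUP i. U i) x = (SUP i. U i x)" for x by (simp add: image_comp)
  have m: "(\<lambda>y. U i y * b (ginv y \<cdot> x)) \<in> borel_measurable \<mu>" for x i
    using borel_translate_inv[OF b(1)] seq(1) by simp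
  have n: "nconv (SUP i. U i) b = (\<lambda>x. SUP i. nconv (U i) b x)"
  proof
    fix x
    have "nconv (SUP i. U i) b x = (\<integral>\<^sup>+y. (SUP i. U i y * b (ginv y \<cdot> x)) \<partial>\<mu>)"
      unfolding nconv_def sup by (simp add: SUP_mult_right_ennreal)
    also have "\<dots> = (SUP i. nconv (U i) b x)"
      unfolding nconv_def using inc m
      by (intro nn_integral_monotone_convergence_SUP)
        (auto simp: incseq_def le_fun_def intro!: mult_right_mono)
    finally show "nconv (SUP i. U i) b x = (SUP i. nconv (U i) b x)" .
  qed
  have s: "(\<integral>\<^sup>+x. (SUP i. U i) x \<partial>\<mu>) = (SUP i. \<integral>\<^sup>+x. U i x \<partial>\<mu>)"
    unfolding sup by (rule nn_integral_monotone_convergence_SUP[OF inc seq(1)])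
  have ok: "nconv_ok (U i) b" for i
  proof (rule seq(5))
    have "(\<integral>\<^sup>+x. U i x \<partial>\<mu>) \<le> (\<integral>\<^sup>+x. (SUP i. U i) x \<partial>\<mu>)"
      unfolding s by (rule SUP_upper) simp
    then show "(\<integral>\<^sup>+x. U i x \<partial>\<mu>) < top" using seq(6) by (rule le_less_trans)
  qed
  have incn: "incseq (\<lambda>i. nconv (U i) b)"
    unfolding nconv_def using inc
    by (auto simp: incseq_def le_fun_def intro!: nn_integral_mono mult_right_mono)
  show ?case
  proof -
    have m1: "nconv (U i) b \<in> borel_measurable \<mu>"
      and i1: "(\<integral>\<^sup>+x. nconv (U i) b x \<partial>\<mu>) = integral\<^sup>N \<mu> (U i) * integral\<^sup>N \<mu> b" for i
      using ok[of i] by (auto simp: nconv_ok_def)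
    show ?thesis
      unfolding nconv_ok_def n s using m1
      by (simp add: nn_integral_monotone_convergence_SUP[OF incn] i1 SUP_mult_right_ennreal)
  qed
qed

end

text \<open>For i = 0, 1, 2, 3 these are the positive parts of Re z, Im z, - Re z and - Im z.
  Through them the theory of nonnegative convolutions reaches complex functions.\<close>

definition quart :: "nat \<Rightarrow> complex \<Rightarrow> real" where
  "quart i z = max 0 (Re ((- \<i>) ^ i * z))"

lemma quart_nonneg: "0 \<le> quart i z"
  by (simp add: quart_def)

lemma quart_le: "quart i z \<le> norm z"
proof -
  have "Re ((- \<i>) ^ i * z) \<le> norm ((- \<i>) ^ i * z)" by (rule complex_Re_le_cmod)
  also have "\<dots> = norm z" by (simp add: norm_mult norm_power)
  finally show ?thesis by (simp add: quart_def)
qed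

lemma quart_sum: "z = (\<Sum>i<4. \<i> ^ i * of_real (quart i z))"
  by (simp add: quart_def eval_nat_numeral complex_eq_iff max_def)

context haar_group begin

section \<open>Convolution of integrable functions\<close>

abbreviation conv where "conv \<equiv> convolution gmul ginv \<mu>"

abbreviation N1 :: "('g \<Rightarrow> complex) \<Rightarrow> real" where "N1 a \<equiv> (\<integral>x. norm (a x) \<partial>\<mu>)"

text \<open>Everything is read off from the convolution H of the absolute values, whose integral is
  the finite product of the norms.\<close>

lemma conv_basic:
  assumes a: "integrable \<mu> a" and b: "integrable \<mu> b"
  shows conv_AE: "AE x in \<mu>. integrable \<mu> (\<lambda>y. a y * b (ginv y \<cdot> x))"
    and conv_integrable: "integrable \<mu> (conv a b)"
    and conv_norm: "N1 (conv a b) \<le> N1 a * N1 b"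
proof -
  have am: "a \<in> borel_measurable \<mu>" and bm: "b \<in> borel_measurable \<mu>" using a b by auto
  define H where "H = nconv (\<lambda>x. ennreal (norm (a x))) (\<lambda>x. ennreal (norm (b x)))"
  have na: "(\<integral>\<^sup>+x. ennreal (norm (a x)) \<partial>\<mu>) = ennreal (N1 a)"
    and nb: "(\<integral>\<^sup>+x. ennreal (norm (b x)) \<partial>\<mu>) = ennreal (N1 b)"
    using a b by (auto intro!: nn_integral_eq_integral)
  have qm: "(\<lambda>x. ennreal (quart i (c x))) \<in> borel_measurable \<mu>" if "c \<in> borel_measurable \<mu>" for c i
  proof -
    have "quart i \<in> borel_measurable borel"
      unfolding quart_def[abs_def] by (intro borel_measurable_continuous_onI continuous_intros)
    then show ?thesis using that by (auto intro: measurable_compose)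
  qed
  have qfin: "(\<integral>\<^sup>+x. ennreal (quart i (c x)) \<partial>\<mu>) < top" if "integrable \<mu> c" for c i
  proof -
    have "(\<integral>\<^sup>+x. ennreal (quart i (c x)) \<partial>\<mu>) \<le> (\<integral>\<^sup>+x. ennreal (norm (c x)) \<partial>\<mu>)"
      by (intro nn_integral_mono ennreal_leI quart_le)
    also have "\<dots> < top" using that unfolding integrable_iff_bounded by simp
    finally show ?thesis .
  qed
  have "nconv_ok (\<lambda>x. ennreal (norm (a x))) (\<lambda>x. ennreal (norm (b x)))"
    using am bm by (intro nconv_ok_all) (auto simp: na nb)
  then have Hm: "H \<in> borel_measurable \<mu>" and HI: "(\<integral>\<^sup>+x. H x \<partial>\<mu>) = ennreal (N1 a) * ennreal (N1 b)"
    unfolding H_def nconv_ok_def na nb by auto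
  have Hfin: "(\<integral>\<^sup>+x. H x \<partial>\<mu>) < top"
    unfolding HI by (simp flip: ennreal_mult)
  have AEH: "AE x in \<mu>. H x \<noteq> top"
    using nn_integral_PInf_AE[OF Hm] Hfin by simp
  have tm: "(\<lambda>y. a y * b (ginv y \<cdot> x)) \<in> borel_measurable \<mu>" for x
    using borel_translate_inv[OF bm] am by (intro borel_measurable_times)
  have int_iff: "integrable \<mu> (\<lambda>y. a y * b (ginv y \<cdot> x)) \<longleftrightarrow> H x \<noteq> top" for x
    unfolding integrable_iff_bounded H_def nconv_def
    using tm[of x] by (simp add: norm_mult ennreal_mult less_top)
  show AEi: "AE x in \<mu>. integrable \<mu> (\<lambda>y. a y * b (ginv y \<cdot> x))"
    using AEH unfolding int_iff .
  define Q where "Q i j = nconv (\<lambda>x. ennreal (quart i (a x))) (\<lambda>x. ennreal (quart j (b x)))" for i j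
  have Qm: "Q i j \<in> borel_measurable \<mu>" for i j
    using nconv_ok_all[OF qm[OF bm] qfin[OF b] qm[OF am] qfin[OF a]]
    unfolding Q_def nconv_ok_def by blast
  \<comment> \<open>An explicit formula at every point gives measurability: a combination of sixteen
    nonnegative convolutions where H is finite, and elsewhere 0, the default value of an integral
    that does not converge.\<close>
  have conv_eq: "conv a b x = (if H x = top then 0 else
      (\<Sum>i<4. \<Sum>j<4. \<i> ^ (i + j) * of_real (enn2real (Q i j x))))" for x
  proof (cases "H x = top")
    case True
    then show ?thesis using int_iff[of x] by (simp add: convolution_def not_integrable_integral_eq)
  next
    case False
    then have I: "integrable \<mu> (\<lambda>y. a y * b (ginv y \<cdot> x))" by (simp add: int_iff)
    have mm: "(\<lambda>y. quart i (a y) * quart j (b (ginv y \<cdot> x))) \<in> borel_measurable \<mu>" for i j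
    proof -
      have qb: "quart i \<in> borel_measurable borel" for i
        unfolding quart_def[abs_def] by (intro borel_measurable_continuous_onI continuous_intros)
      show ?thesis
        by (intro borel_measurable_times measurable_compose[OF am qb]
            measurable_compose[OF borel_translate_inv[OF bm] qb])
    qed
    have iq: "integrable \<mu> (\<lambda>y. quart i (a y) * quart j (b (ginv y \<cdot> x)))" for i j
      by (rule Bochner_Integration.integrable_bound[OF I mm])
        (auto simp: norm_mult quart_nonneg quart_le intro!: mult_mono)
    have "conv a b x = (\<integral>y. (\<Sum>i<4. \<Sum>j<4. \<i> ^ (i + j) *
        of_real (quart i (a y) * quart j (b (ginv y \<cdot> x)))) \<partial>\<mu>)"
      unfolding convolution_def
    proof (rule Bochner_Integration.integral_cong[OF refl])
      fix y
      have "a y * b (ginv y \<cdot> x) = (\<Sum>i<4. \<i> ^ i * of_real (quart i (a y))) *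
          (\<Sum>j<4. \<i> ^ j * of_real (quart j (b (ginv y \<cdot> x))))"
        using quart_sum[of "a y"] quart_sum[of "b (ginv y \<cdot> x)"] by simp
      also have "\<dots> = (\<Sum>i<4. \<Sum>j<4. \<i> ^ (i + j) * of_real (quart i (a y) * quart j (b (ginv y \<cdot> x))))"
        unfolding sum_product by (intro sum.cong refl) (simp add: power_add mult_ac)
      finally show "a y * b (ginv y \<cdot> x) =
          (\<Sum>i<4. \<Sum>j<4. \<i> ^ (i + j) * of_real (quart i (a y) * quart j (b (ginv y \<cdot> x))))" .
    qed
    also have "\<dots> = (\<Sum>i<4. \<Sum>j<4. \<i> ^ (i + j) *
        of_real (\<integral>y. quart i (a y) * quart j (b (ginv y \<cdot> x)) \<partial>\<mu>))"
    proof -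
      have ii: "integrable \<mu> (\<lambda>y. \<i> ^ (i + j) * of_real (quart i (a y) * quart j (b (ginv y \<cdot> x))))" for i j
        by (intro integrable_mult_right integrable_of_real iq)
      have e: "(\<integral>y. \<i> ^ (i + j) * of_real (quart i (a y) * quart j (b (ginv y \<cdot> x))) \<partial>\<mu>) =
          \<i> ^ (i + j) * of_real (\<integral>y. quart i (a y) * quart j (b (ginv y \<cdot> x)) \<partial>\<mu>)" for i j
        by (simp only: integral_mult_right_zero integral_complex_of_real)
      show ?thesis
        by (subst Bochner_Integration.integral_sum, intro Bochner_Integration.integrable_sum ii,
            subst Bochner_Integration.integral_sum, rule ii, simp only: e)
    qed
    also have "\<dots> = (\<Sum>i<4. \<Sum>j<4. \<i> ^ (i + j) * of_real (enn2real (Q i j x)))"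
    proof (intro sum.cong refl)
      fix i j
      have "(\<integral>y. quart i (a y) * quart j (b (ginv y \<cdot> x)) \<partial>\<mu>) =
          enn2real (\<integral>\<^sup>+y. ennreal (quart i (a y) * quart j (b (ginv y \<cdot> x))) \<partial>\<mu>)"
        by (rule integral_eq_nn_integral[OF mm]) (simp add: quart_nonneg)
      then show "\<i> ^ (i + j) * of_real (\<integral>y. quart i (a y) * quart j (b (ginv y \<cdot> x)) \<partial>\<mu>) =
          \<i> ^ (i + j) * complex_of_real (enn2real (Q i j x))"
        by (simp add: Q_def nconv_def ennreal_mult quart_nonneg)
    qed
    finally show ?thesis using False by simp
  qed
  have cm: "conv a b \<in> borel_measurable \<mu>"
  proof -
    have "(\<lambda>x. if H x = top then 0 else
      (\<Sum>i<4. \<Sum>j<4. \<i> ^ (i + j) * complex_of_real (enn2real (Q i j x)))) \<in> borel_measurable \<mu>"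
    proof (rule measurable_If)
      show "{x \<in> space \<mu>. H x = top} \<in> sets \<mu>" using Hm by measurable
      show "(\<lambda>x. \<Sum>i<4. \<Sum>j<4. \<i> ^ (i + j) * complex_of_real (enn2real (Q i j x))) \<in> borel_measurable \<mu>"
        using Qm by (intro borel_measurable_sum borel_measurable_times borel_measurable_const
            borel_measurable_of_real measurable_compose[OF _ borel_measurable_enn2real]) auto
    qed simp
    then show ?thesis by (simp only: conv_eq[abs_def])
  qed
  have le: "ennreal (norm (conv a b x)) \<le> H x" for x
  proof (cases "H x = top")
    case False
    then have I: "integrable \<mu> (\<lambda>y. a y * b (ginv y \<cdot> x))" by (simp add: int_iff)
    show ?thesis
      using integral_norm_bound_ennreal[OF I]
      by (simp add: convolution_def H_def nconv_def norm_mult ennreal_mult)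
  qed simp
  have le2: "(\<integral>\<^sup>+x. ennreal (norm (conv a b x)) \<partial>\<mu>) \<le> ennreal (N1 a * N1 b)"
    using nn_integral_mono[of \<mu> "\<lambda>x. ennreal (norm (conv a b x))" H] le HI
    by (simp add: ennreal_mult)
  show ci: "integrable \<mu> (conv a b)"
    unfolding integrable_iff_bounded using cm le_less_trans[OF le2] by simp
  have "ennreal (N1 (conv a b)) \<le> ennreal (N1 a * N1 b)"
    using le2 by (subst nn_integral_eq_integral[symmetric]) (use ci in auto)
  then show "N1 (conv a b) \<le> N1 a * N1 b"
    by (subst (asm) ennreal_le_iff) (auto intro!: mult_nonneg_nonneg)
qed

lemma conv_diff_left:
  assumes "integrable \<mu> a" "integrable \<mu> a'" "integrable \<mu> b"
  shows "AE x in \<mu>. conv (\<lambda>x. a x - a' x) b x = conv a b x - conv a' b x"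
  using conv_AE[OF assms(1,3)] conv_AE[OF assms(2,3)]
  by eventually_elim (simp add: convolution_def left_diff_distrib)

lemma conv_diff_right:
  assumes "integrable \<mu> a" "integrable \<mu> b" "integrable \<mu> b'"
  shows "AE x in \<mu>. conv a (\<lambda>x. b x - b' x) x = conv a b x - conv a b' x"
  using conv_AE[OF assms(1,2)] conv_AE[OF assms(1,3)]
  by eventually_elim (simp add: convolution_def right_diff_distrib)

lemma conv_add_right:
  assumes "integrable \<mu> a" "integrable \<mu> b" "integrable \<mu> b'"
  shows "AE x in \<mu>. conv a (\<lambda>x. b x + b' x) x = conv a b x + conv a b' x"
  using conv_AE[OF assms(1,2)] conv_AE[OF assms(1,3)]
  by eventually_elim (simp add: convolution_def distrib_left)

lemma ccont_dense:
  fixes a :: "'g \<Rightarrow> complex"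
  assumes "integrable \<mu> a" "\<epsilon> > 0"
  shows "\<exists>k K. continuous_on UNIV k \<and> compact K \<and> (\<forall>x. x \<notin> K \<longrightarrow> k x = 0) \<and> N1 (\<lambda>x. a x - k x) < \<epsilon>"
  using assms
proof (induction a arbitrary: \<epsilon> rule: integrable_induct)
  case (base A c)
  \<comment> \<open>The error is at most 2 \<delta> |c|: one \<delta> for the gap between A and an
    open superset U, one for the gap between U and a compact subset.\<close>
  define \<delta> where "\<delta> = \<epsilon> / (2 * norm c + 1)"
  have "0 < 2 * norm c + 1" using norm_ge_zero[of c] by linarith
  then have \<delta>: "\<delta> > 0" "\<epsilon> = \<delta> * (2 * norm c + 1)" using base(3) by (auto simp: \<delta>_def)
  have Ab: "A \<in> sets borel" using base(1) by simp
  have eA: "emeasure \<mu> A = ennreal (measure \<mu> A)"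
    using base(2) by (auto simp: emeasure_eq_ennreal_measure less_top)
  have "emeasure \<mu> A < emeasure \<mu> A + ennreal \<delta>"
    unfolding eA using \<delta>(1) by (simp add: ennreal_less_iff flip: ennreal_plus)
  then have "(INF U\<in>{U. open U \<and> A \<subseteq> U}. emeasure \<mu> U) < emeasure \<mu> A + ennreal \<delta>"
    by (subst outer_regular[OF Ab, symmetric])
  then obtain U where U: "open U" "A \<subseteq> U" "emeasure \<mu> U < emeasure \<mu> A + ennreal \<delta>"
    unfolding INF_less_iff by blast
  have Ufin: "emeasure \<mu> U < top"
  proof (rule less_trans[OF U(3)])
    show "emeasure \<mu> A + ennreal \<delta> < top"
      unfolding eA using \<delta>(1) by (simp flip: ennreal_plus)
  qed
  obtain f where f: "\<And>i. compact (f i)" "\<And>i. f i \<subseteq> U" "(\<lambda>i. emeasure \<mu> (f i)) \<longlonglongrightarrow> emeasure \<mu> U"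
    by (rule inner_regular_seq[OF U(1)], rule that)
  have mf: "(\<lambda>i. measure \<mu> (f i)) \<longlonglongrightarrow> measure \<mu> U"
    unfolding measure_def using f(3) Ufin by (intro tendsto_enn2real) auto
  have mU: "measure \<mu> U < measure \<mu> A + \<delta>"
  proof -
    have "emeasure \<mu> U = ennreal (measure \<mu> U)" "emeasure \<mu> A = ennreal (measure \<mu> A)"
      using Ufin eA by (auto simp: emeasure_eq_ennreal_measure less_top)
    with U(3) \<delta>(1) have "ennreal (measure \<mu> U) < ennreal (measure \<mu> A + \<delta>)" by simp
    then show ?thesis by (simp add: ennreal_less_iff)
  qed
  obtain i where i: "measure \<mu> U - \<delta> < measure \<mu> (f i)"
    using eventually_happens'[OF _ order_tendstoD(1)[OF mf, of "measure \<mu> U - \<delta>"]] \<delta>(1) by auto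
  obtain k :: "'g \<Rightarrow> real" and K where k: "continuous_on UNIV k" "\<And>x. 0 \<le> k x" "\<And>x. k x \<le> 1"
      "\<And>x. x \<in> f i \<Longrightarrow> k x = 1" "compact K" "K \<subseteq> U" "\<And>x. x \<notin> K \<Longrightarrow> k x = 0"
    by (rule urysohn[OF f(1) U(1) f(2)], rule that)
  have fb: "f i \<in> sets \<mu>" using compact_borel[OF f(1)] by simp
  have ffin: "emeasure \<mu> (f i) < top" using emeasure_compact[OF f(1)] by simp
  have iA: "integrable \<mu> (indicator A :: 'g \<Rightarrow> real)" and iU: "integrable \<mu> (indicator U :: 'g \<Rightarrow> real)"
    and iF: "integrable \<mu> (indicator (f i) :: 'g \<Rightarrow> real)"
    using base(1,2) U(1) Ufin fb ffin by (auto simp: integrable_indicator_iff)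
  have ik: "integrable \<mu> (\<lambda>x. k x *\<^sub>R c)"
    by (rule ccont_integrable[OF _ k(5)]) (use k in \<open>auto intro!: continuous_intros\<close>)
  have "N1 (\<lambda>x. indicator A x *\<^sub>R c - k x *\<^sub>R c) \<le>
      (\<integral>x. ((indicator U x - indicator A x) + (indicator U x - indicator (f i) x)) * norm c \<partial>\<mu>)"
  proof (rule integral_mono)
    show "integrable \<mu> (\<lambda>x. norm (indicator A x *\<^sub>R c - k x *\<^sub>R c))"
    proof -
      have "integrable \<mu> (\<lambda>x. indicator A x *\<^sub>R c)" using iA by (intro integrable_scaleR_left)
      then show ?thesis using ik by (intro integrable_norm Bochner_Integration.integrable_diff)
    qed
    show "integrable \<mu> (\<lambda>x. ((indicator U x - indicator A x) + (indicator U x - indicator (f i) x)) * norm c)"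
      using iA iU iF by (intro integrable_mult_left Bochner_Integration.integrable_add Bochner_Integration.integrable_diff)
    fix x
    have "\<bar>indicator A x - k x\<bar> \<le> (indicator U x - indicator A x) + (indicator U x - indicator (f i) x)"
    proof (cases "x \<in> U")
      case True
      then show ?thesis using k(2,3,4)[of x] by (cases "x \<in> A"; cases "x \<in> f i") auto
    next
      case False
      then have "x \<notin> A" "x \<notin> f i" "x \<notin> K" using U(2) f(2)[of i] k(6) by auto
      then show ?thesis using False k(7)[of x] by simp
    qed
    then show "norm (indicator A x *\<^sub>R c - k x *\<^sub>R c) \<le> ((indicator U x - indicator A x) + (indicator U x - indicator (f i) x)) * norm c"
      by (simp add: mult_right_mono flip: scaleR_diff_left)
  qed
  also have "\<dots> = ((measure \<mu> U - measure \<mu> A) + (measure \<mu> U - measure \<mu> (f i))) * norm c"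
    using iA iU iF base(1) U(1) fb by simp
  also have "\<dots> \<le> (\<delta> + \<delta>) * norm c" using mU i by (intro mult_right_mono) auto
  also have "\<dots> < \<epsilon>" using \<delta> by (simp add: algebra_simps)
  finally show ?case using k
    by (intro exI[of _ "\<lambda>x. k x *\<^sub>R c"] exI[of _ K]) (auto intro!: continuous_intros)
next
  case (add f g)
  obtain k K where k: "continuous_on UNIV k" "compact K" "\<forall>x. x \<notin> K \<longrightarrow> k x = 0" "N1 (\<lambda>x. f x - k x) < \<epsilon> / 2"
    using add(3)[of "\<epsilon> / 2"] add(5) by auto
  obtain l L where l: "continuous_on UNIV l" "compact L" "\<forall>x. x \<notin> L \<longrightarrow> l x = 0" "N1 (\<lambda>x. g x - l x) < \<epsilon> / 2"
    using add(4)[of "\<epsilon> / 2"] add(5) by auto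
  have ik: "integrable \<mu> k" and il: "integrable \<mu> l"
    using ccont_integrable[OF k(1,2)] ccont_integrable[OF l(1,2)] k(3) l(3) by auto
  have "N1 (\<lambda>x. (f x + g x) - (k x + l x)) \<le> (\<integral>x. norm (f x - k x) + norm (g x - l x) \<partial>\<mu>)"
    using add(1,2) ik il by (intro integral_mono) (auto simp: add_diff_add norm_triangle_ineq)
  also have "\<dots> = N1 (\<lambda>x. f x - k x) + N1 (\<lambda>x. g x - l x)"
    using add(1,2) ik il by simp
  also have "\<dots> < \<epsilon>" using k(4) l(4) by simp
  finally show ?case using k l
    by (intro exI[of _ "\<lambda>x. k x + l x"] exI[of _ "K \<union> L"]) (auto intro!: continuous_intros)
next
  case (lim f s)
  have "(\<lambda>i. N1 (\<lambda>x. f x - s i x)) \<longlonglongrightarrow> (\<integral>x. norm (0 :: complex) \<partial>\<mu>)"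
  \<comment> \<open>The approximants satisfy norm (s i x) \<le> 2 * norm (f x), whence the factor
    3.\<close>
  proof (rule integral_dominated_convergence[where w="\<lambda>x. 3 * norm (f x)"])
    show "AE x in \<mu>. (\<lambda>i. norm (f x - s i x)) \<longlonglongrightarrow> norm (0 :: complex)"
    proof (rule AE_I2)
      fix x assume "x \<in> space \<mu>"
      then have "(\<lambda>i. norm (f x - s i x)) \<longlonglongrightarrow> norm (f x - f x)"
        by (intro tendsto_norm tendsto_diff tendsto_const lim(2))
      then show "(\<lambda>i. norm (f x - s i x)) \<longlonglongrightarrow> norm (0 :: complex)" by simp
    qed
    fix i
    show "AE x in \<mu>. norm (norm (f x - s i x)) \<le> 3 * norm (f x)"
    proof (rule AE_I2)
      fix x assume "x \<in> space \<mu>"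
      then show "norm (norm (f x - s i x)) \<le> 3 * norm (f x)"
        using norm_triangle_ineq4[of "f x" "s i x"] lim(3)[of x i] by simp
    qed
  qed (use lim(1,4) in auto)
  then have "(\<lambda>i. N1 (\<lambda>x. f x - s i x)) \<longlonglongrightarrow> 0" by simp
  then obtain i where i: "N1 (\<lambda>x. f x - s i x) < \<epsilon> / 2"
    using eventually_happens'[OF _ order_tendstoD(2)[of _ 0 sequentially "\<epsilon> / 2"]] lim(6) by auto
  obtain k K where k: "continuous_on UNIV k" "compact K" "\<forall>x. x \<notin> K \<longrightarrow> k x = 0" "N1 (\<lambda>x. s i x - k x) < \<epsilon> / 2"
    using lim(5)[of "\<epsilon> / 2" i] lim(6) by auto
  have ik: "integrable \<mu> k" using ccont_integrable[OF k(1,2)] k(3) by auto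
  have "N1 (\<lambda>x. f x - k x) \<le> (\<integral>x. norm (f x - s i x) + norm (s i x - k x) \<partial>\<mu>)"
  proof (rule integral_mono)
    fix x
    show "norm (f x - k x) \<le> norm (f x - s i x) + norm (s i x - k x)"
      using norm_triangle_ineq[of "f x - s i x" "s i x - k x"] by simp
  qed (use lim(1,4) ik in auto)
  also have "\<dots> = N1 (\<lambda>x. f x - s i x) + N1 (\<lambda>x. s i x - k x)"
    using lim(1,4) ik by simp
  also have "\<dots> < \<epsilon>" using i k(4) by simp
  finally show ?case using k by blast
qed

end

section \<open>The pairing of integrable with bounded continuous functions\<close>

context haar_group begin

lemma N1_nonneg [simp]: "0 \<le> N1 a"
  by (rule integral_nonneg_AE) simp

lemma norm_integral_mult_le:
  fixes a s :: "'g \<Rightarrow> complex"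
  assumes a: "integrable \<mu> a" and s: "s \<in> borel_measurable \<mu>" and B: "\<And>x. norm (s x) \<le> B"
  shows "integrable \<mu> (\<lambda>x. a x * s x)" and "norm (\<integral>x. a x * s x \<partial>\<mu>) \<le> N1 a * B"
proof -
  show i: "integrable \<mu> (\<lambda>x. a x * s x)"
  proof (rule Bochner_Integration.integrable_bound)
    show "integrable \<mu> (\<lambda>x. B * norm (a x))" using a by (intro integrable_mult_right integrable_norm)
    show "(\<lambda>x. a x * s x) \<in> borel_measurable \<mu>" using a s by (intro borel_measurable_times) auto
    show "AE x in \<mu>. norm (a x * s x) \<le> norm (B * norm (a x))"
    proof (rule AE_I2)
      fix x
      have "norm (a x * s x) \<le> norm (a x) * B" by (simp add: norm_mult mult_left_mono B)
      also have "\<dots> \<le> norm (B * norm (a x))" by (simp add: mult.commute)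
      finally show "norm (a x * s x) \<le> norm (B * norm (a x))" .
    qed
  qed
  have "norm (\<integral>x. a x * s x \<partial>\<mu>) \<le> (\<integral>x. norm (a x * s x) \<partial>\<mu>)" by (rule integral_norm_bound)
  also have "\<dots> \<le> (\<integral>x. norm (a x) * B \<partial>\<mu>)"
  proof (rule integral_mono)
    show "integrable \<mu> (\<lambda>x. norm (a x * s x))" by (rule integrable_norm[OF i])
    show "integrable \<mu> (\<lambda>x. norm (a x) * B)" by (intro integrable_mult_left integrable_norm a)
  qed (simp add: norm_mult mult_left_mono B)
  finally show "norm (\<integral>x. a x * s x \<partial>\<mu>) \<le> N1 a * B" by simp
qed

lemma bcontfun_meas: "apply_bcontfun S \<in> borel_measurable \<mu>" for S :: "'g \<Rightarrow>\<^sub>C complex"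
  by (rule cont_meas) simp

text \<open>Bilinear, without a conjugate, so that transposes of operators are taken without
  conjugation.\<close>

definition pair :: "('g \<Rightarrow> complex) \<Rightarrow> ('g \<Rightarrow>\<^sub>C complex) \<Rightarrow> complex" where
  "pair a S = (\<integral>x. a x * S x \<partial>\<mu>)"

lemma pair_integrable: "integrable \<mu> a \<Longrightarrow> integrable \<mu> (\<lambda>x. a x * apply_bcontfun S x)"
  for a :: "'g \<Rightarrow> complex"
  by (rule norm_integral_mult_le(1)[OF _ bcontfun_meas norm_bounded])

lemma pair_bound: "integrable \<mu> a \<Longrightarrow> norm (pair a S) \<le> N1 a * norm S"
  unfolding pair_def by (rule norm_integral_mult_le(2)[OF _ bcontfun_meas norm_bounded])

lemma pair_bounded_linear:
  assumes "integrable \<mu> a"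
  shows "bounded_linear (pair a)"
proof (rule bounded_linear_intro)
  fix S T :: "'g \<Rightarrow>\<^sub>C complex" and r :: real
  show "pair a (S + T) = pair a S + pair a T"
    by (simp add: pair_def distrib_left Bochner_Integration.integral_add pair_integrable[OF assms])
  show "pair a (r *\<^sub>R S) = r *\<^sub>R pair a S"
    by (simp add: pair_def)
  show "norm (pair a S) \<le> norm S * N1 a"
    using pair_bound[OF assms, of S] by (simp add: mult.commute)
qed

lemma pair_diff_right: "integrable \<mu> a \<Longrightarrow> pair a (S - T) = pair a S - pair a T"
  and pair_add_right: "integrable \<mu> a \<Longrightarrow> pair a (S + T) = pair a S + pair a T"
  by (simp_all add: linear_diff linear_add bounded_linear.linear[OF pair_bounded_linear])

lemma pair_mulc: "pair a (app (mulc c) S) = c * pair a S"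
  by (simp add: pair_def mult.left_commute)

lemma pair_diff_left:
  "integrable \<mu> a \<Longrightarrow> integrable \<mu> b \<Longrightarrow> pair (\<lambda>x. a x - b x) S = pair a S - pair b S"
  by (simp add: pair_def left_diff_distrib Bochner_Integration.integral_diff pair_integrable)

lemma pair_add_left:
  "integrable \<mu> a \<Longrightarrow> integrable \<mu> b \<Longrightarrow> pair (\<lambda>x. a x + b x) S = pair a S + pair b S"
  by (simp add: pair_def distrib_right Bochner_Integration.integral_add pair_integrable)

lemma pair_scale_left: "pair (\<lambda>x. c * a x) S = c * pair a S"
  by (simp add: pair_def mult.assoc)

lemma continuous_on_mul2 [continuous_intros]: "continuous_on UNIV (\<lambda>y. y \<cdot> g)"
  by (intro continuous_intros)

definition Lop :: "'g \<Rightarrow> 'g cbop" where "Lop g = pullback (\<lambda>p. g \<cdot> p)"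
definition Rop :: "'g \<Rightarrow> 'g cbop" where "Rop g = pullback (\<lambda>p. p \<cdot> g)"

lemma app_Lop [simp]: "app (Lop g) \<phi> p = \<phi> (g \<cdot> p)"
  unfolding Lop_def by (rule app_pullback) (intro continuous_intros)

lemma app_Rop [simp]: "app (Rop g) \<phi> p = \<phi> (p \<cdot> g)"
  unfolding Rop_def by (rule app_pullback) (intro continuous_intros)

lemma norm_Lop: "norm (Lop g) \<le> 1"
  unfolding Lop_def by (rule norm_pullback_le) (intro continuous_intros)

lemma Lop_mult: "Lop g * Lop h = Lop (h \<cdot> g)"
  by (rule cbop_eqI) (simp add: assoc)

lemma Lop_Rop: "Lop g * Rop h = Rop h * Lop g"
  by (rule cbop_eqI) (simp add: assoc)

lemma Lop_mulc: "Lop g * mulc c = mulc c * Lop g"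
  and Rop_mulc: "Rop g * mulc c = mulc c * Rop g"
  by (rule cbop_eqI; simp)+

text \<open>S need not be uniformly continuous. Approximating a in L1 by compactly supported
  functions makes an error that is uniform in y, because S is bounded, and leaves the case of an
  integral over a compact set.\<close>

lemma continuous_on_integral_bcontfun:
  fixes S :: "'g \<Rightarrow>\<^sub>C complex" and h :: "'x::topological_space \<Rightarrow> 'g \<Rightarrow> 'g"
  assumes a: "integrable \<mu> a" and h: "continuous_on UNIV (\<lambda>p. h (fst p) (snd p))"
  shows "continuous_on UNIV (\<lambda>y. \<integral>z. a z * S (h y z) \<partial>\<mu>)"
proof -
  have "\<forall>n. \<exists>k K. continuous_on UNIV k \<and> compact K \<and> (\<forall>x. x \<notin> K \<longrightarrow> k x = 0) \<and>
      N1 (\<lambda>x. a x - k x) < 1 / Suc n"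
    using ccont_dense[OF a] by simp
  from choice[OF this] obtain k where k: "\<forall>n. \<exists>K. continuous_on UNIV (k n) \<and> compact K \<and>
      (\<forall>x. x \<notin> K \<longrightarrow> k n x = 0) \<and> N1 (\<lambda>x. a x - k n x) < 1 / Suc n" by blast
  have sm: "(\<lambda>z. S (h y z)) \<in> borel_measurable \<mu>" for y
  proof (rule cont_meas)
    have "continuous_on UNIV (\<lambda>z. h (fst (y, z)) (snd (y, z)))"
      by (rule continuous_on_compose2[OF h]) (auto intro!: continuous_intros)
    then show "continuous_on UNIV (\<lambda>z. S (h y z))"
      by (intro continuous_on_compose2[OF continuous_on_apply_bcontfun]) auto
  qed
  have ik: "integrable \<mu> (k n)" for n
  proof -
    obtain K where "continuous_on UNIV (k n)" "compact K" "\<forall>x. x \<notin> K \<longrightarrow> k n x = 0"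
      using k by blast
    then show ?thesis by (intro ccont_integrable) auto
  qed
  have ck: "continuous_on UNIV (\<lambda>y. \<integral>z. k n z * S (h y z) \<partial>\<mu>)" for n
  proof -
    obtain K where K: "continuous_on UNIV (k n)" "compact K" "\<forall>x. x \<notin> K \<longrightarrow> k n x = 0"
      using k by blast
    show ?thesis
    proof (rule continuous_on_parametric_integral[OF _ K(2)])
      show "continuous_on UNIV (\<lambda>p. k n (snd p) * S (h (fst p) (snd p)))"
        by (intro continuous_intros continuous_on_compose2[OF K(1)]
            continuous_on_compose2[OF continuous_on_apply_bcontfun h]) auto
    qed (use K(3) in auto)
  qed
  have close: "dist (\<integral>z. k n z * S (h y z) \<partial>\<mu>) (\<integral>z. a z * S (h y z) \<partial>\<mu>) \<le> norm S / Suc n" for n y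
  proof -
    have "(\<integral>z. a z * S (h y z) \<partial>\<mu>) - (\<integral>z. k n z * S (h y z) \<partial>\<mu>) = (\<integral>z. (a z - k n z) * S (h y z) \<partial>\<mu>)"
      using norm_integral_mult_le(1)[OF a sm norm_bounded] norm_integral_mult_le(1)[OF ik sm norm_bounded]
      by (simp add: left_diff_distrib Bochner_Integration.integral_diff)
    then have "dist (\<integral>z. k n z * S (h y z) \<partial>\<mu>) (\<integral>z. a z * S (h y z) \<partial>\<mu>) =
        norm (\<integral>z. (a z - k n z) * S (h y z) \<partial>\<mu>)"
      by (simp add: dist_norm norm_minus_commute)
    also have "\<dots> \<le> N1 (\<lambda>x. a x - k n x) * norm S"
      by (rule norm_integral_mult_le(2)[OF _ sm norm_bounded]) (use a ik in auto)
    also have "\<dots> \<le> (1 / Suc n) * norm S"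
      using k by (intro mult_right_mono) (auto intro: less_imp_le)
    finally show ?thesis by simp
  qed
  have "uniform_limit UNIV (\<lambda>n y. \<integral>z. k n z * S (h y z) \<partial>\<mu>) (\<lambda>y. \<integral>z. a z * S (h y z) \<partial>\<mu>) sequentially"
  proof (rule uniform_limitI)
    fix \<epsilon> :: real assume "\<epsilon> > 0"
    have "(\<lambda>n. norm S / Suc n) \<longlonglongrightarrow> 0"
      using LIMSEQ_Suc[OF lim_const_over_n[of "norm S"]] by simp
    then have "\<forall>\<^sub>F n in sequentially. norm S / Suc n < \<epsilon>"
      using \<open>\<epsilon> > 0\<close> by (rule order_tendstoD(2))
    then show "\<forall>\<^sub>F n in sequentially. \<forall>y\<in>UNIV. dist (\<integral>z. k n z * S (h y z) \<partial>\<mu>) (\<integral>z. a z * S (h y z) \<partial>\<mu>) < \<epsilon>"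
    proof eventually_elim
      case (elim n)
      show ?case using le_less_trans[OF close elim] by simp
    qed
  qed
  then show ?thesis
    by (rule uniform_limit_theorem[rotated]) (auto simp: ck)
qed

text \<open>The transpose, under \<open>pair\<close>, of convolution by b on the right. It commutes
  with left translations.\<close>

definition theta :: "('g \<Rightarrow> complex) \<Rightarrow> 'g cbop" where
  "theta b = cbop_of (\<lambda>S. Bcontfun (\<lambda>y. \<integral>z. b z * S (y \<cdot> z) \<partial>\<mu>))"

lemma translate_bcontfun_meas:
  fixes S :: "'g \<Rightarrow>\<^sub>C complex"
  shows "(\<lambda>z. apply_bcontfun S (y \<cdot> z)) \<in> borel_measurable \<mu>"
    and "(\<lambda>z. apply_bcontfun S (z \<cdot> y)) \<in> borel_measurable \<mu>"
proof -
  show "(\<lambda>z. apply_bcontfun S (y \<cdot> z)) \<in> borel_measurable \<mu>"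
    by (rule cont_meas, rule continuous_on_compose2[OF continuous_on_apply_bcontfun[of UNIV]])
      (intro continuous_intros, simp)
  show "(\<lambda>z. apply_bcontfun S (z \<cdot> y)) \<in> borel_measurable \<mu>"
    by (rule cont_meas, rule continuous_on_compose2[OF continuous_on_apply_bcontfun[of UNIV]])
      (intro continuous_intros, simp)
qed

lemma app_theta:
  assumes b: "integrable \<mu> b"
  shows "app (theta b) S y = (\<integral>z. b z * S (y \<cdot> z) \<partial>\<mu>)"
  unfolding theta_def
proof (rule cbop_from_pointwise(1)[where c = "N1 b"])
  fix S T :: "'g \<Rightarrow>\<^sub>C complex" and y and r :: real
  show "continuous_on UNIV (\<lambda>y. \<integral>z. b z * S (y \<cdot> z) \<partial>\<mu>)"
    by (rule continuous_on_integral_bcontfun[OF b]) (intro continuous_intros)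
  show "norm (\<integral>z. b z * S (y \<cdot> z) \<partial>\<mu>) \<le> N1 b * norm S"
    by (rule norm_integral_mult_le(2)[OF b translate_bcontfun_meas(1) norm_bounded])
  show "(\<integral>z. b z * (S + T) (y \<cdot> z) \<partial>\<mu>) = (\<integral>z. b z * S (y \<cdot> z) \<partial>\<mu>) + (\<integral>z. b z * T (y \<cdot> z) \<partial>\<mu>)"
    using norm_integral_mult_le(1)[OF b translate_bcontfun_meas(1) norm_bounded]
    by (simp add: distrib_left Bochner_Integration.integral_add)
  show "(\<integral>z. b z * (r *\<^sub>R S) (y \<cdot> z) \<partial>\<mu>) = r *\<^sub>R (\<integral>z. b z * S (y \<cdot> z) \<partial>\<mu>)"
    by simp
qed

lemma app_theta_pair: "integrable \<mu> b \<Longrightarrow> app (theta b) S y = pair b (app (Lop y) S)"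
  by (simp add: app_theta pair_def)

lemma theta_Lop: "integrable \<mu> b \<Longrightarrow> theta b * Lop h = Lop h * theta b"
  by (rule cbop_eqI) (simp add: app_theta assoc)

lemma theta_mulc: "integrable \<mu> b \<Longrightarrow> theta b * mulc c = mulc c * theta b"
  by (rule cbop_eqI) (simp only: app_mult app_mulc app_theta mult.left_commute[of "b _" c] integral_mult_right_zero)

text \<open>By density, an identity between bounded bilinear expressions on L1 can be tested on
  continuous functions of compact support, where integrals may be interchanged.\<close>

lemma bilinear_zero:
  fixes D :: "('g \<Rightarrow> complex) \<Rightarrow> ('g \<Rightarrow> complex) \<Rightarrow> complex"
  assumes left: "\<And>a a' b. integrable \<mu> a \<Longrightarrow> integrable \<mu> a' \<Longrightarrow> integrable \<mu> b \<Longrightarrow>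
      D (\<lambda>x. a x - a' x) b = D a b - D a' b"
    and right: "\<And>a b b'. integrable \<mu> a \<Longrightarrow> integrable \<mu> b \<Longrightarrow> integrable \<mu> b' \<Longrightarrow>
      D a (\<lambda>x. b x - b' x) = D a b - D a b'"
    and bound: "\<And>a b. integrable \<mu> a \<Longrightarrow> integrable \<mu> b \<Longrightarrow> norm (D a b) \<le> C * (N1 a * N1 b)"
    and C: "C \<ge> 0"
    and zero: "\<And>k K l L. continuous_on UNIV k \<Longrightarrow> compact K \<Longrightarrow> (\<And>x. x \<notin> K \<Longrightarrow> k x = 0) \<Longrightarrow>
      continuous_on UNIV l \<Longrightarrow> compact L \<Longrightarrow> (\<And>x. x \<notin> L \<Longrightarrow> l x = 0) \<Longrightarrow> D k l = 0"
    and a: "integrable \<mu> a" and b: "integrable \<mu> b"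
  shows "D a b = 0"
proof -
  have "norm (D a b) \<le> \<epsilon>" if "\<epsilon> > 0" for \<epsilon>
  proof -
    \<comment> \<open>Replacing a by k and then b by l costs at most \<delta> C (N1 a + N1 b + 1) =
      \<delta> (Y - 1); the last summand keeps Y positive.\<close>
    define Y where "Y = C * (N1 a + N1 b + 1) + 1"
    define \<delta> where "\<delta> = min 1 (\<epsilon> / Y)"
    have p: "Y > 0"
      unfolding Y_def using C by (intro add_nonneg_pos mult_nonneg_nonneg) auto
    then have \<delta>: "\<delta> > 0" "\<delta> \<le> 1"
      unfolding \<delta>_def using divide_pos_pos[OF that p] by simp_all
    obtain k K where k: "continuous_on UNIV k" "compact K" "\<forall>x. x \<notin> K \<longrightarrow> k x = 0" "N1 (\<lambda>x. a x - k x) < \<delta>"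
      using ccont_dense[OF a \<delta>(1)] by blast
    obtain l L where l: "continuous_on UNIV l" "compact L" "\<forall>x. x \<notin> L \<longrightarrow> l x = 0" "N1 (\<lambda>x. b x - l x) < \<delta>"
      using ccont_dense[OF b \<delta>(1)] by blast
    have ik: "integrable \<mu> k" and il: "integrable \<mu> l"
      using ccont_integrable[OF k(1,2)] ccont_integrable[OF l(1,2)] k(3) l(3) by auto
    have iak: "integrable \<mu> (\<lambda>x. a x - k x)" and ibl: "integrable \<mu> (\<lambda>x. b x - l x)"
      using a b ik il by auto
    have Nk: "N1 k \<le> N1 a + 1"
    proof -
      have "N1 k \<le> (\<integral>x. norm (a x) + norm (a x - k x) \<partial>\<mu>)"
      proof (rule integral_mono)
        fix x
        show "norm (k x) \<le> norm (a x) + norm (a x - k x)"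
          using norm_triangle_ineq4[of "a x" "a x - k x"] by simp
      qed (use a ik iak in auto)
      also have "\<dots> = N1 a + N1 (\<lambda>x. a x - k x)" using a iak by simp
      finally show ?thesis using k(4) \<delta>(2) by simp
    qed
    have "D a b = D (\<lambda>x. a x - k x) b + D k (\<lambda>x. b x - l x) + D k l"
    proof -
      have "x = x - y + (y - z) + z" for x y z :: complex by simp
      then show ?thesis unfolding left[OF a ik b] right[OF ik b il] .
    qed
    also have "D k l = 0" by (rule zero[OF k(1,2) _ l(1,2)]) (use k(3) l(3) in auto)
    finally have eq: "D a b = D (\<lambda>x. a x - k x) b + D k (\<lambda>x. b x - l x)"
      unfolding add_0_right .
    have "norm (D a b) \<le> norm (D (\<lambda>x. a x - k x) b) + norm (D k (\<lambda>x. b x - l x))"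
      unfolding eq by (rule norm_triangle_ineq)
    also have "\<dots> \<le> C * (N1 (\<lambda>x. a x - k x) * N1 b) + C * (N1 k * N1 (\<lambda>x. b x - l x))"
      by (rule add_mono[OF bound[OF iak b] bound[OF ik ibl]])
    also have "\<dots> \<le> C * (\<delta> * N1 b) + C * ((N1 a + 1) * \<delta>)"
    proof -
      have e1: "N1 (\<lambda>x. a x - k x) * N1 b \<le> \<delta> * N1 b"
        by (rule mult_right_mono[OF less_imp_le[OF k(4)] N1_nonneg])
      have e2: "N1 k * N1 (\<lambda>x. b x - l x) \<le> (N1 a + 1) * \<delta>"
        by (rule mult_mono[OF Nk less_imp_le[OF l(4)]]) simp_all
      show ?thesis by (rule add_mono[OF mult_left_mono[OF e1 C] mult_left_mono[OF e2 C]])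
    qed
    also have "\<dots> = \<delta> * (Y - 1)" by (simp add: Y_def algebra_simps)
    also have "\<dots> \<le> \<delta> * Y" by (rule mult_left_mono) (use \<delta>(1) in linarith)+
    also have "\<dots> \<le> (\<epsilon> / Y) * Y"
      by (rule mult_right_mono[OF _ less_imp_le[OF p]]) (simp only: \<delta>_def min.cobounded2)
    also have "\<dots> = \<epsilon>" using less_imp_neq[OF p] by (simp only: nonzero_divide_eq_eq[symmetric] times_divide_eq_left) simp
    finally show ?thesis .
  qed
  then have "norm (D a b) \<le> 0 + \<epsilon>" if "\<epsilon> > 0" for \<epsilon> using that unfolding add_0_left .
  then have "norm (D a b) \<le> 0" by (rule field_le_epsilon)
  then show ?thesis unfolding norm_le_zero_iff .
qed

lemma N1_diff_AE: "AE x in \<mu>. f x = g x \<Longrightarrow> f \<in> borel_measurable \<mu> \<Longrightarrow> g \<in> borel_measurable \<mu> \<Longrightarrow>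
    pair f S = pair g S"
  unfolding pair_def using bcontfun_meas[of S]
  by (intro integral_cong_AE borel_measurable_times) (simp_all, auto elim: eventually_mono)

lemma pair_conv_bounds:
  assumes "integrable \<mu> a" "integrable \<mu> b"
  shows "norm (pair (conv a b) S) \<le> norm S * (N1 a * N1 b)"
proof -
  have "norm (pair (conv a b) S) \<le> N1 (conv a b) * norm S"
    by (rule pair_bound[OF conv_integrable[OF assms]])
  also have "\<dots> \<le> (N1 a * N1 b) * norm S" by (intro mult_right_mono conv_norm assms) auto
  finally show ?thesis by (simp add: mult.commute)
qed

lemma pair_conv_left:
  assumes "integrable \<mu> a" "integrable \<mu> a'" "integrable \<mu> b"
  shows "pair (conv (\<lambda>x. a x - a' x) b) S = pair (conv a b) S - pair (conv a' b) S"
proof -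
  have i: "integrable \<mu> (\<lambda>x. a x - a' x)" using assms by simp
  have "pair (conv (\<lambda>x. a x - a' x) b) S = pair (\<lambda>x. conv a b x - conv a' b x) S"
    using conv_diff_left[OF assms] conv_integrable[OF i assms(3)] conv_integrable[OF assms(1,3)] conv_integrable[OF assms(2,3)]
    by (intro N1_diff_AE) auto
  then show ?thesis using pair_diff_left conv_integrable assms by simp
qed

lemma pair_conv_right:
  assumes "integrable \<mu> a" "integrable \<mu> b" "integrable \<mu> b'"
  shows "pair (conv a (\<lambda>x. b x - b' x)) S = pair (conv a b) S - pair (conv a b') S"
proof -
  have i: "integrable \<mu> (\<lambda>x. b x - b' x)" using assms by simp
  have "pair (conv a (\<lambda>x. b x - b' x)) S = pair (\<lambda>x. conv a b x - conv a b' x) S"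
    using conv_diff_right[OF assms] conv_integrable[OF assms(1) i] conv_integrable[OF assms(1,2)] conv_integrable[OF assms(1,3)]
    by (intro N1_diff_AE) auto
  then show ?thesis using pair_diff_left conv_integrable assms by simp
qed

lemma theta_diff: "integrable \<mu> b \<Longrightarrow> integrable \<mu> b' \<Longrightarrow>
    app (theta (\<lambda>x. b x - b' x)) S = app (theta b) S - app (theta b') S"
  by (rule bcontfun_eqI) (simp add: app_theta_pair pair_diff_left)

lemma norm_theta: "integrable \<mu> b \<Longrightarrow> norm (app (theta b) S) \<le> N1 b * norm S"
  by (rule norm_bound) (simp add: app_theta norm_integral_mult_le(2)[OF _ translate_bcontfun_meas(1) norm_bounded])

lemma pair_conv_theta:
  assumes a: "integrable \<mu> a" and b: "integrable \<mu> b"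
  shows "pair (conv a b) S = pair a (app (theta b) S)"
proof -
  define D where "D a b = pair (conv a b) S - pair a (app (theta b) S)" for a b :: "'g \<Rightarrow> complex"
  have "D a b = 0"
  proof (rule bilinear_zero[where C = "2 * norm S", OF _ _ _ _ _ a b])
    fix a b :: "'g \<Rightarrow> complex" assume ab: "integrable \<mu> a" "integrable \<mu> b"
    have "norm (pair a (app (theta b) S)) \<le> N1 a * (N1 b * norm S)"
      using pair_bound[OF ab(1), of "app (theta b) S"] mult_left_mono[OF norm_theta[OF ab(2), of S], of "N1 a"]
      by simp
    then show "norm (D a b) \<le> 2 * norm S * (N1 a * N1 b)"
      using pair_conv_bounds[OF ab, of S] norm_triangle_ineq4[of "pair (conv a b) S" "pair a (app (theta b) S)"]
      by (simp add: D_def mult_ac)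
  next
    fix a a' b :: "'g \<Rightarrow> complex" assume ab: "integrable \<mu> a" "integrable \<mu> a'" "integrable \<mu> b"
    show "D (\<lambda>x. a x - a' x) b = D a b - D a' b"
      by (simp add: D_def pair_conv_left[OF ab] pair_diff_left ab)
  next
    fix a b b' :: "'g \<Rightarrow> complex" assume ab: "integrable \<mu> a" "integrable \<mu> b" "integrable \<mu> b'"
    show "D a (\<lambda>x. b x - b' x) = D a b - D a b'"
      by (simp add: D_def pair_conv_right[OF ab] theta_diff ab
          pair_diff_right[OF ab(1)])
  next
    fix k l :: "'g \<Rightarrow> complex" and K L
    assume kl: "continuous_on UNIV k" "compact K" "\<And>x. x \<notin> K \<Longrightarrow> k x = 0"
      "continuous_on UNIV l" "compact L" "\<And>x. x \<notin> L \<Longrightarrow> l x = 0"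
    have il: "integrable \<mu> l" by (rule ccont_integrable[OF kl(4-6)])
    show "D k l = 0"
      using integral_conv_ccont(1)[OF kl, of "apply_bcontfun S"] il
      by (simp add: D_def pair_def convolution_def app_theta)
  qed simp
  then show ?thesis by (simp add: D_def)
qed

text \<open>This brings in the right translates of S, where \<open>app_theta_pair\<close> brings in
  the left ones. Both are wanted for annihilators to be two-sided ideals.\<close>

lemma pair_theta_swap:
  assumes a: "integrable \<mu> a" and b: "integrable \<mu> b"
  shows "pair a (app (theta b) S) = (\<integral>z. b z * pair a (app (Rop z) S) \<partial>\<mu>)"
proof -
  have cR: "continuous_on UNIV (\<lambda>z. pair a (app (Rop z) S))" if "integrable \<mu> a" for a :: "'g \<Rightarrow> complex"
  proof -
    have "continuous_on UNIV (\<lambda>z. \<integral>y. a y * S (y \<cdot> z) \<partial>\<mu>)"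
      by (rule continuous_on_integral_bcontfun[OF that]) (intro continuous_intros)
    then show ?thesis by (simp add: pair_def)
  qed
  have nR: "norm (pair a (app (Rop z) S)) \<le> N1 a * norm S" if "integrable \<mu> a" for a :: "'g \<Rightarrow> complex" and z
    using norm_integral_mult_le(2)[OF that translate_bcontfun_meas(2) norm_bounded, of S z]
    by (simp add: pair_def)
  have iR: "integrable \<mu> (\<lambda>z. b z * pair a (app (Rop z) S))" if "integrable \<mu> a" "integrable \<mu> b" for a b :: "'g \<Rightarrow> complex"
    by (rule norm_integral_mult_le(1)[OF that(2) cont_meas[OF cR[OF that(1)]] nR[OF that(1)]])
  define D where "D a b = pair a (app (theta b) S) - (\<integral>z. b z * pair a (app (Rop z) S) \<partial>\<mu>)" for a b :: "'g \<Rightarrow> complex"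
  have "D a b = 0"
  proof (rule bilinear_zero[where C = "2 * norm S", OF _ _ _ _ _ a b])
    fix a b :: "'g \<Rightarrow> complex" assume ab: "integrable \<mu> a" "integrable \<mu> b"
    have 1: "norm (pair a (app (theta b) S)) \<le> N1 a * (N1 b * norm S)"
      using pair_bound[OF ab(1), of "app (theta b) S"] mult_left_mono[OF norm_theta[OF ab(2), of S], of "N1 a"]
      by simp
    have 2: "norm (\<integral>z. b z * pair a (app (Rop z) S) \<partial>\<mu>) \<le> N1 b * (N1 a * norm S)"
      by (rule norm_integral_mult_le(2)[OF ab(2) cont_meas[OF cR[OF ab(1)]] nR[OF ab(1)]])
    show "norm (D a b) \<le> 2 * norm S * (N1 a * N1 b)"
      using 1 2 norm_triangle_ineq4[of "pair a (app (theta b) S)" "\<integral>z. b z * pair a (app (Rop z) S) \<partial>\<mu>"]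
      by (simp add: D_def mult_ac)
  next
    fix a a' b :: "'g \<Rightarrow> complex" assume ab: "integrable \<mu> a" "integrable \<mu> a'" "integrable \<mu> b"
    show "D (\<lambda>x. a x - a' x) b = D a b - D a' b"
      using iR[OF ab(1,3)] iR[OF ab(2,3)]
      by (simp add: D_def pair_diff_left ab right_diff_distrib Bochner_Integration.integral_diff)
  next
    fix a b b' :: "'g \<Rightarrow> complex" assume ab: "integrable \<mu> a" "integrable \<mu> b" "integrable \<mu> b'"
    show "D a (\<lambda>x. b x - b' x) = D a b - D a b'"
      using iR[OF ab(1,2)] iR[OF ab(1,3)]
      by (simp add: D_def theta_diff ab left_diff_distrib Bochner_Integration.integral_diff
          pair_diff_right[OF ab(1)])
  next
    fix k l :: "'g \<Rightarrow> complex" and K L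
    assume kl: "continuous_on UNIV k" "compact K" "\<And>x. x \<notin> K \<Longrightarrow> k x = 0"
      "continuous_on UNIV l" "compact L" "\<And>x. x \<notin> L \<Longrightarrow> l x = 0"
    have il: "integrable \<mu> l" by (rule ccont_integrable[OF kl(4-6)])
    have "(\<integral>y. \<integral>z. k y * l z * S (y \<cdot> z) \<partial>\<mu> \<partial>\<mu>) = (\<integral>z. \<integral>y. k y * l z * S (y \<cdot> z) \<partial>\<mu> \<partial>\<mu>)"
    proof (rule fubini_ccont[OF _ kl(2,5)])
      show "continuous_on UNIV (\<lambda>p. k (fst p) * l (snd p) * S (fst p \<cdot> snd p))"
        by (intro continuous_intros continuous_on_compose2[OF kl(1)] continuous_on_compose2[OF kl(4)]
            continuous_on_compose2[OF continuous_on_apply_bcontfun]) auto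
    qed (use kl(3,6) in auto)
    then show "D k l = 0"
    proof -
      assume eq: "(\<integral>y. \<integral>z. k y * l z * S (y \<cdot> z) \<partial>\<mu> \<partial>\<mu>) = (\<integral>z. \<integral>y. k y * l z * S (y \<cdot> z) \<partial>\<mu> \<partial>\<mu>)"
      have "pair k (app (theta l) S) = (\<integral>y. \<integral>z. k y * l z * S (y \<cdot> z) \<partial>\<mu> \<partial>\<mu>)"
        using il by (simp add: pair_def app_theta mult.assoc)
      moreover have "k y * l z * S (y \<cdot> z) = l z * (k y * S (y \<cdot> z))" for y z by simp
      ultimately show ?thesis unfolding D_def eq by (simp add: pair_def)
    qed
  qed simp
  then show ?thesis by (simp add: D_def)
qed


text \<open>Such a T is its own transpose, and one constant c bounds it in the supremum norm and in
  L1. A series with summable constants then converges in both senses at once.\<close>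

definition sym1 :: "'g cbop \<Rightarrow> real \<Rightarrow> bool" where
  "sym1 T c \<longleftrightarrow> norm T \<le> c \<and> (\<forall>k. integrable \<mu> (apply_bcontfun k) \<longrightarrow>
     integrable \<mu> (apply_bcontfun (app T k)) \<and> N1 (app T k) \<le> c * N1 k \<and>
     (\<forall>l. pair (app T k) l = pair k (app T l)))"

lemma sym1D:
  assumes "sym1 T c"
  shows "norm T \<le> c"
    and "integrable \<mu> (apply_bcontfun k) \<Longrightarrow> integrable \<mu> (apply_bcontfun (app T k))"
    and "integrable \<mu> (apply_bcontfun k) \<Longrightarrow> N1 (app T k) \<le> c * N1 k"
    and "integrable \<mu> (apply_bcontfun k) \<Longrightarrow> pair (app T k) l = pair k (app T l)"
    and "0 \<le> c"
  using assms order_trans[OF norm_ge_zero, of T c] unfolding sym1_def by auto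

lemma sym1_mult:
  assumes S: "sym1 S c" and T: "sym1 T d" and ST: "S * T = T * S"
  shows "sym1 (S * T) (c * d)"
  unfolding sym1_def
proof (intro conjI allI impI)
  show "norm (S * T) \<le> c * d"
    using norm_mult_ineq[of S T] mult_mono[OF sym1D(1)[OF S] sym1D(1)[OF T] sym1D(5)[OF S] norm_ge_zero]
    by linarith
  fix k :: "'g \<Rightarrow>\<^sub>C complex" assume k: "integrable \<mu> (apply_bcontfun k)"
  have Tk: "integrable \<mu> (apply_bcontfun (app T k))" by (rule sym1D(2)[OF T k])
  show "integrable \<mu> (apply_bcontfun (app (S * T) k))" using sym1D(2)[OF S Tk] by simp
  have "N1 (app (S * T) k) \<le> c * N1 (app T k)" using sym1D(3)[OF S Tk] by simp
  also have "\<dots> \<le> c * (d * N1 k)" by (intro mult_left_mono sym1D(3)[OF T k] sym1D(5)[OF S])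
  finally show "N1 (app (S * T) k) \<le> c * d * N1 k" by (simp add: mult.assoc)
  fix l
  have "pair (app (S * T) k) l = pair k (app T (app S l))"
    using sym1D(4)[OF S Tk] sym1D(4)[OF T k] by simp
  \<comment> \<open>Transposition reverses products; commutativity restores the order.\<close>
  then show "pair (app (S * T) k) l = pair k (app (S * T) l)" by (simp add: ST)
qed

lemma sym1_one: "sym1 1 1"
  by (simp add: sym1_def)

lemma sym1_power: "sym1 T c \<Longrightarrow> sym1 (T ^ n) (c ^ n)"
proof (induction n)
  case 0
  show ?case using sym1_one by simp
next
  case (Suc n)
  then show ?case using sym1_mult[OF Suc(2) Suc(1)[OF Suc(2)]] by (simp add: power_commutes)
qed

lemma sym1_scaleR:
  assumes T: "sym1 T c" shows "sym1 (r *\<^sub>R T) (\<bar>r\<bar> * c)"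
  unfolding sym1_def
proof (intro conjI allI impI)
  show "norm (r *\<^sub>R T) \<le> \<bar>r\<bar> * c" using sym1D(1)[OF T] by (simp add: mult_left_mono)
  fix k :: "'g \<Rightarrow>\<^sub>C complex" assume k: "integrable \<mu> (apply_bcontfun k)"
  have e: "apply_bcontfun (app (r *\<^sub>R T) k) = (\<lambda>x. of_real r * app T k x)"
    by (rule ext) (simp only: app.scaleR_left apply_bcontfun_simps, simp only: scaleR_conv_of_real)
  show "integrable \<mu> (apply_bcontfun (app (r *\<^sub>R T) k))"
    unfolding e by (intro integrable_mult_right sym1D(2)[OF T k])
  have "N1 (app (r *\<^sub>R T) k) = \<bar>r\<bar> * N1 (app T k)" unfolding e by (simp add: norm_mult)
  also have "\<dots> \<le> \<bar>r\<bar> * (c * N1 k)" by (intro mult_left_mono sym1D(3)[OF T k]) auto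
  finally show "N1 (app (r *\<^sub>R T) k) \<le> \<bar>r\<bar> * c * N1 k" by (simp add: mult.assoc)
  fix l
  have e': "app (r *\<^sub>R T) l = app (mulc (of_real r)) (app T l)"
    by (rule bcontfun_eqI)
      (simp only: app_mulc app.scaleR_left apply_bcontfun_simps, simp only: scaleR_conv_of_real)
  show "pair (app (r *\<^sub>R T) k) l = pair k (app (r *\<^sub>R T) l)"
    unfolding e e' pair_scale_left pair_mulc sym1D(4)[OF T k] ..
qed

lemma sym1_add:
  assumes S: "sym1 S c" and T: "sym1 T d" shows "sym1 (S + T) (c + d)"
  unfolding sym1_def
proof (intro conjI allI impI)
  show "norm (S + T) \<le> c + d" by (intro norm_triangle_le add_mono sym1D(1)[OF S] sym1D(1)[OF T])
  fix k :: "'g \<Rightarrow>\<^sub>C complex" assume k: "integrable \<mu> (apply_bcontfun k)"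
  have e: "apply_bcontfun (app (S + T) k) = (\<lambda>x. app S k x + app T k x)"
    by (rule ext) (simp add: app.add_left)
  note iS = sym1D(2)[OF S k] and iT = sym1D(2)[OF T k]
  show "integrable \<mu> (apply_bcontfun (app (S + T) k))"
    unfolding e by (intro Bochner_Integration.integrable_add iS iT)
  have "N1 (app (S + T) k) \<le> (\<integral>x. norm (app S k x) + norm (app T k x) \<partial>\<mu>)"
    unfolding e using iS iT by (intro integral_mono) (auto simp: norm_triangle_ineq)
  also have "\<dots> = N1 (app S k) + N1 (app T k)" using iS iT by simp
  also have "\<dots> \<le> c * N1 k + d * N1 k" by (intro add_mono sym1D(3)[OF S k] sym1D(3)[OF T k])
  finally show "N1 (app (S + T) k) \<le> (c + d) * N1 k" by (simp add: distrib_right)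
  fix l
  show "pair (app (S + T) k) l = pair k (app (S + T) l)"
  proof -
    have "pair (app (S + T) k) l = pair k (app S l) + pair k (app T l)"
      unfolding e pair_add_left[OF iS iT] sym1D(4)[OF S k] sym1D(4)[OF T k] ..
    then show ?thesis unfolding app.add_left pair_add_right[OF k] .
  qed
qed

lemma sym1_sum: "finite A \<Longrightarrow> (\<And>i. i \<in> A \<Longrightarrow> sym1 (T i) (c i)) \<Longrightarrow> sym1 (sum T A) (sum c A)"
proof (induction A rule: finite_induct)
  case empty
  show ?case using sym1_scaleR[OF sym1_one, of 0] by simp
qed (simp add: sym1_add)

text \<open>Evaluation at a point, the L1 norm and the pairing are each taken through the sum, with
  the summable c as dominating series in every case.\<close>

lemma sym1_suminf:
  fixes T :: "nat \<Rightarrow> 'g cbop"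
  assumes T: "\<And>n. sym1 (T n) (c n)" and c: "summable c"
  shows "sym1 (suminf T) (suminf c)"
  unfolding sym1_def
proof (intro conjI allI impI)
  show "norm (suminf T) \<le> suminf c" by (rule norm_suminf_le[OF sym1D(1)[OF T] c])
  have sT: "summable T" by (rule summable_comparison_test'[OF c]) (use sym1D(1)[OF T] in auto)
  have app_sum: "(\<lambda>n. app (T n) \<phi>) sums app (suminf T) \<phi>" for \<phi>
    by (rule bounded_linear.sums[OF app.bounded_linear_left summable_sums[OF sT]])
  have pt: "(\<lambda>n. app (T n) \<phi> x) sums app (suminf T) \<phi> x" for \<phi> x
    by (rule bounded_linear.sums[OF bounded_linear_apply_bcontfun app_sum])
  have pt_abs: "summable (\<lambda>n. norm (app (T n) \<phi> x))" for \<phi> x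
  proof (rule summable_comparison_test'[where N=0])
    show "summable (\<lambda>n. c n * norm \<phi>)" by (intro summable_mult2 c)
    fix n
    have "norm (app (T n) \<phi> x) \<le> norm (app (T n) \<phi>)" by (rule norm_bounded)
    also have "\<dots> \<le> norm (T n) * norm \<phi>" by (rule norm_app)
    also have "\<dots> \<le> c n * norm \<phi>" by (intro mult_right_mono sym1D(1)[OF T]) auto
    finally show "norm (norm (app (T n) \<phi> x)) \<le> c n * norm \<phi>" by simp
  qed
  fix k :: "'g \<Rightarrow>\<^sub>C complex" assume k: "integrable \<mu> (apply_bcontfun k)"
  have iT: "integrable \<mu> (apply_bcontfun (app (T n) k))" for n by (rule sym1D(2)[OF T k])
  have sN: "summable (\<lambda>n. N1 (app (T n) k))"
    by (rule summable_comparison_test'[OF summable_mult2[OF c, of "N1 k"], of 0])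
      (simp add: sym1D(3)[OF T k])
  have eq: "apply_bcontfun (app (suminf T) k) = (\<lambda>x. \<Sum>n. app (T n) k x)"
    using pt by (simp add: fun_eq_iff sums_iff)
  show i: "integrable \<mu> (apply_bcontfun (app (suminf T) k))"
    unfolding eq by (rule integrable_suminf[OF iT _ sN]) (simp add: pt_abs)
  have "N1 (app (suminf T) k) \<le> (\<integral>x. (\<Sum>n. norm (app (T n) k x)) \<partial>\<mu>)"
  proof (rule integral_mono)
    show "integrable \<mu> (\<lambda>x. norm (app (suminf T) k x))" using i by simp
    show "integrable \<mu> (\<lambda>x. \<Sum>n. norm (app (T n) k x))"
      by (rule integrable_suminf) (use iT pt_abs sN in auto)
    show "norm (app (suminf T) k x) \<le> (\<Sum>n. norm (app (T n) k x))" for x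
      unfolding eq by (rule summable_norm[OF pt_abs])
  qed
  also have "\<dots> = (\<Sum>n. N1 (app (T n) k))"
    by (rule integral_suminf) (use iT pt_abs sN in auto)
  also have "\<dots> \<le> (\<Sum>n. c n * N1 k)"
    by (intro suminf_le sN summable_mult2 c sym1D(3)[OF T k])
  also have "\<dots> = suminf c * N1 k" by (rule suminf_mult2[OF c, symmetric])
  finally show "N1 (app (suminf T) k) \<le> suminf c * N1 k" .
  fix l
  have "(\<lambda>n. pair k (app (T n) l)) sums pair k (app (suminf T) l)"
    by (rule bounded_linear.sums[OF pair_bounded_linear[OF k] app_sum])
  moreover have "(\<lambda>n. pair (app (T n) k) l) sums pair (app (suminf T) k) l"
  proof -
    have s1: "(\<lambda>n. app (T n) k x * l x) sums (app (suminf T) k x * l x)" for x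
      by (rule sums_mult2[OF pt])
    have s2: "summable (\<lambda>n. norm (app (T n) k x * l x))" for x
      unfolding norm_mult by (rule summable_mult2[OF pt_abs])
    have s3: "integrable \<mu> (\<lambda>x. app (T n) k x * l x)" for n by (rule pair_integrable[OF iT])
    have s4: "summable (\<lambda>n. \<integral>x. norm (app (T n) k x * l x) \<partial>\<mu>)"
    proof (rule summable_comparison_test'[OF summable_mult2[OF sN, of "norm l"], of 0])
      fix n
      have "(\<integral>x. norm (app (T n) k x * l x) \<partial>\<mu>) \<le> (\<integral>x. norm (app (T n) k x) * norm l \<partial>\<mu>)"
        using s3 iT by (intro integral_mono integrable_norm integrable_mult_left)
          (auto simp: norm_mult mult_left_mono norm_bounded)
      then show "norm (\<integral>x. norm (app (T n) k x * l x) \<partial>\<mu>) \<le> N1 (app (T n) k) * norm l"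
        by (simp add: integral_nonneg_AE)
    qed
    have "(\<lambda>n. \<integral>x. app (T n) k x * l x \<partial>\<mu>) sums (\<integral>x. (\<Sum>n. app (T n) k x * l x) \<partial>\<mu>)"
      by (rule sums_integral[OF s3 _ s4]) (simp add: s2)
    then show ?thesis using s1 by (simp add: pair_def sums_iff)
  qed
  ultimately show "pair (app (suminf T) k) l = pair k (app (suminf T) l)"
    using sym1D(4)[OF T k] sums_unique2 by simp
qed

lemma sym1_exp:
  assumes "sym1 A c" shows "sym1 (exp A) (exp c)"
proof -
  have "sym1 (A ^ n /\<^sub>R fact n) (c ^ n /\<^sub>R fact n)" for n
    using sym1_scaleR[OF sym1_power[OF assms], of "inverse (fact n)" n] by simp
  then show ?thesis
    unfolding exp_def by (rule sym1_suminf) (rule summable_exp_generic)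
qed

lemma sym1_mulc: "sym1 (mulc c) (norm c)"
  unfolding sym1_def
proof (intro conjI allI impI)
  show "norm (mulc c :: 'g cbop) \<le> norm c" by (rule norm_mulc_le)
  fix k :: "'g \<Rightarrow>\<^sub>C complex" assume k: "integrable \<mu> (apply_bcontfun k)"
  have e: "apply_bcontfun (app (mulc c) k) = (\<lambda>x. c * k x)" by (rule ext) simp
  show "integrable \<mu> (apply_bcontfun (app (mulc c) k))" unfolding e by (intro integrable_mult_right k)
  show "N1 (app (mulc c) k) \<le> norm c * N1 k" unfolding e by (simp add: norm_mult)
  show "pair (app (mulc c) k) l = pair k (app (mulc c) l)" for l
    unfolding e pair_mulc pair_scale_left ..
qed

lemma pair_Lop:
  assumes k: "integrable \<mu> (apply_bcontfun k)"
  shows "integrable \<mu> (apply_bcontfun (app (Lop y) k))" "N1 (app (Lop y) k) = N1 k"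
    "pair (app (Lop y) k) l = pair k (app (Lop (ginv y)) l)"
proof -
  have e: "apply_bcontfun (app (Lop y) k) = (\<lambda>x. k (y \<cdot> x))" by (rule ext) simp
  show "integrable \<mu> (apply_bcontfun (app (Lop y) k))" unfolding e by (rule integrable_translate[OF k])
  show "N1 (app (Lop y) k) = N1 k"
    unfolding e by (rule integral_translate) (use k in auto)
  have "(\<lambda>x. k x * l (ginv y \<cdot> x)) \<in> borel_measurable \<mu>"
    by (intro borel_measurable_times bcontfun_meas translate_bcontfun_meas)
  from integral_translate[OF this, of y] show "pair (app (Lop y) k) l = pair k (app (Lop (ginv y)) l)"
    by (simp add: pair_def)
qed

section \<open>Continuous functions vanishing at infinity\<close>

definition c0 :: "('g \<Rightarrow>\<^sub>C complex) \<Rightarrow> bool" where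
  "c0 \<phi> \<longleftrightarrow> (\<forall>\<epsilon>>0. \<exists>C. compact C \<and> (\<forall>p. p \<notin> C \<longrightarrow> norm (\<phi> p) \<le> \<epsilon>))"

lemma c0_limit:
  assumes "\<And>\<epsilon>. \<epsilon> > 0 \<Longrightarrow> \<exists>\<psi>. c0 \<psi> \<and> norm (\<phi> - \<psi>) \<le> \<epsilon>"
  shows "c0 \<phi>"
  unfolding c0_def
proof (intro allI impI)
  fix \<epsilon> :: real assume "\<epsilon> > 0"
  then have e: "\<epsilon> / 2 > 0" by simp
  obtain \<psi> where \<psi>: "c0 \<psi>" "norm (\<phi> - \<psi>) \<le> \<epsilon> / 2" using assms[OF e] by blast
  obtain C where C: "compact C" "\<And>p. p \<notin> C \<Longrightarrow> norm (\<psi> p) \<le> \<epsilon> / 2" using \<psi>(1) e unfolding c0_def by blast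
  have "norm (\<phi> p) \<le> \<epsilon>" if "p \<notin> C" for p
    using C(2)[OF that] \<psi>(2) norm_bounded[of "\<phi> - \<psi>" p] norm_triangle_ineq[of "\<phi> p - \<psi> p" "\<psi> p"] by simp
  then show "\<exists>C. compact C \<and> (\<forall>p. p \<notin> C \<longrightarrow> norm (\<phi> p) \<le> \<epsilon>)" using C(1) by blast
qed

lemma c0_add: assumes "c0 \<phi>" "c0 \<psi>" shows "c0 (\<phi> + \<psi>)"
  unfolding c0_def
proof (intro allI impI)
  fix \<epsilon> :: real assume "\<epsilon> > 0"
  then have e: "\<epsilon> / 2 > 0" by simp
  obtain C where C: "compact C" "\<And>p. p \<notin> C \<Longrightarrow> norm (\<phi> p) \<le> \<epsilon> / 2" using assms(1) e unfolding c0_def by blast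
  obtain D where D: "compact D" "\<And>p. p \<notin> D \<Longrightarrow> norm (\<psi> p) \<le> \<epsilon> / 2" using assms(2) e unfolding c0_def by blast
  have "norm ((\<phi> + \<psi>) p) \<le> \<epsilon>" if "p \<notin> C \<union> D" for p
    using C(2)[of p] D(2)[of p] that norm_triangle_ineq[of "\<phi> p" "\<psi> p"] by simp
  then show "\<exists>C. compact C \<and> (\<forall>p. p \<notin> C \<longrightarrow> norm ((\<phi> + \<psi>) p) \<le> \<epsilon>)"
    using compact_Un[OF C(1) D(1)] by blast
qed

lemma c0_mulc: assumes "c0 \<phi>" shows "c0 (app (mulc c) \<phi>)"
  unfolding c0_def
proof (intro allI impI)
  fix \<epsilon> :: real assume "\<epsilon> > 0"
  then have e: "\<epsilon> / (norm c + 1) > 0" by (simp add: add_nonneg_pos)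
  obtain C where C: "compact C" "\<And>p. p \<notin> C \<Longrightarrow> norm (\<phi> p) \<le> \<epsilon> / (norm c + 1)" using assms(1) e unfolding c0_def by blast
  have "norm (app (mulc c) \<phi> p) \<le> \<epsilon>" if "p \<notin> C" for p
  proof -
    have "norm (app (mulc c) \<phi> p) \<le> (norm c + 1) * norm (\<phi> p)" by (simp add: norm_mult distrib_right)
    also have "\<dots> \<le> (norm c + 1) * (\<epsilon> / (norm c + 1))" by (intro mult_left_mono C(2) that) simp
    also have "\<dots> = \<epsilon>" using norm_ge_zero[of c] by (simp add: add_nonneg_eq_0_iff)
    finally show ?thesis .
  qed
  then show "\<exists>C. compact C \<and> (\<forall>p. p \<notin> C \<longrightarrow> norm (app (mulc c) \<phi> p) \<le> \<epsilon>)" using C(1) by blast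
qed

lemma c0_scaleR: assumes "c0 \<phi>" shows "c0 (r *\<^sub>R \<phi>)"
proof -
  have "r *\<^sub>R \<phi> = app (mulc (of_real r)) \<phi>"
    by (rule bcontfun_eqI) (simp only: app_mulc apply_bcontfun_simps scaleR_conv_of_real)
  then show ?thesis using c0_mulc[OF assms] by simp
qed

lemma c0_zero: "c0 0"
  unfolding c0_def by (auto intro!: exI[of _ "{}"])

lemma c0_Lop: assumes "c0 \<phi>" shows "c0 (app (Lop y) \<phi>)"
  unfolding c0_def
proof (intro allI impI)
  fix \<epsilon> :: real assume "\<epsilon> > 0"
  then obtain C where C: "compact C" "\<And>p. p \<notin> C \<Longrightarrow> norm (\<phi> p) \<le> \<epsilon>" using assms(1) unfolding c0_def by blast
  have "compact (gmul (ginv y) ` C)" by (intro compact_continuous_image C continuous_intros)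
  moreover have "norm (app (Lop y) \<phi> p) \<le> \<epsilon>" if "p \<notin> gmul (ginv y) ` C" for p
  proof -
    have "y \<cdot> p \<notin> C"
    proof
      assume "y \<cdot> p \<in> C"
      then have "ginv y \<cdot> (y \<cdot> p) \<in> gmul (ginv y) ` C" by blast
      with that show False by simp
    qed
    then show ?thesis using C(2) by simp
  qed
  ultimately show "\<exists>C. compact C \<and> (\<forall>p. p \<notin> C \<longrightarrow> norm (app (Lop y) \<phi> p) \<le> \<epsilon>)" by blast
qed

lemma c0_sums:
  fixes f :: "nat \<Rightarrow> 'g \<Rightarrow>\<^sub>C complex"
  assumes "f \<longlonglongrightarrow> \<phi>" "\<And>n. c0 (f n)"
  shows "c0 \<phi>"
proof (rule c0_limit)
  fix \<epsilon> :: real assume "\<epsilon> > 0"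
  then obtain n where "dist (f n) \<phi> < \<epsilon>" using assms(1) unfolding lim_sequentially by blast
  then show "\<exists>\<psi>. c0 \<psi> \<and> norm (\<phi> - \<psi>) \<le> \<epsilon>"
    using assms(2) by (intro exI[of _ "f n"]) (simp add: dist_norm norm_minus_commute)
qed

definition c0ops :: "'g cbop set" where "c0ops = {T. \<forall>\<phi>. c0 \<phi> \<longrightarrow> c0 (app T \<phi>)}"

lemma closed_subalg_c0ops: "closed_subalg c0ops"
  unfolding closed_subalg_def
proof (intro conjI ballI allI)
  show "closed c0ops"
    unfolding closed_sequential_limits
  proof (intro allI impI, elim conjE)
    fix T :: "nat \<Rightarrow> 'g cbop" and S assume T: "\<forall>n. T n \<in> c0ops" "T \<longlonglongrightarrow> S"
    have "c0 (app S \<phi>)" if "c0 \<phi>" for \<phi>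
    proof (rule c0_sums)
      show "(\<lambda>n. app (T n) \<phi>) \<longlonglongrightarrow> app S \<phi>" using T(2) by (intro app.tendsto tendsto_const)
      show "c0 (app (T n) \<phi>)" for n using T(1) that by (simp add: c0ops_def)
    qed
    then show "S \<in> c0ops" by (simp add: c0ops_def)
  qed
qed (auto simp: c0ops_def app.add_left app.scaleR_left c0_add simp del: apply_bcontfun_simps intro: c0_scaleR)

lemma c0_uniform:
  assumes \<phi>: "c0 \<phi>" and \<epsilon>: "\<epsilon> > 0"
  shows "\<exists>U. open U \<and> e \<in> U \<and> (\<forall>u\<in>U. \<forall>p. norm (\<phi> (u \<cdot> p) - \<phi> p) \<le> \<epsilon>)"
proof -
  have \<epsilon>2: "\<epsilon> / 2 > 0" using \<epsilon> by simp
  obtain C where C: "compact C" "\<And>p. p \<notin> C \<Longrightarrow> norm (\<phi> p) \<le> \<epsilon> / 2"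
    using \<phi> \<epsilon>2 unfolding c0_def by blast
  have cont: "continuous_on UNIV (\<lambda>p. \<phi> (fst p \<cdot> snd p))"
    by (rule continuous_on_compose2[OF continuous_on_apply_bcontfun[of UNIV]]) (intro continuous_intros, simp)
  obtain V where V: "e \<in> V" "open V" "\<forall>x\<in>V \<inter> UNIV. \<forall>t\<in>C. dist (\<phi> (x \<cdot> t)) (\<phi> (e \<cdot> t)) \<le> \<epsilon>"
    by (rule continuous_on_prod_compactE[where ?x0.0 = e, OF continuous_on_subset[OF cont subset_UNIV] C(1) UNIV_I \<epsilon>])
      (auto simp: that)
  \<comment> \<open>Symmetry of U covers the case where u \<cdot> p lies in C and p does not: p is
    then the shift by \<open>ginv u\<close> of a point of C.\<close>
  define U where "U = V \<inter> ginv -` V"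
  have U: "open U" unfolding U_def using V(2) by (intro open_Int open_vimage continuous_intros)
  have "norm (\<phi> (u \<cdot> p) - \<phi> p) \<le> \<epsilon>" if u: "u \<in> U" for u p
  proof -
    consider "p \<in> C" | "u \<cdot> p \<in> C" | "p \<notin> C" "u \<cdot> p \<notin> C" by blast
    then show ?thesis
    proof cases
      case 1
      then show ?thesis using V(3) u by (simp add: U_def dist_norm)
    next
      case 2
      have "ginv u \<in> V" using u by (simp add: U_def)
      with V(3) 2 have "dist (\<phi> (ginv u \<cdot> (u \<cdot> p))) (\<phi> (e \<cdot> (u \<cdot> p))) \<le> \<epsilon>" by blast
      then show ?thesis by (simp add: dist_norm norm_minus_commute)
    next
      case 3
      then show ?thesis
        using C(2)[of p] C(2)[of "u \<cdot> p"] norm_triangle_ineq4[of "\<phi> (u \<cdot> p)" "\<phi> p"] by simp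
    qed
  qed
  then show ?thesis using U V(1) by (intro exI[of _ U]) (auto simp: U_def)
qed

end

section \<open>Averages over conjugacy classes\<close>

text \<open>If w does not eventually leave a compact C, restricting the filter to the x with w x in
  C keeps it proper, and w has a cluster point there, towards which a finer filter makes it
  converge. Finitely many maps are treated in turn. For values in a compact space this is the
  passage to a convergent subnet.\<close>

lemma filter_refine:
  fixes W :: "('a \<Rightarrow> 'b::topological_space) set" and F :: "'a filter"
  assumes "finite W" "F \<noteq> bot"
  shows "\<exists>F'. F' \<le> F \<and> F' \<noteq> bot \<and> (\<forall>w\<in>W. (\<exists>z. filterlim w (nhds z) F') \<or>
     (\<forall>C. compact C \<longrightarrow> eventually (\<lambda>x. w x \<notin> C) F'))"
  using assms(1)
proof (induction W rule: finite_induct)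
  case empty
  then show ?case using assms(2) by auto
next
  case (insert w W)
  then obtain F' where F': "F' \<le> F" "F' \<noteq> bot" and W: "\<forall>w\<in>W. (\<exists>z. filterlim w (nhds z) F') \<or>
     (\<forall>C. compact C \<longrightarrow> eventually (\<lambda>x. w x \<notin> C) F')" by blast
  show ?case
  proof (cases "\<forall>C. compact C \<longrightarrow> eventually (\<lambda>x. w x \<notin> C) F'")
    case True
    then show ?thesis using F' W by blast
  next
    case False
    then obtain C where C: "compact C" "\<not> eventually (\<lambda>x. w x \<notin> C) F'" by blast
    define F1 where "F1 = inf F' (principal {x. w x \<in> C})"
    have F1: "F1 \<noteq> bot"
      using C(2) by (simp add: F1_def trivial_limit_def eventually_inf_principal)
    have "filtermap w F1 \<noteq> bot" using F1 by (simp add: filtermap_bot_iff)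
    moreover have "eventually (\<lambda>y. y \<in> C) (filtermap w F1)"
      by (simp add: eventually_filtermap F1_def eventually_inf_principal)
    ultimately obtain z where z: "inf (nhds z) (filtermap w F1) \<noteq> bot"
      using C(1) unfolding compact_filter by blast
    define F2 where "F2 = inf F1 (filtercomap w (nhds z))"
    have "F2 \<noteq> bot"
    proof
      assume "F2 = bot"
      then have "eventually (\<lambda>_. False) F2" by simp
      then obtain P Q where PQ: "eventually P F1" "eventually Q (filtercomap w (nhds z))" "\<forall>x. P x \<and> Q x \<longrightarrow> False"
        unfolding F2_def eventually_inf by blast
      obtain Q' where Q': "eventually Q' (nhds z)" "\<And>x. Q' (w x) \<Longrightarrow> Q x"
        using PQ(2) unfolding eventually_filtercomap by blast
      have "eventually (\<lambda>y. \<exists>x. P x \<and> y = w x) (filtermap w F1)"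
        unfolding eventually_filtermap using PQ(1) by (auto elim: eventually_mono)
      then have "eventually (\<lambda>_. False) (inf (nhds z) (filtermap w F1))"
        unfolding eventually_inf using Q' PQ(3) by blast
      with z show False by (simp add: trivial_limit_def)
    qed
    moreover have le: "F2 \<le> F'" unfolding F2_def F1_def by (simp add: le_infI1)
    moreover have "filterlim w (nhds z) F2"
      unfolding filterlim_iff_le_filtercomap F2_def by simp
    moreover have "(\<exists>z. filterlim v (nhds z) F2) \<or> (\<forall>C. compact C \<longrightarrow> eventually (\<lambda>x. v x \<notin> C) F2)"
      if "v \<in> W" for v
      using W that le by (meson filter_leD filterlim_mono order_refl)
    ultimately show ?thesis using F'(1) by (intro exI[of _ F2]) auto
  qed
qed

locale almost_abelian = haar_group gmul ginv e \<mu>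
  for gmul :: "'g::t2_space \<Rightarrow> 'g \<Rightarrow> 'g" (infixl "\<cdot>" 70) and ginv e \<mu> +
  fixes N :: "'g set"
  assumes eN: "e \<in> N" and mulN: "\<And>x y. x \<in> N \<Longrightarrow> y \<in> N \<Longrightarrow> x \<cdot> y \<in> N"
    and invN: "\<And>x. x \<in> N \<Longrightarrow> ginv x \<in> N" and closedN: "closed N"
    and normalN: "\<And>g n. n \<in> N \<Longrightarrow> g \<cdot> n \<cdot> ginv g \<in> N"
    and commN: "\<And>x y. x \<in> N \<Longrightarrow> y \<in> N \<Longrightarrow> x \<cdot> y = y \<cdot> x"
    and noncompactN: "\<not> compact N" and finite_index: "finite ((\<lambda>g. gmul g ` N) ` UNIV)"
begin

section \<open>Conjugacy classes in the abelian normal subgroup\<close>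

definition cj :: "'g \<Rightarrow> 'g \<Rightarrow> 'g" where "cj g x = g \<cdot> x \<cdot> ginv g"

lemma cj_cj: "cj g (cj h x) = cj (g \<cdot> h) x"
  by (simp add: cj_def assoc inv_mul)

lemma cj_inv: "ginv (cj g x) = cj g (ginv x)"
  by (simp add: cj_def assoc inv_mul)

lemma cj_mul: "cj g (x \<cdot> y) = cj g x \<cdot> cj g y"
  by (simp add: cj_def assoc)

lemma cj_N: "x \<in> N \<Longrightarrow> cj g x \<in> N"
  by (simp add: cj_def normalN)

lemma cj_N_trivial: "n \<in> N \<Longrightarrow> x \<in> N \<Longrightarrow> cj n x = x"
  using commN[of n x] by (simp add: cj_def assoc)

definition reps :: "'g set" where
  "reps = (SOME R. finite R \<and> (\<forall>g. \<exists>r\<in>R. \<exists>n\<in>N. g = r \<cdot> n))"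

lemma reps: "finite reps" "\<exists>r\<in>reps. \<exists>n\<in>N. g = r \<cdot> n"
proof -
  obtain R where R: "finite R" "(\<lambda>g. gmul g ` N) ` UNIV = (\<lambda>g. gmul g ` N) ` R"
    using finite_subset_image[OF finite_index order_refl] by metis
  have "\<exists>r\<in>R. \<exists>n\<in>N. g = r \<cdot> n" for g
  proof -
    have "gmul g ` N \<in> (\<lambda>g. gmul g ` N) ` R" using R(2) by blast
    then obtain r where r: "r \<in> R" "gmul g ` N = gmul r ` N" by blast
    have "g \<cdot> e \<in> gmul g ` N" using eN by blast
    then have "g \<in> gmul r ` N" by (simp add: r(2))
    then show ?thesis using r(1) by blast
  qed
  then have "\<exists>R. finite R \<and> (\<forall>g. \<exists>r\<in>R. \<exists>n\<in>N. g = r \<cdot> n)" using R(1) by blast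
  from someI_ex[OF this] show "finite reps" "\<exists>r\<in>reps. \<exists>n\<in>N. g = r \<cdot> n"
    unfolding reps_def by blast+
qed

text \<open>For x in the abelian N the conjugate by g depends only on the coset of g, so
  representatives give all conjugates. Inverses are added to make the average symmetric.\<close>

definition orb :: "'g \<Rightarrow> 'g set" where
  "orb x = (\<lambda>r. cj r x) ` reps \<union> (\<lambda>r. ginv (cj r x)) ` reps"

definition M :: nat where "M = 2 * card reps"

lemma finite_orb: "finite (orb x)" and card_orb_le: "card (orb x) \<le> M"
proof -
  show "finite (orb x)" by (simp add: orb_def reps)
  have "card (orb x) \<le> card ((\<lambda>r. cj r x) ` reps) + card ((\<lambda>r. ginv (cj r x)) ` reps)"
    unfolding orb_def by (rule card_Un_le)
  also have "\<dots> \<le> card reps + card reps" by (intro add_mono card_image_le reps)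
  finally show "card (orb x) \<le> M" by (simp add: M_def)
qed

lemma cj_orb: assumes "x \<in> N" shows "cj g x \<in> orb x"
proof -
  obtain r n where rn: "r \<in> reps" "n \<in> N" "g = r \<cdot> n" using reps(2)[of g] by blast
  have "cj g x = cj r x" using cj_N_trivial[OF rn(2) assms] by (simp add: rn(3) cj_cj[symmetric])
  then show ?thesis using rn(1) by (auto simp: orb_def)
qed

lemma orb_inv: "y \<in> orb x \<Longrightarrow> ginv y \<in> orb x"
  by (auto simp: orb_def)

lemma orb_cj: assumes "x \<in> N" "y \<in> orb x" shows "cj g y \<in> orb x"
proof -
  have "cj g (cj r x) \<in> orb x" for r using cj_orb[OF assms(1)] by (simp add: cj_cj)
  moreover have "cj g (ginv (cj r x)) \<in> orb x" for r
    using orb_inv[OF calculation[of r]] by (simp add: cj_inv)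
  ultimately show ?thesis using assms(2) by (auto simp: orb_def)
qed

lemma orb_N: "x \<in> N \<Longrightarrow> y \<in> orb x \<Longrightarrow> y \<in> N"
  by (auto simp: orb_def intro: cj_N invN)

lemma orb_nonempty: "x \<in> N \<Longrightarrow> orb x \<noteq> {}"
  using cj_orb by blast

lemma card_orb_pos: "x \<in> N \<Longrightarrow> 0 < card (orb x)"
  using orb_nonempty finite_orb by (simp add: card_gt_0_iff)

lemma M_pos: "0 < M"
  using card_orb_pos[OF eN] card_orb_le[of e] by simp

text \<open>The first condition on C removes the first-order effect of the average on a function
  concentrated on a compact set. Products of two elements cannot all be far out, as y \<cdot> ginv y
  = e; those that are not are required to be almost trivial.\<close>

definition far :: "'g set \<Rightarrow> 'g set \<Rightarrow> 'g \<Rightarrow> bool" where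
  "far U C x \<longleftrightarrow> x \<in> N \<and> (\<forall>y\<in>orb x. y \<notin> C) \<and> (\<forall>y\<in>orb x. \<forall>y'\<in>orb x. y \<cdot> y' \<in> U \<or> y \<cdot> y' \<notin> C)"

text \<open>Along a suitable filter on \<open>N\<close> every word of length two in the conjugates of \<open>x\<close> and their inverses
  either converges or leaves all compact sets; quotients \<open>y y'\<^sup>-\<^sup>1\<close> along that filter are \<open>far\<close>.\<close>
lemma far_exists:
  assumes U: "open U" "e \<in> U" and C: "compact C"
  shows "\<exists>x. far U C x"
proof -
  \<comment> \<open>Its members are the complements in N of compact sets; it is proper because the
    closed set N is not compact.\<close>
  define F0 where "F0 = (INF D\<in>{D. compact D}. principal (N - D))"
  have ev0: "eventually P F0 \<longleftrightarrow> (\<exists>D. compact D \<and> (\<forall>x\<in>N - D. P x))" for P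
    unfolding F0_def
  proof (subst eventually_INF_base)
    show "\<exists>x\<in>{D. compact D}. principal (N - x) \<le> inf (principal (N - a)) (principal (N - b))"
      if "a \<in> {D. compact D}" "b \<in> {D. compact D}" for a b :: "'g set"
      using that by (intro bexI[of _ "a \<union> b"]) auto
  qed (auto simp: eventually_principal intro: exI[of _ "{}"])
  have "F0 \<noteq> bot"
  proof
    assume "F0 = bot"
    then have "eventually (\<lambda>_. False) F0" by simp
    then obtain D where D: "compact D" "N \<subseteq> D" unfolding ev0 by blast
    then have "N = D \<inter> N" by blast
    then show False using compact_Int_closed[OF D(1) closedN] noncompactN by simp
  qed
  \<comment> \<open>\<open>\<sigma>\<close> lists conjugations by representatives and their
    inverses. On the abelian N these maps, and the words of length two formed from them, are
    homomorphisms, so a word at \<open>y \<cdot> ginv y'\<close> is a quotient of its values at y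
    and y'.\<close>
  define \<sigma> where "\<sigma> s x = (if snd s then cj (fst s) x else ginv (cj (fst s) x))" for s :: "'g \<times> bool" and x
  define I where "I = reps \<times> (UNIV :: bool set)"
  have fI: "finite I" by (simp add: I_def reps)
  have orbI: "orb x = (\<lambda>s. \<sigma> s x) ` I" for x
  proof -
    have "(\<lambda>s. \<sigma> s x) ` I = (\<lambda>r. \<sigma> (r, True) x) ` reps \<union> (\<lambda>r. \<sigma> (r, False) x) ` reps"
      unfolding I_def by (auto simp: image_iff) (metis (full_types))
    then show ?thesis by (simp add: \<sigma>_def orb_def)
  qed
  have \<sigma>N: "\<sigma> s x \<in> N" if "x \<in> N" for s x using that by (auto simp: \<sigma>_def cj_N invN)
  have \<sigma>_hom: "\<sigma> s (x \<cdot> ginv y) = \<sigma> s x \<cdot> ginv (\<sigma> s y)" if "x \<in> N" "y \<in> N" for s x y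
  proof (cases "snd s")
    case True
    then show ?thesis by (simp add: \<sigma>_def cj_mul cj_inv)
  next
    case False
    have "ginv (cj (fst s) (x \<cdot> ginv y)) = cj (fst s) y \<cdot> cj (fst s) (ginv x)"
      by (simp add: cj_inv cj_mul inv_mul)
    also have "\<dots> = cj (fst s) (ginv x) \<cdot> cj (fst s) y" by (intro commN cj_N invN that)
    finally show ?thesis using False by (simp add: \<sigma>_def cj_inv)
  qed
  define W where "W = (\<lambda>p x. \<sigma> (fst p) x \<cdot> \<sigma> (snd p) x) ` (I \<times> I)"
  have w_hom: "w (x \<cdot> ginv y) = w x \<cdot> ginv (w y)" if wW: "w \<in> W" and that: "x \<in> N" "y \<in> N" for w x y
  proof -
    obtain p where p: "w = (\<lambda>x. \<sigma> (fst p) x \<cdot> \<sigma> (snd p) x)" using wW unfolding W_def by blast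
    define s s' where "s = fst p" and "s' = snd p"
    have w: "w = (\<lambda>x. \<sigma> s x \<cdot> \<sigma> s' x)" by (simp add: p s_def s'_def)
    have "ginv (\<sigma> s y) \<cdot> (\<sigma> s' x \<cdot> ginv (\<sigma> s' y)) = (\<sigma> s' x \<cdot> ginv (\<sigma> s' y)) \<cdot> ginv (\<sigma> s y)"
      by (intro commN invN mulN \<sigma>N that)
    then show ?thesis by (simp add: w \<sigma>_hom that inv_mul assoc)
  qed
  have fW: "finite W" unfolding W_def using fI by simp
  obtain F where F: "F \<le> F0" "F \<noteq> bot" and FW: "\<forall>w\<in>W. (\<exists>z. filterlim w (nhds z) F) \<or>
     (\<forall>C. compact C \<longrightarrow> eventually (\<lambda>x. w x \<notin> C) F)"
    using filter_refine[OF fW \<open>F0 \<noteq> bot\<close>] by blast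
  define Wb where "Wb = {w \<in> W. \<exists>z. filterlim w (nhds z) F}"
  have cN: "eventually (\<lambda>x. x \<in> N) F"
    using F(1) ev0[of "\<lambda>x. x \<in> N"] by (auto intro: filter_leD exI[of _ "{}"])
  have "\<exists>Z. eventually (\<lambda>x. w x \<in> Z) F \<and> (\<forall>u\<in>Z. \<forall>v\<in>Z. u \<cdot> ginv v \<in> U)" if wWb: "w \<in> Wb" for w
  proof -
    obtain z where z: "filterlim w (nhds z) F" using wWb unfolding Wb_def by blast
    have "open ((\<lambda>p. fst p \<cdot> ginv (snd p)) -` U)" by (intro open_vimage U continuous_intros)
    moreover have "(z, z) \<in> (\<lambda>p. fst p \<cdot> ginv (snd p)) -` U" using U(2) by simp
    ultimately obtain A B where AB: "open A" "open B" "(z, z) \<in> A \<times> B" "A \<times> B \<subseteq> (\<lambda>p. fst p \<cdot> ginv (snd p)) -` U"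
      by (rule open_prod_elim)
    have "eventually (\<lambda>x. w x \<in> A \<inter> B) F"
      by (rule topological_tendstoD[OF z open_Int[OF AB(1,2)]]) (use AB(3) in simp)
    moreover have "\<forall>u\<in>A \<inter> B. \<forall>v\<in>A \<inter> B. u \<cdot> ginv v \<in> U" using AB(4) by auto
    ultimately show ?thesis by blast
  qed
  then have "\<forall>w\<in>Wb. \<exists>Z. eventually (\<lambda>x. w x \<in> Z) F \<and> (\<forall>u\<in>Z. \<forall>v\<in>Z. u \<cdot> ginv v \<in> U)" by blast
  from bchoice[OF this] obtain Z where Z': "\<forall>w\<in>Wb. eventually (\<lambda>x. w x \<in> Z w) F \<and>
    (\<forall>u\<in>Z w. \<forall>v\<in>Z w. u \<cdot> ginv v \<in> U)" ..
  then have Z: "eventually (\<lambda>x. w x \<in> Z w) F" "\<forall>u\<in>Z w. \<forall>v\<in>Z w. u \<cdot> ginv v \<in> U" if "w \<in> Wb" for w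
    using that by simp_all
  have fWb: "finite Wb" unfolding Wb_def using fW by simp
  have evZ: "eventually (\<lambda>x. \<forall>w\<in>Wb. w x \<in> Z w) F"
    using fWb Z(1) by (simp add: eventually_ball_finite)
  \<comment> \<open>y' is fixed first, and y is then taken far out relative to it. A convergent word
    has nearby values at y and y', so its quotient lies in U; any other word, and each single
    conjugate, has left the translate of C determined by y'.\<close>
  obtain y' where y': "y' \<in> N" "\<forall>w\<in>Wb. w y' \<in> Z w"
    using eventually_happens'[OF F(2) eventually_conj[OF cN evZ]] by blast
  have cR: "compact ((\<lambda>u. u \<cdot> v) ` C)" for v
    by (intro compact_continuous_image C continuous_intros)
  have ev1: "eventually (\<lambda>x. \<forall>w\<in>W - Wb. w x \<notin> (\<lambda>u. u \<cdot> w y') ` C) F"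
    using fW FW cR by (intro eventually_ball_finite) (auto simp: Wb_def)
  have ev2: "eventually (\<lambda>x. \<forall>s\<in>I. \<sigma> s x \<notin> (\<lambda>u. u \<cdot> \<sigma> s y') ` C) F"
  proof (intro eventually_ball_finite[OF fI] ballI)
    fix s assume "s \<in> I"
    \<comment> \<open>\<open>\<tau>\<close> is a continuous left inverse of
      \<open>\<sigma> s\<close>; hence \<open>\<sigma> s\<close> reaches a compact set only from a
      compact set, which F0 avoids.\<close>
    define \<tau> where "\<tau> u = (if snd s then cj (ginv (fst s)) u else cj (ginv (fst s)) (ginv u))" for u
    have c\<tau>: "continuous_on UNIV \<tau>"
      unfolding \<tau>_def cj_def by (cases "snd s") (auto intro!: continuous_intros)
    have "compact (\<tau> ` (\<lambda>u. u \<cdot> \<sigma> s y') ` C)"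
      by (rule compact_continuous_image[OF continuous_on_subset[OF c\<tau> subset_UNIV] cR])
    moreover have "\<tau> (\<sigma> s x) = x" for x
      by (simp add: \<tau>_def \<sigma>_def cj_cj) (simp add: cj_def)
    then have "\<sigma> s x \<notin> (\<lambda>u. u \<cdot> \<sigma> s y') ` C" if "x \<notin> \<tau> ` (\<lambda>u. u \<cdot> \<sigma> s y') ` C" for x
      using that by (metis imageI)
    ultimately have "eventually (\<lambda>x. \<sigma> s x \<notin> (\<lambda>u. u \<cdot> \<sigma> s y') ` C) F0"
      unfolding ev0 by blast
    then show "eventually (\<lambda>x. \<sigma> s x \<notin> (\<lambda>u. u \<cdot> \<sigma> s y') ` C) F" using F(1) by (rule filter_leD[rotated])
  qed
  obtain y where y: "y \<in> N" "\<forall>w\<in>Wb. w y \<in> Z w" "\<forall>w\<in>W - Wb. w y \<notin> (\<lambda>u. u \<cdot> w y') ` C"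
    "\<forall>s\<in>I. \<sigma> s y \<notin> (\<lambda>u. u \<cdot> \<sigma> s y') ` C"
    using eventually_happens'[OF F(2) eventually_conj[OF eventually_conj[OF cN evZ] eventually_conj[OF ev1 ev2]]]
    by blast
  define x where "x = y \<cdot> ginv y'"
  have "far U C x"
    unfolding far_def
  proof (intro conjI ballI)
    show "x \<in> N" unfolding x_def by (intro mulN invN y y')
    fix v assume "v \<in> orb x"
    then obtain s where s: "s \<in> I" "v = \<sigma> s x" by (auto simp: orbI)
    show "v \<notin> C"
    proof
      assume "v \<in> C"
      then have "v \<cdot> \<sigma> s y' \<in> (\<lambda>u. u \<cdot> \<sigma> s y') ` C" by blast
      moreover have "v \<cdot> \<sigma> s y' = \<sigma> s y" unfolding s(2) x_def \<sigma>_hom[OF y(1) y'(1)] by (simp add: assoc)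
      ultimately show False using y(4) s(1) by auto
    qed
    fix v' assume "v' \<in> orb x"
    then obtain s' where s': "s' \<in> I" "v' = \<sigma> s' x" by (auto simp: orbI)
    define w where "w = (\<lambda>x. \<sigma> s x \<cdot> \<sigma> s' x)"
    have w: "w \<in> W" unfolding W_def w_def using s(1) s'(1) by (intro image_eqI[of _ _ "(s, s')"]) auto
    have wx: "v \<cdot> v' = w y \<cdot> ginv (w y')"
      using w_hom[OF w y(1) y'(1)] by (simp add: s(2) s'(2) w_def x_def)
    show "v \<cdot> v' \<in> U \<or> v \<cdot> v' \<notin> C"
    proof (cases "w \<in> Wb")
      case True
      then show ?thesis using Z(2)[OF True] y(2) y'(2) wx by auto
    next
      case False
      have "v \<cdot> v' \<notin> C"
      proof
        assume "v \<cdot> v' \<in> C"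
        then have "v \<cdot> v' \<cdot> w y' \<in> (\<lambda>u. u \<cdot> w y') ` C" by blast
        moreover have "v \<cdot> v' \<cdot> w y' = w y" unfolding wx by (simp add: assoc)
        ultimately show False using y(3) w False by auto
      qed
      then show ?thesis ..
    qed
  qed
  then show ?thesis ..
qed

text \<open>The sense in which x tends to infinity from here on.\<close>

definition XX :: "'g filter" where
  "XX = (INF p\<in>{(U, C). open U \<and> e \<in> U \<and> compact C}. principal {x. far (fst p) (snd p) x})"

lemma eventually_XX: "eventually P XX \<longleftrightarrow> (\<exists>U C. open U \<and> e \<in> U \<and> compact C \<and> (\<forall>x. far U C x \<longrightarrow> P x))"
  unfolding XX_def
proof (subst eventually_INF_base)
  fix a b :: "'g set \<times> 'g set" assume "a \<in> {(U, C). open U \<and> e \<in> U \<and> compact C}" "b \<in> {(U, C). open U \<and> e \<in> U \<and> compact C}"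
  then show "\<exists>x\<in>{(U, C). open U \<and> e \<in> U \<and> compact C}. principal {y. far (fst x) (snd x) y} \<le>
      inf (principal {x. far (fst a) (snd a) x}) (principal {x. far (fst b) (snd b) x})"
    by (intro bexI[of _ "(fst a \<inter> fst b, snd a \<union> snd b)"]) (auto simp: far_def)
qed (auto simp: eventually_principal)

lemma XX_ne_bot: "XX \<noteq> bot"
  unfolding trivial_limit_def eventually_XX using far_exists by blast

lemma eventually_XX_N: "eventually (\<lambda>x. x \<in> N) XX"
  unfolding eventually_XX far_def by (intro exI[of _ UNIV] exI[of _ "{}"]) auto

section \<open>Averages of translations and the algebra commuting with translations\<close>

definition nu :: "'g \<Rightarrow> 'g cbop" where
  "nu x = (1 / real (card (orb x))) *\<^sub>R (\<Sum>y\<in>orb x. Lop y)"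

lemma app_nu: "app (nu x) \<phi> = (1 / real (card (orb x))) *\<^sub>R (\<Sum>y\<in>orb x. app (Lop y) \<phi>)"
  by (simp only: nu_def app.scaleR_left app.sum_left)

lemma app_nu_pt: "app (nu x) \<phi> p = (\<Sum>y\<in>orb x. \<phi> (y \<cdot> p)) / of_nat (card (orb x))"
  by (simp add: app_nu apply_bcontfun_sum scaleR_conv_of_real)

lemma nu_sym: "nu x = (1 / real (card (orb x))) *\<^sub>R (\<Sum>y\<in>orb x. (1/2) *\<^sub>R (Lop y + Lop (ginv y)))"
proof -
  have b: "bij_betw ginv (orb x) (orb x)"
    by (rule bij_betwI[where g = ginv]) (auto intro: orb_inv)
  have "(\<Sum>y\<in>orb x. Lop (ginv y)) = (\<Sum>y\<in>orb x. Lop y)"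
    by (rule sum.reindex_bij_betw[OF b])
  then have "(\<Sum>y\<in>orb x. (1/2) *\<^sub>R (Lop y + Lop (ginv y))) = (\<Sum>y\<in>orb x. Lop y)"
    by (simp only: scaleR_sum_right[symmetric] sum.distrib scaleR_add_right scaleR_left_distrib[symmetric]) simp
  then show ?thesis by (simp only: nu_def)
qed

text \<open>The transpose of \<open>Lop y\<close> is \<open>Lop (ginv y)\<close>, so a symmetrised
  pair is its own transpose; left invariance gives the L1 bound.\<close>

lemma sym1_nu: assumes "x \<in> N" shows "sym1 (nu x) 1"
proof -
  have s: "sym1 ((1/2) *\<^sub>R (Lop y + Lop (ginv y))) 1" for y
    unfolding sym1_def
  proof (intro conjI allI impI)
    have "norm (Lop y + Lop (ginv y)) \<le> 1 + 1" by (intro norm_triangle_le add_mono norm_Lop)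
    then show "norm ((1/2) *\<^sub>R (Lop y + Lop (ginv y))) \<le> 1" by simp
    fix k :: "'g \<Rightarrow>\<^sub>C complex" assume k: "integrable \<mu> (apply_bcontfun k)"
    have eq: "apply_bcontfun (app ((1/2) *\<^sub>R (Lop y + Lop (ginv y))) \<phi>) = (\<lambda>x. (1/2) * (app (Lop y) \<phi> x + app (Lop (ginv y)) \<phi> x))" for \<phi>
      by (rule ext) (simp only: app.scaleR_left app.add_left apply_bcontfun_simps, simp only: scaleR_conv_of_real, simp)
    note i1 = pair_Lop[OF k, of y] and i2 = pair_Lop[OF k, of "ginv y"]
    show "integrable \<mu> (apply_bcontfun (app ((1/2) *\<^sub>R (Lop y + Lop (ginv y))) k))"
      unfolding eq by (intro integrable_mult_right Bochner_Integration.integrable_add i1(1) i2(1))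
    have "N1 (app ((1/2) *\<^sub>R (Lop y + Lop (ginv y))) k) \<le>
        (\<integral>x. (1/2) * (norm (app (Lop y) k x) + norm (app (Lop (ginv y)) k x)) \<partial>\<mu>)"
    proof (rule integral_mono)
      show "integrable \<mu> (\<lambda>x. norm (app ((1/2) *\<^sub>R (Lop y + Lop (ginv y))) k x))"
        unfolding eq by (intro integrable_norm integrable_mult_right Bochner_Integration.integrable_add i1(1) i2(1))
      show "integrable \<mu> (\<lambda>x. (1/2) * (norm (app (Lop y) k x) + norm (app (Lop (ginv y)) k x)))"
        by (intro integrable_norm integrable_mult_right Bochner_Integration.integrable_add i1(1) i2(1))
      show "norm (app ((1/2) *\<^sub>R (Lop y + Lop (ginv y))) k x) \<le>
          (1/2) * (norm (app (Lop y) k x) + norm (app (Lop (ginv y)) k x))" for x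
        unfolding eq norm_mult using norm_triangle_ineq[of "app (Lop y) k x" "app (Lop (ginv y)) k x"] by simp
    qed
    also have "\<dots> = (1/2) * (N1 (app (Lop y) k) + N1 (app (Lop (ginv y)) k))"
      using integrable_norm[OF i1(1)] integrable_norm[OF i2(1)]
      by (simp only: integral_mult_right_zero Bochner_Integration.integral_add)
    also have "\<dots> = 1 * N1 k" using i1(2) i2(2) by simp
    finally show "N1 (app ((1/2) *\<^sub>R (Lop y + Lop (ginv y))) k) \<le> 1 * N1 k" .
    fix l
    have "pair (app ((1/2) *\<^sub>R (Lop y + Lop (ginv y))) k) l = (1/2) * (pair (app (Lop y) k) l + pair (app (Lop (ginv y)) k) l)"
      unfolding eq pair_scale_left pair_add_left[OF i1(1) i2(1)] ..
    also have "\<dots> = (1/2) * (pair k (app (Lop (ginv y)) l) + pair k (app (Lop y) l))"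
      using i1(3)[of l] i2(3)[of l] by simp
    also have "\<dots> = pair k (app (mulc (1/2)) (app (Lop y) l + app (Lop (ginv y)) l))"
      unfolding pair_mulc pair_add_right[OF k] by (simp add: add.commute)
    also have "app (mulc (1/2)) (app (Lop y) l + app (Lop (ginv y)) l) = app ((1/2) *\<^sub>R (Lop y + Lop (ginv y))) l"
      by (rule bcontfun_eqI) (simp add: eq)
    finally show "pair (app ((1/2) *\<^sub>R (Lop y + Lop (ginv y))) k) l = pair k (app ((1/2) *\<^sub>R (Lop y + Lop (ginv y))) l)" .
  qed
  have "sym1 (\<Sum>y\<in>orb x. (1/2) *\<^sub>R (Lop y + Lop (ginv y))) (\<Sum>y\<in>orb x. 1)"
    by (rule sym1_sum[OF finite_orb s])
  from sym1_scaleR[OF this, of "1 / real (card (orb x))"] show ?thesis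
    using card_orb_pos[OF assms] unfolding nu_sym by simp
qed

text \<open>Commuting with translations makes annihilators of kernels two-sided, commuting with
  \<open>theta\<close> lets operators pass through convolutions, commuting with \<open>mulc\<close>
  is complex linearity, and preserving \<open>c0\<close> keeps orbits within reach of
  \<open>nu_far\<close>.\<close>

definition calg :: "'g cbop set" where
  "calg = c0ops \<inter> (\<Inter>D\<in>{D. (\<exists>g. D = Lop g \<or> D = Rop g) \<or> (\<exists>c. D = mulc c) \<or> (\<exists>b. integrable \<mu> b \<and> D = theta b)}.
     {T. T * D = D * T})"

lemma closed_subalg_calg: "closed_subalg calg"
proof -
  have "calg = \<Inter>(insert c0ops ((\<lambda>D. {T. T * D = D * T}) `
      {D. (\<exists>g. D = Lop g \<or> D = Rop g) \<or> (\<exists>c. D = mulc c) \<or> (\<exists>b. integrable \<mu> b \<and> D = theta b)}))"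
    unfolding calg_def by simp
  also have "closed_subalg \<dots>"
    by (rule closed_subalg_Inter) (auto simp: closed_subalg_commute closed_subalg_c0ops)
  finally show ?thesis .
qed

lemma calgD:
  assumes "T \<in> calg"
  shows "T * Lop g = Lop g * T" "T * Rop g = Rop g * T" "T * mulc c = mulc c * T"
    "integrable \<mu> b \<Longrightarrow> T * theta b = theta b * T" "c0 \<phi> \<Longrightarrow> c0 (app T \<phi>)"
  using assms unfolding calg_def c0ops_def by blast+

lemma mulc_calg: "mulc c \<in> calg"
proof -
  have "mulc c * mulc d = mulc d * mulc c" for d
    unfolding mulc_mult[symmetric] by (simp add: mult.commute)
  then show ?thesis
    unfolding calg_def c0ops_def
    using Lop_mulc Rop_mulc theta_mulc c0_mulc by auto
qed

lemma sum_comm: "(\<And>y. y \<in> A \<Longrightarrow> f y * D = D * f y) \<Longrightarrow> sum f A * D = D * sum f A"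
  for f :: "'i \<Rightarrow> 'g cbop"
  by (simp add: sum_distrib_left sum_distrib_right)

text \<open>\<open>Lop y * Lop g\<close> is the translation by g \<cdot> y = \<open>cj g y\<close>
  \<cdot> g, so commuting with \<open>Lop g\<close> amounts to conjugation permuting the orbit. For
  the other generators every single \<open>Lop y\<close> commutes.\<close>

lemma nu_calg: assumes x: "x \<in> N" shows "nu x \<in> calg"
proof -
  have L: "nu x * Lop g = Lop g * nu x" for g
  proof -
    have b: "bij_betw (cj g) (orb x) (orb x)"
      by (rule bij_betwI[where g = "cj (ginv g)"]) (auto simp: cj_cj orb_cj[OF x], auto simp: cj_def)
    have "(\<Sum>y\<in>orb x. Lop y) * Lop g = (\<Sum>y\<in>orb x. Lop (g \<cdot> y))"
      by (simp add: sum_distrib_right Lop_mult)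
    also have "\<dots> = (\<Sum>y\<in>orb x. Lop (cj g y \<cdot> g))"
      by (intro sum.cong refl arg_cong[of _ _ Lop]) (simp add: cj_def assoc)
    also have "\<dots> = (\<Sum>y\<in>orb x. Lop (y \<cdot> g))"
      by (rule sum.reindex_bij_betw[OF b, of "\<lambda>y. Lop (y \<cdot> g)"])
    also have "\<dots> = Lop g * (\<Sum>y\<in>orb x. Lop y)"
      by (simp add: sum_distrib_left Lop_mult)
    finally show ?thesis by (simp only: nu_def mult_scaleR_left mult_scaleR_right)
  qed
  have gen: "nu x * D = D * nu x" if "\<And>y. Lop y * D = D * Lop y" for D
    using sum_comm[of "orb x" Lop D] that by (simp only: nu_def mult_scaleR_left mult_scaleR_right)
  have c: "nu x \<in> c0ops"
    unfolding nu_def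
    by (intro closed_subalgD(5)[OF closed_subalg_c0ops] closed_subalg_sum[OF closed_subalg_c0ops])
      (simp add: c0ops_def c0_Lop)
  show ?thesis
    unfolding calg_def using L c gen[OF Lop_Rop] gen[OF Lop_mulc] gen[OF theta_Lop[symmetric]] by auto
qed

lemma calg_comm_nu: assumes "T \<in> calg" shows "T * nu x = nu x * T"
  using sum_comm[of "orb x" Lop T] calgD(1)[OF assms] by (simp only: nu_def mult_scaleR_left mult_scaleR_right)

lemma nu_cnj: "cnjop * nu x = nu x * cnjop"
  by (rule cbop_eqI) (simp add: app_nu_pt)

end

text \<open>Bernoulli's inequality for the m-th root u of 1 / q bounds J + 2 by a multiple of u ^ J;
  then m-th powers are taken.\<close>

lemma power_decay:
  assumes "0 < q" "q < (1::real)"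
  shows "\<exists>C. \<forall>J::nat. q ^ J \<le> C / (real J + 2) ^ m"
proof (cases "m = 0")
  case True
  have "q ^ J \<le> 1" for J using assms by (intro power_le_one) auto
  then show ?thesis using True by (intro exI[of _ 1]) auto
next
  case False
  define u where "u = root m (1 / q)"
  have um: "u ^ m = 1 / q" unfolding u_def using False assms by (intro real_root_pow_pos2) auto
  have u1: "u > 1" unfolding u_def using False assms by (simp add: real_root_gt_1_iff)
  define \<delta> where "\<delta> = u - 1"
  have \<delta>: "\<delta> > 0" using u1 by (simp add: \<delta>_def)
  define C where "C = 2 + 1 / \<delta>"
  have C: "C > 0" using \<delta> by (simp add: C_def add_pos_pos)
  have "q ^ J \<le> C ^ m / (real J + 2) ^ m" for J :: nat
  proof -
    have "1 + real J * \<delta> \<le> (1 + \<delta>) ^ J" using \<delta> by (intro Bernoulli_inequality) simp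
    then have b: "1 + real J * \<delta> \<le> u ^ J" by (simp add: \<delta>_def)
    have "real J + 2 \<le> C * (1 + real J * \<delta>)"
      using \<delta> by (simp add: C_def field_simps)
    also have "\<dots> \<le> C * u ^ J" using b C by (intro mult_left_mono) auto
    finally have "(real J + 2) ^ m \<le> (C * u ^ J) ^ m" by (intro power_mono) auto
    also have "\<dots> = C ^ m * (u ^ m) ^ J" by (simp add: power_mult_distrib flip: power_mult) (simp add: mult.commute)
    also have "\<dots> = C ^ m / q ^ J" by (simp add: um power_one_over)
    finally show ?thesis using assms by (simp add: field_simps)
  qed
  then show ?thesis by blast
qed

context almost_abelian begin

text \<open>Since \<open>x\<close> is far out, a product of two elements of \<open>orb x\<close> is either almost trivial or moves
  \<open>C\<^sub>0\<close> away from the essential support of \<open>\<phi>\<close>; \<open>\<theta>\<close> is the proportion of the former pairs.\<close>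
lemma nu_far:
  assumes \<phi>: "c0 \<phi>" and \<epsilon>: "\<epsilon> > 0" and C0: "compact C0"
  shows "eventually (\<lambda>x. x \<in> N \<and> (\<exists>\<theta>. 1 / real M \<le> \<theta> \<and> \<theta> \<le> 1 \<and> (\<forall>p\<in>C0. norm (app (nu x) \<phi> p) \<le> \<epsilon> \<and>
    norm (app (nu x) (app (nu x) \<phi>) p - of_real \<theta> * \<phi> p) \<le> \<epsilon>))) XX"
proof -
  obtain C1 where C1: "compact C1" "\<And>p. p \<notin> C1 \<Longrightarrow> norm (\<phi> p) \<le> \<epsilon>"
    using \<phi> \<epsilon> unfolding c0_def by blast
  define C where "C = C0 \<union> C1"
  have C: "compact C" "\<And>p. p \<notin> C \<Longrightarrow> norm (\<phi> p) \<le> \<epsilon>"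
    using compact_Un[OF C0 C1(1)] C1(2) by (auto simp: C_def)
  obtain U where U: "open U" "e \<in> U" "\<And>u p. u \<in> U \<Longrightarrow> norm (\<phi> (u \<cdot> p) - \<phi> p) \<le> \<epsilon>"
    using c0_uniform[OF \<phi> \<epsilon>] by blast
  \<comment> \<open>C' = C C^-1: an element outside C' moves all of C off C.\<close>
  define C' where "C' = (\<lambda>p. fst p \<cdot> snd p) ` (C \<times> (ginv ` C))"
  have cC': "compact C'"
    unfolding C'_def
    using compact_mult_image[OF C(1) compact_continuous_image[OF _ C(1)] continuous_on_id, of ginv]
    by (simp add: continuous_on_ginv continuous_on_id)
  have sep: "w \<in> C'" if "p \<in> C" "w \<cdot> p \<in> C" for w p
  proof -
    have "(w \<cdot> p) \<cdot> ginv p \<in> C'" unfolding C'_def using that by force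
    then show ?thesis by (simp add: assoc)
  qed
  have main: "x \<in> N \<and> (\<exists>\<theta>. 1 / real M \<le> \<theta> \<and> \<theta> \<le> 1 \<and> (\<forall>p\<in>C0. norm (app (nu x) \<phi> p) \<le> \<epsilon> \<and>
    norm (app (nu x) (app (nu x) \<phi>) p - of_real \<theta> * \<phi> p) \<le> \<epsilon>))"
    if far: "far U C' x" for x
  proof -
    have xN: "x \<in> N" using far by (simp add: far_def)
    have M1: "1 \<le> real M" using M_pos by simp
    define O' where "O' = orb x"
    define c where "c = card O'"
    have cpos: "0 < real c" using card_orb_pos[OF xN] by (simp add: c_def O'_def)
    have cM: "real c \<le> real M" using card_orb_le[of x] by (simp add: c_def O'_def)
    have fO: "finite O'" by (simp add: O'_def finite_orb)
    define B1 where "B1 p = app (nu x) \<phi> p" for p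
    define B2 where "B2 p = app (nu x) (app (nu x) \<phi>) p" for p
    have B1e: "B1 p = (\<Sum>y\<in>O'. \<phi> (y \<cdot> p)) / of_nat c" for p
      by (simp add: B1_def app_nu_pt O'_def c_def)
    have B2e: "B2 p = (\<Sum>q\<in>O' \<times> O'. \<phi> (snd q \<cdot> fst q \<cdot> p)) / of_nat (c * c)" for p
      by (simp add: B2_def app_nu_pt O'_def c_def assoc sum.cartesian_product' sum_divide_distrib[symmetric])
    define Nr where "Nr = {q \<in> O' \<times> O'. snd q \<cdot> fst q \<in> U}"
    define \<theta> where "\<theta> = real (card Nr) / real (c * c)"
    \<comment> \<open>The pairs (y, ginv y) have product e and belong to \<open>Nr\<close>; they
      alone give \<theta> \<ge> c / c^2 = 1 / c \<ge> 1 / M.\<close>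
    have "card ((\<lambda>y. (y, ginv y)) ` O') \<le> card Nr"
      unfolding Nr_def using U(2) fO orb_inv by (intro card_mono) (auto simp: O'_def)
    then have cNr: "c \<le> card Nr" by (subst (asm) card_image) (auto simp: inj_on_def c_def)
    have Nrc: "card Nr \<le> c * c"
      unfolding Nr_def c_def card_cartesian_product[symmetric] using fO by (intro card_mono) auto
    have \<theta>1: "\<theta> \<le> 1" unfolding \<theta>_def using Nrc cpos by (simp add: divide_le_eq_1 flip: of_nat_mult)
    have \<theta>M: "1 / real M \<le> \<theta>"
    proof -
      have "1 / real M \<le> 1 / real c" using cM cpos M1 by (intro divide_left_mono) auto
      also have "\<dots> = real c / real (c * c)" using cpos by simp
      also have "\<dots> \<le> \<theta>" unfolding \<theta>_def using cNr by (intro divide_right_mono) auto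
      finally show ?thesis .
    qed
    have small1: "norm (B1 p) \<le> \<epsilon>" if p: "p \<in> C" for p
    proof -
      have "norm (\<phi> (y \<cdot> p)) \<le> \<epsilon>" if "y \<in> O'" for y
        using far that sep[OF p, of y] C(2)[of "y \<cdot> p"] by (auto simp: far_def O'_def)
      then have "norm (\<Sum>y\<in>O'. \<phi> (y \<cdot> p)) \<le> (\<Sum>y\<in>O'. \<epsilon>)" by (intro sum_norm_le)
      then show ?thesis using cpos unfolding B1e by (simp add: norm_divide c_def[symmetric] divide_le_eq mult.commute)
    qed
    have small2: "norm (B2 p - of_real \<theta> * \<phi> p) \<le> \<epsilon>" if p: "p \<in> C" for p
    proof -
      have e: "norm (\<phi> (snd q \<cdot> fst q \<cdot> p) - (if q \<in> Nr then \<phi> p else 0)) \<le> \<epsilon>" if q: "q \<in> O' \<times> O'" for q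
      proof (cases "snd q \<cdot> fst q \<in> U")
        case True
        then show ?thesis using q U(3) by (simp add: Nr_def)
      next
        case False
        then have "snd q \<cdot> fst q \<notin> C'" using far q unfolding far_def O'_def by (auto simp: mem_Times_iff)
        then have "snd q \<cdot> fst q \<cdot> p \<notin> C" using sep[OF p] by blast
        then show ?thesis using False C(2) by (simp add: Nr_def)
      qed
      have "(\<Sum>q\<in>O' \<times> O'. (if q \<in> Nr then \<phi> p else 0)) = of_nat (card Nr) * \<phi> p"
      proof -
        have "O' \<times> O' \<inter> {q. q \<in> Nr} = Nr" by (auto simp: Nr_def)
        then show ?thesis using fO by (simp add: sum.If_cases)
      qed
      then have "B2 p - of_real \<theta> * \<phi> p = (\<Sum>q\<in>O' \<times> O'. \<phi> (snd q \<cdot> fst q \<cdot> p) - (if q \<in> Nr then \<phi> p else 0)) / of_nat (c * c)"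
        unfolding B2e \<theta>_def sum_subtractf by (simp add: diff_divide_distrib)
      moreover have "norm (\<Sum>q\<in>O' \<times> O'. \<phi> (snd q \<cdot> fst q \<cdot> p) - (if q \<in> Nr then \<phi> p else 0)) \<le> (\<Sum>q\<in>O' \<times> O'. \<epsilon>)"
        by (intro sum_norm_le e)
      moreover have "card (O' \<times> O') = c * c" by (simp add: card_cartesian_product c_def)
      ultimately show ?thesis using cpos by (simp add: norm_divide norm_mult divide_le_eq mult.commute)
    qed
    have "p \<in> C" if "p \<in> C0" for p using that by (simp add: C_def)
    then show ?thesis
      using xN \<theta>M \<theta>1 small1 small2 unfolding B1_def B2_def by blast
  qed
  then show ?thesis
    unfolding eventually_XX using U cC' by blast
qed

text \<open>Taylor expansion to second order. On C, which carries the bulk of \<phi>, the linear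
  term is small and the quadratic one is close to - t^2 \<theta> / 2 times \<phi>, so \<phi>
  shrinks. Off C, \<phi> is small and the remaining terms have weight |t| + t^2 / 2 \<le>
  1/2.\<close>

lemma indep1:
  assumes \<phi>: "c0 \<phi>" and \<epsilon>: "\<epsilon> > 0"
  shows "eventually (\<lambda>x. \<forall>t. \<bar>t\<bar> \<le> 1 / (8 * real M) \<longrightarrow>
    norm (app (exp (t *\<^sub>R (Jop * nu x))) \<phi>) \<le> (1 - t\<^sup>2 / (4 * real M)) * norm \<phi> + \<epsilon>) XX"
proof -
  obtain C where C: "compact C" "\<And>p. p \<notin> C \<Longrightarrow> norm (\<phi> p) \<le> \<epsilon>"
    using \<phi> \<epsilon> unfolding c0_def by blast
  have main: "norm (app (exp (t *\<^sub>R (Jop * nu x))) \<phi>) \<le> (1 - t\<^sup>2 / (4 * real M)) * norm \<phi> + \<epsilon>"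
    if x: "x \<in> N \<and> (\<exists>\<theta>. 1 / real M \<le> \<theta> \<and> \<theta> \<le> 1 \<and> (\<forall>p\<in>C. norm (app (nu x) \<phi> p) \<le> \<epsilon> \<and>
      norm (app (nu x) (app (nu x) \<phi>) p - of_real \<theta> * \<phi> p) \<le> \<epsilon>))"
      and t: "\<bar>t\<bar> \<le> 1 / (8 * real M)" for x t
  proof -
    obtain \<theta> where xN: "x \<in> N" and \<theta>M: "1 / real M \<le> \<theta>" and \<theta>1: "\<theta> \<le> 1"
      and sm: "\<forall>p\<in>C. norm (app (nu x) \<phi> p) \<le> \<epsilon> \<and> norm (app (nu x) (app (nu x) \<phi>) p - of_real \<theta> * \<phi> p) \<le> \<epsilon>"
      using x by blast
    have M1: "1 \<le> real M" using M_pos by simp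
    have t8: "\<bar>t\<bar> \<le> 1 / 8"
    proof -
      have "1 / (8 * real M) \<le> 1 / 8" using M1 by (simp add: field_simps)
      with t show ?thesis by linarith
    qed
    have t2: "t\<^sup>2 \<le> \<bar>t\<bar> / 8"
      using mult_left_mono[OF t8, of "\<bar>t\<bar>"] by (simp add: power2_eq_square abs_mult[symmetric])
    define B1 where "B1 p = app (nu x) \<phi> p" for p
    define B2 where "B2 p = app (nu x) (app (nu x) \<phi>) p" for p
    have nuT: "norm (nu x) \<le> 1" using sym1D(1)[OF sym1_nu[OF xN]] .
    have nB: "norm (app (nu x) \<psi>) \<le> norm \<psi>" for \<psi>
      using norm_app[of "nu x" \<psi>] mult_right_mono[OF nuT, of "norm \<psi>"] by simp
    have nB1: "norm (B1 p) \<le> norm \<phi>" for p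
      unfolding B1_def using norm_bounded nB by (rule order_trans)
    have nB2: "norm (B2 p) \<le> norm \<phi>" for p
      unfolding B2_def using order_trans[OF norm_bounded nB] nB by (rule order_trans)
    have small1: "norm (B1 p) \<le> \<epsilon>" and small2: "norm (B2 p - of_real \<theta> * \<phi> p) \<le> \<epsilon>" if "p \<in> C" for p
      using sm that by (simp_all add: B1_def B2_def)
    define A where "A p = \<phi> p + (\<i> * of_real t) * B1 p - of_real (t\<^sup>2 / 2) * B2 p" for p
    have tt: "\<bar>t\<bar> + t\<^sup>2 / 2 \<le> 1/2" using t8 t2 by linarith
    have q0: "t\<^sup>2 / (2 * real M) \<le> 1/2"
    proof -
      have "t\<^sup>2 / (2 * real M) \<le> t\<^sup>2 / 2" using M1 by (intro divide_left_mono) auto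
      then show ?thesis using tt by linarith
    qed
    have nA: "norm (A p) \<le> (1 - t\<^sup>2 / (2 * real M)) * norm \<phi> + \<epsilon>" for p
    proof (cases "p \<in> C")
      case True
      have "A p = of_real (1 - t\<^sup>2 * \<theta> / 2) * \<phi> p + (\<i> * of_real t) * B1 p - of_real (t\<^sup>2 / 2) * (B2 p - of_real \<theta> * \<phi> p)"
        by (simp add: A_def field_simps)
      then have "norm (A p) \<le> norm (of_real (1 - t\<^sup>2 * \<theta> / 2) * \<phi> p) + norm ((\<i> * of_real t) * B1 p) + norm (of_real (t\<^sup>2 / 2) * (B2 p - of_real \<theta> * \<phi> p))"
        by (metis add_right_mono norm_triangle_ineq norm_triangle_ineq4 order_trans)
      also have "\<dots> \<le> (1 - t\<^sup>2 / (2 * real M)) * norm \<phi> + \<bar>t\<bar> * \<epsilon> + (t\<^sup>2 / 2) * \<epsilon>"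
      proof (intro add_mono)
        have "t\<^sup>2 * \<theta> / 2 \<le> 1"
          using mult_left_mono[OF \<theta>1, of "t\<^sup>2"] tt by auto
        moreover have "t\<^sup>2 / (2 * real M) \<le> t\<^sup>2 * \<theta> / 2"
          using mult_left_mono[OF \<theta>M, of "t\<^sup>2 / 2"] by simp
        ultimately have "\<bar>1 - t\<^sup>2 * \<theta> / 2\<bar> \<le> 1 - t\<^sup>2 / (2 * real M)" by linarith
        then show "norm (of_real (1 - t\<^sup>2 * \<theta> / 2) * \<phi> p) \<le> (1 - t\<^sup>2 / (2 * real M)) * norm \<phi>"
          unfolding norm_mult norm_of_real by (intro mult_mono norm_bounded) (use q0 in auto)
        show "norm ((\<i> * of_real t) * B1 p) \<le> \<bar>t\<bar> * \<epsilon>"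
          using mult_left_mono[OF small1[OF True], of "\<bar>t\<bar>"] by (simp add: norm_mult)
        show "norm (of_real (t\<^sup>2 / 2) * (B2 p - of_real \<theta> * \<phi> p)) \<le> (t\<^sup>2 / 2) * \<epsilon>"
          using mult_left_mono[OF small2[OF True], of "t\<^sup>2 / 2"] by (simp add: norm_mult norm_divide norm_power)
      qed
      also have "\<dots> = (1 - t\<^sup>2 / (2 * real M)) * norm \<phi> + (\<bar>t\<bar> + t\<^sup>2 / 2) * \<epsilon>" by (simp add: distrib_right)
      also have "\<dots> \<le> (1 - t\<^sup>2 / (2 * real M)) * norm \<phi> + 1 * \<epsilon>"
        using tt \<epsilon> by (intro add_left_mono mult_right_mono) auto
      finally show ?thesis by simp
    next
      case False
      have "norm (A p) \<le> norm (\<phi> p) + norm ((\<i> * of_real t) * B1 p) + norm (of_real (t\<^sup>2 / 2) * B2 p)"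
        unfolding A_def by (metis add_right_mono norm_triangle_ineq norm_triangle_ineq4 order_trans)
      also have "\<dots> \<le> \<epsilon> + \<bar>t\<bar> * norm \<phi> + (t\<^sup>2 / 2) * norm \<phi>"
        using C(2)[OF False] mult_left_mono[OF nB1, of "\<bar>t\<bar>" p] mult_left_mono[OF nB2, of "t\<^sup>2 / 2" p]
        by (intro add_mono) (simp_all add: norm_mult norm_divide norm_power)
      also have "\<dots> = (\<bar>t\<bar> + t\<^sup>2 / 2) * norm \<phi> + \<epsilon>" by (simp add: distrib_right)
      also have "\<dots> \<le> (1 - t\<^sup>2 / (2 * real M)) * norm \<phi> + \<epsilon>"
        using tt q0 by (intro add_right_mono mult_right_mono) auto
      finally show ?thesis .
    qed
    define X where "X = t *\<^sub>R (Jop * nu x)"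
    have nX: "norm X \<le> \<bar>t\<bar>"
    proof -
      have "norm (Jop * nu x) \<le> 1 * 1"
        by (rule order_trans[OF norm_mult_ineq]) (intro mult_mono norm_Jop nuT, auto)
      then show ?thesis by (simp add: X_def mult_left_le)
    qed
    have JJ: "(Jop * nu x) * (Jop * nu x) = - (nu x * nu x)"
    proof -
      have "(Jop * nu x) * (Jop * nu x) = (Jop * Jop) * (nu x * nu x)"
        using calgD(3)[OF nu_calg[OF xN], of \<i>] by (simp add: mult.assoc) (simp only: mult.assoc[symmetric])
      then show ?thesis by (simp add: Jop_sq)
    qed
    have X2: "X ^ 2 = (- (t\<^sup>2)) *\<^sub>R (nu x * nu x)"
      by (simp add: X_def power2_eq_square JJ)
    have Ap: "app (\<Sum>n<3. X ^ n /\<^sub>R fact n) \<phi> p = A p" for p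
    proof -
      have "(\<Sum>n<3. X ^ n /\<^sub>R fact n) = 1 + X + (1/2) *\<^sub>R X ^ 2"
        by (simp add: eval_nat_numeral)
      then have Se: "(\<Sum>n<3. X ^ n /\<^sub>R fact n) = 1 + X + (1/2) *\<^sub>R ((- (t\<^sup>2)) *\<^sub>R (nu x * nu x))"
        by (simp only: X2)
      show ?thesis
        unfolding Se unfolding X_def A_def B1_def B2_def
        by (simp only: app.add_left app.scaleR_left apply_bcontfun_simps app_mult app_one app_mulc)
          (simp add: scaleR_conv_of_real)
    qed
    have "norm (app (\<Sum>n<3. X ^ n /\<^sub>R fact n) \<phi>) \<le> (1 - t\<^sup>2 / (2 * real M)) * norm \<phi> + \<epsilon>"
      by (rule norm_bound) (simp only: Ap nA)
    moreover have "norm (app (exp X) \<phi> - app (\<Sum>n<3. X ^ n /\<^sub>R fact n) \<phi>) \<le> (t\<^sup>2 / (4 * real M)) * norm \<phi>"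
    proof -
      have "norm (app (exp X) \<phi> - app (\<Sum>n<3. X ^ n /\<^sub>R fact n) \<phi>) \<le> norm (exp X - (\<Sum>n<3. X ^ n /\<^sub>R fact n)) * norm \<phi>"
        unfolding app.diff_left[symmetric] by (rule norm_app)
      also have "\<dots> \<le> (t\<^sup>2 / (4 * real M)) * norm \<phi>"
      proof (rule mult_right_mono)
        \<comment> \<open>The cubic remainder consumes half of the gain t^2 / (2 M); the range |t|
          \<le> 1 / (8 M) is chosen for this.\<close>
        have "norm X ^ 3 * exp (norm X) \<le> \<bar>t\<bar> ^ 3 * 2"
        proof (intro mult_mono power_mono nX)
          have "norm (exp (norm X)) \<le> 2" using nX t8 by (intro exp_bound_half) simp
          then show "exp (norm X) \<le> 2" by simp
        qed auto
        also have "\<dots> = t\<^sup>2 * (2 * \<bar>t\<bar>)" by (simp add: eval_nat_numeral)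
        also have "\<dots> \<le> t\<^sup>2 * (1 / (4 * real M))"
          using t by (intro mult_left_mono) auto
        finally show "norm (exp X - (\<Sum>n<3. X ^ n /\<^sub>R fact n)) \<le> t\<^sup>2 / (4 * real M)"
          using exp_remainder[of X 3] by simp
      qed simp
      finally show ?thesis .
    qed
    ultimately have "norm (app (exp X) \<phi>) \<le> (1 - t\<^sup>2 / (2 * real M)) * norm \<phi> + \<epsilon> + (t\<^sup>2 / (4 * real M)) * norm \<phi>"
      using norm_triangle_sub[of "app (exp X) \<phi>" "app (\<Sum>n<3. X ^ n /\<^sub>R fact n) \<phi>"] by linarith
    also have "\<dots> = (1 - t\<^sup>2 / (4 * real M)) * norm \<phi> + \<epsilon>"
    proof -
      have "t\<^sup>2 / (2 * real M) = 2 * (t\<^sup>2 / (4 * real M))" by simp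
      then show ?thesis by (simp only:) (simp add: algebra_simps)
    qed
    finally show ?thesis by (simp add: X_def)
  qed
  show ?thesis
    by (rule eventually_mono[OF nu_far[OF \<phi> \<epsilon> C(1)]]) (use main in blast)
qed

lemma indep:
  assumes "finite \<K>" "\<And>\<phi>. \<phi> \<in> \<K> \<Longrightarrow> c0 \<phi>" "\<epsilon> > 0"
  shows "eventually (\<lambda>x. \<forall>\<phi>\<in>\<K>. \<forall>t. \<bar>t\<bar> \<le> 1 / (8 * real M) \<longrightarrow>
    norm (app (exp (t *\<^sub>R (Jop * nu x))) \<phi>) \<le> (1 - t\<^sup>2 / (4 * real M)) * norm \<phi> + \<epsilon>) XX"
  by (rule eventually_ball_finite[OF assms(1)]) (use indep1 assms in blast)

end

section \<open>Rapidly decaying orbits\<close>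

text \<open>\<open>exp (X j)\<close> is \<open>exp (X j - A) * exp A\<close> by commutativity, and
  the first factor tends to 1.\<close>

lemma tendsto_exp_commuting:
  fixes X :: "nat \<Rightarrow> 'a::{real_normed_algebra_1,banach}"
  assumes X: "X \<longlonglongrightarrow> A" and c: "\<And>j. X j * A = A * X j"
  shows "(\<lambda>j. exp (X j)) \<longlonglongrightarrow> exp A"
proof -
  have D: "(\<lambda>j. X j - A) \<longlonglongrightarrow> 0" using X by (rule LIM_zero)
  have "(\<lambda>j. norm (X j - A) * exp (norm (X j - A))) \<longlonglongrightarrow> norm (0::'a) * exp (norm (0::'a))"
    by (intro tendsto_mult tendsto_exp tendsto_norm D)
  then have b: "(\<lambda>j. norm (X j - A) * exp (norm (X j - A))) \<longlonglongrightarrow> 0" by simp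
  have "(\<lambda>j. exp (X j - A) - 1) \<longlonglongrightarrow> 0"
  proof (rule Lim_null_comparison[OF always_eventually b], rule allI)
    show "norm (exp (X j - A) - 1) \<le> norm (X j - A) * exp (norm (X j - A))" for j
      using exp_remainder[of "X j - A" 1] by simp
  qed
  then have "(\<lambda>j. exp (X j - A)) \<longlonglongrightarrow> 1" by (rule LIM_zero_cancel)
  then have "(\<lambda>j. exp (X j - A) * exp A) \<longlonglongrightarrow> 1 * exp A" by (intro tendsto_mult tendsto_const)
  moreover have "exp (X j) = exp (X j - A) * exp A" for j
    using exp_add_commuting[of "X j - A" A] c by (simp add: left_diff_distrib right_diff_distrib)
  ultimately show ?thesis by simp
qed

text \<open>All the contraction takes place in the block from J to 2 J; afterwards only the errors
  (1/2) ^ j accumulate.\<close>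

lemma decay_seq:
  fixes \<psi> :: "nat \<Rightarrow> real" and \<rho> :: real
  assumes \<rho>: "0 \<le> \<rho>" "\<rho> \<le> 1" and B: "\<And>j. \<psi> j \<le> B"
    and step: "\<And>j. J \<le> j \<Longrightarrow> \<psi> (Suc j) \<le> \<psi> j + (1/2) ^ j"
    and step': "\<And>j. J \<le> j \<Longrightarrow> j < 2 * J \<Longrightarrow> \<psi> (Suc j) \<le> \<rho> * \<psi> j + (1/2) ^ j"
    and j: "2 * J \<le> j"
  shows "\<psi> j \<le> \<rho> ^ J * B + 2 * (1/2) ^ J"
proof -
  define h where "h n = (1/2 :: real) ^ n" for n :: nat
  have h: "2 * h (Suc n) = h n" "0 \<le> h n" for n by (simp_all add: h_def)
  have hmono: "h n \<le> h m" if "m \<le> n" for m n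
    unfolding h_def using that by (intro power_decreasing) auto
  \<comment> \<open>\<open>2 * (h J - h j)\<close> is the sum of the errors from J to j - 1. The
    third premise is 2 h (n + 1) = h n, which adds one more error to that sum.\<close>
  have key: "p \<le> X + 2 * (c - v)" if "p \<le> r + w" "r \<le> X + 2 * (c - w)" "2 * v = w" for p r X c v w :: real
    using that by (simp add: algebra_simps)
  have a: "\<psi> (J + i) \<le> \<rho> ^ i * B + 2 * (h J - h (J + i))" if "i \<le> J" for i
    using that
  proof (induction i)
    case 0
    show ?case using B[of J] by (simp only: add_0_right power_0 mult_1_left diff_self mult_zero_right)
  next
    case (Suc i)
    have IH: "\<psi> (J + i) \<le> \<rho> ^ i * B + 2 * (h J - h (J + i))" by (rule Suc.IH) (use Suc.prems in simp)
    have "J \<le> J + i" "J + i < 2 * J" using Suc.prems by simp_all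
    then have "\<psi> (Suc (J + i)) \<le> \<rho> * \<psi> (J + i) + h (J + i)" unfolding h_def by (rule step')
    moreover have "\<rho> * \<psi> (J + i) \<le> \<rho> ^ Suc i * B + 2 * (h J - h (J + i))"
    proof -
      have "\<rho> * \<psi> (J + i) \<le> \<rho> * (\<rho> ^ i * B + 2 * (h J - h (J + i)))"
        by (rule mult_left_mono[OF IH \<rho>(1)])
      also have "\<dots> = \<rho> ^ Suc i * B + \<rho> * (2 * (h J - h (J + i)))"
        by (simp only: distrib_left power_Suc mult.assoc)
      also have "\<dots> \<le> \<rho> ^ Suc i * B + 1 * (2 * (h J - h (J + i)))"
        by (intro add_left_mono mult_right_mono \<rho>(2)) (use hmono[of J "J + i"] in simp)
      finally show ?thesis by (simp only: mult_1_left)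
    qed
    ultimately have "\<psi> (Suc (J + i)) \<le> \<rho> ^ Suc i * B + 2 * (h J - h (Suc (J + i)))"
      using h(1)[of "J + i"] by (rule key)
    then show ?case by (simp only: add_Suc_right)
  qed
  have b: "\<psi> (2 * J + i) \<le> \<rho> ^ J * B + 2 * (h J - h (2 * J + i))" for i
  proof (induction i)
    case 0
    show ?case using a[OF order_refl] by (simp only: mult_2 add_0_right)
  next
    case (Suc i)
    have "J \<le> 2 * J + i" by simp
    then have "\<psi> (Suc (2 * J + i)) \<le> \<psi> (2 * J + i) + h (2 * J + i)" unfolding h_def by (rule step)
    from this Suc h(1)[of "2 * J + i"] have "\<psi> (Suc (2 * J + i)) \<le> \<rho> ^ J * B + 2 * (h J - h (Suc (2 * J + i)))"
      by (rule key)
    then show ?case by (simp only: add_Suc_right)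
  qed
  have "\<psi> j \<le> \<rho> ^ J * B + 2 * (h J - h j)" using b[of "j - 2 * J"] j by simp
  also have "\<dots> \<le> \<rho> ^ J * B + 2 * h J" using h(2)[of j] by simp
  finally show ?thesis by (simp only: h_def)
qed

context almost_abelian begin

section \<open>A starting function of positive type\<close>

lemma exists_bump:
  "\<exists>k :: 'g \<Rightarrow>\<^sub>C complex. (\<exists>K. compact K \<and> (\<forall>x. x \<notin> K \<longrightarrow> k x = 0)) \<and> (\<forall>x. 0 \<le> Re (k x) \<and> Im (k x) = 0) \<and> k e = 1"
proof -
  obtain k :: "'g \<Rightarrow> real" and K where k: "continuous_on UNIV k" "\<And>x. 0 \<le> k x" "\<And>x. k x \<le> 1"
    "\<And>x. x \<in> {e} \<Longrightarrow> k x = 1" "compact K" "K \<subseteq> UNIV" "\<And>x. x \<notin> K \<Longrightarrow> k x = 0"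
    by (rule urysohn[of "{e}" UNIV]) auto
  have b: "(\<lambda>x. complex_of_real (k x)) \<in> bcontfun"
    by (rule bcontfun_normI[where b = 1]) (use k(1,2,3) in \<open>auto intro!: continuous_intros\<close>)
  have "apply_bcontfun (Bcontfun (\<lambda>x. complex_of_real (k x))) = (\<lambda>x. complex_of_real (k x))"
    by (rule Bcontfun_inverse[OF b])
  then show ?thesis using k by (intro exI[of _ "Bcontfun (\<lambda>x. complex_of_real (k x))"]) auto
qed

definition k0 :: "'g \<Rightarrow>\<^sub>C complex" where
  "k0 = (SOME k :: _ \<Rightarrow>\<^sub>C _. (\<exists>K. compact K \<and> (\<forall>x. x \<notin> K \<longrightarrow> k x = 0)) \<and> (\<forall>x. 0 \<le> Re (k x) \<and> Im (k x) = 0) \<and> k e = 1)"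

lemma k0: "\<exists>K. compact K \<and> (\<forall>x. x \<notin> K \<longrightarrow> k0 x = 0)" "0 \<le> Re (k0 x)" "Im (k0 x) = 0" "k0 e = 1"
  using someI_ex[OF exists_bump] unfolding k0_def[symmetric] by blast+

lemma k0_integrable: "integrable \<mu> (apply_bcontfun k0)"
  using k0(1) by (metis ccont_integrable continuous_on_apply_bcontfun)

definition B0 :: real where "B0 = (\<integral>x. (norm (k0 x))\<^sup>2 \<partial>\<mu>)"

lemma sq_integrable:
  fixes k :: "'g \<Rightarrow>\<^sub>C complex"
  assumes "integrable \<mu> (apply_bcontfun k)"
  shows "integrable \<mu> (\<lambda>x. (norm (apply_bcontfun k x))\<^sup>2)"
proof -
  have "integrable \<mu> (\<lambda>x. k x * app cnjop k x)" by (rule pair_integrable[OF assms])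
  then have "integrable \<mu> (\<lambda>x. norm (k x * app cnjop k x))" by (rule integrable_norm)
  then show ?thesis by (simp add: norm_mult power2_eq_square)
qed

lemma pair_cnj: assumes "integrable \<mu> (apply_bcontfun k)"
  shows "pair k (app cnjop k) = of_real (\<integral>x. (norm (apply_bcontfun k x))\<^sup>2 \<partial>\<mu>)"
  unfolding pair_def integral_complex_of_real[symmetric]
  by (intro Bochner_Integration.integral_cong refl) (simp add: complex_norm_square[symmetric])

lemma B0_pos: "B0 > 0"
proof -
  have i: "integrable \<mu> (\<lambda>x. (norm (k0 x))\<^sup>2)" by (rule sq_integrable[OF k0_integrable])
  have "B0 \<noteq> 0"
  proof
    assume "B0 = 0"
    then have ae: "AE x in \<mu>. (norm (k0 x))\<^sup>2 = 0"
      using integral_nonneg_eq_0_iff_AE[OF i] by (simp add: B0_def)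
    have op: "open {x. 0 < norm (k0 x)}" by (intro open_Collect_less continuous_intros) simp
    have "e \<in> {x. 0 < norm (k0 x)}" by (simp add: k0(4))
    then have pos: "emeasure \<mu> {x. 0 < norm (k0 x)} > 0" using emeasure_open_pos[OF op] by blast
    have "{x. 0 < norm (k0 x)} \<in> null_sets \<mu>"
      using ae op by (subst AE_iff_null_sets) (auto elim: eventually_mono)
    with pos show False by (simp add: null_sets_def)
  qed
  moreover have "B0 \<ge> 0" unfolding B0_def by (rule integral_nonneg_AE) simp
  ultimately show ?thesis by simp
qed

text \<open>A coefficient of the regular representation at the real vector \<open>k0\<close>. An
  operator commuting with \<open>theta k0\<close> acts on it by acting on one copy of
  \<open>k0\<close>, which turns L2 bounds into supremum bounds.\<close>

definition phi0 :: "'g \<Rightarrow>\<^sub>C complex" where "phi0 = app (theta k0) k0"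

lemma phi0_pt: "phi0 p = (\<integral>z. k0 z * k0 (p \<cdot> z) \<partial>\<mu>)"
  by (simp add: phi0_def app_theta[OF k0_integrable])

lemma phi0_e: "phi0 e \<noteq> 0"
proof -
  have "phi0 e = pair k0 (app cnjop k0)"
    unfolding phi0_pt pair_def using k0(3)
    by (intro Bochner_Integration.integral_cong refl) (simp add: complex_eq_iff)
  also have "\<dots> = of_real B0" by (simp add: pair_cnj[OF k0_integrable] B0_def)
  finally show ?thesis using B0_pos by simp
qed

lemma phi0_c0: "c0 phi0"
  unfolding c0_def
proof (intro allI impI)
  fix \<epsilon> :: real assume "\<epsilon> > 0"
  obtain K where K: "compact K" "\<And>x. x \<notin> K \<Longrightarrow> k0 x = 0" using k0(1) by blast
  define C where "C = (\<lambda>p. fst p \<cdot> snd p) ` (K \<times> (ginv ` K))"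
  have "compact C"
    unfolding C_def
    using compact_mult_image[OF K(1) compact_continuous_image[OF _ K(1)] continuous_on_id, of ginv]
    by (simp add: continuous_on_ginv continuous_on_id)
  moreover have "norm (phi0 p) \<le> \<epsilon>" if p: "p \<notin> C" for p
  proof -
    have "k0 z * k0 (p \<cdot> z) = 0" for z
    proof (rule ccontr)
      assume "k0 z * k0 (p \<cdot> z) \<noteq> 0"
      then have "z \<in> K" "p \<cdot> z \<in> K" using K(2) by auto
      then have "(p \<cdot> z) \<cdot> ginv z \<in> C" unfolding C_def by force
      then show False using p by (simp add: assoc)
    qed
    then show ?thesis
      using \<open>\<epsilon> > 0\<close> by (simp only: phi0_pt Bochner_Integration.integral_zero norm_zero less_imp_le)
  qed
  ultimately show "\<exists>C. compact C \<and> (\<forall>p. p \<notin> C \<longrightarrow> norm (phi0 p) \<le> \<epsilon>)" by blast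
qed

lemma calg_exp: "W \<in> calg \<Longrightarrow> exp (t *\<^sub>R (Jop * W)) \<in> calg"
  by (intro closed_subalg_exp closed_subalgD(4,5) closed_subalg_calg mulc_calg)

lemma sym1_expJ:
  assumes "W \<in> calg" "sym1 W c"
  shows "sym1 (exp (t *\<^sub>R (Jop * W))) (exp (\<bar>t\<bar> * c))"
proof -
  have "sym1 (Jop * W) (norm \<i> * c)"
    by (rule sym1_mult[OF sym1_mulc assms(2)]) (simp add: calgD(3)[OF assms(1)])
  from sym1_exp[OF sym1_scaleR[OF this, of t]] show ?thesis by simp
qed

text \<open>\<open>exp (t J W)\<close> is unitary on \<open>L\<^sup>2\<close>, because \<open>W\<close> is symmetric and real.\<close>
lemma expJ_unitary:
  assumes W: "W \<in> calg" "sym1 W c" "cnjop * W = W * cnjop"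
    and k: "integrable \<mu> (apply_bcontfun k)"
  shows "(\<integral>x. (norm (app (exp (t *\<^sub>R (Jop * W))) k x))\<^sup>2 \<partial>\<mu>) = (\<integral>x. (norm (k x))\<^sup>2 \<partial>\<mu>)"
proof -
  define A where "A = t *\<^sub>R (Jop * W)"
  note s = sym1_expJ[OF W(1,2), of t, folded A_def]
  have Dk: "integrable \<mu> (apply_bcontfun (app (exp A) k))" by (rule sym1D(2)[OF s k])
  \<comment> \<open>Conjugation anticommutes with multiplication by i and commutes with W, so it
    carries exp A to its inverse exp (- A).\<close>
  have "cnjop * A = (- A) * cnjop"
  proof -
    have "cnjop * (Jop * W) = (cnjop * Jop) * W" by (simp add: mult.assoc)
    also have "\<dots> = - (Jop * (cnjop * W))" by (simp add: cnjop_Jop mult.assoc)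
    also have "\<dots> = - (Jop * W) * cnjop" by (simp add: W(3) mult.assoc)
    finally show ?thesis unfolding A_def mult_scaleR_right mult_scaleR_left scaleR_minus_right[symmetric] by simp
  qed
  then have inter: "cnjop * exp A = exp (- A) * cnjop" by (rule exp_intertwine)
  have inv: "exp A * exp (- A) = 1" by (rule exp_minus_inverse)
  have "app cnjop (app (exp A) k) = app (exp (- A)) (app cnjop k)"
    using arg_cong[OF inter, of "\<lambda>T. app T k"] by simp
  then have "pair (app (exp A) k) (app cnjop (app (exp A) k)) = pair (app (exp A) k) (app (exp (- A)) (app cnjop k))"
    by simp
  also have "\<dots> = pair k (app (exp A) (app (exp (- A)) (app cnjop k)))" by (rule sym1D(4)[OF s k])
  also have "\<dots> = pair k (app cnjop k)"
    using arg_cong[OF inv, of "\<lambda>T. app T (app cnjop k)"] by simp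
  finally show ?thesis
    unfolding pair_cnj[OF Dk] pair_cnj[OF k] A_def[symmetric] by (simp only: of_real_eq_iff)
qed

text \<open>The exponential passes through \<open>theta k0\<close> onto one copy of
  \<open>k0\<close>. The integral of a product is at most half the sum of the two squared L2 norms,
  both equal to \<open>B0\<close>. Unlike a bound by the operator norm, this depends neither on t
  nor on W.\<close>

lemma psd_bound:
  assumes W: "W \<in> calg" "sym1 W c" "cnjop * W = W * cnjop"
  shows "norm (app (exp (t *\<^sub>R (Jop * W))) phi0) \<le> B0"
proof (rule norm_bound)
  fix p
  define D where "D = exp (t *\<^sub>R (Jop * W))"
  have Dc: "D \<in> calg" unfolding D_def by (rule calg_exp[OF W(1)])
  have Dk: "integrable \<mu> (apply_bcontfun (app D k0))"
    unfolding D_def by (rule sym1D(2)[OF sym1_expJ[OF W(1,2)] k0_integrable])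
  have "app D phi0 = app (theta k0) (app D k0)"
    using arg_cong[OF calgD(4)[OF Dc k0_integrable], of "\<lambda>T. app T k0"] by (simp add: phi0_def)
  then have "norm (app D phi0 p) = norm (\<integral>z. k0 z * app D k0 (p \<cdot> z) \<partial>\<mu>)"
    by (simp add: app_theta[OF k0_integrable])
  also have "\<dots> \<le> (\<integral>z. norm (k0 z * app D k0 (p \<cdot> z)) \<partial>\<mu>)" by (rule integral_norm_bound)
  also have "\<dots> \<le> (\<integral>z. (1/2) * ((norm (k0 z))\<^sup>2 + (norm (app D k0 (p \<cdot> z)))\<^sup>2) \<partial>\<mu>)"
  proof (rule integral_mono)
    show "integrable \<mu> (\<lambda>z. norm (k0 z * app D k0 (p \<cdot> z)))"
      using norm_integral_mult_le(1)[OF k0_integrable translate_bcontfun_meas(1) norm_bounded]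
      by (rule integrable_norm)
    show "integrable \<mu> (\<lambda>z. (1/2) * ((norm (k0 z))\<^sup>2 + (norm (app D k0 (p \<cdot> z)))\<^sup>2))"
      using sq_integrable[OF k0_integrable] integrable_translate[OF sq_integrable[OF Dk], of p]
      by (intro integrable_mult_right Bochner_Integration.integrable_add)
    fix z
    show "norm (k0 z * app D k0 (p \<cdot> z)) \<le> (1/2) * ((norm (k0 z))\<^sup>2 + (norm (app D k0 (p \<cdot> z)))\<^sup>2)"
      using sum_squares_bound[of "norm (k0 z)" "norm (app D k0 (p \<cdot> z))"] by (simp add: norm_mult)
  qed
  also have "\<dots> = (1/2) * ((\<integral>z. (norm (k0 z))\<^sup>2 \<partial>\<mu>) + (\<integral>z. (norm (app D k0 (p \<cdot> z)))\<^sup>2 \<partial>\<mu>))"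
    using sq_integrable[OF k0_integrable] integrable_translate[OF sq_integrable[OF Dk], of p]
    by (simp only: integral_mult_right_zero Bochner_Integration.integral_add)
  also have "(\<integral>z. (norm (app D k0 (p \<cdot> z)))\<^sup>2 \<partial>\<mu>) = (\<integral>z. (norm (app D k0 z))\<^sup>2 \<partial>\<mu>)"
    using borel_measurable_integrable[OF sq_integrable[OF Dk]]
    by (rule integral_translate)
  also have "\<dots> = B0"
    unfolding D_def B0_def by (rule expJ_unitary[OF W k0_integrable])
  finally show "norm (app (exp (t *\<^sub>R (Jop * W))) phi0 p) \<le> B0"
    by (simp add: D_def B0_def)
qed

text \<open>Summable, so that the averages add up to V, yet slow: |n| \<open>av j\<close> is of
  order one for j of order sqrt |n|. About sqrt |n| stages therefore contract the n-th term of the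
  orbit.\<close>

definition av :: "nat \<Rightarrow> real" where "av j = 1 / (real j + 1)\<^sup>2"

lemma av: "0 < av j" "av j \<le> 1" "summable av"
proof -
  show "0 < av j" by (simp add: av_def)
  show "av j \<le> 1" by (simp add: av_def divide_le_eq_1)
  have "summable (\<lambda>n. inverse (real (Suc n) ^ 2))"
    by (subst summable_Suc_iff) (rule inverse_power_summable, simp)
  then show "summable av" by (simp add: av_def[abs_def] inverse_eq_divide add.commute)
qed

definition goodW :: "nat \<Rightarrow> 'g cbop \<Rightarrow> bool" where
  "goodW j W \<longleftrightarrow> W \<in> calg \<and> sym1 W (\<Sum>i<j. av i) \<and> cnjop * W = W * cnjop"

text \<open>At stage j only finitely many integers n satisfy the condition, so one far x can serve
  all of them. The average added at stage j acts at time n with strength n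
  \<open>av j\<close>.\<close>

definition stepW :: "nat \<Rightarrow> 'g cbop \<Rightarrow> 'g cbop \<Rightarrow> bool" where
  "stepW j W W' \<longleftrightarrow> (\<exists>x\<in>N. W' = W + av j *\<^sub>R nu x \<and> (\<forall>n::int. \<bar>real_of_int n\<bar> * av j \<le> 1 / (8 * real M) \<longrightarrow>
     norm (app (exp (real_of_int n *\<^sub>R (Jop * W'))) phi0) \<le>
     (1 - (real_of_int n * av j)\<^sup>2 / (4 * real M)) * norm (app (exp (real_of_int n *\<^sub>R (Jop * W))) phi0) + (1/2) ^ j))"

lemma goodW_step:
  assumes W: "goodW j W"
  shows "\<exists>W'. goodW (Suc j) W' \<and> stepW j W W'"
proof -
  have Wc: "W \<in> calg" and Ws: "sym1 W (\<Sum>i<j. av i)" and Wr: "cnjop * W = W * cnjop"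
    using W by (auto simp: goodW_def)
  define r where "r = 1 / (8 * real M) / av j"
  \<comment> \<open>These times, and with them the family to be contracted, are finite in number
    because \<open>av j\<close> is positive.\<close>
  define Ns where "Ns = {n::int. \<bar>real_of_int n\<bar> * av j \<le> 1 / (8 * real M)}"
  have "Ns \<subseteq> {- \<lceil>r\<rceil>..\<lceil>r\<rceil>}"
  proof
    fix n assume "n \<in> Ns"
    then have "\<bar>real_of_int n\<bar> \<le> r" using av(1)[of j] by (simp only: Ns_def r_def mem_Collect_eq pos_le_divide_eq)
    then show "n \<in> {- \<lceil>r\<rceil>..\<lceil>r\<rceil>}" by (simp add: abs_le_iff) linarith
  qed
  then have fin: "finite Ns" by (rule finite_subset) simp
  define \<K> where "\<K> = (\<lambda>n::int. app (exp (real_of_int n *\<^sub>R (Jop * W))) phi0) ` Ns"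
  have "eventually (\<lambda>x. x \<in> N \<and> (\<forall>\<phi>\<in>\<K>. \<forall>t. \<bar>t\<bar> \<le> 1 / (8 * real M) \<longrightarrow>
    norm (app (exp (t *\<^sub>R (Jop * nu x))) \<phi>) \<le> (1 - t\<^sup>2 / (4 * real M)) * norm \<phi> + (1/2) ^ j)) XX"
    using fin calgD(5)[OF calg_exp[OF Wc] phi0_c0]
    by (intro eventually_conj eventually_XX_N indep) (auto simp: \<K>_def)
  then obtain x where x: "x \<in> N" "\<forall>\<phi>\<in>\<K>. \<forall>t. \<bar>t\<bar> \<le> 1 / (8 * real M) \<longrightarrow>
    norm (app (exp (t *\<^sub>R (Jop * nu x))) \<phi>) \<le> (1 - t\<^sup>2 / (4 * real M)) * norm \<phi> + (1/2) ^ j"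
    using eventually_happens'[OF XX_ne_bot] by blast
  define W' where "W' = W + av j *\<^sub>R nu x"
  have g: "goodW (Suc j) W'"
    unfolding goodW_def
  proof (intro conjI)
    show "W' \<in> calg"
      unfolding W'_def by (intro closed_subalgD(3,5)[OF closed_subalg_calg] Wc nu_calg x(1))
    show "sym1 W' (\<Sum>i<Suc j. av i)"
      using sym1_add[OF Ws sym1_scaleR[OF sym1_nu[OF x(1)], of "av j"]] av(1)[of j] by (simp add: W'_def)
    show "cnjop * W' = W' * cnjop"
      by (simp only: W'_def distrib_left distrib_right Wr mult_scaleR_left mult_scaleR_right nu_cnj)
  qed
  have ex: "exp (real_of_int n *\<^sub>R (Jop * W')) = exp ((real_of_int n * av j) *\<^sub>R (Jop * nu x)) * exp (real_of_int n *\<^sub>R (Jop * W))" for n :: int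
  proof -
    have JW: "W * Jop = Jop * W" by (rule calgD(3)[OF Wc])
    have Jn: "nu x * Jop = Jop * nu x" by (rule calgD(3)[OF nu_calg[OF x(1)]])
    have "(Jop * nu x) * (Jop * W) = Jop * Jop * (nu x * W)"
      by (simp only: mult.assoc) (simp only: mult.assoc[symmetric] Jn)
    also have "nu x * W = W * nu x" by (rule calg_comm_nu[OF Wc, symmetric])
    also have "Jop * Jop * (W * nu x) = (Jop * W) * (Jop * nu x)"
      by (simp only: mult.assoc) (simp only: mult.assoc[symmetric] JW)
    finally have "(Jop * nu x) * (Jop * W) = (Jop * W) * (Jop * nu x)" .
    then have c: "((real_of_int n * av j) *\<^sub>R (Jop * nu x)) * (real_of_int n *\<^sub>R (Jop * W)) =
        (real_of_int n *\<^sub>R (Jop * W)) * ((real_of_int n * av j) *\<^sub>R (Jop * nu x))"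
      by (simp only: mult_scaleR_left mult_scaleR_right scaleR_scaleR mult.commute)
    have "real_of_int n *\<^sub>R (Jop * W') = (real_of_int n * av j) *\<^sub>R (Jop * nu x) + real_of_int n *\<^sub>R (Jop * W)"
      by (simp only: W'_def distrib_left mult_scaleR_right scaleR_add_right scaleR_scaleR add.commute)
    then show ?thesis by (simp only: exp_add_commuting[OF c])
  qed
  have "stepW j W W'"
    unfolding stepW_def
  proof (intro bexI[of _ x] conjI allI impI)
    fix n :: int assume n: "\<bar>real_of_int n\<bar> * av j \<le> 1 / (8 * real M)"
    then have nN: "app (exp (real_of_int n *\<^sub>R (Jop * W))) phi0 \<in> \<K>" by (auto simp: \<K>_def Ns_def)
    have "\<bar>real_of_int n * av j\<bar> \<le> 1 / (8 * real M)" using n av(1)[of j] by (simp add: abs_mult)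
    with x(2) nN show "norm (app (exp (real_of_int n *\<^sub>R (Jop * W'))) phi0) \<le>
     (1 - (real_of_int n * av j)\<^sup>2 / (4 * real M)) * norm (app (exp (real_of_int n *\<^sub>R (Jop * W))) phi0) + (1/2) ^ j"
      unfolding ex app_mult by blast
  qed (use x(1) in \<open>auto simp: W'_def\<close>)
  then show ?thesis using g by blast
qed

lemma Wseq_exists: "\<exists>W. \<forall>j. goodW j (W j) \<and> stepW j (W j) (W (Suc j))"
proof (rule dependent_nat_choice)
  have "goodW 0 0"
    unfolding goodW_def
    using closed_subalgD(6)[OF closed_subalg_calg] sym1_scaleR[OF sym1_one, of 0] by simp
  then show "\<exists>W. goodW 0 W" ..
qed (rule goodW_step)

text \<open>Given n, let J be the first stage with |n| \<open>av J\<close> \<le> 1 / (8 M). For J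
  \<le> j < 2 J the product |n| \<open>av j\<close> stays above 1 / (72 M), so each step contracts
  by \<rho>, and later steps do no harm. J grows at least like sqrt |n|, so \<rho> ^ J beats every
  power of n.\<close>

lemma V_exists:
  "\<exists>V c. V \<in> calg \<and> sym1 V c \<and>
    (\<forall>s. \<exists>K. \<forall>n::int. norm (app (exp (real_of_int n *\<^sub>R (Jop * V))) phi0) \<le> K / (1 + \<bar>real_of_int n\<bar>) ^ s)"
proof -
  obtain W where W': "\<forall>j. goodW j (W j) \<and> stepW j (W j) (W (Suc j))" using Wseq_exists ..
  have W: "goodW j (W j)" "stepW j (W j) (W (Suc j))" for j
    using W'[rule_format, of j] by simp_all
  have "\<forall>j. \<exists>x. x \<in> N \<and> W (Suc j) = W j + av j *\<^sub>R nu x" using W(2) unfolding stepW_def by blast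
  from choice[OF this] obtain x where x': "\<forall>j. x j \<in> N \<and> W (Suc j) = W j + av j *\<^sub>R nu (x j)" ..
  have x: "x j \<in> N" "W (Suc j) = W j + av j *\<^sub>R nu (x j)" for j
    using x'[rule_format, of j] by simp_all
  have s: "sym1 (av j *\<^sub>R nu (x j)) (av j)" for j
    using sym1_scaleR[OF sym1_nu[OF x(1)], of "av j" j] av(1)[of j] by simp
  have sm: "summable (\<lambda>j. av j *\<^sub>R nu (x j))"
    by (rule summable_comparison_test'[OF av(3)]) (use sym1D(1)[OF s] in auto)
  define V where "V = (\<Sum>j. av j *\<^sub>R nu (x j))"
  have Vs: "sym1 V (suminf av)" unfolding V_def by (rule sym1_suminf[OF s av(3)])
  have Vc: "V \<in> calg"
    unfolding V_def by (intro closed_subalg_suminf[OF closed_subalg_calg] sm closed_subalgD(5)[OF closed_subalg_calg] nu_calg x)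
  have W0: "W 0 = 0" using sym1D(1)[of "W 0" 0] W(1)[of 0] by (simp add: goodW_def)
  have Wj: "W = (\<lambda>j. \<Sum>i<j. av i *\<^sub>R nu (x i))"
  proof
    show "W j = (\<Sum>i<j. av i *\<^sub>R nu (x i))" for j
      by (induction j) (simp_all only: W0 x(2) sum.lessThan_Suc lessThan_0 sum.empty)
  qed
  have WV: "W \<longlonglongrightarrow> V"
    unfolding V_def by (subst Wj) (rule summable_LIMSEQ[OF sm])
  define \<psi> where "\<psi> n j = norm (app (exp (real_of_int n *\<^sub>R (Jop * W j))) phi0)" for n :: int and j
  have lim: "(\<lambda>j. \<psi> n j) \<longlonglongrightarrow> norm (app (exp (real_of_int n *\<^sub>R (Jop * V))) phi0)" for n
    unfolding \<psi>_def
  proof (intro tendsto_norm app.tendsto tendsto_const tendsto_exp_commuting tendsto_scaleR tendsto_mult WV)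
    have a: "W j * V = V * W j" for j
      unfolding fun_cong[OF Wj, of j]
      by (rule sum_comm) (simp only: mult_scaleR_left mult_scaleR_right calg_comm_nu[OF Vc])
    have JV: "V * Jop = Jop * V" by (rule calgD(3)[OF Vc])
    have JW: "W j * Jop = Jop * W j" for j
      using W(1)[of j] calgD(3) unfolding goodW_def by blast
    have "(Jop * W j) * (Jop * V) = Jop * Jop * (W j * V)" for j
      by (simp only: mult.assoc) (simp only: mult.assoc[symmetric] JW)
    moreover have "Jop * Jop * (V * W j) = (Jop * V) * (Jop * W j)" for j
      by (simp only: mult.assoc) (simp only: mult.assoc[symmetric] JV)
    ultimately have "(Jop * W j) * (Jop * V) = (Jop * V) * (Jop * W j)" for j by (simp only: a)
    then show "(real_of_int n *\<^sub>R (Jop * W j)) * (real_of_int n *\<^sub>R (Jop * V)) =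
        (real_of_int n *\<^sub>R (Jop * V)) * (real_of_int n *\<^sub>R (Jop * W j))" for j
      by (simp only: mult_scaleR_left mult_scaleR_right)
  qed
  \<comment> \<open>Positive type gives a starting value independent of n; an exponential bound here
    would outweigh the gain.\<close>
  have \<psi>B: "\<psi> n j \<le> B0" for n j
    using W(1)[of j] unfolding \<psi>_def goodW_def by (intro psd_bound) auto
  have st: "\<psi> n (Suc j) \<le> (1 - (real_of_int n * av j)\<^sup>2 / (4 * real M)) * \<psi> n j + (1/2) ^ j"
    if "\<bar>real_of_int n\<bar> * av j \<le> 1 / (8 * real M)" for n j
    using W(2)[of j] that unfolding stepW_def \<psi>_def by blast
  have M1: "1 \<le> real M" using M_pos by simp
  \<comment> \<open>72 = 9 * 8: minimality of J gives J^2 < 8 M |n|, and (j + 1)^2 \<le> (3 J)^2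
    inside the block.\<close>
  define \<rho> where "\<rho> = 1 - (1 / (72 * real M))\<^sup>2 / (4 * real M)"
  have small: "(1 / (72 * real M))\<^sup>2 / (4 * real M) \<le> 1/4" "0 < (1 / (72 * real M))\<^sup>2 / (4 * real M)"
  proof -
    have "1 / (72 * real M) \<le> 1" using M1 by simp
    then have "(1 / (72 * real M))\<^sup>2 \<le> 1" by (intro power_le_one) auto
    then show "(1 / (72 * real M))\<^sup>2 / (4 * real M) \<le> 1/4" using M1 by (intro frac_le) auto
    show "0 < (1 / (72 * real M))\<^sup>2 / (4 * real M)" using M1 by (intro divide_pos_pos) auto
  qed
  have \<rho>: "1/2 \<le> \<rho>" "\<rho> < 1" using small by (auto simp: \<rho>_def)
  have bound: "\<exists>J. (1 + \<bar>real_of_int n\<bar>) \<le> (real J + 2)\<^sup>2 \<and>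
      norm (app (exp (real_of_int n *\<^sub>R (Jop * V))) phi0) \<le> \<rho> ^ J * (B0 + 2)" for n :: int
  proof -
    define P where "P J \<longleftrightarrow> \<bar>real_of_int n\<bar> * av J \<le> 1 / (8 * real M)" for J
    have Piff: "P J \<longleftrightarrow> 8 * real M * \<bar>real_of_int n\<bar> \<le> (real J + 1)\<^sup>2" for J
    proof -
      have M8: "0 < 8 * real M" and J1: "0 < (real J + 1)\<^sup>2" using M1 by auto
      have "P J \<longleftrightarrow> \<bar>real_of_int n\<bar> / (real J + 1)\<^sup>2 \<le> 1 / (8 * real M)"
        by (simp only: P_def av_def times_divide_eq_right mult_1_right)
      also have "\<dots> \<longleftrightarrow> \<bar>real_of_int n\<bar> \<le> (real J + 1)\<^sup>2 / (8 * real M)"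
        by (simp only: pos_divide_le_eq[OF J1] times_divide_eq_left mult_1_left)
      also have "\<dots> \<longleftrightarrow> 8 * real M * \<bar>real_of_int n\<bar> \<le> (real J + 1)\<^sup>2"
        unfolding pos_le_divide_eq[OF M8] by (simp only: mult.commute)
      finally show ?thesis .
    qed
    have Pmono: "P j" if "P i" "i \<le> j" for i j
    proof -
      have "(real i + 1)\<^sup>2 \<le> (real j + 1)\<^sup>2" using that by (intro power_mono) auto
      then show ?thesis using that Piff by (meson order_trans)
    qed
    obtain J' :: nat where "8 * real M * \<bar>real_of_int n\<bar> \<le> real J'" using real_arch_simple by blast
    moreover have "real J' \<le> (real J' + 1)\<^sup>2" by (simp add: power2_eq_square algebra_simps)
    ultimately have exP: "\<exists>J. P J" unfolding Piff by (meson order_trans)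
    define J where "J = (LEAST J. P J)"
    have PJ: "P J" unfolding J_def by (rule LeastI_ex[OF exP])
    have step1: "\<psi> n (Suc j) \<le> \<psi> n j + (1/2) ^ j" if "J \<le> j" for j
    proof -
      have "\<psi> n (Suc j) \<le> (1 - (real_of_int n * av j)\<^sup>2 / (4 * real M)) * \<psi> n j + (1/2) ^ j"
        using st Pmono[OF PJ that] unfolding P_def by blast
      also have "\<dots> \<le> 1 * \<psi> n j + (1/2) ^ j"
        using M1 by (intro add_right_mono mult_right_mono) (auto simp: \<psi>_def)
      finally show ?thesis by simp
    qed
    have step2: "\<psi> n (Suc j) \<le> \<rho> * \<psi> n j + (1/2) ^ j" if j: "J \<le> j" "j < 2 * J" for j
    proof -
      have J1: "J \<ge> 1" using j by simp
      have "\<not> P (J - 1)" unfolding J_def by (rule not_less_Least) (use J1 in \<open>simp add: J_def[symmetric]\<close>)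
      then have a: "(real J)\<^sup>2 < 8 * real M * \<bar>real_of_int n\<bar>" unfolding Piff using J1 by (simp add: of_nat_diff)
      have "real j + 1 \<le> 3 * real J" using j J1 by linarith
      then have "(real j + 1)\<^sup>2 \<le> (3 * real J)\<^sup>2" by (intro power_mono) auto
      also have "\<dots> = 9 * (real J)\<^sup>2" by (simp add: power2_eq_square)
      also have "\<dots> \<le> 72 * real M * \<bar>real_of_int n\<bar>" using a by (simp add: mult_ac)
      finally have "(real j + 1)\<^sup>2 \<le> \<bar>real_of_int n\<bar> * (72 * real M)" by (simp only: mult_ac)
      then have "(real j + 1)\<^sup>2 / (72 * real M) \<le> \<bar>real_of_int n\<bar>"
        using M1 by (subst pos_divide_le_eq) auto
      then have "1 / (72 * real M) \<le> \<bar>real_of_int n\<bar> * av j"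
        unfolding av_def times_divide_eq_right mult_1_right by (subst pos_le_divide_eq) auto
      then have "(1 / (72 * real M))\<^sup>2 \<le> (\<bar>real_of_int n\<bar> * av j)\<^sup>2" by (intro power_mono) auto
      then have "(1 / (72 * real M))\<^sup>2 / (4 * real M) \<le> (real_of_int n * av j)\<^sup>2 / (4 * real M)"
        by (intro divide_right_mono) (auto simp: power_mult_distrib)
      then have "(1 - (real_of_int n * av j)\<^sup>2 / (4 * real M)) * \<psi> n j \<le> \<rho> * \<psi> n j"
        by (intro mult_right_mono) (auto simp: \<rho>_def \<psi>_def)
      moreover have "\<psi> n (Suc j) \<le> (1 - (real_of_int n * av j)\<^sup>2 / (4 * real M)) * \<psi> n j + (1/2) ^ j"
        using st Pmono[OF PJ j(1)] unfolding P_def by blast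
      ultimately show ?thesis by linarith
    qed
    have "\<psi> n j \<le> \<rho> ^ J * B0 + 2 * (1/2) ^ J" if "2 * J \<le> j" for j
      by (rule decay_seq[OF _ _ \<psi>B step1 step2 that]) (use \<rho> in auto)
    then have "norm (app (exp (real_of_int n *\<^sub>R (Jop * V))) phi0) \<le> \<rho> ^ J * B0 + 2 * (1/2) ^ J"
      by (intro LIMSEQ_le_const2[OF lim]) blast
    also have "\<dots> \<le> \<rho> ^ J * B0 + 2 * \<rho> ^ J" using \<rho> by (intro add_left_mono mult_left_mono power_mono) auto
    finally have 1: "norm (app (exp (real_of_int n *\<^sub>R (Jop * V))) phi0) \<le> \<rho> ^ J * (B0 + 2)" by (simp add: algebra_simps)
    \<comment> \<open>J is at least of the order of sqrt |n|, so decay in J becomes decay in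
      n.\<close>
    have "\<bar>real_of_int n\<bar> \<le> 8 * real M * \<bar>real_of_int n\<bar>" using mult_right_mono[of 1 "8 * real M" "\<bar>real_of_int n\<bar>"] M1 by simp
    also have "\<dots> \<le> (real J + 1)\<^sup>2" using PJ unfolding Piff .
    finally have "1 + \<bar>real_of_int n\<bar> \<le> (real J + 2)\<^sup>2" by (simp add: power2_eq_square algebra_simps)
    with 1 show ?thesis by blast
  qed
  have "\<exists>K. \<forall>n::int. norm (app (exp (real_of_int n *\<^sub>R (Jop * V))) phi0) \<le> K / (1 + \<bar>real_of_int n\<bar>) ^ s" for s
  proof -
    obtain C where C: "\<And>J::nat. \<rho> ^ J \<le> C / (real J + 2) ^ (2 * s)" using power_decay[of \<rho> "2 * s"] \<rho> by auto
    have C0: "0 \<le> C" 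
    proof (rule ccontr)
      assume "\<not> 0 \<le> C"
      then have "C / (real 0 + 2) ^ (2 * s) < 0" by (intro divide_neg_pos) auto
      then show False using C[of 0] unfolding power_0 by linarith
    qed
    have "norm (app (exp (real_of_int n *\<^sub>R (Jop * V))) phi0) \<le> (C * (B0 + 2)) / (1 + \<bar>real_of_int n\<bar>) ^ s" for n :: int
    proof -
      obtain J where J: "(1 + \<bar>real_of_int n\<bar>) \<le> (real J + 2)\<^sup>2"
        "norm (app (exp (real_of_int n *\<^sub>R (Jop * V))) phi0) \<le> \<rho> ^ J * (B0 + 2)" using bound by blast
      have "\<rho> ^ J \<le> C / ((real J + 2)\<^sup>2) ^ s" using C[of J] by (simp add: power_mult)
      also have "\<dots> \<le> C / (1 + \<bar>real_of_int n\<bar>) ^ s"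
        using C0 J(1) by (intro divide_left_mono power_mono mult_pos_pos zero_less_power) auto
      finally have "\<rho> ^ J * (B0 + 2) \<le> C / (1 + \<bar>real_of_int n\<bar>) ^ s * (B0 + 2)"
        using B0_pos by (intro mult_right_mono) auto
      then show ?thesis using J(2) by simp
    qed
    then show ?thesis by blast
  qed
  then show ?thesis using Vc Vs by blast
qed

end

section \<open>Resonant waves\<close>

lemma has_sum_sum_nat:
  fixes f :: "nat \<Rightarrow> 'i \<Rightarrow> 'b::topological_comm_monoid_add"
  assumes "\<And>k. (f k has_sum s k) A"
  shows "((\<lambda>x. \<Sum>k<m. f k x) has_sum (\<Sum>k<m. s k)) A"
proof (induction m)
  case (Suc m)
  then show ?case using has_sum_add[OF Suc assms[of m]] by simp
qed (simp add: has_sum_0)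

text \<open>Averaging the Fourier series over the \<open>m\<close>-th roots of unity isolates the constant coefficient
  up to a tail.\<close>
lemma exists_frequency:
  fixes u :: "int \<Rightarrow> complex"
  assumes s: "(\<lambda>n. norm (u n)) summable_on UNIV" and u0: "u 0 \<noteq> 0"
  shows "\<exists>\<beta>::real. infsum (\<lambda>n. cis (\<beta> * of_int n) * u n) UNIV \<noteq> 0"
proof (rule ccontr)
  assume "\<not> ?thesis"
  then have z: "infsum (\<lambda>n. cis (\<beta> * of_int n) * u n) UNIV = 0" for \<beta> :: real by blast
  have h: "((\<lambda>n. cis (\<beta> * of_int n) * u n) has_sum 0) UNIV" for \<beta> :: real
  proof -
    have "(\<lambda>n. cis (\<beta> * of_int n) * u n) summable_on UNIV"
      by (rule abs_summable_summable) (simp add: norm_mult s)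
    from has_sum_infsum[OF this] show ?thesis unfolding z .
  qed
  define S where "S = infsum (\<lambda>n. norm (u n)) UNIV"
  have S: "((\<lambda>n. norm (u n)) has_sum S) UNIV" unfolding S_def by (rule has_sum_infsum[OF s])
  obtain F0 where F0: "finite F0" "dist (sum (\<lambda>n. norm (u n)) F0) S \<le> norm (u 0) / 2"
    using infsum_finite_approximation[OF s, of "norm (u 0) / 2"] u0 unfolding S_def by auto
  define F where "F = insert 0 F0"
  have F: "finite F" "0 \<in> F" using F0 by (auto simp: F_def)
  have "sum (\<lambda>n. norm (u n)) F0 \<le> sum (\<lambda>n. norm (u n)) F"
    using F0(1) by (intro sum_mono2) (auto simp: F_def)
  then have tail: "S - sum (\<lambda>n. norm (u n)) F \<le> norm (u 0) / 2"
    using F0(2) unfolding dist_real_def by linarith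
  have tS: "((\<lambda>n. norm (u n)) has_sum (S - sum (\<lambda>n. norm (u n)) F)) (UNIV - F)"
    by (rule has_sum_Diff[OF S has_sum_finite[OF F(1)] subset_UNIV])
  \<comment> \<open>m exceeds |n| for every n in F, so 0 is the only multiple of m in F.\<close>
  define m where "m = 1 + (\<Sum>n\<in>F. nat \<bar>n\<bar>)"
  have m: "m > 0" by (simp add: m_def)
  have nd: "n = 0" if "n \<in> F" "int m dvd n" for n
  proof (rule ccontr)
    assume "n \<noteq> 0"
    then have "\<bar>int m\<bar> \<le> \<bar>n\<bar>" using that(2) by (rule dvd_imp_le_int)
    moreover have "nat \<bar>n\<bar> \<le> (\<Sum>n\<in>F. nat \<bar>n\<bar>)" using member_le_sum[OF that(1), of "\<lambda>n. nat \<bar>n\<bar>"] F(1) by simp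
    moreover have "m \<le> nat \<bar>n\<bar>" using \<open>\<bar>int m\<bar> \<le> \<bar>n\<bar>\<close> by linarith
    ultimately show False by (simp add: m_def)
  qed
  define c where "c n = (if int m dvd n then of_nat m else 0 :: complex)" for n
  have "((\<lambda>n. \<Sum>k<m. cis (2 * pi * real k / real m * of_int n) * u n) has_sum (\<Sum>k<m. 0)) UNIV"
    by (rule has_sum_sum_nat[OF h])
  then have hc: "((\<lambda>n. c n * u n) has_sum 0) UNIV"
    unfolding sum_distrib_right[symmetric] root_of_unity_sum[OF m] c_def by simp
  have "sum (\<lambda>n. c n * u n) F = of_nat m * u 0"
  proof -
    have "sum (\<lambda>n. c n * u n) F = sum (\<lambda>n. c n * u n) {0}"
      by (rule sum.mono_neutral_right) (use F nd in \<open>auto simp: c_def\<close>)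
    then show ?thesis by (simp add: c_def)
  qed
  then have "((\<lambda>n. c n * u n) has_sum (0 - of_nat m * u 0)) (UNIV - F)"
    using has_sum_Diff[OF hc has_sum_finite[OF F(1)] subset_UNIV] by simp
  moreover have "((\<lambda>n. real m * norm (u n)) has_sum (real m * (S - sum (\<lambda>n. norm (u n)) F))) (UNIV - F)"
    by (rule has_sum_cmult_right[OF tS])
  ultimately have "norm (0 - of_nat m * u 0) \<le> real m * (S - sum (\<lambda>n. norm (u n)) F)"
    by (rule norm_infsum_le) (simp add: c_def norm_mult)
  also have "\<dots> \<le> real m * (norm (u 0) / 2)" using tail by (intro mult_left_mono) auto
  finally have "real m * norm (u 0) \<le> real m * (norm (u 0) / 2)" by (simp add: norm_mult)
  then show False using m u0 by simp
qed

section \<open>Two-sided sums of orbits and their perturbation\<close>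

definition Z2 :: real where "Z2 = infsum (\<lambda>n::int. 1 / (1 + \<bar>real_of_int n\<bar>)\<^sup>2) UNIV"

lemma has_sum_Z2: "((\<lambda>n::int. 1 / (1 + \<bar>real_of_int n\<bar>)\<^sup>2) has_sum Z2) UNIV"
proof -
  define g :: "int \<Rightarrow> real" where "g n = 1 / (1 + \<bar>real_of_int n\<bar>)\<^sup>2" for n
  have "summable (\<lambda>n. inverse (real (Suc n) ^ 2))"
    by (subst summable_Suc_iff) (rule inverse_power_summable, simp)
  then have "(\<lambda>n. 1 / (1 + real n)\<^sup>2) summable_on UNIV"
    by (intro norm_summable_imp_summable_on) (simp add: inverse_eq_divide)
  then have "(g \<circ> int) summable_on UNIV" "(g \<circ> (\<lambda>n. - int n)) summable_on UNIV"
    by (simp_all add: g_def comp_def)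
  then have "g summable_on range int" "g summable_on range (\<lambda>n. - int n)"
    by (subst summable_on_reindex; simp add: inj_on_def)+
  then have "g summable_on (range int \<union> range (\<lambda>n. - int n))" by (rule summable_on_union)
  moreover have "range int \<union> range (\<lambda>n. - int n) = UNIV"
    using int_cases2 by (auto simp: image_iff) (metis int_cases2)
  ultimately have "g summable_on UNIV" by simp
  from has_sum_infsum[OF this] show ?thesis by (simp add: Z2_def g_def[abs_def])
qed

definition wave :: "'a::{topological_space} cbop \<Rightarrow> ('a \<Rightarrow>\<^sub>C complex) \<Rightarrow> 'a \<Rightarrow>\<^sub>C complex" where
  "wave A \<phi> = infsum (\<lambda>n::int. app (exp (real_of_int n *\<^sub>R A)) \<phi>) UNIV"

definition wave1 :: "'a::{topological_space} cbop \<Rightarrow> ('a \<Rightarrow>\<^sub>C complex) \<Rightarrow> 'a \<Rightarrow>\<^sub>C complex" where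
  "wave1 A \<phi> = infsum (\<lambda>n::int. real_of_int n *\<^sub>R app (exp (real_of_int n *\<^sub>R A)) \<phi>) UNIV"

lemma abs_summable_decay:
  fixes f :: "int \<Rightarrow> 'b::banach"
  assumes "\<And>n. norm (f n) \<le> K / (1 + \<bar>real_of_int n\<bar>)\<^sup>2"
  shows "f summable_on UNIV"
proof -
  have "(\<lambda>n::int. K * (1 / (1 + \<bar>real_of_int n\<bar>)\<^sup>2)) summable_on UNIV"
    by (rule summable_on_cmult_right) (use has_sum_Z2 in \<open>auto simp: summable_on_def\<close>)
  then have "(\<lambda>n. norm (f n)) summable_on UNIV"
    by (rule Infinite_Sum.abs_summable_on_comparison_test') (use assms in simp)
  then show ?thesis by (rule abs_summable_summable)
qed

text \<open>Applying exp A shifts the summation index by one. Cubic decay of the orbit leaves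
  quadratic decay after multiplication by n, which is summable.\<close>

lemma wave:
  fixes A :: "'a::topological_space cbop"
  assumes d: "\<And>n::int. norm (app (exp (real_of_int n *\<^sub>R A)) \<phi>) \<le> K / (1 + \<bar>real_of_int n\<bar>) ^ 3"
  shows has_sum_wave: "((\<lambda>n::int. app (exp (real_of_int n *\<^sub>R A)) \<phi>) has_sum wave A \<phi>) UNIV"
    and app_wave: "app (exp A) (wave A \<phi>) = wave A \<phi>"
    and app_wave1: "app (exp A) (wave1 A \<phi>) = wave1 A \<phi> - wave A \<phi>"
proof -
  define f where "f n = app (exp (real_of_int n *\<^sub>R A)) \<phi>" for n :: int
  have K: "0 \<le> K" using order_trans[OF norm_ge_zero d[of 0]] by simp
  have b1: "norm (real_of_int n *\<^sub>R f n) \<le> K / (1 + \<bar>real_of_int n\<bar>)\<^sup>2"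
    and b0: "norm (f n) \<le> K / (1 + \<bar>real_of_int n\<bar>)\<^sup>2" for n
  proof -
    define r where "r = 1 + \<bar>real_of_int n\<bar>"
    have r: "r \<ge> 1" "\<bar>real_of_int n\<bar> \<le> r" by (simp_all add: r_def)
    have "norm (f n) \<le> K / r ^ 3" unfolding f_def r_def by (rule d)
    also have "K / r ^ 3 = K / r\<^sup>2 / r" by (simp add: eval_nat_numeral)
    finally have 1: "norm (f n) * r \<le> K / r\<^sup>2" using r by (subst (asm) pos_le_divide_eq) auto
    have "norm (f n) * 1 \<le> norm (f n) * r" by (intro mult_left_mono r) simp
    then show "norm (f n) \<le> K / (1 + \<bar>real_of_int n\<bar>)\<^sup>2" using 1 by (simp add: r_def)
    have "\<bar>real_of_int n\<bar> * norm (f n) \<le> norm (f n) * r"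
      using mult_right_mono[OF r(2), of "norm (f n)"] by (simp add: mult.commute)
    then show "norm (real_of_int n *\<^sub>R f n) \<le> K / (1 + \<bar>real_of_int n\<bar>)\<^sup>2" using 1 by (simp add: r_def)
  qed
  have s0: "(f has_sum wave A \<phi>) UNIV"
    unfolding wave_def f_def[symmetric] by (rule has_sum_infsum[OF abs_summable_decay[OF b0]])
  then show "((\<lambda>n::int. app (exp (real_of_int n *\<^sub>R A)) \<phi>) has_sum wave A \<phi>) UNIV"
    by (simp add: f_def[abs_def])
  have s1: "((\<lambda>n. real_of_int n *\<^sub>R f n) has_sum wave1 A \<phi>) UNIV"
    unfolding wave1_def f_def[symmetric] by (rule has_sum_infsum[OF abs_summable_decay[OF b1]])
  have Ef: "app (exp A) (f n) = f (n + 1)" for n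
  proof -
    have "exp A * exp (real_of_int n *\<^sub>R A) = exp (A + real_of_int n *\<^sub>R A)"
      by (rule exp_add_commuting[symmetric]) simp
    also have "A + real_of_int n *\<^sub>R A = real_of_int (n + 1) *\<^sub>R A" by (simp add: scaleR_add_left)
    finally show ?thesis unfolding f_def by (simp only: app_mult[symmetric])
  qed
  have bij: "bij_betw (\<lambda>n::int. n + 1) UNIV UNIV" by (rule bij_betwI[where g = "\<lambda>n. n - 1"]) auto
  have shift0: "((\<lambda>n. f (n + 1)) has_sum wave A \<phi>) UNIV"
    using has_sum_reindex_bij_betw[OF bij, of f] s0 by simp
  have "((\<lambda>n. f (n + 1)) has_sum app (exp A) (wave A \<phi>)) UNIV"
    using has_sum_bounded_linear[OF app.bounded_linear_right s0, of "exp A"] by (simp only: Ef)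
  from has_sum_unique[OF this shift0] show "app (exp A) (wave A \<phi>) = wave A \<phi>" .
  have "((\<lambda>n. real_of_int (n + 1) *\<^sub>R f (n + 1)) has_sum wave1 A \<phi>) UNIV"
    using has_sum_reindex_bij_betw[OF bij, of "\<lambda>n. real_of_int n *\<^sub>R f n"] s1 by simp
  moreover have "((\<lambda>n. (- 1) *\<^sub>R f (n + 1)) has_sum (- 1) *\<^sub>R wave A \<phi>) UNIV" by (rule has_sum_scaleR[OF shift0])
  ultimately have "((\<lambda>n. real_of_int (n + 1) *\<^sub>R f (n + 1) + (- 1) *\<^sub>R f (n + 1)) has_sum (wave1 A \<phi> + (- 1) *\<^sub>R wave A \<phi>)) UNIV"
    by (rule has_sum_add)
  then have 1: "((\<lambda>n. real_of_int n *\<^sub>R f (n + 1)) has_sum (wave1 A \<phi> - wave A \<phi>)) UNIV"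
    by (simp add: scaleR_add_left)
  have "((\<lambda>n. real_of_int n *\<^sub>R f (n + 1)) has_sum app (exp A) (wave1 A \<phi>)) UNIV"
    using has_sum_bounded_linear[OF app.bounded_linear_right s1, of "exp A"] by (simp only: app.scaleR_right Ef)
  from has_sum_unique[OF this 1] show "app (exp A) (wave1 A \<phi>) = wave1 A \<phi> - wave A \<phi>" .
qed

lemma exp_mulc: "exp (mulc c :: 'a::topological_space cbop) = mulc (exp c)"
proof -
  have bl: "bounded_linear (mulc :: complex \<Rightarrow> 'a::topological_space cbop)"
    by (rule bounded_linear_intro[where K = 1])
      (simp_all only: mulc_add mulc_mult mulc_of_real norm_mulc_le mult_1_right scaleR_conv_of_real mult_scaleR_left mult_1_left)
  have "(mulc c :: 'a cbop) ^ n = mulc (c ^ n)" for n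
    by (induction n) (simp_all add: mulc_mult mulc_of_real[of 1, simplified])
  moreover have "(\<lambda>n. mulc (c ^ n /\<^sub>R fact n)) sums (mulc (exp c) :: 'a cbop)"
    by (rule bounded_linear.sums[OF bl exp_converges])
  ultimately have "(\<lambda>n. mulc c ^ n /\<^sub>R fact n) sums (mulc (exp c) :: 'a cbop)"
    by (simp add: linear_cmul[OF bounded_linear.linear[OF bl]])
  from sums_unique2[OF exp_converges this] show ?thesis .
qed

text \<open>The interval is cut into k steps of length |r| \<le> 1, each costing at most 3 |r| G.
  The bound is linear in s times the growth G of the group, where the power series would give exp
  |s|.\<close>

lemma norm_exp_diff_one:
  fixes B :: "'a::{real_normed_algebra_1,banach}"
  assumes B: "norm B \<le> 1" and G: "\<And>t. \<bar>t\<bar> \<le> \<bar>s\<bar> \<Longrightarrow> norm (exp (t *\<^sub>R B)) \<le> G"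
  shows "norm (exp (s *\<^sub>R B) - 1) \<le> 3 * \<bar>s\<bar> * G"
proof -
  define k where "k = nat \<lceil>\<bar>s\<bar>\<rceil> + 1"
  have k: "real k \<ge> 1" "\<bar>s\<bar> \<le> real k" unfolding k_def by (simp, linarith)
  define r where "r = s / real k"
  have r: "\<bar>r\<bar> \<le> 1" "real k * r = s" using k by (simp_all add: r_def divide_le_eq)
  have G0: "0 \<le> G" using order_trans[OF norm_ge_zero G[of 0]] by simp
  have nr: "norm (r *\<^sub>R B) \<le> \<bar>r\<bar>" using B by (simp add: mult_left_le)
  have d: "norm (exp (r *\<^sub>R B) - 1) \<le> 3 * \<bar>r\<bar>"
  proof -
    have "norm (exp (r *\<^sub>R B) - 1) \<le> norm (r *\<^sub>R B) * exp (norm (r *\<^sub>R B))"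
      using exp_remainder[of "r *\<^sub>R B" 1] by simp
    also have "\<dots> \<le> \<bar>r\<bar> * 3"
    proof (rule mult_mono[OF nr])
      have "exp (norm (r *\<^sub>R B)) \<le> exp 1" using nr r(1) by (subst exp_le_cancel_iff) linarith
      then show "exp (norm (r *\<^sub>R B)) \<le> 3" using exp_le by linarith
    qed auto
    finally show ?thesis by simp
  qed
  have "norm (exp ((real j * r) *\<^sub>R B) - 1) \<le> real j * (G * (3 * \<bar>r\<bar>))" if "j \<le> k" for j
    using that
  proof (induction j)
    case (Suc j)
    have "(real (Suc j) * r) *\<^sub>R B = (real j * r) *\<^sub>R B + r *\<^sub>R B"
      by (simp add: distrib_right flip: scaleR_add_left)
    also have "exp \<dots> = exp ((real j * r) *\<^sub>R B) * exp (r *\<^sub>R B)"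
      by (rule exp_add_commuting) simp
    finally have split: "exp ((real (Suc j) * r) *\<^sub>R B) = exp ((real j * r) *\<^sub>R B) * exp (r *\<^sub>R B)" .
    have "exp ((real (Suc j) * r) *\<^sub>R B) - 1 =
        exp ((real j * r) *\<^sub>R B) * (exp (r *\<^sub>R B) - 1) + (exp ((real j * r) *\<^sub>R B) - 1)"
      unfolding split by (simp add: right_diff_distrib)
    also have "norm \<dots> \<le>
        norm (exp ((real j * r) *\<^sub>R B)) * norm (exp (r *\<^sub>R B) - 1) + norm (exp ((real j * r) *\<^sub>R B) - 1)"
      by (rule order_trans[OF norm_triangle_ineq add_right_mono[OF norm_mult_ineq]])
    also have "\<dots> \<le> G * (3 * \<bar>r\<bar>) + real j * (G * (3 * \<bar>r\<bar>))"
    proof (intro add_mono mult_mono d)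
      have "real j * \<bar>r\<bar> \<le> real k * \<bar>r\<bar>" using Suc.prems by (intro mult_right_mono) auto
      also have "\<dots> = \<bar>s\<bar>" by (simp add: r(2)[symmetric] abs_mult)
      finally show "norm (exp ((real j * r) *\<^sub>R B)) \<le> G" by (intro G) (simp add: abs_mult)
      show "norm (exp ((real j * r) *\<^sub>R B) - 1) \<le> real j * (G * (3 * \<bar>r\<bar>))" using Suc by simp
    qed (use G0 in auto)
    also have "\<dots> = real (Suc j) * (G * (3 * \<bar>r\<bar>))" by (simp add: distrib_right)
    finally show ?case .
  qed simp
  from this[OF order_refl] have "norm (exp (s *\<^sub>R B) - 1) \<le> real k * (G * (3 * \<bar>r\<bar>))" by (simp only: r(2))
  also have "\<dots> = 3 * \<bar>real k * r\<bar> * G" by (simp add: abs_mult)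
  finally show ?thesis by (simp only: r(2))
qed

lemma scaleR_mulc: "r *\<^sub>R mulc c = mulc (of_real r * c)"
  by (simp add: mulc_mult mulc_of_real)

context almost_abelian begin

text \<open>N is abelian, so the exponential of the average is a product of at most M commuting
  exponentials, each of linear growth. The degree M is the same for all x.\<close>

lemma nu_growth:
  assumes x: "x \<in> N"
  shows "norm (exp (s *\<^sub>R (Jop * nu x))) \<le> (8 * \<bar>s\<bar> + 7) ^ M"
proof -
  define h where "h y = (1/2) *\<^sub>R (Lop y + Lop (ginv y))" for y
  define Q where "Q D = {T. T * D = D * T}" for D :: "'g cbop"
  have Q: "closed_subalg (Q D)" for D unfolding Q_def by (rule closed_subalg_commute)
  have Qsym: "S \<in> Q T \<Longrightarrow> T \<in> Q S" for S T by (simp add: Q_def)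
  have LL: "Lop a \<in> Q (Lop b)" if "a \<in> N" "b \<in> N" for a b
    using commN[OF that] by (simp add: Q_def Lop_mult)
  have hQ: "Jop * h y \<in> Q D" if "Jop \<in> Q D" "Lop y \<in> Q D" "Lop (ginv y) \<in> Q D" for y D
    unfolding h_def using that by (intro closed_subalgD(3,4,5)[OF Q])
  have JL: "Jop \<in> Q (Lop b)" for b using Lop_mulc[of b \<i>] by (simp add: Q_def)
  have 1: "Jop * h y \<in> Q (Lop b)" if "y \<in> N" "b \<in> N" for y b
    using that by (intro hQ JL LL invN)
  have 2: "Jop * h y \<in> Q Jop" for y
    by (intro hQ Qsym[OF JL]) (simp add: Q_def)
  have 3: "Jop * h y \<in> Q (Jop * h z)" if "y \<in> N" "z \<in> N" for y z
    by (intro hQ Qsym[OF 1] Qsym[OF 2] that invN)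
  have "norm (exp (t *\<^sub>R (Jop * (\<Sum>y\<in>F. h y)))) \<le> (8 * \<bar>t\<bar> + 7) ^ card F" if "finite F" "F \<subseteq> N" for F t
    using that
  proof (induction F rule: finite_induct)
    case (insert a F)
    define S where "S = (\<Sum>y\<in>F. h y)"
    have "Jop * S \<in> Q (Jop * h a)"
      unfolding S_def sum_distrib_left using insert.prems by (intro closed_subalg_sum[OF Q] 3) auto
    then have c: "(t *\<^sub>R (Jop * h a)) * (t *\<^sub>R (Jop * S)) = (t *\<^sub>R (Jop * S)) * (t *\<^sub>R (Jop * h a))"
      by (simp add: Q_def)
    have "t *\<^sub>R (Jop * (\<Sum>y\<in>insert a F. h y)) = t *\<^sub>R (Jop * h a) + t *\<^sub>R (Jop * S)"
      using insert.hyps by (simp add: S_def distrib_left scaleR_add_right)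
    then have "norm (exp (t *\<^sub>R (Jop * (\<Sum>y\<in>insert a F. h y)))) \<le>
        norm (exp (t *\<^sub>R (Jop * h a))) * norm (exp (t *\<^sub>R (Jop * S)))"
      by (simp only: exp_add_commuting[OF c] norm_mult_ineq)
    also have "\<dots> \<le> (8 * \<bar>t\<bar> + 7) * (8 * \<bar>t\<bar> + 7) ^ card F"
    proof (rule mult_mono)
      show "norm (exp (t *\<^sub>R (Jop * h a))) \<le> 8 * \<bar>t\<bar> + 7"
        unfolding h_def Lop_def by (rule norm_exp_pullback_le) (auto intro!: continuous_intros)
      show "norm (exp (t *\<^sub>R (Jop * S))) \<le> (8 * \<bar>t\<bar> + 7) ^ card F"
        unfolding S_def using insert by simp
    qed auto
    finally show ?case using insert.hyps by simp
  qed simp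
  from this[OF finite_orb, of x "s / real (card (orb x))"] have
    b: "norm (exp ((s / real (card (orb x))) *\<^sub>R (Jop * (\<Sum>y\<in>orb x. h y)))) \<le>
      (8 * \<bar>s / real (card (orb x))\<bar> + 7) ^ card (orb x)"
    using orb_N[OF x] by blast
  have "s *\<^sub>R (Jop * nu x) = (s / real (card (orb x))) *\<^sub>R (Jop * (\<Sum>y\<in>orb x. h y))"
    unfolding nu_sym h_def[symmetric] by simp
  then have "norm (exp (s *\<^sub>R (Jop * nu x))) \<le> (8 * \<bar>s / real (card (orb x))\<bar> + 7) ^ card (orb x)"
    using b by (simp only:)
  also have "\<dots> \<le> (8 * \<bar>s\<bar> + 7) ^ card (orb x)"
  proof (intro power_mono add_right_mono mult_left_mono)
    show "\<bar>s / real (card (orb x))\<bar> \<le> \<bar>s\<bar>"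
      using card_orb_pos[OF x] by (simp add: abs_divide divide_le_eq mult_le_cancel_left1)
  qed auto
  also have "\<dots> \<le> (8 * \<bar>s\<bar> + 7) ^ M" by (intro power_increasing card_orb_le) simp
  finally show ?thesis .
qed

text \<open>The frequency is chosen to make the wave nonzero at e. The perturbed wave starts from
  the same \<open>phi0\<close>; its terms differ by a factor exp (- n \<eta> J \<nu>) - 1, at most
  |n| \<eta> times a polynomial of degree M. The decay of the orbit absorbs this, and the distance
  is of order \<eta> uniformly in x.\<close>

lemma resonance:
  "\<exists>A T c. A \<in> calg \<and> sym1 (exp A) c \<and> c0 T \<and> T \<noteq> 0 \<and> app (exp A) T = T \<and>
    (\<exists>S. app (exp A) S = S - T) \<and>
    (\<exists>C. \<forall>\<eta> x. 0 < \<eta> \<longrightarrow> \<eta> \<le> 1 \<longrightarrow> x \<in> N \<longrightarrow>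
      (\<exists>T'. app (exp (A - \<eta> *\<^sub>R (Jop * nu x))) T' = T' \<and> norm (T' - T) \<le> C * \<eta>))"
proof -
  obtain V c where V: "V \<in> calg" "sym1 V c"
    and dec: "\<forall>s. \<exists>K. \<forall>n::int. norm (app (exp (real_of_int n *\<^sub>R (Jop * V))) phi0) \<le> K / (1 + \<bar>real_of_int n\<bar>) ^ s"
    using V_exists by blast
  define u where "u n = app (exp (real_of_int n *\<^sub>R (Jop * V))) phi0 e" for n :: int
  have su: "(\<lambda>n. norm (u n)) summable_on UNIV"
  proof -
    obtain K where K: "norm (app (exp (real_of_int n *\<^sub>R (Jop * V))) phi0) \<le> K / (1 + \<bar>real_of_int n\<bar>)\<^sup>2" for n :: int
      using dec by blast
    have "norm (norm (u n)) \<le> K / (1 + \<bar>real_of_int n\<bar>)\<^sup>2" for n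
      unfolding u_def real_norm_def abs_norm_cancel by (rule order_trans[OF norm_bounded K])
    then show ?thesis by (rule abs_summable_decay)
  qed
  have "u 0 \<noteq> 0" using phi0_e by (simp add: u_def)
  from exists_frequency[OF su this] obtain \<beta> :: real where \<beta>: "infsum (\<lambda>n. cis (\<beta> * of_int n) * u n) UNIV \<noteq> 0" ..
  \<comment> \<open>Adding \<beta> to V multiplies the n-th term of the orbit by cis (\<beta> n);
    \<beta> plays the role of - \<lambda>.\<close>
  define W where "W = V + \<beta> *\<^sub>R 1"
  have W: "W \<in> calg" "sym1 W (c + \<bar>\<beta>\<bar> * 1)"
    unfolding W_def
    by (intro closed_subalgD(2,3,5)[OF closed_subalg_calg] V) (intro sym1_add sym1_scaleR sym1_one V)
  define A where "A = Jop * W"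
  have Ac: "A \<in> calg" unfolding A_def by (intro closed_subalgD(4)[OF closed_subalg_calg] mulc_calg W)
  have As: "sym1 (exp A) (exp (1 * (c + \<bar>\<beta>\<bar> * 1)))"
    using sym1_expJ[OF W, of 1] by (simp add: A_def)
  have eA: "exp (real_of_int n *\<^sub>R A) = mulc (cis (\<beta> * of_int n)) * exp (real_of_int n *\<^sub>R (Jop * V))" for n :: int
  proof -
    have e: "real_of_int n *\<^sub>R A = mulc (\<i> * of_real (\<beta> * of_int n)) + real_of_int n *\<^sub>R (Jop * V)"
    proof -
      have R: "real_of_int n *\<^sub>R (\<beta> *\<^sub>R Jop) = mulc (\<i> * of_real (\<beta> * of_int n))"
        by (simp only: scaleR_mulc of_real_mult of_real_of_int_eq mult_ac)
      show ?thesis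
        by (simp only: A_def W_def distrib_left scaleR_add_right mult_scaleR_right mult_1_right R add.commute)
    qed
    have c: "mulc (\<i> * of_real (\<beta> * of_int n)) * (real_of_int n *\<^sub>R (Jop * V)) = (real_of_int n *\<^sub>R (Jop * V)) * mulc (\<i> * of_real (\<beta> * of_int n))"
      by (rule calgD(3)[symmetric]) (intro closed_subalgD(4,5)[OF closed_subalg_calg] mulc_calg V)
    show ?thesis unfolding e exp_add_commuting[OF c] exp_mulc cis_conv_exp ..
  qed
  have decA: "\<exists>K\<ge>0. \<forall>n::int. norm (app (exp (real_of_int n *\<^sub>R A)) phi0) \<le> K / (1 + \<bar>real_of_int n\<bar>) ^ s" for s
  proof -
    obtain K where K: "norm (app (exp (real_of_int n *\<^sub>R (Jop * V))) phi0) \<le> K / (1 + \<bar>real_of_int n\<bar>) ^ s" for n :: int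
      using dec by blast
    have "norm (app (exp (real_of_int n *\<^sub>R A)) phi0) \<le> K / (1 + \<bar>real_of_int n\<bar>) ^ s" for n
    proof -
      have "norm (app (exp (real_of_int n *\<^sub>R A)) phi0) \<le> norm (mulc (cis (\<beta> * of_int n)) :: 'g cbop) * norm (app (exp (real_of_int n *\<^sub>R (Jop * V))) phi0)"
        unfolding eA app_mult by (rule norm_app)
      also have "\<dots> \<le> 1 * norm (app (exp (real_of_int n *\<^sub>R (Jop * V))) phi0)"
        using norm_mulc_le[of "cis (\<beta> * of_int n)"] by (intro mult_right_mono) simp_all
      finally show ?thesis using K[of n] by simp
    qed
    moreover have "0 \<le> K" using order_trans[OF norm_ge_zero K[of 0]] by simp
    ultimately show ?thesis by blast
  qed
  define T where "T = wave A phi0"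
  obtain K3 where K3: "norm (app (exp (real_of_int n *\<^sub>R A)) phi0) \<le> K3 / (1 + \<bar>real_of_int n\<bar>) ^ 3" for n :: int
    using decA by blast
  note hT = has_sum_wave[OF K3, folded T_def]
  have "((\<lambda>n. cis (\<beta> * of_int n) * u n) has_sum T e) UNIV"
    using has_sum_bounded_linear[OF bounded_linear_apply_bcontfun hT, of e] by (simp add: eA u_def)
  then have "T e \<noteq> 0" using \<beta> infsumI by metis
  then have T0: "T \<noteq> 0" by auto
  have Tc: "c0 T"
  proof (rule c0_limit)
    fix \<epsilon> :: real assume \<epsilon>: "\<epsilon> > 0"
    have "(\<lambda>n::int. app (exp (real_of_int n *\<^sub>R A)) phi0) summable_on UNIV" using hT by (auto simp: summable_on_def)
    from infsum_finite_approximation[OF this \<epsilon>] obtain F :: "int set" where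
      F: "finite F" "dist (\<Sum>n\<in>F. app (exp (real_of_int n *\<^sub>R A)) phi0) T \<le> \<epsilon>"
      unfolding T_def wave_def by blast
    have "c0 (\<Sum>n\<in>F. app (exp (real_of_int n *\<^sub>R A)) phi0)"
      using F(1)
    proof (induction F rule: finite_induct)
      case (insert n F)
      have "exp (real_of_int n *\<^sub>R A) \<in> calg"
        by (intro closed_subalg_exp closed_subalgD(5) closed_subalg_calg Ac)
      then show ?case using insert by (simp add: c0_add calgD(5) phi0_c0)
    qed (simp add: c0_zero)
    then show "\<exists>\<psi>. c0 \<psi> \<and> norm (T - \<psi>) \<le> \<epsilon>" using F(2) by (metis dist_norm dist_commute)
  qed
  \<comment> \<open>Of the M + 3 powers, M absorb the growth of the exponentials of
    \<open>nu x\<close>, one absorbs the factor n of the difference, and two make the series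
    converge.\<close>
  obtain K where K0: "K \<ge> 0" and K: "norm (app (exp (real_of_int n *\<^sub>R A)) phi0) \<le> K / (1 + \<bar>real_of_int n\<bar>) ^ (M + 3)" for n :: int
    using decA by blast
  define K' where "K' = 8 ^ M * K"
  have K': "(8 * (1 + \<bar>real_of_int n\<bar>)) ^ M * (K / (1 + \<bar>real_of_int n\<bar>) ^ (M + 3)) = K' / (1 + \<bar>real_of_int n\<bar>) ^ 3" for n :: int
  proof -
    have "1 + \<bar>real_of_int n\<bar> \<noteq> 0" by linarith
    then show ?thesis by (simp only: K'_def power_mult_distrib power_add) (simp add: divide_simps)
  qed
  have pert: "\<exists>T'. app (exp (A - \<eta> *\<^sub>R (Jop * nu x))) T' = T' \<and> norm (T' - T) \<le> 3 * K' * Z2 * \<eta>"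
    if \<eta>: "0 < \<eta>" "\<eta> \<le> 1" and x: "x \<in> N" for \<eta> x
  proof -
    define B where "B = A - \<eta> *\<^sub>R (Jop * nu x)"
    \<comment> \<open>\<open>D n\<close> is the factor by which the perturbed orbit differs from the
      original one at time n.\<close>
    define D where "D n = exp ((- (real_of_int n * \<eta>)) *\<^sub>R (Jop * nu x))" for n :: int
    have cA: "(Jop * nu x) * A = A * (Jop * nu x)"
    proof -
      have "A * (Jop * nu x) = (Jop * A) * nu x" using calgD(3)[OF Ac, of \<i>] by (simp add: mult.assoc[symmetric])
      also have "\<dots> = Jop * nu x * A" using calg_comm_nu[OF Ac, of x] by (simp add: mult.assoc)
      finally show ?thesis by simp
    qed
    have eB: "exp (real_of_int n *\<^sub>R B) = D n * exp (real_of_int n *\<^sub>R A)" for n :: int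
    proof -
      have "real_of_int n *\<^sub>R B = (- (real_of_int n * \<eta>)) *\<^sub>R (Jop * nu x) + real_of_int n *\<^sub>R A"
        by (simp add: B_def scaleR_diff_right)
      moreover have "((- (real_of_int n * \<eta>)) *\<^sub>R (Jop * nu x)) * (real_of_int n *\<^sub>R A) = (real_of_int n *\<^sub>R A) * ((- (real_of_int n * \<eta>)) *\<^sub>R (Jop * nu x))"
        using cA by (simp add: mult.commute)
      ultimately show ?thesis unfolding D_def by (simp only: exp_add_commuting)
    qed
    have g: "norm (exp (t *\<^sub>R (Jop * nu x))) \<le> (8 * (1 + \<bar>real_of_int n\<bar>)) ^ M"
      if t: "\<bar>t\<bar> \<le> \<bar>- (real_of_int n * \<eta>)\<bar>" for t and n :: int
    proof -
      have "\<bar>- (real_of_int n * \<eta>)\<bar> \<le> \<bar>real_of_int n\<bar>" using \<eta> by (simp add: abs_mult mult_left_le)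
      with t have "\<bar>t\<bar> \<le> \<bar>real_of_int n\<bar>" by (rule order_trans)
      then have "8 * \<bar>t\<bar> + 7 \<le> 8 * (1 + \<bar>real_of_int n\<bar>)" by (simp add: distrib_left)
      then have "(8 * \<bar>t\<bar> + 7) ^ M \<le> (8 * (1 + \<bar>real_of_int n\<bar>)) ^ M" by (intro power_mono) auto
      then show ?thesis using nu_growth[OF x, of t] by (rule order_trans[rotated])
    qed
    have nJ: "norm (Jop * nu x) \<le> 1"
    proof -
      have "norm (Jop * nu x) \<le> 1 * 1"
        by (rule order_trans[OF norm_mult_ineq]) (intro mult_mono norm_Jop sym1D(1)[OF sym1_nu[OF x]], auto)
      then show ?thesis by simp
    qed
    have dB: "norm (app (exp (real_of_int n *\<^sub>R B)) phi0) \<le> K' / (1 + \<bar>real_of_int n\<bar>) ^ 3" for n :: int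
    proof -
      have "norm (app (exp (real_of_int n *\<^sub>R B)) phi0) \<le> norm (D n) * norm (app (exp (real_of_int n *\<^sub>R A)) phi0)"
        unfolding eB app_mult by (rule norm_app)
      also have "\<dots> \<le> (8 * (1 + \<bar>real_of_int n\<bar>)) ^ M * (K / (1 + \<bar>real_of_int n\<bar>) ^ (M + 3))"
        unfolding D_def by (intro mult_mono g K) auto
      finally show ?thesis unfolding K' .
    qed
    define T' where "T' = wave B phi0"
    note hT' = has_sum_wave[OF dB, folded T'_def]
    have hd: "((\<lambda>n::int. app (exp (real_of_int n *\<^sub>R B)) phi0 + (- 1) *\<^sub>R app (exp (real_of_int n *\<^sub>R A)) phi0) has_sum (T' + (- 1) *\<^sub>R T)) UNIV"
      by (rule has_sum_add[OF hT' has_sum_scaleR[OF hT]])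
    have bd: "norm (app (exp (real_of_int n *\<^sub>R B)) phi0 + (- 1) *\<^sub>R app (exp (real_of_int n *\<^sub>R A)) phi0) \<le> (3 * \<eta> * K') * (1 / (1 + \<bar>real_of_int n\<bar>)\<^sup>2)" for n :: int
    proof -
      define r where "r = 1 + \<bar>real_of_int n\<bar>"
      have r: "r > 0" "\<bar>real_of_int n\<bar> \<le> r" by (simp_all add: r_def)
      have K'0: "0 \<le> K'" using K0 by (simp add: K'_def)
      have "app (exp (real_of_int n *\<^sub>R B)) phi0 + (- 1) *\<^sub>R app (exp (real_of_int n *\<^sub>R A)) phi0 = app (D n - 1) (app (exp (real_of_int n *\<^sub>R A)) phi0)"
        unfolding eB app_mult by (simp add: app.diff_left)
      then have "norm (app (exp (real_of_int n *\<^sub>R B)) phi0 + (- 1) *\<^sub>R app (exp (real_of_int n *\<^sub>R A)) phi0) \<le> norm (D n - 1) * norm (app (exp (real_of_int n *\<^sub>R A)) phi0)"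
        using norm_app by metis
      also have "\<dots> \<le> (3 * \<bar>- (real_of_int n * \<eta>)\<bar> * (8 * (1 + \<bar>real_of_int n\<bar>)) ^ M) * (K / (1 + \<bar>real_of_int n\<bar>) ^ (M + 3))"
        unfolding D_def by (intro mult_mono norm_exp_diff_one nJ g K) auto
      also have "\<dots> = 3 * \<bar>- (real_of_int n * \<eta>)\<bar> * (K' / r ^ 3)"
        unfolding K'[symmetric] r_def by (simp only: mult.assoc)
      also have "\<dots> = (3 * \<eta> * (K' / r ^ 3)) * \<bar>real_of_int n\<bar>" using \<eta> by (simp add: abs_mult)
      also have "\<dots> \<le> (3 * \<eta> * (K' / r ^ 3)) * r" using \<eta> K'0 r by (intro mult_left_mono) auto
      also have "\<dots> = (3 * \<eta> * K') * (1 / r\<^sup>2)" using r by (simp add: eval_nat_numeral)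
      finally show ?thesis unfolding r_def .
    qed
    have "norm (T' + (- 1) *\<^sub>R T) \<le> (3 * \<eta> * K') * Z2"
      by (rule norm_infsum_le[OF hd has_sum_cmult_right[OF has_sum_Z2] bd])
    then have "norm (T' - T) \<le> 3 * K' * Z2 * \<eta>" by (simp add: mult_ac)
    moreover have "app (exp B) T' = T'" unfolding T'_def by (rule app_wave[OF dB])
    ultimately show ?thesis unfolding B_def by blast
  qed
  show ?thesis
    using Ac As Tc T0 app_wave[OF K3, folded T_def] app_wave1[OF K3, folded T_def] pert by blast
qed

end

section \<open>Quotient norms and limits of ideals\<close>

lemma Liminf_finer: "F' \<le> F \<Longrightarrow> Liminf F f \<le> Liminf F' (f :: _ \<Rightarrow> 'b::complete_lattice)"
  unfolding Liminf_def by (rule SUP_subset_mono) (auto intro: filter_leD)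

lemma normality_finer:
  "F' \<le> F \<Longrightarrow> normality_property A F I \<Longrightarrow> normality_property A F' I"
  unfolding normality_property_def by (meson Liminf_finer less_le_trans)

lemma tau_n_closedD:
  "tau_n_closed A M \<Longrightarrow> F \<noteq> bot \<Longrightarrow> eventually (\<lambda>J. J \<in> M) F \<Longrightarrow> normality_property A F I \<Longrightarrow>
    I \<in> Id_set A \<Longrightarrow> I \<in> M"
  unfolding tau_n_closed_def by blast

text \<open>A net in the union either is frequently in M, and then restricts to a net in M that
  keeps the normality property, or is eventually in M'.\<close>

lemma tau_n_closed_Un:
  assumes "tau_n_closed A M" "tau_n_closed A M'"
  shows "tau_n_closed A (M \<union> M')"
  unfolding tau_n_closed_def
proof (intro conjI allI ballI impI; (elim conjE)?)
  show "M \<union> M' \<subseteq> Id_set A" using assms by (simp add: tau_n_closed_def)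
  fix F I assume I: "I \<in> Id_set A" "F \<noteq> bot" "eventually (\<lambda>J. J \<in> M \<union> M') F" "normality_property A F I"
  show "I \<in> M \<union> M'"
  proof (cases "inf F (principal M) = bot")
    case True
    then have "eventually (\<lambda>J. J \<notin> M) F" by (simp add: trivial_limit_def eventually_inf_principal)
    with I(3) have "eventually (\<lambda>J. J \<in> M') F" by eventually_elim auto
    then show ?thesis using tau_n_closedD[OF assms(2) I(2) _ I(4,1)] by blast
  next
    case False
    have "eventually (\<lambda>J. J \<in> M) (inf F (principal M))" by (simp add: eventually_inf_principal)
    from tau_n_closedD[OF assms(1) False this normality_finer[OF inf_le1 I(4)] I(1)] show ?thesis by blast
  qed
qed

lemma istopology_tau_n: "istopology (\<lambda>U. U \<subseteq> Id_set A \<and> tau_n_closed A (Id_set A - U))"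
  unfolding istopology_def
proof (intro conjI allI impI; (elim conjE)?)
  fix S T assume "tau_n_closed A (Id_set A - S)" "tau_n_closed A (Id_set A - T)"
  from tau_n_closed_Un[OF this] show "tau_n_closed A (Id_set A - S \<inter> T)" by (simp add: Diff_Int)
next
  fix S T assume "S \<subseteq> Id_set A" then show "S \<inter> T \<subseteq> Id_set A" by blast
next
  fix \<K> assume K: "\<forall>K\<in>\<K>. K \<subseteq> Id_set A \<and> tau_n_closed A (Id_set A - K)"
  then show "\<Union>\<K> \<subseteq> Id_set A" by blast
  show "tau_n_closed A (Id_set A - \<Union>\<K>)"
    unfolding tau_n_closed_def
  proof (intro conjI allI ballI impI; (elim conjE)?)
    fix F I assume I: "I \<in> Id_set A" "F \<noteq> bot" "eventually (\<lambda>J. J \<in> Id_set A - \<Union>\<K>) F" "normality_property A F I"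
    have "I \<notin> U" if "U \<in> \<K>" for U
    proof -
      have "eventually (\<lambda>J. J \<in> Id_set A - U) F" using I(3) by (rule eventually_mono) (use that in blast)
      then show ?thesis using tau_n_closedD[OF _ I(2) _ I(4,1), of "Id_set A - U"] K that by blast
    qed
    then show "I \<in> Id_set A - \<Union>\<K>" using I(1) by blast
  qed blast
qed

lemma openin_tau_n: "openin (tau_n A) U \<longleftrightarrow> U \<subseteq> Id_set A \<and> tau_n_closed A (Id_set A - U)"
  unfolding tau_n_def topology_inverse'[OF istopology_tau_n] ..

text \<open>Convergence in a generated topology is decided on the generating sets; it is used for
  \<open>tau_r\<close> and, inside it, for \<open>tau_u\<close>.\<close>

lemma eventually_generate_topology_on:
  assumes "generate_topology_on \<S> U" and "\<And>V. V \<in> \<S> \<Longrightarrow> I \<in> V \<Longrightarrow> eventually (\<lambda>i. J i \<in> V) F"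
  shows "I \<in> U \<Longrightarrow> eventually (\<lambda>i. J i \<in> U) F"
  using assms(1)
proof (induction U rule: generate_topology_on.induct)
  case (Int a b)
  then have "eventually (\<lambda>i. J i \<in> a) F" "eventually (\<lambda>i. J i \<in> b) F" by blast+
  then show ?case by eventually_elim blast
next
  case (UN K)
  then obtain k where "k \<in> K" "eventually (\<lambda>i. J i \<in> k) F" by blast
  then show ?case by (auto elim!: eventually_mono)
qed (use assms(2) in auto)

context haar_group begin

section \<open>Closed ideals and quotient norms of the group algebra\<close>

abbreviation L1 :: "('g \<Rightarrow> complex) snalg" where "L1 \<equiv> L1_alg gmul ginv \<mu>"

lemma L1_simps [simp]: "acar L1 = {f. integrable \<mu> f}" "amul L1 = conv" "anorm L1 a = N1 a"
  "aadd L1 a b = (\<lambda>x. a x + b x)" "asmul L1 c a = (\<lambda>x. c * a x)" "azero L1 = (\<lambda>_. 0)"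
  "asub L1 a b = (\<lambda>x. a x - b x)"
  by (simp_all add: L1_alg_def asub_def)

lemma N1_triangle: "integrable \<mu> a \<Longrightarrow> integrable \<mu> b \<Longrightarrow> N1 (\<lambda>x. a x + b x) \<le> N1 a + N1 b"
  for a b :: "'g \<Rightarrow> complex"
proof -
  assume a: "integrable \<mu> a" and b: "integrable \<mu> b"
  have "N1 (\<lambda>x. a x + b x) \<le> (\<integral>x. norm (a x) + norm (b x) \<partial>\<mu>)"
    using a b by (intro integral_mono) (auto simp: norm_triangle_ineq)
  then show ?thesis using a b by simp
qed

lemma N1_scale: "N1 (\<lambda>x. c * a x) = norm c * N1 a"
  by (simp add: norm_mult)

lemma N1_minus_commute: "N1 (\<lambda>x. a x - b x) = N1 (\<lambda>x. b x - a x)"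
  by (simp add: norm_minus_commute)

lemma Id_setD:
  assumes "J \<in> Id_set L1"
  shows "a \<in> J \<Longrightarrow> integrable \<mu> a" "(\<lambda>_. 0) \<in> J" "a \<in> J \<Longrightarrow> b \<in> J \<Longrightarrow> (\<lambda>x. a x + b x) \<in> J"
    "a \<in> J \<Longrightarrow> (\<lambda>x. c * a x) \<in> J" "integrable \<mu> a \<Longrightarrow> b \<in> J \<Longrightarrow> conv a b \<in> J"
    "integrable \<mu> a \<Longrightarrow> b \<in> J \<Longrightarrow> conv b a \<in> J"
  using assms by (auto simp: Id_set_def two_sided_ideal_def left_ideal_def subspace_of_def)

text \<open>Closedness implies saturation: an element at seminorm distance 0 from J is a limit of a
  constant sequence in J.\<close>

lemma Id_setI:
  assumes "\<And>a. a \<in> J \<Longrightarrow> integrable \<mu> a" "(\<lambda>_. 0) \<in> J" "\<And>a b. a \<in> J \<Longrightarrow> b \<in> J \<Longrightarrow> (\<lambda>x. a x + b x) \<in> J"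
    "\<And>c a. a \<in> J \<Longrightarrow> (\<lambda>x. c * a x) \<in> J" "\<And>a b. integrable \<mu> a \<Longrightarrow> b \<in> J \<Longrightarrow> conv a b \<in> J"
    "\<And>a b. integrable \<mu> a \<Longrightarrow> b \<in> J \<Longrightarrow> conv b a \<in> J"
    and cl: "\<And>a. integrable \<mu> a \<Longrightarrow> (\<And>\<epsilon>. \<epsilon> > 0 \<Longrightarrow> \<exists>b\<in>J. N1 (\<lambda>x. a x - b x) < \<epsilon>) \<Longrightarrow> a \<in> J"
  shows "J \<in> Id_set L1"
proof -
  have "saturated L1 J"
    unfolding saturated_def
  proof (intro ballI impI)
    fix a b assume a: "a \<in> J" and b: "b \<in> acar L1" and z: "anorm L1 (asub L1 a b) = 0"
    have "N1 (\<lambda>x. b x - a x) = 0" using z N1_minus_commute[of a b] by simp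
    then show "b \<in> J" using a b by (intro cl) (auto intro!: bexI[of _ a])
  qed
  moreover have "norm_closed L1 J" unfolding norm_closed_def using cl by simp
  ultimately show ?thesis
    using assms(1-6) by (auto simp: Id_set_def two_sided_ideal_def left_ideal_def subspace_of_def)
qed

abbreviation qn where "qn \<equiv> qnorm L1"

lemma qn_le: "b \<in> J \<Longrightarrow> qn J a \<le> N1 (\<lambda>x. a x - b x)"
  unfolding qnorm_def by (rule cInf_lower) (auto intro!: bdd_belowI[of _ 0])

lemma qn_ex: "J \<in> Id_set L1 \<Longrightarrow> qn J a < t \<Longrightarrow> \<exists>b\<in>J. N1 (\<lambda>x. a x - b x) < t"
  using cInf_lessD[of "(\<lambda>b. N1 (\<lambda>x. a x - b x)) ` J" t] Id_setD(2)[of J] by (auto simp: qnorm_def)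

lemma qn_nonneg: "J \<in> Id_set L1 \<Longrightarrow> 0 \<le> qn J a"
  unfolding qnorm_def by (rule cInf_greatest) (use Id_setD(2) in auto)

lemma qn_le_N1: "J \<in> Id_set L1 \<Longrightarrow> qn J a \<le> N1 a"
  using qn_le[OF Id_setD(2), of J a] by simp

lemma qn_add:
  assumes J: "J \<in> Id_set L1" and "integrable \<mu> a" "integrable \<mu> b" "qn J a < s" "qn J b < t"
  shows "qn J (\<lambda>x. a x + b x) < s + t"
proof -
  obtain a' b' where a': "a' \<in> J" "N1 (\<lambda>x. a x - a' x) < s" and b': "b' \<in> J" "N1 (\<lambda>x. b x - b' x) < t"
    using qn_ex[OF J assms(4)] qn_ex[OF J assms(5)] by blast
  have "qn J (\<lambda>x. a x + b x) \<le> N1 (\<lambda>x. a x + b x - (a' x + b' x))"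
    by (rule qn_le[OF Id_setD(3)[OF J a'(1) b'(1)]])
  also have "\<dots> = N1 (\<lambda>x. (a x - a' x) + (b x - b' x))" by (simp add: algebra_simps)
  also have "\<dots> \<le> N1 (\<lambda>x. a x - a' x) + N1 (\<lambda>x. b x - b' x)"
    using Id_setD(1)[OF J] a' b' assms by (intro N1_triangle) auto
  finally show ?thesis using a' b' by linarith
qed

lemma qn_scale:
  assumes J: "J \<in> Id_set L1" and "qn J a < t"
  shows "qn J (\<lambda>x. c * a x) \<le> norm c * t"
proof -
  obtain a' where a': "a' \<in> J" "N1 (\<lambda>x. a x - a' x) < t" using qn_ex[OF J assms(2)] by blast
  have "qn J (\<lambda>x. c * a x) \<le> N1 (\<lambda>x. c * a x - c * a' x)" by (rule qn_le[OF Id_setD(4)[OF J a'(1)]])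
  also have "\<dots> = norm c * N1 (\<lambda>x. a x - a' x)" unfolding right_diff_distrib[symmetric] by (rule N1_scale)
  also have "\<dots> \<le> norm c * t" using a' by (intro mult_left_mono) auto
  finally show ?thesis .
qed

lemma qn_conv_left:
  assumes J: "J \<in> Id_set L1" and a: "integrable \<mu> a" and b: "integrable \<mu> b" and q: "qn J b < t"
  shows "qn J (conv a b) \<le> N1 a * t"
proof -
  obtain b' where b': "b' \<in> J" "N1 (\<lambda>x. b x - b' x) < t" using qn_ex[OF J q] by blast
  note ib = Id_setD(1)[OF J b'(1)]
  have "qn J (conv a b) \<le> N1 (\<lambda>x. conv a b x - conv a b' x)" by (rule qn_le[OF Id_setD(5)[OF J a b'(1)]])
  also have "\<dots> = N1 (conv a (\<lambda>x. b x - b' x))"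
  proof (rule integral_cong_AE)
    show "(\<lambda>x. norm (conv a b x - conv a b' x)) \<in> borel_measurable \<mu>"
      using conv_integrable[OF a b] conv_integrable[OF a ib] by (intro borel_measurable_integrable integrable_norm) auto
    show "(\<lambda>x. norm (conv a (\<lambda>x. b x - b' x) x)) \<in> borel_measurable \<mu>"
      using conv_integrable[OF a, of "\<lambda>x. b x - b' x"] b ib by (intro borel_measurable_integrable integrable_norm) auto
    show "AE x in \<mu>. norm (conv a b x - conv a b' x) = norm (conv a (\<lambda>x. b x - b' x) x)"
      using conv_diff_right[OF a b ib] by eventually_elim simp
  qed
  also have "\<dots> \<le> N1 a * N1 (\<lambda>x. b x - b' x)" using a b ib by (intro conv_norm) auto
  also have "\<dots> \<le> N1 a * t" using b' by (intro mult_left_mono) auto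
  finally show ?thesis .
qed

lemma qn_conv_right:
  assumes J: "J \<in> Id_set L1" and a: "integrable \<mu> a" and b: "integrable \<mu> b" and q: "qn J b < t"
  shows "qn J (conv b a) \<le> t * N1 a"
proof -
  obtain b' where b': "b' \<in> J" "N1 (\<lambda>x. b x - b' x) < t" using qn_ex[OF J q] by blast
  note ib = Id_setD(1)[OF J b'(1)]
  have "qn J (conv b a) \<le> N1 (\<lambda>x. conv b a x - conv b' a x)" by (rule qn_le[OF Id_setD(6)[OF J a b'(1)]])
  also have "\<dots> = N1 (conv (\<lambda>x. b x - b' x) a)"
  proof (rule integral_cong_AE)
    show "(\<lambda>x. norm (conv b a x - conv b' a x)) \<in> borel_measurable \<mu>"
      using conv_integrable[OF b a] conv_integrable[OF ib a] by (intro borel_measurable_integrable integrable_norm) auto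
    show "(\<lambda>x. norm (conv (\<lambda>x. b x - b' x) a x)) \<in> borel_measurable \<mu>"
      using conv_integrable[of "\<lambda>x. b x - b' x", OF _ a] b ib by (intro borel_measurable_integrable integrable_norm) auto
    show "AE x in \<mu>. norm (conv b a x - conv b' a x) = norm (conv (\<lambda>x. b x - b' x) a x)"
      using conv_diff_left[OF b ib a] by eventually_elim simp
  qed
  also have "\<dots> \<le> N1 (\<lambda>x. b x - b' x) * N1 a" using a b ib by (intro conv_norm) auto
  also have "\<dots> \<le> t * N1 a" using b' by (intro mult_right_mono) auto
  finally show ?thesis .
qed

lemma qn_perturb:
  assumes J: "J \<in> Id_set L1" and a: "integrable \<mu> a" and b: "integrable \<mu> b" and q: "qn J b < t"
  shows "qn J a < t + N1 (\<lambda>x. a x - b x)"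
proof -
  obtain b' where b': "b' \<in> J" "N1 (\<lambda>x. b x - b' x) < t" using qn_ex[OF J q] by blast
  note ib = Id_setD(1)[OF J b'(1)]
  have "qn J a \<le> N1 (\<lambda>x. a x - b' x)" by (rule qn_le[OF b'(1)])
  also have "\<dots> = N1 (\<lambda>x. (b x - b' x) + (a x - b x))" by simp
  also have "\<dots> \<le> N1 (\<lambda>x. b x - b' x) + N1 (\<lambda>x. a x - b x)"
    using a b ib by (intro N1_triangle) auto
  finally show ?thesis using b' by linarith
qed

text \<open>A strong convergence that treats \<open>tau_u\<close> and \<open>tau_n\<close> together:
  quotient norms tend to 0 on I and stay away from 0 off I. Only positivity is recorded off I, not
  the size of the norm. Ideals are indexed, so one family can be followed along several
  filters.\<close>

definition SC :: "'i filter \<Rightarrow> ('i \<Rightarrow> ('g \<Rightarrow> complex) set) \<Rightarrow> ('g \<Rightarrow> complex) set \<Rightarrow> bool" where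
  "SC F J I \<longleftrightarrow> I \<in> Id_set L1 \<and> (\<forall>a\<in>I. \<forall>\<epsilon>>0. eventually (\<lambda>i. qn (J i) a < \<epsilon>) F) \<and>
    (\<forall>a. integrable \<mu> a \<longrightarrow> a \<notin> I \<longrightarrow> (\<exists>\<delta>>0. eventually (\<lambda>i. \<delta> \<le> qn (J i) a) F))"

text \<open>For \<open>tau_u\<close>, an a with quotient norm below t modulo I is approximated by an
  element of I, on which the norms tend to 0. For \<open>tau_n\<close>, ideals frequently outside V
  would give a net in the closed complement with the normality property for I, and I would lie there
  too.\<close>

lemma SC_limitin:
  assumes SC: "SC F J I" and J: "\<And>i. J i \<in> Id_set L1"
  shows "limitin (tau_r L1) J I F"
  unfolding limitin_def
proof (intro conjI allI impI)
  have I: "I \<in> Id_set L1" using SC unfolding SC_def by blast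
  have "openin (tau_u L1) (Id_set L1)"
    unfolding tau_u_def by (rule topology_generated_by_Basis) simp
  then show "I \<in> topspace (tau_r L1)" using I unfolding tau_r_def by auto
  fix U assume "openin (tau_r L1) U \<and> I \<in> U"
  then have g: "generate_topology_on ({U. openin (tau_u L1) U} \<union> {U. openin (tau_n L1) U}) U" and IU: "I \<in> U"
    by (auto simp: tau_r_def dest: openin_topology_generated_by)
  show "eventually (\<lambda>i. J i \<in> U) F"
  proof (rule eventually_generate_topology_on[OF g _ IU])
    fix V assume V: "V \<in> {U. openin (tau_u L1) U} \<union> {U. openin (tau_n L1) U}" and IV: "I \<in> V"
    from V consider "openin (tau_u L1) V" | "openin (tau_n L1) V" by blast
    then show "eventually (\<lambda>i. J i \<in> V) F"
    proof cases
      case 1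
      then have g: "generate_topology_on (insert (Id_set L1) {{I\<in>Id_set L1. qn I a < t} | a t. a \<in> acar L1}) V"
        unfolding tau_u_def by (rule openin_topology_generated_by)
      show ?thesis
      proof (rule eventually_generate_topology_on[OF g _ IV])
        fix V assume "V \<in> insert (Id_set L1) {{I\<in>Id_set L1. qn I a < t} | a t. a \<in> acar L1}" and IV: "I \<in> V"
        then consider "V = Id_set L1" | a t where "V = {I\<in>Id_set L1. qn I a < t}" "integrable \<mu> a" by auto
        then show "eventually (\<lambda>i. J i \<in> V) F"
        proof cases
          case 1
          then show ?thesis using J by simp
        next
          case (2 a t)
          then have "qn I a < t" using IV by simp
          from qn_ex[OF I this] obtain b where b: "b \<in> I" "N1 (\<lambda>x. a x - b x) < t" by blast
          have "eventually (\<lambda>i. qn (J i) b < t - N1 (\<lambda>x. a x - b x)) F"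
            using SC b unfolding SC_def by simp
          then show ?thesis
          proof (rule eventually_mono)
            fix i assume q: "qn (J i) b < t - N1 (\<lambda>x. a x - b x)"
            have "qn (J i) a < (t - N1 (\<lambda>x. a x - b x)) + N1 (\<lambda>x. a x - b x)"
              by (rule qn_perturb[OF J 2(2) Id_setD(1)[OF I b(1)] q])
            then show "J i \<in> V" using J 2(1) by simp
          qed
        qed
      qed
    next
      case 2
      show ?thesis
      proof (rule ccontr)
        assume n: "\<not> eventually (\<lambda>i. J i \<in> V) F"
        define F' where "F' = filtermap J (inf F (principal {i. J i \<notin> V}))"
        have "F' \<noteq> bot"
          unfolding F'_def filtermap_bot_iff
          unfolding trivial_limit_def eventually_inf_principal using n by simp
        moreover have "eventually (\<lambda>K. K \<in> Id_set L1 - V) F'"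
          using J by (simp add: F'_def eventually_filtermap eventually_inf_principal)
        moreover have "normality_property L1 F' I"
          unfolding normality_property_def
        proof (intro ballI impI)
          fix a assume "a \<in> acar L1" "a \<notin> I"
          then obtain \<delta> where \<delta>: "\<delta> > 0" "eventually (\<lambda>i. \<delta> \<le> qn (J i) a) F"
            using SC unfolding SC_def by auto
          have "eventually (\<lambda>K. ereal \<delta> \<le> ereal (qn K a)) F'"
            using \<delta>(2) by (simp add: F'_def eventually_filtermap eventually_inf_principal eventually_mono)
          then have "ereal \<delta> \<le> Liminf F' (\<lambda>K. ereal (qn K a))" by (rule Liminf_bounded)
          moreover have "0 < ereal \<delta>" using \<delta>(1) by simp
          ultimately show "0 < Liminf F' (\<lambda>K. ereal (qn K a))" by (rule less_le_trans[rotated])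
        qed
        moreover have "tau_n_closed L1 (Id_set L1 - V)" using 2 unfolding openin_tau_n by blast
        ultimately have "I \<in> Id_set L1 - V" using I tau_n_closedD by blast
        then show False using IV by blast
      qed
    qed
  qed
qed

text \<open>By Tychonoff all quotient norms converge along a finer filter, each one living in a
  compact interval. I collects the elements with limit 0; at any other element the positive limit
  provides the lower bound.\<close>

lemma SC_exists:
  assumes F: "F \<noteq> bot" and J: "\<And>i. J i \<in> Id_set L1"
  shows "\<exists>F' I. F' \<le> F \<and> F' \<noteq> bot \<and> SC F' J I"
proof -
  \<comment> \<open>Off L1 the value 0 is taken, which lies in the interval {0..N1 a} for any
    function a.\<close>
  define w where "w i a = (if integrable \<mu> a then qn (J i) a else 0)" for i and a :: "'g \<Rightarrow> complex"
  define C where "C = PiE UNIV (\<lambda>a :: 'g \<Rightarrow> complex. {0..N1 a})"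
  have C: "compact C"
    using compactin_PiE[of "\<lambda>_. euclidean" UNIV "\<lambda>a :: 'g \<Rightarrow> complex. {0..N1 a}"]
    by (simp add: C_def euclidean_product_topology compactin_euclidean_iff)
  have wC: "w i \<in> C" for i
    using qn_nonneg[OF J] qn_le_N1[OF J] by (auto simp: C_def w_def)
  obtain F' where F': "F' \<le> F" "F' \<noteq> bot" and
    "\<forall>w\<in>{w}. (\<exists>z. filterlim w (nhds z) F') \<or> (\<forall>C. compact C \<longrightarrow> eventually (\<lambda>x. w x \<notin> C) F')"
    using filter_refine[of "{w}" F, OF _ F] by blast
  then obtain z where z: "filterlim w (nhds z) F'"
    using C wC F'(2) by (auto simp: trivial_limit_def)
  have lim: "((\<lambda>i. qn (J i) a) \<longlongrightarrow> z a) F'" if "integrable \<mu> a" for a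
  proof -
    have "((\<lambda>i. w i a) \<longlongrightarrow> z a) F'"
      using continuous_on_tendsto_compose[OF continuous_on_product_coordinates z, of a] by simp
    then show ?thesis using that by (simp add: w_def)
  qed
  define I where "I = {a. integrable \<mu> a \<and> (\<forall>\<epsilon>>0. eventually (\<lambda>i. qn (J i) a < \<epsilon>) F')}"
  have scaled: "\<exists>t>0. c * t < \<epsilon>" if "0 \<le> c" "0 < \<epsilon>" for c \<epsilon> :: real
    using that by (intro exI[of _ "\<epsilon> / (c + 1)"]) (simp add: field_simps)
  have "I \<in> Id_set L1"
  proof (rule Id_setI)
    show "(\<lambda>_. 0) \<in> I"
    proof -
      have "qn (J i) (\<lambda>_. 0) < \<epsilon>" if "\<epsilon> > 0" for i \<epsilon>
        using qn_le_N1[OF J, of i "\<lambda>_. 0"] that by simp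
      then show ?thesis by (simp add: I_def)
    qed
    fix a b :: "'g \<Rightarrow> complex" and c :: complex assume b: "b \<in> I"
    { assume a: "a \<in> I"
      have "eventually (\<lambda>i. qn (J i) (\<lambda>x. a x + b x) < \<epsilon>) F'" if "\<epsilon> > 0" for \<epsilon>
      proof -
        have "eventually (\<lambda>i. qn (J i) a < \<epsilon> / 2) F'" "eventually (\<lambda>i. qn (J i) b < \<epsilon> / 2) F'"
          using a b half_gt_zero[OF that] unfolding I_def by blast+
        then show ?thesis
        proof eventually_elim
          case (elim i)
          have "qn (J i) (\<lambda>x. a x + b x) < \<epsilon> / 2 + \<epsilon> / 2"
            by (rule qn_add[OF J _ _ elim]) (use a b in \<open>auto simp: I_def\<close>)
          then show ?case by simp
        qed
      qed
      then show "(\<lambda>x. a x + b x) \<in> I" using a b by (simp add: I_def) }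
    have "eventually (\<lambda>i. qn (J i) (\<lambda>x. c * b x) < \<epsilon>) F'" if \<epsilon>: "\<epsilon> > 0" for \<epsilon>
    proof -
      obtain t where t: "t > 0" "norm c * t < \<epsilon>" using scaled[OF norm_ge_zero \<epsilon>] by blast
      have "eventually (\<lambda>i. qn (J i) b < t) F'" using b t by (simp add: I_def)
      then show ?thesis by eventually_elim (rule le_less_trans[OF qn_scale[OF J] t(2)])
    qed
    then show "(\<lambda>x. c * b x) \<in> I" using b by (simp add: I_def)
    assume a: "integrable \<mu> a"
    have ib: "integrable \<mu> b" using b by (simp add: I_def)
    have ev: "eventually (\<lambda>i. qn (J i) (conv a b) < \<epsilon> \<and> qn (J i) (conv b a) < \<epsilon>) F'" if \<epsilon>: "\<epsilon> > 0" for \<epsilon>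
    proof -
      obtain t where t: "t > 0" "N1 a * t < \<epsilon>" using scaled[OF N1_nonneg \<epsilon>] by blast
      have "eventually (\<lambda>i. qn (J i) b < t) F'" using b t by (simp add: I_def)
      then show ?thesis
      proof eventually_elim
        case (elim i)
        have "t * N1 a < \<epsilon>" using t(2) by (simp only: mult.commute)
        then show ?case
          using le_less_trans[OF qn_conv_left[OF J a ib elim] t(2)] le_less_trans[OF qn_conv_right[OF J a ib elim]] by blast
      qed
    qed
    show "conv a b \<in> I" "conv b a \<in> I"
      using ev conv_integrable[OF a ib] conv_integrable[OF ib a] by (auto simp: I_def eventually_conj_iff)
  next
    fix a assume a: "integrable \<mu> a" and cl: "\<And>\<epsilon>. \<epsilon> > 0 \<Longrightarrow> \<exists>b\<in>I. N1 (\<lambda>x. a x - b x) < \<epsilon>"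
    have "eventually (\<lambda>i. qn (J i) a < \<epsilon>) F'" if \<epsilon>: "\<epsilon> > 0" for \<epsilon>
    proof -
      obtain b where b: "b \<in> I" "N1 (\<lambda>x. a x - b x) < \<epsilon> / 2" using cl[OF half_gt_zero[OF \<epsilon>]] by blast
      have "eventually (\<lambda>i. qn (J i) b < \<epsilon> / 2) F'" using b(1) half_gt_zero[OF \<epsilon>] unfolding I_def by blast
      then show ?thesis
      proof eventually_elim
        case (elim i)
        have "qn (J i) a < \<epsilon> / 2 + N1 (\<lambda>x. a x - b x)"
          by (rule qn_perturb[OF J a _ elim]) (use b in \<open>simp add: I_def\<close>)
        then show ?case using b(2) by linarith
      qed
    qed
    then show "a \<in> I" using a by (simp add: I_def)
  qed (simp add: I_def)
  moreover have "\<exists>\<delta>>0. eventually (\<lambda>i. \<delta> \<le> qn (J i) a) F'" if a: "integrable \<mu> a" "a \<notin> I" for a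
  proof -
    obtain \<epsilon> where \<epsilon>: "\<epsilon> > 0" "\<not> eventually (\<lambda>i. qn (J i) a < \<epsilon>) F'" using a by (auto simp: I_def)
    have "\<not> z a < \<epsilon>" using order_tendstoD(2)[OF lim[OF a(1)]] \<epsilon>(2) by blast
    then have "\<epsilon> / 2 < z a" using \<epsilon>(1) by simp
    from order_tendstoD(1)[OF lim[OF a(1)] this] have "eventually (\<lambda>i. \<epsilon> / 2 \<le> qn (J i) a) F'"
      by (rule eventually_mono) simp
    then show ?thesis using \<epsilon>(1) half_gt_zero by blast
  qed
  moreover have "\<forall>a\<in>I. \<forall>\<epsilon>>0. eventually (\<lambda>i. qn (J i) a < \<epsilon>) F'" by (simp add: I_def)
  ultimately have "SC F' J I" unfolding SC_def by blast
  then show ?thesis using F' by blast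
qed

end

section \<open>Spectral synthesis fails\<close>

context haar_group begin

definition ann :: "('g \<Rightarrow>\<^sub>C complex) set \<Rightarrow> ('g \<Rightarrow> complex) set" where
  "ann Y = {a. integrable \<mu> a \<and> (\<forall>S\<in>Y. pair a S = 0)}"

text \<open>For b in the annihilator, the pairing of \<open>conv a b\<close> with S involves left
  translates of S and that of \<open>conv b a\<close> right translates.\<close>

lemma ann_Id_set:
  assumes L: "\<And>S g. S \<in> Y \<Longrightarrow> app (Lop g) S \<in> Y" and R: "\<And>S g. S \<in> Y \<Longrightarrow> app (Rop g) S \<in> Y"
  shows "ann Y \<in> Id_set L1"
proof (rule Id_setI)
  fix a b :: "'g \<Rightarrow> complex" assume a: "integrable \<mu> a" and b: "b \<in> ann Y"
  have ib: "integrable \<mu> b" and pb: "pair b S = 0" if "S \<in> Y" for S using b that by (auto simp: ann_def)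
  have ib: "integrable \<mu> b" using b by (simp add: ann_def)
  have "pair (conv a b) S = 0" if S: "S \<in> Y" for S
  proof -
    have "app (theta b) S = 0" by (rule bcontfun_eqI) (simp add: app_theta_pair[OF ib] pb[OF L[OF S]])
    then have "pair a (app (theta b) S) = 0" by (simp add: pair_def)
    then show ?thesis by (simp only: pair_conv_theta[OF a ib])
  qed
  then show "conv a b \<in> ann Y" using conv_integrable[OF a ib] by (simp add: ann_def)
  have "pair (conv b a) S = 0" if S: "S \<in> Y" for S
    by (simp add: pair_conv_theta[OF ib a] pair_theta_swap[OF ib a] pb[OF R[OF S]])
  then show "conv b a \<in> ann Y" using conv_integrable[OF ib a] by (simp add: ann_def)
next
  fix a assume a: "integrable \<mu> a" and cl: "\<And>\<epsilon>. \<epsilon> > 0 \<Longrightarrow> \<exists>b\<in>ann Y. N1 (\<lambda>x. a x - b x) < \<epsilon>"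
  have "pair a S = 0" if S: "S \<in> Y" for S
  proof (rule ccontr)
    assume "pair a S \<noteq> 0"
    define p s where "p = norm (pair a S)" and "s = norm S"
    have p: "p > 0" and s: "s \<ge> 0" using \<open>pair a S \<noteq> 0\<close> by (simp_all add: p_def s_def)
    then have "p / (s + 1) > 0" by (intro divide_pos_pos) auto
    then obtain b where b: "b \<in> ann Y" "N1 (\<lambda>x. a x - b x) < p / (s + 1)" using cl by blast
    then have ib: "integrable \<mu> b" "pair b S = 0" using S by (auto simp: ann_def)
    have "p = norm (pair (\<lambda>x. a x - b x) S)" by (simp add: p_def pair_diff_left a ib)
    also have "\<dots> \<le> N1 (\<lambda>x. a x - b x) * s" unfolding s_def using a ib by (intro pair_bound) auto
    also have "\<dots> \<le> p / (s + 1) * s" using b(2) s by (intro mult_right_mono) auto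
    also have "\<dots> < p" using p s by (simp add: field_simps)
    finally show False by simp
  qed
  then show "a \<in> ann Y" using a by (simp add: ann_def)
qed (auto simp: ann_def pair_add_left pair_scale_left, simp add: pair_def)

lemma N1_diff_zero_AE: "AE x in \<mu>. a x = b x \<Longrightarrow> N1 (\<lambda>x. a x - b x) = 0"
  by (rule integral_eq_zero_AE) (auto elim: eventually_mono)

text \<open>If \<open>L\<close> does not contain \<open>K\<close> then \<open>L + K\<close> is the whole algebra, so the modular right unit is
  \<open>u = l + k\<close>, and \<open>\<kappa> \<equiv> \<kappa> l + \<kappa> k\<close> puts every \<open>\<kappa> \<in> K\<close> into \<open>L\<close>.\<close>
lemma Prim_absorb:
  assumes P: "P \<in> Prim L1" and I: "I \<in> Id_set L1" and K: "K \<in> Id_set L1" and IP: "I \<subseteq> P"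
    and KK: "\<And>a b. a \<in> K \<Longrightarrow> b \<in> K \<Longrightarrow> conv a b \<in> I"
  shows "K \<subseteq> P"
proof -
  obtain L where mm: "maximal_modular_left_ideal L1 L" and PL: "P = {a. integrable \<mu> a \<and> (\<forall>b. integrable \<mu> b \<longrightarrow> conv a b \<in> L)}"
    using P unfolding Prim_def by auto
  have Lid: "left_ideal L1 L" and Lmax: "\<And>L'. left_ideal L1 L' \<Longrightarrow> L \<subseteq> L' \<Longrightarrow> L' \<noteq> acar L1 \<Longrightarrow> L' = L"
    using mm unfolding maximal_modular_left_ideal_def modular_left_ideal_def by blast+
  obtain u where u: "integrable \<mu> u" and uL: "\<And>a. integrable \<mu> a \<Longrightarrow> (\<lambda>x. a x - conv a u x) \<in> L"
    using mm unfolding maximal_modular_left_ideal_def modular_left_ideal_def by auto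
  have Li: "\<And>a. a \<in> L \<Longrightarrow> integrable \<mu> a" and L0: "(\<lambda>_. 0) \<in> L"
    and Ladd: "\<And>a b. a \<in> L \<Longrightarrow> b \<in> L \<Longrightarrow> (\<lambda>x. a x + b x) \<in> L"
    and Lscale: "\<And>c a. a \<in> L \<Longrightarrow> (\<lambda>x. c * a x) \<in> L"
    and Lmul: "\<And>a b. integrable \<mu> a \<Longrightarrow> b \<in> L \<Longrightarrow> conv a b \<in> L"
    using Lid by (auto simp: left_ideal_def subspace_of_def)
  have "saturated L1 L" using Lid by (simp add: left_ideal_def subspace_of_def)
  then have Lsat: "b \<in> L" if "a \<in> L" "integrable \<mu> b" "N1 (\<lambda>x. a x - b x) = 0" for a b
    using that unfolding saturated_def by simp
  have IL: "i \<in> L" if "i \<in> I" for i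
  proof -
    have i: "integrable \<mu> i" "conv i u \<in> L" using IP that u by (auto simp: PL)
    show ?thesis using Ladd[OF uL[OF i(1)] i(2)] by simp
  qed
  note K' = Id_setD[OF K]
  have KL: "K \<subseteq> L"
  proof (rule ccontr)
    assume "\<not> K \<subseteq> L"
    then obtain \<kappa> where \<kappa>: "\<kappa> \<in> K" "\<kappa> \<notin> L" by blast
    define L' where "L' = {c. \<exists>l\<in>L. \<exists>k\<in>K. c = (\<lambda>x. l x + k x)}"
    \<comment> \<open>L' consists of exact pointwise sums, while algebraic identities hold up to
      null functions; the saturated L absorbs the difference.\<close>
    have L'I: "b \<in> L'" if l: "l \<in> L" and k: "k \<in> K" and b: "integrable \<mu> b" and z: "N1 (\<lambda>x. l x + k x - b x) = 0" for l k b
    proof -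
      have il: "integrable \<mu> l" and ik: "integrable \<mu> k" using Li[OF l] K'(1)[OF k] .
      have "(\<lambda>x. b x - (l x + k x)) \<in> L"
      proof (rule Lsat[OF L0])
        show "integrable \<mu> (\<lambda>x. b x - (l x + k x))" using b il ik by auto
        show "N1 (\<lambda>x. 0 - (b x - (l x + k x))) = 0" using z by simp
      qed
      from this have lb: "(\<lambda>x. b x - (l x + k x)) \<in> L" .
      define l' where "l' x = l x + (b x - (l x + k x))" for x
      have l': "l' \<in> L" unfolding l'_def[abs_def] by (rule Ladd[OF l lb])
      have "b = (\<lambda>x. l' x + k x)" by (rule ext) (simp add: l'_def)
      then show ?thesis
        unfolding L'_def by (intro CollectI bexI[of _ l'] bexI[of _ k] l' k)
    qed
    have L'E: "\<exists>l\<in>L. \<exists>k\<in>K. c = (\<lambda>x. l x + k x)" if "c \<in> L'" for c using that by (simp add: L'_def)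
    have L'i: "integrable \<mu> c" if "c \<in> L'" for c
      using L'E[OF that] Li K'(1) by auto
    have "left_ideal L1 L'"
      unfolding left_ideal_def subspace_of_def saturated_def
    proof (intro conjI ballI allI impI)
      show "L' \<subseteq> acar L1" using L'i by auto
      show "azero L1 \<in> L'" by (rule L'I[OF L0 K'(2)]) simp_all
    next
      fix a b assume "a \<in> L'" "b \<in> L'"
      then obtain l k l' k' where lk: "l \<in> L" "k \<in> K" "l' \<in> L" "k' \<in> K" "a = (\<lambda>x. l x + k x)" "b = (\<lambda>x. l' x + k' x)"
        using L'E by metis
      show "aadd L1 a b \<in> L'"
        by (rule L'I[OF Ladd[OF lk(1,3)] K'(3)[OF lk(2,4)]])
          (use Li[OF lk(1)] Li[OF lk(3)] K'(1)[OF lk(2)] K'(1)[OF lk(4)] in \<open>auto simp: lk(5,6)\<close>)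
    next
      fix c a assume "a \<in> L'"
      then obtain l k where lk: "l \<in> L" "k \<in> K" "a = (\<lambda>x. l x + k x)" using L'E by metis
      show "asmul L1 c a \<in> L'"
        by (rule L'I[OF Lscale[OF lk(1), of c] K'(4)[OF lk(2), of c]])
          (use Li[OF lk(1)] K'(1)[OF lk(2)] in \<open>auto simp: lk(3) distrib_left\<close>)
    next
      fix a b assume "a \<in> L'" and b: "b \<in> acar L1" "anorm L1 (asub L1 a b) = 0"
      then obtain l k where lk: "l \<in> L" "k \<in> K" "a = (\<lambda>x. l x + k x)" using L'E by metis
      show "b \<in> L'" by (rule L'I[OF lk(1,2)]) (use b lk(3) in auto)
    next
      fix a b assume a: "a \<in> acar L1" and "b \<in> L'"
      then obtain l k where lk: "l \<in> L" "k \<in> K" "b = (\<lambda>x. l x + k x)" using L'E by metis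
      have ia: "integrable \<mu> a" using a by simp
      have il: "integrable \<mu> l" and ik: "integrable \<mu> k" using Li[OF lk(1)] K'(1)[OF lk(2)] .
      have ib: "integrable \<mu> b" using il ik by (simp add: lk(3))
      have "AE x in \<mu>. conv a l x + conv a k x = conv a b x"
        using conv_add_right[OF ia il ik] unfolding lk(3) by eventually_elim simp
      then show "amul L1 a b \<in> L'"
        using conv_integrable[OF ia ib] by (intro L'I[OF Lmul[OF ia lk(1)] K'(5)[OF ia lk(2)]]) (auto intro: N1_diff_zero_AE)
    qed
    moreover have "L \<subseteq> L'"
    proof
      fix l assume l: "l \<in> L"
      show "l \<in> L'" by (rule L'I[OF l K'(2)]) (use Li[OF l] in auto)
    qed
    moreover have "\<kappa> \<in> L'" by (rule L'I[OF L0 \<kappa>(1)]) (use K'(1)[OF \<kappa>(1)] in auto)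
    ultimately have "L' = acar L1" using Lmax \<kappa>(2) by blast
    then have "u \<in> L'" using u by simp
    then obtain l k where lk: "l \<in> L" "k \<in> K" "u = (\<lambda>x. l x + k x)" using L'E by metis
    note i\<kappa> = K'(1)[OF \<kappa>(1)]
    have s: "(\<lambda>x. conv \<kappa> l x + conv \<kappa> k x) \<in> L"
      by (rule Ladd[OF Lmul[OF i\<kappa> lk(1)] IL[OF KK[OF \<kappa>(1) lk(2)]]])
    have "AE x in \<mu>. conv \<kappa> l x + conv \<kappa> k x = conv \<kappa> u x"
      using conv_add_right[OF i\<kappa> Li[OF lk(1)] K'(1)[OF lk(2)]] unfolding lk(3) by eventually_elim simp
    from Lsat[OF s conv_integrable[OF i\<kappa> u] N1_diff_zero_AE[OF this]] have "conv \<kappa> u \<in> L" .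
    from Ladd[OF uL[OF i\<kappa>] this] have "\<kappa> \<in> L" by simp
    with \<kappa>(2) show False ..
  qed
  show ?thesis
  proof
    fix \<kappa> assume "\<kappa> \<in> K"
    then show "\<kappa> \<in> P" using K'(1,6) KL by (auto simp: PL)
  qed
qed

lemma pair_theta_e: "integrable \<mu> b \<Longrightarrow> pair b S = app (theta b) S e"
  by (simp add: app_theta pair_def)

text \<open>After b is replaced by a k supported on a compact K, a point y outside C K^-1 has y K
  disjoint from C, and off C the function \<phi> is small.\<close>

lemma c0_theta:
  assumes b: "integrable \<mu> b" and \<phi>: "c0 \<phi>" shows "c0 (app (theta b) \<phi>)"
  unfolding c0_def
proof (intro allI impI)
  fix \<epsilon> :: real assume \<epsilon>: "\<epsilon> > 0"
  define d where "d = \<epsilon> / 2 / (norm \<phi> + 1)"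
  have d: "d > 0" unfolding d_def using \<epsilon> by (intro divide_pos_pos) (auto intro: add_nonneg_pos)
  obtain k K where k: "continuous_on UNIV k" "compact K" "\<forall>x. x \<notin> K \<longrightarrow> k x = 0" "N1 (\<lambda>x. b x - k x) < d"
    using ccont_dense[OF b d] by blast
  have ik: "integrable \<mu> k" using k by (intro ccont_integrable[of k K]) auto
  define d' where "d' = \<epsilon> / 2 / (N1 k + 1)"
  have d': "d' > 0" unfolding d'_def using \<epsilon> by (intro divide_pos_pos) (auto intro: add_nonneg_pos)
  obtain C where C: "compact C" "\<And>p. p \<notin> C \<Longrightarrow> norm (\<phi> p) \<le> d'" using \<phi> d' unfolding c0_def by blast
  define D where "D = (\<lambda>p. fst p \<cdot> snd p) ` (C \<times> (ginv ` K))"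
  have "compact D"
    unfolding D_def
    using compact_mult_image[OF C(1) compact_continuous_image[OF _ k(2)] continuous_on_id, of ginv]
    by (simp add: continuous_on_ginv continuous_on_id)
  moreover have "norm (app (theta b) \<phi> y) \<le> \<epsilon>" if y: "y \<notin> D" for y
  proof -
    \<comment> \<open>Cutting the translate of \<phi> to K makes the bound d' hold at all points, as
      \<open>norm_integral_mult_le\<close> asks.\<close>
    have small: "norm (\<integral>z. k z * (if z \<in> K then \<phi> (y \<cdot> z) else 0) \<partial>\<mu>) \<le> N1 k * d'"
    proof (rule norm_integral_mult_le(2)[OF ik])
      have "K \<in> sets \<mu>" using compact_borel[OF k(2)] by simp
      then show "(\<lambda>z. if z \<in> K then \<phi> (y \<cdot> z) else 0) \<in> borel_measurable \<mu>"
        using translate_bcontfun_meas(1)[of \<phi> y] by (intro measurable_If_set) (auto simp: Int_absorb1 sets.sets_into_space)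
      fix z
      have "norm (\<phi> (y \<cdot> z)) \<le> d'" if "z \<in> K"
      proof (rule C(2))
        show "y \<cdot> z \<notin> C"
        proof
          assume "y \<cdot> z \<in> C"
          then have "(y \<cdot> z) \<cdot> ginv z \<in> D" unfolding D_def using that by force
          then show False using y by (simp add: assoc)
        qed
      qed
      then show "norm (if z \<in> K then \<phi> (y \<cdot> z) else 0) \<le> d'" using d' by simp
    qed
    have "(\<integral>z. k z * (if z \<in> K then \<phi> (y \<cdot> z) else 0) \<partial>\<mu>) = app (theta k) \<phi> y"
      unfolding app_theta[OF ik] by (rule Bochner_Integration.integral_cong) (use k(3) in auto)
    then have 1: "norm (app (theta k) \<phi> y) \<le> N1 k * d'" using small by simp
    have "app (theta b) \<phi> y - app (theta k) \<phi> y = app (theta (\<lambda>x. b x - k x)) \<phi> y"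
      using theta_diff[OF b ik, of \<phi>] by simp
    also have "norm \<dots> \<le> norm (app (theta (\<lambda>x. b x - k x)) \<phi>)" by (rule norm_bounded)
    also have "\<dots> \<le> N1 (\<lambda>x. b x - k x) * norm \<phi>" using b ik by (intro norm_theta) auto
    also have "\<dots> \<le> d * norm \<phi>" using k(4) by (intro mult_right_mono) auto
    also have "\<dots> \<le> \<epsilon> / 2"
    proof -
      have "norm \<phi> / (norm \<phi> + 1) \<le> 1" by (simp add: divide_le_eq_1 add_nonneg_pos)
      from mult_left_mono[OF this, of "\<epsilon> / 2"] show ?thesis using \<epsilon> by (simp add: d_def)
    qed
    also have "N1 k * d' \<le> \<epsilon> / 2"
    proof -
      have "N1 k / (N1 k + 1) \<le> 1" using N1_nonneg[of k] by (simp add: divide_le_eq_1 add_nonneg_pos)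
      from mult_left_mono[OF this, of "\<epsilon> / 2"] show ?thesis using \<epsilon> by (simp add: d'_def mult.commute)
    qed
    ultimately show ?thesis
      using 1 norm_triangle_ineq[of "app (theta b) \<phi> y - app (theta k) \<phi> y" "app (theta k) \<phi> y"] by simp
  qed
  ultimately show "\<exists>C. compact C \<and> (\<forall>p. p \<notin> C \<longrightarrow> norm (app (theta b) \<phi> p) \<le> \<epsilon>)" by blast
qed

text \<open>Dropping the zeroth term of the series gives a constant that is small with c; the
  triangle inequality would give exp c + 1.\<close>

lemma sym1_exp_minus_one:
  assumes "sym1 X c" shows "sym1 (exp X - 1) (exp c - 1)"
proof -
  have "sym1 (inverse (fact (Suc n)) *\<^sub>R X ^ Suc n) (inverse (fact (Suc n)) *\<^sub>R c ^ Suc n)" for n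
    using sym1_scaleR[OF sym1_power[OF assms], of "inverse (fact (Suc n))" "Suc n"] by simp
  moreover have "summable (\<lambda>n. inverse (fact (Suc n)) *\<^sub>R c ^ Suc n)"
    using summable_exp_generic[of c] by (subst summable_Suc_iff)
  ultimately have "sym1 (\<Sum>n. inverse (fact (Suc n)) *\<^sub>R X ^ Suc n) (\<Sum>n. inverse (fact (Suc n)) *\<^sub>R c ^ Suc n)"
    by (rule sym1_suminf)
  then show ?thesis using exp_first_term[of X] exp_first_term[of c] by simp
qed

lemma pair_image_diff:
  assumes E: "sym1 E c" and k: "integrable \<mu> (apply_bcontfun k)"
  shows "integrable \<mu> (apply_bcontfun (app E k - k))"
    and "pair (apply_bcontfun (app E k - k)) S = pair k (app E S - S)"
proof -
  have e: "apply_bcontfun (app E k - k) = (\<lambda>x. app E k x - k x)" by (rule ext) simp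
  show "integrable \<mu> (apply_bcontfun (app E k - k))" unfolding e using sym1D(2)[OF E k] k by simp
  show "pair (apply_bcontfun (app E k - k)) S = pair k (app E S - S)"
    unfolding e pair_diff_left[OF sym1D(2)[OF E k] k] pair_diff_right[OF k] sym1D(4)[OF E k] ..
qed

end

context almost_abelian begin

text \<open>The conjugate of T times a bump at a point where T is nonzero gives a nonnegative
  integrand, positive on an open set.\<close>

lemma exists_test:
  assumes "T \<noteq> 0"
  shows "\<exists>k. integrable \<mu> (apply_bcontfun k) \<and> pair (apply_bcontfun k) T \<noteq> 0"
proof -
  obtain p where p: "T p \<noteq> 0" using assms by (metis bcontfun_eqI apply_bcontfun_simps(4))
  define h where "h = app (Lop (ginv p)) k0"
  have ih: "integrable \<mu> (apply_bcontfun h)" unfolding h_def by (rule pair_Lop(1)[OF k0_integrable])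
  have h: "0 \<le> Re (h x)" "Im (h x) = 0" "h p = 1" for x using k0(2,3,4) by (simp_all add: h_def)
  have bc: "(\<lambda>x. h x * cnj (T x)) \<in> bcontfun"
    by (rule bcontfun_normI[where b = "norm h * norm T"])
      (auto intro!: continuous_intros simp: norm_mult mult_mono norm_bounded)
  define k where "k = Bcontfun (\<lambda>x. h x * cnj (T x))"
  have k: "apply_bcontfun k = (\<lambda>x. h x * cnj (T x))" unfolding k_def by (rule Bcontfun_inverse[OF bc])
  have ik: "integrable \<mu> (apply_bcontfun k)" using pair_integrable[OF ih, of "app cnjop T"] by (simp add: k)
  define q where "q x = Re (h x) * (norm (T x))\<^sup>2" for x
  have qk: "k x * T x = of_real (q x)" for x
  proof -
    have "h x = of_real (Re (h x))" using h(2)[of x] by (simp add: complex_eq_iff)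
    moreover have "cnj (T x) * T x = of_real ((norm (T x))\<^sup>2)" 
      using complex_norm_square[of "T x"] by (simp add: mult.commute)
    ultimately show ?thesis unfolding k q_def by (metis mult.assoc of_real_mult)
  qed
  have iq: "integrable \<mu> q"
  proof -
    have "norm (k x * T x) = q x" for x using h(1)[of x] unfolding qk norm_of_real by (simp add: q_def)
    then show ?thesis using integrable_norm[OF pair_integrable[OF ik, of T]] by (simp only:)
  qed
  have q0: "0 \<le> q x" for x using h(1)[of x] by (simp add: q_def)
  have pq: "pair (apply_bcontfun k) T = of_real (\<integral>x. q x \<partial>\<mu>)"
    unfolding pair_def qk by (rule integral_complex_of_real)
  have "pair (apply_bcontfun k) T \<noteq> 0"
  proof
    assume "pair (apply_bcontfun k) T = 0"
    then have "(\<integral>x. q x \<partial>\<mu>) = 0" unfolding pq by simp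
    then have ae: "AE x in \<mu>. q x = 0"
      using integral_nonneg_eq_0_iff_AE[OF iq] q0 by simp
    have op: "open {x. 0 < q x}" unfolding q_def by (intro open_Collect_less continuous_intros) simp_all
    have "p \<in> {x. 0 < q x}" using p by (simp add: q_def h(3))
    then have pos: "emeasure \<mu> {x. 0 < q x} > 0" using emeasure_open_pos[OF op] by blast
    have "{x. 0 < q x} \<in> null_sets \<mu>"
      using ae op by (subst AE_iff_null_sets) (auto elim: eventually_mono)
    with pos show False by (simp add: null_sets_def)
  qed
  then show ?thesis using ik by blast
qed

text \<open>The contradiction is with the requirement that proper closed ideals be intersections of
  primitive ideals.\<close>

lemma not_synthesis:
  assumes A: "E \<in> calg" "sym1 E c" and T: "T \<noteq> 0" "app E T = T" and S: "app E S = S - T"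
  shows "\<not> spectral_synthesis L1"
proof
  assume syn: "spectral_synthesis L1"
  obtain k where k: "integrable \<mu> (apply_bcontfun k)" "pair (apply_bcontfun k) T \<noteq> 0" using exists_test[OF T(1)] by blast
  \<comment> \<open>YK and YI are the kernels of E - 1 and of (E - 1)^2.\<close>
  define YK where "YK = {\<phi>. app E \<phi> = \<phi>}"
  define YI where "YI = {\<phi>. app E (app E \<phi> - \<phi>) = app E \<phi> - \<phi>}"
  have comm: "app E (app D \<phi>) = app D (app E \<phi>)" if "E * D = D * E" for D \<phi>
    using arg_cong[OF that, of "\<lambda>T. app T \<phi>"] by simp
  note cL = comm[OF calgD(1)[OF A(1)]] and cR = comm[OF calgD(2)[OF A(1)]]
  have K: "ann YK \<in> Id_set L1" by (rule ann_Id_set) (simp_all add: YK_def cL cR)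
  have I: "ann YI \<in> Id_set L1"
    by (rule ann_Id_set) (simp_all add: YI_def cL cR flip: app.diff_right)
  have KK: "conv a b \<in> ann YI" if a: "a \<in> ann YK" and b: "b \<in> ann YK" for a b
  proof -
    have ia: "integrable \<mu> a" and ib: "integrable \<mu> b" using a b by (auto simp: ann_def)
    note c\<theta> = comm[OF calgD(4)[OF A(1) ib]]
    have "pair (conv a b) \<phi> = 0" if \<phi>: "\<phi> \<in> YI" for \<phi>
    proof -
      \<comment> \<open>b annihilates the translates of (E - 1) \<phi>, so \<open>theta b\<close>
        maps \<phi> into YK, where a annihilates it.\<close>
      have "app (Lop y) (app E \<phi> - \<phi>) \<in> YK" for y using \<phi> by (simp add: YK_def YI_def cL)
      then have "app (theta b) (app E \<phi> - \<phi>) = 0"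
        using b by (intro bcontfun_eqI) (simp add: app_theta_pair[OF ib] ann_def)
      then have "app E (app (theta b) \<phi>) = app (theta b) \<phi>" by (simp add: c\<theta> app.diff_right)
      then show ?thesis using a by (simp add: pair_conv_theta[OF ia ib] ann_def YK_def)
    qed
    then show ?thesis using conv_integrable[OF ia ib] by (simp add: ann_def)
  qed
  \<comment> \<open>E is symmetric, so f pairs with \<phi> as k does with (E - 1) \<phi>: to 0 on
    YK, and to - \<open>pair k T\<close> on S.\<close>
  define f where "f = apply_bcontfun (app E k - k)"
  note f = pair_image_diff[OF A(2) k(1), folded f_def]
  have fK: "f \<in> ann YK" using f by (simp add: ann_def YK_def pair_def)
  have "S \<in> YI" using T(2) by (simp add: YI_def S app.minus_right)
  moreover have "pair f S \<noteq> 0"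
  proof -
    have "app E S - S = (-1) *\<^sub>R T" by (simp add: S)
    then have "pair f S = (-1) *\<^sub>R pair k T"
      using linear_cmul[OF bounded_linear.linear[OF pair_bounded_linear[OF k(1)]], of "-1" T] by (simp only: f(2))
    then show ?thesis using k(2) by simp
  qed
  ultimately have fI: "f \<notin> ann YI" by (auto simp: ann_def)
  then have "ann YI \<noteq> acar L1" using f(1) by auto
  then obtain \<S> where \<S>: "\<S> \<subseteq> Prim L1" "ann YI = \<Inter>\<S>"
    using syn I unfolding spectral_synthesis_def by blast
  have "ann YK \<subseteq> P" if P: "P \<in> \<S>" for P
  proof (rule Prim_absorb[OF _ I K _ KK])
    show "P \<in> Prim L1" using P \<S>(1) by blast
    show "ann YI \<subseteq> P" using P unfolding \<S>(2) by blast
  qed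
  then have "ann YK \<subseteq> ann YI" unfolding \<S>(2) by blast
  then show False using fK fI by blast
qed

end

section \<open>Iterated limits of ideals\<close>

context almost_abelian begin

lemma exp_nu_calg:
  assumes A: "A \<in> calg" and x: "x \<in> N"
  shows "(s *\<^sub>R (Jop * nu x)) * A = A * (s *\<^sub>R (Jop * nu x))"
    and "A - s *\<^sub>R (Jop * nu x) \<in> calg"
proof -
  have "A * (Jop * nu x) = (Jop * A) * nu x" using calgD(3)[OF A, of \<i>] by (simp add: mult.assoc[symmetric])
  also have "\<dots> = Jop * nu x * A" using calg_comm_nu[OF A, of x] by (simp add: mult.assoc)
  finally show "(s *\<^sub>R (Jop * nu x)) * A = A * (s *\<^sub>R (Jop * nu x))" by simp
  show "A - s *\<^sub>R (Jop * nu x) \<in> calg"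
    by (intro closed_subalgD(4,5,8)[OF closed_subalg_calg] A mulc_calg nu_calg x)
qed

lemma sym1_Jnu: "x \<in> N \<Longrightarrow> sym1 (s *\<^sub>R (Jop * nu x)) \<bar>s\<bar>"
proof -
  assume x: "x \<in> N"
  have "sym1 (Jop * nu x) (norm \<i> * 1)"
    by (rule sym1_mult[OF sym1_mulc sym1_nu[OF x]]) (simp add: calgD(3)[OF nu_calg[OF x]])
  from sym1_scaleR[OF this, of s] show ?thesis by simp
qed

text \<open>For x outside N the annihilator of the empty set is the whole algebra. This keeps the
  family total, with closed ideals as values, as \<open>SC_exists\<close> expects; along
  \<open>XX\<close> x is eventually in N.\<close>

definition Iperturb :: "'g cbop \<Rightarrow> real \<Rightarrow> 'g \<Rightarrow> ('g \<Rightarrow> complex) set" where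
  "Iperturb A \<eta> x = ann (if x \<in> N then {\<phi>. app (exp (A - \<eta> *\<^sub>R (Jop * nu x))) \<phi> = \<phi>} else {})"

lemma Iperturb_Id_set:
  assumes A: "A \<in> calg" shows "Iperturb A \<eta> x \<in> Id_set L1"
proof (cases "x \<in> N")
  case True
  have E: "exp (A - \<eta> *\<^sub>R (Jop * nu x)) \<in> calg"
    by (intro closed_subalg_exp closed_subalg_calg exp_nu_calg A True)
  have comm: "app (exp (A - \<eta> *\<^sub>R (Jop * nu x))) (app D \<phi>) = app D (app (exp (A - \<eta> *\<^sub>R (Jop * nu x))) \<phi>)"
    if "exp (A - \<eta> *\<^sub>R (Jop * nu x)) * D = D * exp (A - \<eta> *\<^sub>R (Jop * nu x))" for D \<phi>
    using arg_cong[OF that, of "\<lambda>T. app T \<phi>"] by simp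
  show ?thesis
    unfolding Iperturb_def using True
    by (intro ann_Id_set) (simp_all add: comm[OF calgD(1)[OF E]] comm[OF calgD(2)[OF E]])
next
  case False
  then show ?thesis unfolding Iperturb_def by (intro ann_Id_set) simp_all
qed

text \<open>A commutes with \<open>nu x\<close>, so exp A and its perturbation differ by a commuting
  factor.\<close>

lemma exp_split:
  assumes A: "A \<in> calg" and x: "x \<in> N"
  shows "exp A = exp (\<eta> *\<^sub>R (Jop * nu x)) * exp (A - \<eta> *\<^sub>R (Jop * nu x))"
    and "exp A = exp (A - \<eta> *\<^sub>R (Jop * nu x)) * exp (\<eta> *\<^sub>R (Jop * nu x))"
    and "exp (A - \<eta> *\<^sub>R (Jop * nu x)) = exp ((- \<eta>) *\<^sub>R (Jop * nu x)) * exp A"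
    and "exp ((- \<eta>) *\<^sub>R (Jop * nu x)) * exp A = exp A * exp ((- \<eta>) *\<^sub>R (Jop * nu x))"
proof -
  define X where "X = \<eta> *\<^sub>R (Jop * nu x)"
  have XA: "X * A = A * X" unfolding X_def by (rule exp_nu_calg(1)[OF A x])
  have c1: "X * (A - X) = (A - X) * X" using XA by (simp add: left_diff_distrib right_diff_distrib)
  have c2: "(- X) * A = A * (- X)" using XA by simp
  have m: "(- \<eta>) *\<^sub>R (Jop * nu x) = - X" by (simp add: X_def)
  show "exp A = exp (\<eta> *\<^sub>R (Jop * nu x)) * exp (A - \<eta> *\<^sub>R (Jop * nu x))"
    unfolding X_def[symmetric] using exp_add_commuting[OF c1] by simp
  show "exp A = exp (A - \<eta> *\<^sub>R (Jop * nu x)) * exp (\<eta> *\<^sub>R (Jop * nu x))"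
    unfolding X_def[symmetric] using exp_add_commuting[OF c1[symmetric]] by simp
  show "exp (A - \<eta> *\<^sub>R (Jop * nu x)) = exp ((- \<eta>) *\<^sub>R (Jop * nu x)) * exp A"
    unfolding m X_def[symmetric] using exp_add_commuting[OF c2] by simp
  show "exp ((- \<eta>) *\<^sub>R (Jop * nu x)) * exp A = exp A * exp ((- \<eta>) *\<^sub>R (Jop * nu x))"
    unfolding m using exp_add_commuting[OF c2] exp_add_commuting[OF c2[symmetric]] by (simp add: add.commute)
qed

text \<open>With D the perturbed exponential and g = exp X k, the element (D - 1) g annihilates the
  fixed vectors of D. Since exp A k = D g, it differs from (exp A - 1) k only by (exp X - 1) k,
  which is of order \<eta> in L1.\<close>

lemma qn_Iperturb_small:
  assumes A: "A \<in> calg" and E: "sym1 (exp A) c" and k: "integrable \<mu> (apply_bcontfun k)"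
    and x: "x \<in> N" and \<eta>: "0 < \<eta>"
  shows "qn (Iperturb A \<eta> x) (apply_bcontfun (app (exp A) k - k)) \<le> (exp \<eta> - 1) * N1 k"
proof -
  define X where "X = \<eta> *\<^sub>R (Jop * nu x)"
  define D where "D = exp (A - X)"
  have sX: "sym1 X \<eta>" using sym1_Jnu[OF x, of \<eta>] \<eta> by (simp add: X_def)
  have sX': "sym1 (exp ((- \<eta>) *\<^sub>R (Jop * nu x))) (exp \<eta>)" using sym1_exp[OF sym1_Jnu[OF x, of "- \<eta>"]] \<eta> by simp
  have sD: "sym1 D (exp \<eta> * c)"
    unfolding D_def X_def exp_split(3)[OF A x] by (rule sym1_mult[OF sX' E]) (use exp_split(4)[OF A x] in simp)
  define g where "g = app (exp X) k"
  have ig: "integrable \<mu> (apply_bcontfun g)" unfolding g_def by (rule sym1D(2)[OF sym1_exp[OF sX] k])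
  have gI: "apply_bcontfun (app D g - g) \<in> Iperturb A \<eta> x"
  proof -
    have "pair (apply_bcontfun (app D g - g)) S = 0" if "app D S = S" for S
      unfolding pair_image_diff(2)[OF sD ig] that by (simp add: pair_def)
    then show ?thesis
      using pair_image_diff(1)[OF sD ig] x by (simp add: Iperturb_def ann_def D_def X_def)
  qed
  have e: "app (exp A) k = app D g"
    unfolding g_def D_def X_def exp_split(2)[OF A x, of \<eta>] app_mult ..
  have "qn (Iperturb A \<eta> x) (apply_bcontfun (app (exp A) k - k)) \<le>
      N1 (\<lambda>x. apply_bcontfun (app (exp A) k - k) x - apply_bcontfun (app D g - g) x)"
    by (rule qn_le[OF gI])
  also have "\<dots> = N1 (app (exp X - 1) k)" by (simp add: e g_def app.diff_left)
  also have "\<dots> \<le> (exp \<eta> - 1) * N1 k" by (rule sym1D(3)[OF sym1_exp_minus_one[OF sX] k])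
  finally show ?thesis .
qed

text \<open>The main estimate: \<open>R = \<nu>\<^sub>x T'\<close>, with \<open>T'\<close> the perturbed wave, is annihilated by \<open>Iperturb A \<eta> x\<close>,
  while \<open>(exp A - 1) R = \<eta> J \<nu>\<^sub>x\<^sup>2 T + O(\<eta>\<^sup>2)\<close>.\<close>
lemma Iperturb_lower:
  assumes A: "A \<in> calg" and E: "sym1 (exp A) c" and k: "integrable \<mu> (apply_bcontfun k)"
    and x: "x \<in> N" and \<eta>: "0 < \<eta>" "\<eta> \<le> 1" and C: "0 \<le> C"
    and T': "app (exp (A - \<eta> *\<^sub>R (Jop * nu x))) T' = T'" "norm (T' - T) \<le> C * \<eta>"
    and a: "integrable \<mu> a" and a': "a' \<in> Iperturb A \<eta> x"
  defines "f \<equiv> apply_bcontfun (app (exp A) k - k)" and "B \<equiv> norm T + C"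
  shows "\<eta> * norm (pair k (app (nu x) (app (nu x) T))) - \<eta>\<^sup>2 * (N1 k * (3 * B + C)) \<le>
    norm (pair (\<lambda>x. f x - a x) (app (nu x) T)) + N1 (\<lambda>x. f x - a x) * (C * \<eta>) + N1 (\<lambda>x. a x - a' x) * B"
proof -
  define X where "X = \<eta> *\<^sub>R (Jop * nu x)"
  define D where "D = exp (A - X)"
  define R where "R = app (nu x) T'"
  \<comment> \<open>T does not depend on x, so the pairing of Q with a fixed element of L1 tends to
    0 as x tends to infinity. R itself is compared with Q up to order \<eta>.\<close>
  define Q where "Q = app (nu x) T"
  have nu1: "norm (app (nu x) \<phi>) \<le> norm \<phi>" for \<phi>
    using norm_app[of "nu x" \<phi>] mult_right_mono[OF sym1D(1)[OF sym1_nu[OF x]], of "norm \<phi>"] by simp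
  have nX: "norm X \<le> \<eta>" using sym1D(1)[OF sym1_Jnu[OF x, of \<eta>]] \<eta> by (simp add: X_def)
  have B0: "0 \<le> B" using C by (simp add: B_def)
  have "C * \<eta> \<le> C" using C \<eta> by (simp add: mult_left_le)
  then have "norm T' \<le> B" using T'(2) norm_triangle_sub[of T' T] by (simp add: B_def)
  then have nR: "norm R \<le> B" using nu1[of T'] by (simp add: R_def)
  have RQ: "norm (R - Q) \<le> C * \<eta>"
    using nu1[of "T' - T"] T'(2) by (simp add: R_def Q_def app.diff_right)
  have Dc: "D \<in> calg" unfolding D_def X_def by (intro closed_subalg_exp closed_subalg_calg exp_nu_calg A x)
  have DR: "app D R = R"
    using arg_cong[OF calg_comm_nu[OF Dc, of x], of "\<lambda>S. app S T'"] T'(1) by (simp add: R_def D_def X_def)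
  have ia': "integrable \<mu> a'" and pa': "pair a' R = 0"
    using a' DR x by (auto simp: Iperturb_def ann_def D_def X_def)
  note if' = pair_image_diff[OF E k, folded f_def]
  have ER: "app (exp A) R = app (exp X) R"
    unfolding exp_split(1)[OF A x, of \<eta>] app_mult X_def[symmetric] D_def[symmetric] DR ..
  \<comment> \<open>D R = R turns exp A R into exp X R, so that only the perturbation is left. Its
    first-order term is moved from R to Q, which makes one more error of order \<eta>^2.\<close>
  have dec: "app (exp A) R - R = app (exp X - (1 + X)) R + (app X (R - Q) + app X Q)"
    unfolding ER by (simp add: app.diff_left app.add_left app.diff_right)
  have pf: "pair f R = pair k (app (exp X - (1 + X)) R) + (pair k (app X (R - Q)) + pair k (app X Q))"
    unfolding if'(2) dec pair_add_right[OF k] ..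
  have b1: "norm (pair k (app (exp X - (1 + X)) R)) \<le> N1 k * (\<eta>\<^sup>2 * 3 * B)"
  proof -
    have "norm X ^ 2 * exp (norm X) \<le> \<eta>\<^sup>2 * 3"
    proof (intro mult_mono power_mono nX)
      have "exp (norm X) \<le> exp 1" using nX \<eta> by (subst exp_le_cancel_iff) linarith
      then show "exp (norm X) \<le> 3" using exp_le by linarith
    qed auto
    moreover have "(\<Sum>n<2. X ^ n /\<^sub>R fact n) = 1 + X" by (simp add: eval_nat_numeral)
    ultimately have "norm (exp X - (1 + X)) \<le> \<eta>\<^sup>2 * 3" using exp_remainder[of X 2] by simp
    then have "norm (exp X - (1 + X)) * norm R \<le> \<eta>\<^sup>2 * 3 * B" using nR by (intro mult_mono) auto
    then have "norm (app (exp X - (1 + X)) R) \<le> \<eta>\<^sup>2 * 3 * B" using norm_app order_trans by blast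
    then have "N1 k * norm (app (exp X - (1 + X)) R) \<le> N1 k * (\<eta>\<^sup>2 * 3 * B)" by (intro mult_left_mono) auto
    then show ?thesis using pair_bound[OF k] order_trans by blast
  qed
  have b2: "norm (pair k (app X (R - Q))) \<le> N1 k * (\<eta> * (C * \<eta>))"
  proof -
    have "norm X * norm (R - Q) \<le> \<eta> * (C * \<eta>)" using nX RQ \<eta> by (intro mult_mono) auto
    then have "norm (app X (R - Q)) \<le> \<eta> * (C * \<eta>)" using norm_app order_trans by blast
    then have "N1 k * norm (app X (R - Q)) \<le> N1 k * (\<eta> * (C * \<eta>))" by (intro mult_left_mono) auto
    then show ?thesis using pair_bound[OF k] order_trans by blast
  qed
  have b3: "norm (pair k (app X Q)) = \<eta> * norm (pair k (app (nu x) Q))"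
  proof -
    have "app X Q = app (mulc (of_real \<eta> * \<i>)) (app (nu x) Q)"
      unfolding X_def scaleR_mulc[symmetric] by (simp only: app.scaleR_left app_mult)
    then show ?thesis using \<eta> by (simp add: pair_mulc norm_mult)
  qed
  have lower: "\<eta> * norm (pair k (app (nu x) Q)) - \<eta>\<^sup>2 * (N1 k * (3 * B + C)) \<le> norm (pair f R)"
  proof -
    define u v w where "u = pair k (app (exp X - (1 + X)) R)" and "v = pair k (app X (R - Q))" and "w = pair k (app X Q)"
    have "norm w \<le> norm (u + (v + w)) + norm u + norm v"
      using norm_triangle_ineq4[of "u + (v + w)" "u + v"] norm_triangle_ineq[of u v] by simp
    moreover have "\<eta>\<^sup>2 * (N1 k * (3 * B + C)) = N1 k * (\<eta>\<^sup>2 * 3 * B) + N1 k * (\<eta> * (C * \<eta>))"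
      by (simp add: power2_eq_square algebra_simps)
    ultimately show ?thesis
      using b1 b2 unfolding b3[symmetric] pf u_def[symmetric] v_def[symmetric] w_def[symmetric] by linarith
  qed
  have upper: "norm (pair f R) \<le> norm (pair (\<lambda>x. f x - a x) Q) + N1 (\<lambda>x. f x - a x) * (C * \<eta>) + N1 (\<lambda>x. a x - a' x) * B"
  proof -
    have ifa: "integrable \<mu> (\<lambda>x. f x - a x)" and iaa: "integrable \<mu> (\<lambda>x. a x - a' x)"
      using if'(1) a ia' by auto
    \<comment> \<open>f is split as (f - a) + (a - a') + a', and a' annihilates R.\<close>
    have "pair f R = pair (\<lambda>x. f x - a x) Q + pair (\<lambda>x. f x - a x) (R - Q) + pair (\<lambda>x. a x - a' x) R"
      unfolding pair_diff_right[OF ifa] by (simp add: pair_diff_left[OF if'(1) a] pair_diff_left[OF a ia'] pa')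
    then have "norm (pair f R) = norm (pair (\<lambda>x. f x - a x) Q + pair (\<lambda>x. f x - a x) (R - Q) + pair (\<lambda>x. a x - a' x) R)"
      by (rule arg_cong)
    also have "\<dots> \<le> norm (pair (\<lambda>x. f x - a x) Q) + norm (pair (\<lambda>x. f x - a x) (R - Q)) + norm (pair (\<lambda>x. a x - a' x) R)"
      by (rule order_trans[OF norm_triangle_ineq add_right_mono[OF norm_triangle_ineq]])
    also have "\<dots> \<le> norm (pair (\<lambda>x. f x - a x) Q) + N1 (\<lambda>x. f x - a x) * (C * \<eta>) + N1 (\<lambda>x. a x - a' x) * B"
    proof (intro add_mono order_refl)
      show "norm (pair (\<lambda>x. f x - a x) (R - Q)) \<le> N1 (\<lambda>x. f x - a x) * (C * \<eta>)"
        by (rule order_trans[OF pair_bound[OF ifa] mult_left_mono[OF RQ N1_nonneg]])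
      show "norm (pair (\<lambda>x. a x - a' x) R) \<le> N1 (\<lambda>x. a x - a' x) * B"
        by (rule order_trans[OF pair_bound[OF iaa] mult_left_mono[OF nR N1_nonneg]])
    qed
    finally show ?thesis .
  qed
  show ?thesis using lower upper unfolding Q_def by linarith
qed

text \<open>\<open>Iperturb_lower\<close> leads to \<eta> \<delta> \<le> N1 (f - a) C \<eta> for
  every a in a limit over x, and \<eta> cancels: f keeps the distance \<delta> / C from these
  limits. Before the limit its quotient norm is of order \<eta>, but a limit ideal forgets how small
  a positive quotient norm was. So the iterated limit excludes f, while a limit along the joint net
  contains it.\<close>

lemma not_Hausdorff: "\<not> Hausdorff_space (tau_r L1)"
proof
  assume haus: "Hausdorff_space (tau_r L1)"
  obtain A T c C' where A: "A \<in> calg" and E: "sym1 (exp A) c" and Tc: "c0 T" and T0: "T \<noteq> 0"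
    and pert: "\<forall>\<eta> x. 0 < \<eta> \<longrightarrow> \<eta> \<le> 1 \<longrightarrow> x \<in> N \<longrightarrow>
      (\<exists>T'. app (exp (A - \<eta> *\<^sub>R (Jop * nu x))) T' = T' \<and> norm (T' - T) \<le> C' * \<eta>)"
    using resonance by blast
  define C where "C = \<bar>C'\<bar> + 1"
  have C: "C > 0" "C' \<le> C" by (simp_all add: C_def)
  obtain k where k: "integrable \<mu> (apply_bcontfun k)" "pair (apply_bcontfun k) T \<noteq> 0" using exists_test[OF T0] by blast
  define f where "f = apply_bcontfun (app (exp A) k - k)"
  have if': "integrable \<mu> f" unfolding f_def by (rule pair_image_diff(1)[OF E k(1)])
  define \<kappa> where "\<kappa> = norm (pair k T)"
  have \<kappa>: "\<kappa> > 0" using k(2) by (simp add: \<kappa>_def)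
  have M1: "1 \<le> real M" using M_pos by simp
  define B where "B = norm T + C"
  define D where "D = N1 k * (3 * B + C)"
  have D: "D \<ge> 0" using C by (simp add: D_def B_def)
  \<comment> \<open>The square of \<open>nu x\<close> takes T close to \<theta> T with \<theta>
    \<ge> 1 / M. Allowing an error 2 \<delta>, the pairing with k is at least \<kappa> / M - 2
    \<delta> = 2 \<delta>.\<close>
  define \<delta> where "\<delta> = \<kappa> / (4 * real M)"
  have \<delta>: "\<delta> > 0" unfolding \<delta>_def using \<kappa> M1 by (intro divide_pos_pos) auto
  \<comment> \<open>For \<eta> \<le> \<eta>0 the quadratic error \<eta>^2 D uses up at most half of
    the main term 2 \<eta> \<delta>.\<close>
  define \<eta>0 where "\<eta>0 = min 1 (\<delta> / (D + 1))"
  have \<eta>0: "0 < \<eta>0" "\<eta>0 \<le> 1" unfolding \<eta>0_def using \<delta> D by auto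
  have \<eta>D: "\<eta> * D \<le> \<delta>" if "0 \<le> \<eta>" "\<eta> \<le> \<eta>0" for \<eta>
  proof -
    have "\<eta> * D \<le> \<delta> / (D + 1) * D" using that D by (intro mult_right_mono) (auto simp: \<eta>0_def)
    also have "\<dots> = \<delta> * (D / (D + 1))" by simp
    also have "\<dots> \<le> \<delta> * 1" using \<delta> D by (intro mult_left_mono) auto
    finally show ?thesis by simp
  qed
  \<comment> \<open>The pairing is the average of \<open>theta b\<close> T over the points of
    \<open>orb x\<close>, which are far out, and \<open>theta b\<close> T vanishes at
    infinity.\<close>
  have ev_nu: "eventually (\<lambda>x. norm (pair b (app (nu x) T)) \<le> \<epsilon>) XX" if b: "integrable \<mu> b" and \<epsilon>: "\<epsilon> > 0" for b \<epsilon>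
  proof (rule eventually_mono[OF nu_far[OF c0_theta[OF b Tc] \<epsilon> compact_insert[OF compact_empty, of e]]])
    fix x assume x: "x \<in> N \<and> (\<exists>\<theta>. 1 / real M \<le> \<theta> \<and> \<theta> \<le> 1 \<and> (\<forall>p\<in>{e}. norm (app (nu x) (app (theta b) T) p) \<le> \<epsilon> \<and>
      norm (app (nu x) (app (nu x) (app (theta b) T)) p - of_real \<theta> * app (theta b) T p) \<le> \<epsilon>))"
    then have xN: "x \<in> N" by blast
    have "app (theta b) (app (nu x) T) = app (nu x) (app (theta b) T)"
      using arg_cong[OF calgD(4)[OF nu_calg[OF xN] b], of "\<lambda>S. app S T"] by simp
    then show "norm (pair b (app (nu x) T)) \<le> \<epsilon>" using x by (auto simp: pair_theta_e[OF b])
  qed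
  have ev_nu2: "eventually (\<lambda>x. 2 * \<delta> \<le> norm (pair k (app (nu x) (app (nu x) T)))) XX"
  proof (rule eventually_mono[OF nu_far[OF c0_theta[OF k(1) Tc] _ compact_insert[OF compact_empty, of e]]])
    show "2 * \<delta> > 0" using \<delta> by simp
    fix x assume x: "x \<in> N \<and> (\<exists>\<theta>. 1 / real M \<le> \<theta> \<and> \<theta> \<le> 1 \<and> (\<forall>p\<in>{e}. norm (app (nu x) (app (theta k) T) p) \<le> 2 * \<delta> \<and>
      norm (app (nu x) (app (nu x) (app (theta k) T)) p - of_real \<theta> * app (theta k) T p) \<le> 2 * \<delta>))"
    then obtain \<theta> where xN: "x \<in> N" and \<theta>: "1 / real M \<le> \<theta>"
      and b: "norm (app (nu x) (app (nu x) (app (theta k) T)) e - of_real \<theta> * app (theta k) T e) \<le> 2 * \<delta>" by blast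
    have cm: "app (theta k) (app (nu x) S) = app (nu x) (app (theta k) S)" for S
      using arg_cong[OF calgD(4)[OF nu_calg[OF xN] k(1)], of "\<lambda>Q. app Q S"] by simp
    have b': "norm (pair k (app (nu x) (app (nu x) T)) - of_real \<theta> * pair k T) \<le> 2 * \<delta>"
      using b by (simp only: pair_theta_e[OF k(1)] cm)
    have "1 / real M * \<kappa> \<le> \<theta> * \<kappa>" using \<theta> \<kappa> by (intro mult_right_mono) auto
    moreover have "1 / real M * \<kappa> = 4 * \<delta>" using M1 by (simp add: \<delta>_def)
    moreover have "norm (of_real \<theta> * pair k T) = \<theta> * \<kappa>"
      using \<theta> M1 order_trans[of 0 "1 / real M" \<theta>] by (simp add: norm_mult \<kappa>_def)
    ultimately show "2 * \<delta> \<le> norm (pair k (app (nu x) (app (nu x) T)))"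
      using b' norm_triangle_ineq2[of "of_real \<theta> * pair k T" "pair k (app (nu x) (app (nu x) T))"]
      by (simp add: norm_minus_commute)
  qed
  note Jid = Iperturb_Id_set[OF A]
  have lower: "\<delta> / C \<le> qn I f"
    if \<eta>: "0 < \<eta>" "\<eta> \<le> \<eta>0" and F: "F \<le> XX" "F \<noteq> bot" and SC: "SC F (Iperturb A \<eta>) I" for \<eta> F I
  proof -
    have \<eta>1: "\<eta> \<le> 1" using \<eta> \<eta>0 by linarith
    have Iid: "I \<in> Id_set L1" using SC by (simp add: SC_def)
    have "\<delta> / C \<le> N1 (\<lambda>x. f x - a x)" if a: "a \<in> I" for a
    proof -
      have ia: "integrable \<mu> a" by (rule Id_setD(1)[OF Iid a])
      have ifa: "integrable \<mu> (\<lambda>x. f x - a x)" using if' ia by auto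
      \<comment> \<open>\<tau> collects the terms that tend to 0 along F for fixed \<eta>: the
        pairing of f - a with Q and the distance of a from the ideal at x.\<close>
      have "\<eta> * \<delta> \<le> N1 (\<lambda>x. f x - a x) * (C * \<eta>) + \<tau>" if \<tau>: "\<tau> > 0" for \<tau>
      proof -
        have BB: "B \<ge> 0" using C by (simp add: B_def)
        define \<tau>' where "\<tau>' = \<tau> / (1 + B)"
        have \<tau>': "\<tau>' > 0" unfolding \<tau>'_def using \<tau> BB by (intro divide_pos_pos) auto
        have "eventually (\<lambda>x. qn (Iperturb A \<eta> x) a < \<tau>') F" using SC a \<tau>' by (simp add: SC_def)
        moreover have "eventually (\<lambda>x. norm (pair (\<lambda>x. f x - a x) (app (nu x) T)) \<le> \<tau>') F"
          using F(1) ev_nu[OF ifa \<tau>'] by (rule filter_leD)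
        moreover have "eventually (\<lambda>x. 2 * \<delta> \<le> norm (pair k (app (nu x) (app (nu x) T)))) F"
          using F(1) ev_nu2 by (rule filter_leD)
        moreover have "eventually (\<lambda>x. x \<in> N) F" using F(1) eventually_XX_N by (rule filter_leD)
        ultimately have "eventually (\<lambda>x. qn (Iperturb A \<eta> x) a < \<tau>' \<and> norm (pair (\<lambda>x. f x - a x) (app (nu x) T)) \<le> \<tau>' \<and>
            2 * \<delta> \<le> norm (pair k (app (nu x) (app (nu x) T))) \<and> x \<in> N) F"
          by eventually_elim blast
        from eventually_happens'[OF F(2) this] obtain x where x: "qn (Iperturb A \<eta> x) a < \<tau>'"
          "norm (pair (\<lambda>x. f x - a x) (app (nu x) T)) \<le> \<tau>'"
          "2 * \<delta> \<le> norm (pair k (app (nu x) (app (nu x) T)))" "x \<in> N" by blast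
        obtain a' where a': "a' \<in> Iperturb A \<eta> x" "N1 (\<lambda>x. a x - a' x) < \<tau>'" using qn_ex[OF Jid x(1)] by blast
        obtain T' where T': "app (exp (A - \<eta> *\<^sub>R (Jop * nu x))) T' = T'" "norm (T' - T) \<le> C' * \<eta>"
          using pert[rule_format, OF \<eta>(1) \<eta>1 x(4)] by blast
        have "norm (T' - T) \<le> C * \<eta>" using T'(2) mult_right_mono[OF C(2), of \<eta>] \<eta> by linarith
        note main = Iperturb_lower[OF A E k(1) x(4) \<eta>(1) \<eta>1 less_imp_le[OF C(1)] T'(1) this ia a'(1),
          folded f_def B_def, folded D_def]
        have key: "d \<le> s + t" if "u \<le> v" "w \<le> d" "q \<le> r" "z + r = t" "u = d + d" "v - w \<le> y + s + q" "y \<le> z"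
          for d s t u v w q r y z :: real using that by linarith
        have 1: "\<eta> * (2 * \<delta>) \<le> \<eta> * norm (pair k (app (nu x) (app (nu x) T)))" using x(3) \<eta> by (intro mult_left_mono) auto
        have 2: "\<eta>\<^sup>2 * D \<le> \<eta> * \<delta>"
          using mult_left_mono[OF \<eta>D[OF less_imp_le[OF \<eta>(1)] \<eta>(2)], of \<eta>] \<eta> by (simp add: power2_eq_square mult.assoc)
        have 3: "N1 (\<lambda>x. a x - a' x) * B \<le> \<tau>' * B" using a'(2) BB by (intro mult_right_mono) auto
        have 4: "\<tau>' + \<tau>' * B = \<tau>"
        proof -
          have "\<tau>' + \<tau>' * B = \<tau>' * (1 + B)" by (simp add: distrib_left)
          also have "\<dots> = \<tau>" using BB by (simp add: \<tau>'_def)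
          finally show ?thesis .
        qed
        have 5: "\<eta> * (2 * \<delta>) = \<eta> * \<delta> + \<eta> * \<delta>" by simp
        show ?thesis by (rule key[OF 1 2 3 4 5 main x(2)])
      qed
      then have "\<eta> * \<delta> \<le> N1 (\<lambda>x. f x - a x) * (C * \<eta>)" by (rule field_le_epsilon)
      then have "\<eta> * \<delta> \<le> \<eta> * (N1 (\<lambda>x. f x - a x) * C)" by (simp only: mult_ac)
      then have "\<delta> \<le> N1 (\<lambda>x. f x - a x) * C" using \<eta>(1) by (simp only: mult_le_cancel_left_pos)
      then show ?thesis using C(1) by (simp only: pos_divide_le_eq)
    qed
    note lo = this
    show ?thesis
      unfolding qnorm_def
    proof (rule cInf_greatest)
      show "(\<lambda>b. anorm L1 (asub L1 f b)) ` I \<noteq> {}" using Id_setD(2)[OF Iid] by blast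
      fix y assume "y \<in> (\<lambda>b. anorm L1 (asub L1 f b)) ` I"
      then obtain a where "a \<in> I" and y: "y = anorm L1 (asub L1 f a)" by (rule imageE)
      from lo[OF this(1)] show "\<delta> / C \<le> y" unfolding y L1_simps .
    qed
  qed
  define \<eta> where "\<eta> n = \<eta>0 / (real n + 1)" for n :: nat
  have \<eta>: "0 < \<eta> n" "\<eta> n \<le> \<eta>0" for n
  proof -
    show "0 < \<eta> n" unfolding \<eta>_def using \<eta>0(1) by (intro divide_pos_pos) auto
    have "\<eta>0 / (real n + 1) \<le> \<eta>0 / 1" using \<eta>0(1) by (intro divide_left_mono) auto
    then show "\<eta> n \<le> \<eta>0" by (simp only: \<eta>_def div_by_1)
  qed
  have "\<forall>n. \<exists>F. F \<le> XX \<and> F \<noteq> bot \<and> (\<exists>I. SC F (Iperturb A (\<eta> n)) I)"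
  proof
    fix n
    show "\<exists>F. F \<le> XX \<and> F \<noteq> bot \<and> (\<exists>I. SC F (Iperturb A (\<eta> n)) I)"
      using SC_exists[of XX "Iperturb A (\<eta> n)", OF XX_ne_bot Jid] by blast
  qed
  from choice[OF this] obtain F where F': "\<forall>n. F n \<le> XX \<and> F n \<noteq> bot \<and> (\<exists>I. SC (F n) (Iperturb A (\<eta> n)) I)" ..
  have F: "F n \<le> XX" "F n \<noteq> bot" for n using F'[rule_format, of n] by simp_all
  have "\<forall>n. \<exists>I. SC (F n) (Iperturb A (\<eta> n)) I"
  proof
    show "\<exists>I. SC (F n) (Iperturb A (\<eta> n)) I" for n using F'[rule_format, of n] by (elim conjE)
  qed
  from choice[OF this] obtain I where I': "\<forall>n. SC (F n) (Iperturb A (\<eta> n)) (I n)" ..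
  have I: "SC (F n) (Iperturb A (\<eta> n)) (I n)" for n by (rule I'[rule_format])
  have Iid: "I n \<in> Id_set L1" for n using I[of n] by (simp add: SC_def)
  obtain G I1 where G: "G \<le> sequentially" "G \<noteq> bot" and I1: "SC G I I1"
    using SC_exists[of sequentially I, OF sequentially_bot Iid] by blast
  have f1: "f \<notin> I1"
  proof
    assume "f \<in> I1"
    moreover have "\<delta> / C > 0" using \<delta> C by simp
    ultimately have "eventually (\<lambda>n. qn (I n) f < \<delta> / C) G" using I1 unfolding SC_def by blast
    then obtain n where "qn (I n) f < \<delta> / C" using eventually_happens'[OF G(2)] by blast
    with lower[OF \<eta> F I, of n] show False by simp
  qed
  \<comment> \<open>The filter of the iterated limit, first x along \<open>F n\<close>, then n along
    G. An open set containing I1 eventually contains \<open>I n\<close>, hence eventually the ideals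
    converging to \<open>I n\<close>, so the joint family tends to I1 along H.\<close>
  define H where "H = Abs_filter (\<lambda>P. eventually (\<lambda>n. eventually (\<lambda>x. P (n, x)) (F n)) G)"
  have evH: "eventually P H \<longleftrightarrow> eventually (\<lambda>n. eventually (\<lambda>x. P (n, x)) (F n)) G" for P
    unfolding H_def
  proof (rule eventually_Abs_filter, rule is_filter.intro)
    fix P Q :: "nat \<times> 'g \<Rightarrow> bool"
    assume "eventually (\<lambda>n. eventually (\<lambda>x. P (n, x)) (F n)) G" "eventually (\<lambda>n. eventually (\<lambda>x. Q (n, x)) (F n)) G"
    then show "eventually (\<lambda>n. eventually (\<lambda>x. P (n, x) \<and> Q (n, x)) (F n)) G"
      by eventually_elim (rule eventually_conj)
  next
    fix P Q :: "nat \<times> 'g \<Rightarrow> bool"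
    assume PQ: "\<forall>x. P x \<longrightarrow> Q x" and "eventually (\<lambda>n. eventually (\<lambda>x. P (n, x)) (F n)) G"
    from this(2) show "eventually (\<lambda>n. eventually (\<lambda>x. Q (n, x)) (F n)) G"
      by eventually_elim (use PQ in \<open>auto elim: eventually_mono\<close>)
  qed simp
  have Hb: "H \<noteq> bot"
    unfolding trivial_limit_def evH using F(2) G(2) by simp
  define J where "J p = Iperturb A (\<eta> (fst p)) (snd p)" for p
  have JI: "J p \<in> Id_set L1" for p unfolding J_def by (rule Jid)
  have lim1: "limitin (tau_r L1) J I1 H"
    unfolding limitin_def
  proof (intro conjI allI impI)
    show "I1 \<in> topspace (tau_r L1)" using SC_limitin[OF I1 Iid] by (simp add: limitin_def)
    fix U assume U: "openin (tau_r L1) U \<and> I1 \<in> U"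
    then have "eventually (\<lambda>n. I n \<in> U) G" using SC_limitin[OF I1 Iid] unfolding limitin_def by blast
    then show "eventually (\<lambda>p. J p \<in> U) H"
      unfolding evH
    proof eventually_elim
      case (elim n)
      then show ?case using SC_limitin[OF I Jid, of n] U unfolding limitin_def J_def by simp
    qed
  qed
  \<comment> \<open>A finer filter along which the joint family converges strongly. Its limit has to
    be I1 in a Hausdorff space, although it contains f because \<eta> n tends to 0 along H.\<close>
  obtain H' I2 where H': "H' \<le> H" "H' \<noteq> bot" and I2: "SC H' J I2"
    using SC_exists[of H J, OF Hb JI] by blast
  have l2: "limitin (tau_r L1) J I2 H'" by (rule SC_limitin[OF I2 JI])
  have l1: "limitin (tau_r L1) J I1 H'"
    unfolding limitin_def
  proof (intro conjI allI impI)
    show "I1 \<in> topspace (tau_r L1)" using lim1 by (simp only: limitin_def)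
    fix U assume "openin (tau_r L1) U \<and> I1 \<in> U"
    then have "eventually (\<lambda>p. J p \<in> U) H" using lim1 by (simp only: limitin_def)
    then show "eventually (\<lambda>p. J p \<in> U) H'" by (rule filter_leD[OF H'(1)])
  qed
  have "I2 = I1" by (rule limitin_Hausdorff_unique[OF l2 l1 H'(2) haus])
  moreover have "f \<in> I2"
  proof (rule ccontr)
    assume "f \<notin> I2"
    then obtain d where d: "d > 0" "eventually (\<lambda>p. d \<le> qn (J p) f) H'" 
    proof -
      from I2 have "\<forall>a. integrable \<mu> a \<longrightarrow> a \<notin> I2 \<longrightarrow> (\<exists>\<delta>>0. eventually (\<lambda>p. \<delta> \<le> qn (J p) a) H')"
        unfolding SC_def by (elim conjE)
      from this[rule_format, OF if' \<open>f \<notin> I2\<close>] show ?thesis using that by blast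
    qed
    have "(\<lambda>n. (exp (\<eta> n) - 1) * N1 k) \<longlonglongrightarrow> (exp 0 - 1) * N1 k"
    proof (intro tendsto_mult tendsto_diff tendsto_exp tendsto_const)
      have "(\<lambda>n. \<eta>0 * inverse (real (Suc n))) \<longlonglongrightarrow> \<eta>0 * 0"
        by (intro tendsto_mult tendsto_const LIMSEQ_inverse_real_of_nat)
      moreover have "\<eta>0 * inverse (real (Suc n)) = \<eta> n" for n
        by (simp only: \<eta>_def divide_inverse of_nat_Suc)  (simp only: add.commute)
      ultimately show "\<eta> \<longlonglongrightarrow> 0" by (simp only: mult_zero_right)
    qed
    then have "eventually (\<lambda>n. (exp (\<eta> n) - 1) * N1 k < d) sequentially" using d(1) by (intro order_tendstoD(2)) auto
    then have ev: "eventually (\<lambda>n. (exp (\<eta> n) - 1) * N1 k < d) G" by (rule filter_leD[OF G(1)])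
    have "eventually (\<lambda>p. qn (J p) f < d) H"
      unfolding evH using ev
    proof eventually_elim
      case (elim n)
      have "eventually (\<lambda>x. x \<in> N) (F n)" using F(1) eventually_XX_N by (rule filter_leD)
      then show ?case
      proof eventually_elim
        case x: (elim x)
        show ?case
          unfolding J_def fst_conv snd_conv f_def
          by (rule le_less_trans[OF qn_Iperturb_small[OF A E k(1) x \<eta>(1)] elim])
      qed
    qed
    then have "eventually (\<lambda>p. qn (J p) f < d) H'" by (rule filter_leD[OF H'(1)])
    from eventually_happens'[OF H'(2) eventually_conj[OF d(2) this]] show False by force
  qed
  ultimately show False using f1 by simp
qed

end

theorem theorem3p6:
  fixes gmul :: "'g::t2_space \<Rightarrow> 'g \<Rightarrow> 'g" and ginv :: "'g \<Rightarrow> 'g" and e :: 'g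
    and \<mu> :: "'g measure" and N :: "'g set"
  assumes "lc_group gmul ginv e"
    and "left_haar gmul \<mu>"
    and "e \<in> N" and "\<forall>x\<in>N. \<forall>y\<in>N. gmul x y \<in> N" and "\<forall>x\<in>N. ginv x \<in> N"
    and "closed N"
    and "\<forall>g. \<forall>n\<in>N. gmul (gmul g n) (ginv g) \<in> N"
    and "\<forall>x\<in>N. \<forall>y\<in>N. gmul x y = gmul y x"
    and "\<not> compact N"
    and "finite ((\<lambda>g. gmul g ` N) ` UNIV)"
  shows "\<not> spectral_synthesis (L1_alg gmul ginv \<mu>) \<and> \<not> Hausdorff_space (tau_r (L1_alg gmul ginv \<mu>))"
proof -
  interpret almost_abelian gmul ginv e \<mu> N
    using assms by unfold_locales blast+
  obtain A T c S where "A \<in> calg" "sym1 (exp A) c" "T \<noteq> 0" "app (exp A) T = T" "app (exp A) S = S - T"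
    using resonance by metis
  then have "\<not> spectral_synthesis L1"
    by (intro not_synthesis[of "exp A" c T S] closed_subalg_exp closed_subalg_calg)
  then show ?thesis using not_Hausdorff by blast
qed

end
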